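(* Let $0<p<\infty$ and $\varepsilon>0$, and let $\omega$ be a weight and $\mu$ a positive Borel measure on $\mathbb{D}$ such that either (A) $\omega\in\widehat{\mathcal{D}}$ with $\omega>0$ almost everywhere on $\mathbb{D}$, and $\mu$ is a $p$-Carleson measure for $A^p_\omega$; or (B) $\omega\in C_\infty$ and, for some $r_0\in(0,1)$, there is a constant $C>0$ such that $\mu(\Delta(a,r_0))\le C\,\omega(\Delta(a,r_0))$ for all $a\in\mathbb{D}\setminus\{0\}$. Then there exists an $r\in(0,1)$ such that $\mu$ is a sampling measure for $A^p_\omega$ whenever the set $G=\{z\in\mathbb{D}:k_r(z)>\varepsilon\|M_\omega(\mu)\|_{L^\infty}\}$ is a dominating set for $A^p_\omega$.
   Context: $\mathbb{D}=\{z\in\mathbb{C}:|z|<1\}$, $\mathcal{H}(\mathbb{D})$ is the space of analytic functions in $\mathbb{D}$, and $dA(z)=\frac{dx\,dy}{\pi}$. A weight is a function $\omega:\mathbb{D}\to[0,\infty)$ integrable over $\mathbb{D}$ (with respect to $dA$); it is radial if $\omega(z)=\omega(|z|)$; $\omega(E)=\int_E\omega\,dA$. $A^p_\omega$ consists of $f\in\mathcal{H}(\mathbb{D})$ with $\|f\|_{A^p_\omega}^p=\int_{\mathbb{D}}|f|^p\omega\,dA<\infty$. For a radial weight $\omega$ put $\widehat\omega(z)=\int_{|z|}^1\omega(s)\,ds$; it is assumed that $\widehat\omega(z)>0$ for all $z\in\mathbb{D}$. A radial weight $\omega$ belongs to $\widehat{\mathcal{D}}$ if there exists $C\ge1$ such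 that $\widehat\omega(r)\le C\widehat\omega(\frac{1+r}{2})$ for all $0\le r<1$. $\Delta(z,r)=\{\zeta\in\mathbb{D}:|\frac{z-\zeta}{1-\overline z\zeta}|<r\}$ is the pseudohyperbolic disc and $|\cdot|$ of a set denotes its area. For $1<q<\infty$ and $\frac1q+\frac1{q'}=1$, an almost everywhere positive weight $\omega$ belongs to $C_q$ if for some (equivalently for each) $r\in(0,1)$ there exists $C=C(q,r,\omega)>0$ such that $$\left(\int_{\Delta(z,r)}\omega\,dA\right)^{1/q}\left(\int_{\Delta(z,r)}\omega^{-q'/q}\,dA\right)^{1/q'}\le C|\Delta(z,r)|,\quad z\in\mathbb{D};$$ $C_\infty=\bigcup_{q>1}C_q$. Carleson squares are the sets $S(a)=\{re^{i\theta}\in\mathbb{D}:|a|<r<1,\ |\arg(ae^{-i\theta})|<\frac{1-|a|}{2}\}$, $a\in\mathbb{D}\setminus\{0\}$. For a positive Borel measure $\mu$ on $\mathbb{D}$, $M_\omega(\mu)(z)=\sup_{S\ni z}\frac{\mu(S)}{\omega(S)}$, the supremum being over Carleson squares $S$ containing $z$, and $k_r(z)=\mu(\Delta(z,r))/\omega(\Delta(z,r))$. $\mu$ is a $p$-Carleson measure for $A^p_\omega$ if $A^p_\omega$ is continuously embedded into $L^p_\mu$, i.e. $\int_{\mathbb{D}}|f|^p\,d\mu\lesssim\|f\|_{A^p_\omega}^p$ for all $f\in A^p_\omega$. $\mu$ is a sampling measure for $A^p_\omega$ if $\int_{\mathbb{D}}|f|^p\,d\mu\asymp\|f\|_{A^p_\omega}^p$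 for all $f\in A^p_\omega$ (two-sided inequalities with constants independent of $f$). A measurable set $G\subset\mathbb{D}$ is a dominating set for $A^p_\omega$ if there exists $\delta>0$ such that $\int_G|f|^p\omega\,dA\ge\delta\|f\|_{A^p_\omega}^p$ for all $f\in A^p_\omega$.
   Formalization: The radius r is allowed to depend on the constant δ with which G is dominating (for every δ>0 there is r such that μ is sampling whenever G is dominating with constant δ); with one r for all δ the claim is false, e.g. for p=2, ω=1 and μ carried by a suitable zero set. *)

theory Defs
  imports "HOL-Analysis.Analysis" "HOL-Probability.Essential_Supremum"
begin

abbreviation unit_disc :: "complex set" where
  "unit_disc \<equiv> ball 0 1"

definition dA :: "complex measure" where
  "dA = scale_measure (ennreal (1 / pi)) (lebesgue_on unit_disc)"


section \<open>Weights\<close>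

text \<open>All functions and measures live on the unit disc: functions are total on the complex plane,
  but no definition below looks at their values outside the disc.\<close>

definition weight :: "(complex \<Rightarrow> real) \<Rightarrow> bool" where
  "weight \<omega> \<longleftrightarrow> (\<forall>z\<in>unit_disc. 0 \<le> \<omega> z) \<and> integrable dA \<omega>"

definition radial :: "(complex \<Rightarrow> real) \<Rightarrow> bool" where
  "radial \<omega> \<longleftrightarrow> (\<forall>z\<in>unit_disc. \<omega> z = \<omega> (of_real (cmod z)))"

definition weight_mass :: "(complex \<Rightarrow> real) \<Rightarrow> complex set \<Rightarrow> ennreal" where
  "weight_mass \<omega> E = (\<integral>\<^sup>+z\<in>E. ennreal (\<omega> z) \<partial>dA)"

text \<open>The tail integral is extended real valued, since integrability over the disc does not force
  the integral over the whole radius to be finite.\<close>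

definition weight_tail :: "(complex \<Rightarrow> real) \<Rightarrow> complex \<Rightarrow> ennreal" where
  "weight_tail \<omega> z = (\<integral>\<^sup>+s\<in>{cmod z..<1}. ennreal (\<omega> (of_real s)) \<partial>lebesgue)"

definition D_hat :: "(complex \<Rightarrow> real) set" where
  "D_hat = {\<omega>. weight \<omega> \<and> radial \<omega> \<and> (\<forall>z\<in>unit_disc. 0 < weight_tail \<omega> z) \<and>
     (\<exists>C::real. 1 \<le> C \<and> (\<forall>r::real. 0 \<le> r \<and> r < 1 \<longrightarrow>
        weight_tail \<omega> (of_real r) \<le> ennreal C * weight_tail \<omega> (of_real ((1 + r) / 2))))}"

definition pseudo_disc :: "complex \<Rightarrow> real \<Rightarrow> complex set" where
  "pseudo_disc z r = {\<zeta>\<in>unit_disc. cmod ((z - \<zeta>) / (1 - cnj z * \<zeta>)) < r}"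

text \<open>The integrability clause says that the second integral is finite; without it the
  Bochner integral would silently be 0. On the null set where the weight vanishes, the negative
  power is 0 by convention, which does not affect the integral.\<close>

definition C_class :: "real \<Rightarrow> (complex \<Rightarrow> real) set" where
  "C_class q = {\<omega>. weight \<omega> \<and> (AE z in dA. 0 < \<omega> z) \<and>
     (\<exists>r::real. 0 < r \<and> r < 1 \<and> (\<exists>C::real. 0 < C \<and> (\<forall>z\<in>unit_disc.
        (let q' = q / (q - 1) in
          set_integrable dA (pseudo_disc z r) (\<lambda>\<zeta>. \<omega> \<zeta> powr (- (q' / q))) \<and>
          (LINT \<zeta>:pseudo_disc z r|dA. \<omega> \<zeta>) powr (1 / q) *
          (LINT \<zeta>:pseudo_disc z r|dA. \<omega> \<zeta> powr (- (q' / q))) powr (1 / q')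
            \<le> C * measure lebesgue (pseudo_disc z r)))))}"

definition C_infinity :: "(complex \<Rightarrow> real) set" where
  "C_infinity = (\<Union>q\<in>{1<..}. C_class q)"


section \<open>Carleson squares, the maximal function and averages of a measure\<close>

definition borel_measure_on_disc :: "complex measure \<Rightarrow> bool" where
  "borel_measure_on_disc \<mu> \<longleftrightarrow> sets \<mu> = sets (restrict_space borel unit_disc)"

definition carleson_square :: "complex \<Rightarrow> complex set" where
  "carleson_square a = {rcis r \<theta> |r \<theta>.
     cmod a < r \<and> r < 1 \<and> \<bar>Arg (a * cis (- \<theta>))\<bar> < (1 - cmod a) / 2}"

text \<open>The origin lies in no Carleson square; the supremum there is 0.\<close>

definition maximal_function ::
    "(complex \<Rightarrow> real) \<Rightarrow> complex measure \<Rightarrow> complex \<Rightarrow> ennreal" where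
  "maximal_function \<omega> \<mu> z =
     (SUP a\<in>{a \<in> unit_disc - {0}. z \<in> carleson_square a}.
        emeasure \<mu> (carleson_square a) / weight_mass \<omega> (carleson_square a))"

definition maximal_norm :: "(complex \<Rightarrow> real) \<Rightarrow> complex measure \<Rightarrow> ennreal" where
  "maximal_norm \<omega> \<mu> = esssup dA (maximal_function \<omega> \<mu>)"

definition disc_average ::
    "(complex \<Rightarrow> real) \<Rightarrow> complex measure \<Rightarrow> real \<Rightarrow> complex \<Rightarrow> ennreal" where
  "disc_average \<omega> \<mu> r z = emeasure \<mu> (pseudo_disc z r) / weight_mass \<omega> (pseudo_disc z r)"


section \<open>Weighted Bergman spaces, Carleson and sampling measures, dominating sets\<close>

text \<open>The \<open>p\<close>-th power of the (quasi-)norm.\<close>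

definition bergman_norm_p :: "real \<Rightarrow> (complex \<Rightarrow> real) \<Rightarrow> (complex \<Rightarrow> complex) \<Rightarrow> ennreal" where
  "bergman_norm_p p \<omega> f = (\<integral>\<^sup>+z. ennreal (cmod (f z) powr p * \<omega> z) \<partial>dA)"

definition bergman_space :: "real \<Rightarrow> (complex \<Rightarrow> real) \<Rightarrow> (complex \<Rightarrow> complex) set" where
  "bergman_space p \<omega> = {f. f holomorphic_on unit_disc \<and> bergman_norm_p p \<omega> f < \<infinity>}"

definition carleson_measure :: "real \<Rightarrow> (complex \<Rightarrow> real) \<Rightarrow> complex measure \<Rightarrow> bool" where
  "carleson_measure p \<omega> \<mu> \<longleftrightarrow> (\<exists>C::real. 0 < C \<and> (\<forall>f\<in>bergman_space p \<omega>.
     (\<integral>\<^sup>+z. ennreal (cmod (f z) powr p) \<partial>\<mu>) \<le> ennreal C * bergman_norm_p p \<omega> f))"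

definition sampling_measure :: "real \<Rightarrow> (complex \<Rightarrow> real) \<Rightarrow> complex measure \<Rightarrow> bool" where
  "sampling_measure p \<omega> \<mu> \<longleftrightarrow> (\<exists>c C::real. 0 < c \<and> 0 < C \<and> (\<forall>f\<in>bergman_space p \<omega>.
     ennreal c * bergman_norm_p p \<omega> f \<le> (\<integral>\<^sup>+z. ennreal (cmod (f z) powr p) \<partial>\<mu>) \<and>
     (\<integral>\<^sup>+z. ennreal (cmod (f z) powr p) \<partial>\<mu>) \<le> ennreal C * bergman_norm_p p \<omega> f))"

text \<open>A dominating set is a set that is dominating with some constant \<open>\<delta> > 0\<close>. The
  constant is kept explicit because other parameters may have to be chosen depending on it.\<close>

definition dominating_set_with ::
    "real \<Rightarrow> real \<Rightarrow> (complex \<Rightarrow> real) \<Rightarrow> complex set \<Rightarrow> bool" where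
  "dominating_set_with \<delta> p \<omega> G \<longleftrightarrow> G \<in> sets dA \<and> (\<forall>f\<in>bergman_space p \<omega>.
     (\<integral>\<^sup>+z\<in>G. ennreal (cmod (f z) powr p * \<omega> z) \<partial>dA) \<ge> ennreal \<delta> * bergman_norm_p p \<omega> f)"

definition dominating_set :: "real \<Rightarrow> (complex \<Rightarrow> real) \<Rightarrow> complex set \<Rightarrow> bool" where
  "dominating_set p \<omega> G \<longleftrightarrow> (\<exists>\<delta>>0. dominating_set_with \<delta> p \<omega> G)"

end

theory Submission
  imports Defs "HOL-Complex_Analysis.Complex_Analysis"
begin

text \<open>The radius is chosen after the dominating constant \<open>\<delta>\<close>: the
  averaging gains a multiple of \<open>\<epsilon> * M * \<delta>\<close> times the norm, the
  oscillation costs a multiple of \<open>r powr p\<close> times the norm, so \<open>r\<close> must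
  be small against \<open>\<delta>\<close>. The two cases need different majorants because
  membership in \<open>D_hat\<close> bounds only annuli reaching the boundary; the mass of a Whitney
  ball may be tiny compared with that of the tent below it, so area means over hyperbolic discs say
  nothing in terms of the weight. Instead f(z) is bounded by means over circles further out than z,
  integrated in the radius against the weight. Such a mean sees the whole boundary annulus, hence
  the kernel must decay faster than the weight of ancestors can grow. Passing to the power p/2 turns
  the norm into an L^2 norm, so one embedding theorem serves every p, also p \<le> 1. In case (A)
  the Carleson hypothesis, tested on f = 1, gives \<open>\<mu>\<close> finite total mass; the
  condition on squares is read off from M.\<close>

text \<open>
  Let \<open>M\<close> be the norm of the maximal function and \<open>G\<close> the set on which \<open>k\<^sub>r > \<epsilon> M\<close>. On \<open>G\<close> the measure
  \<open>\<omega> dA\<close> is at most \<open>k\<^sub>r \<omega> dA / (\<epsilon> M)\<close>, so Fubini's theorem bounds the integral of \<open>|f|\<^sup>p \<omega>\<close> over \<open>G\<close>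
  by a multiple of the integral of \<open>|f|\<^sup>p\<close> against \<open>\<mu>\<close>, up to the oscillation of \<open>f\<close> on pseudohyperbolic
  discs of radius \<open>r\<close>. This oscillation is \<open>O(r)\<close> times the supremum of \<open>|f|\<close> over a Whitney ball, hence is
  absorbed for small \<open>r\<close> once the suprema of \<open>|f|\<^sup>p\<close> over Whitney balls have a majorant whose integral against
  \<open>\<mu>\<close> is at most a constant times the norm of \<open>f\<close>. In case (B) Hoelder's inequality and the
  subharmonicity of \<open>|f|\<^sup>p\<^sup>/\<^sup>q\<close> give such a majorant. In case (A) finiteness of \<open>M\<close> is a Carleson condition on
  squares; a circle mean with a rapidly decaying kernel bounds \<open>|f|\<^sup>p\<^sup>/\<^sup>2\<close> by a geometrically damped sum of
  its \<open>\<omega>\<close>-averages over the dyadic ancestors, and the dyadic Carleson embedding theorem applies with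
  exponent 2. If \<open>M = \<infinity>\<close> or \<open>M = 0\<close>, then \<open>G\<close> is too small to be dominating.
\<close>

section \<open>Circle means of holomorphic functions\<close>

text \<open>Cauchy's formula at \<open>z\<close> for a power of a zero-free \<open>f\<close>, multiplied by the \<open>\<gamma>\<close>-th power of a factor
  that equals 1 at \<open>z\<close>, has its kernel bounded by \<open>circle_kernel\<close>; Blaschke factors remove the zeros.\<close>

definition circle_kernel :: "nat \<Rightarrow> real \<Rightarrow> complex \<Rightarrow> complex \<Rightarrow> real" where
  "circle_kernel \<gamma> s z w = (2 * (s - cmod z) / cmod (w - z)) ^ \<gamma> * (s / cmod (w - z))"

lemma cis_circlepath: "circlepath 0 s t = complex_of_real s * cis (2 * pi * t)"
  by (simp add: circlepath cis_conv_exp mult_ac)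

lemma circle_mean_zero_free:
  fixes \<beta> :: real
  assumes g: "g holomorphic_on ball 0 R" and s: "0 < s" "s < R"
    and nz: "\<And>w. w \<in> ball 0 R \<Longrightarrow> g w \<noteq> 0" and z: "cmod z < s"
  shows "cmod (g z) powr \<beta> \<le> integral {0..1} (\<lambda>t. cmod (g (of_real s * cis (2*pi*t))) powr \<beta> *
           circle_kernel \<gamma> s z (of_real s * cis (2*pi*t)))"
proof -
  define W where "W = (\<lambda>t. complex_of_real s * cis (2 * pi * t))"
  have Ws: "cmod (W t) = s" for t using s by (simp add: W_def norm_mult)
  have Wb: "W t \<in> ball 0 R" for t using Ws[of t] s by simp
  have contW: "continuous_on A W" for A unfolding W_def by (intro continuous_intros)
  have "0 \<in> ball (0::complex) R" using s by simp
  then obtain L where L: "L holomorphic_on ball 0 R" "\<And>x. x \<in> ball 0 R \<Longrightarrow> exp (L x) = g x"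
    using holomorphic_logarithm_exists[OF convex_ball open_ball g nz] by metis
  \<comment> \<open>A holomorphic branch of the \<open>\<beta>\<close>-th power of \<open>g\<close>;
    a non-integer exponent is the reason for excluding zeros here.\<close>
  define h where "h = (\<lambda>w. exp (of_real \<beta> * L w))"
  have h: "h holomorphic_on ball 0 R" unfolding h_def by (intro holomorphic_intros L)
  have hn: "cmod (h w) = cmod (g w) powr \<beta>" if "w \<in> ball 0 R" for w
  proof -
    have "cmod (g w) = exp (Re (L w))" using L(2)[OF that] by (metis norm_exp_eq_Re)
    then show ?thesis by (simp add: h_def norm_exp_eq_Re powr_def)
  qed
  \<comment> \<open>The denominator of the Szegoe kernel of the disc of radius \<open>s\<close>, up
    to scaling: zero-free on the closed disc, equal to \<open>s^2 - |z|^2\<close> at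
    \<open>z\<close>, and of modulus \<open>s * |w - z|\<close> on the circle. Powers of its
    normalised reciprocal cost nothing at \<open>z\<close> and damp the points of the circle far
    from \<open>z\<close>.\<close>
  define D where "D = (\<lambda>w. complex_of_real (s\<^sup>2) - cnj z * w)"
  have D0: "D w \<noteq> 0" if "cmod w \<le> s" for w
  proof
    assume "D w = 0"
    then have "complex_of_real (s\<^sup>2) = cnj z * w" by (simp add: D_def)
    then have "s\<^sup>2 = cmod z * cmod w" by (metis complex_mod_cnj norm_mult norm_of_real abs_of_nonneg zero_le_power2)
    also have "\<dots> < s * s" using z that s by (smt (verit) mult_left_mono mult_strict_right_mono norm_ge_zero)
    finally show False by (simp add: power2_eq_square)
  qed
  define K where "K = (\<lambda>w. (complex_of_real (s\<^sup>2 - (cmod z)\<^sup>2) / D w) ^ \<gamma>)"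
  have Kz: "K z = 1"
  proof -
    have "D z = complex_of_real (s\<^sup>2 - (cmod z)\<^sup>2)"
      using complex_norm_square[of z] by (simp add: D_def mult.commute)
    then show ?thesis using D0[of z] z by (simp add: K_def)
  qed
  have Dhol: "D holomorphic_on A" for A unfolding D_def by (intro holomorphic_intros)
  have Khol: "K holomorphic_on ball 0 s" unfolding K_def
    by (intro holomorphic_intros Dhol) (use D0 in auto)
  have Kcont: "continuous_on (cball 0 s) K" unfolding K_def
    by (intro continuous_intros holomorphic_on_imp_continuous_on[OF Dhol]) (use D0 in auto)
  have hcont: "continuous_on (cball 0 s) h"
    by (rule continuous_on_subset[OF holomorphic_on_imp_continuous_on[OF h]]) (use s in auto)
  have "((\<lambda>u. (h u * K u)/(u-z)) has_contour_integral (2 * of_real pi * \<i> * (h z * K z))) (circlepath 0 s)"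
  proof (rule Cauchy_integral_circlepath)
    show "continuous_on (cball 0 s) (\<lambda>u. h u * K u)" by (intro continuous_intros hcont Kcont)
    show "(\<lambda>u. h u * K u) holomorphic_on ball 0 s"
      by (intro holomorphic_intros Khol holomorphic_on_subset[OF h]) (use s in auto)
  qed (use z in simp)
  then have "((\<lambda>x. h (circlepath 0 s x) * K (circlepath 0 s x) / (circlepath 0 s x - z) *
      vector_derivative (circlepath 0 s) (at x within {0..1})) has_integral 2 * of_real pi * \<i> * h z) {0..1}"
    by (simp add: has_contour_integral_def Kz)
  then have "((\<lambda>x. (h (W x) * K (W x))/(W x - z) * (2 * pi * \<i> * W x)) has_integral (2 * of_real pi * \<i> * h z)) {0..1}"
    by (rule has_integral_eq[rotated])
       (simp add: cis_circlepath vector_derivative_circlepath01 W_def cis_conv_exp mult_ac)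
  from has_integral_mult_right[OF this, of "1/(2 * of_real pi * \<i>)"]
  have I: "((\<lambda>x. (h (W x) * K (W x))/(W x - z) * W x) has_integral h z) {0..1}"
    by (simp add: Kz field_simps)
  define k where "k = (\<lambda>t. cmod (g (W t)) powr \<beta> * circle_kernel \<gamma> s z (W t))"
  have Wz: "W t \<noteq> z" for t using Ws[of t] z by auto
  have "continuous_on {0..1} (\<lambda>t. g (W t))"
    by (intro continuous_on_compose2[OF holomorphic_on_imp_continuous_on[OF g] contW]) (use Wb in auto)
  moreover have "cmod (g (W t)) \<noteq> 0" for t using nz[OF Wb[of t]] by simp
  ultimately have "continuous_on {0..1} k" unfolding k_def circle_kernel_def
    by (intro continuous_intros contW) (use Wz in auto)
  then have kint: "k integrable_on {0..1}" by (rule integrable_continuous_real)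
  have "cmod (h z) \<le> integral {0..1} k"
    unfolding integral_unique[OF I, symmetric]
  proof (rule integral_norm_bound_integral[OF has_integral_integrable[OF I] kint])
    fix t :: real
    have Dt: "cmod (D (W t)) = s * cmod (W t - z)"
    proof -
      have "D (W t) = W t * cnj (W t - z)"
        using complex_norm_square[of "W t"] by (simp add: D_def Ws algebra_simps)
      then have "cmod (D (W t)) = cmod (W t) * cmod (W t - z)" by (metis norm_mult complex_mod_cnj)
      then show ?thesis by (simp add: Ws)
    qed
    have pos: "cmod (W t - z) > 0" using Wz by simp
    have "s\<^sup>2 - (cmod z)\<^sup>2 = (s - cmod z) * (s + cmod z)" by (simp add: power2_eq_square algebra_simps)
    also have "\<dots> \<le> (s - cmod z) * (2 * s)" using z by (intro mult_left_mono) auto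
    finally have le: "s\<^sup>2 - (cmod z)\<^sup>2 \<le> (s - cmod z) * (2 * s)" .
    have ge: "0 \<le> s\<^sup>2 - (cmod z)\<^sup>2" using z s by (simp add: power_mono)
    have "cmod (K (W t)) = ((s\<^sup>2 - (cmod z)\<^sup>2) / (s * cmod (W t - z))) ^ \<gamma>"
      using ge by (simp only: K_def norm_power norm_divide Dt norm_of_real abs_of_nonneg)
    also have "\<dots> \<le> (((s - cmod z) * (2 * s)) / (s * cmod (W t - z))) ^ \<gamma>"
      using ge le s pos by (intro power_mono divide_right_mono divide_nonneg_pos) auto
    also have "((s - cmod z) * (2 * s)) / (s * cmod (W t - z)) = 2 * (s - cmod z) / cmod (W t - z)"
      using s pos by (simp add: field_simps)
    finally have KW: "cmod (K (W t)) \<le> (2 * (s - cmod z) / cmod (W t - z)) ^ \<gamma>" .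
    have "cmod ((h (W t) * K (W t))/(W t - z) * W t) = cmod (g (W t)) powr \<beta> * (cmod (K (W t)) * (s / cmod (W t - z)))"
      by (simp add: norm_mult norm_divide Ws hn[OF Wb])
    also have "\<dots> \<le> k t" unfolding k_def circle_kernel_def
      using KW s pos by (intro mult_left_mono mult_right_mono) auto
    finally show "cmod ((h (W t) * K (W t))/(W t - z) * W t) \<le> k t" .
  qed
  then show ?thesis using hn[of z] z s by (simp add: k_def W_def)
qed

text \<open>Trading the factor \<open>(w - a)^n\<close> for the n-th power of a zero-free function
  of the same modulus on the circle and larger modulus inside leaves the right-hand side alone and
  only increases the left-hand side. The full multiplicity goes at once, so the induction runs over
  the distinct zeros.\<close>

lemma circle_mean_finite_zeros:
  fixes \<beta> :: real
  assumes s: "0 < s" "s < R" and z: "cmod z < s" and "0 \<le> \<beta>" and "finite Z"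
  shows "f holomorphic_on ball 0 R \<Longrightarrow> {w \<in> cball 0 s. f w = 0} = Z \<Longrightarrow> Z \<subseteq> ball 0 s \<Longrightarrow>
    cmod (f z) powr \<beta> \<le> integral {0..1} (\<lambda>t. cmod (f (of_real s * cis (2*pi*t))) powr \<beta> *
           circle_kernel \<gamma> s z (of_real s * cis (2*pi*t)))"
  using \<open>finite Z\<close>
proof (induction Z arbitrary: f rule: finite_induct)
  case empty
  \<comment> \<open>Without zeros on the closed disc of radius \<open>s\<close> there is a zero-free
    open disc that is slightly larger: the zeros in the closed disc of radius \<open>R1\<close> form
    a compact set, and the nearest one to the origin fixes the radius.\<close>
  define R1 where "R1 = (s + R) / 2"
  have R1: "s < R1" "R1 < R" using s by (auto simp: R1_def)
  define Y where "Y = {w \<in> cball 0 R1. f w = 0}"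
  have "continuous_on (cball 0 R1) f"
    by (rule continuous_on_subset[OF holomorphic_on_imp_continuous_on[OF empty(1)]]) (use R1 in auto)
  then have "closed (cball 0 R1 \<inter> f -` {0})"
    by (intro continuous_closed_preimage) auto
  moreover have "Y = cball 0 R1 \<inter> f -` {0}" by (auto simp: Y_def)
  ultimately have Yc: "compact Y" by (simp add: compact_eq_bounded_closed bounded_Int)
  have "\<exists>R'. s < R' \<and> R' < R \<and> (\<forall>w\<in>ball 0 R'. f w \<noteq> 0)"
  proof (cases "Y = {}")
    case True
    then show ?thesis using R1 by (intro exI[of _ R1]) (auto simp: Y_def)
  next
    case False
    then obtain w0 where w0: "w0 \<in> Y" "\<And>y. y \<in> Y \<Longrightarrow> cmod w0 \<le> cmod y"
      using continuous_attains_inf[OF Yc False, of cmod] continuous_on_norm_id by blast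
    have "cmod w0 > s"
    proof (rule ccontr)
      assume "\<not> cmod w0 > s"
      then have "w0 \<in> {w \<in> cball 0 s. f w = 0}" using w0(1) by (auto simp: Y_def)
      then show False unfolding empty(2) by blast
    qed
    moreover have "cmod w0 \<le> R1" using w0(1) by (auto simp: Y_def)
    moreover have "f w \<noteq> 0" if "cmod w < cmod w0" for w
      using that w0(2)[of w] \<open>cmod w0 \<le> R1\<close> by (auto simp: Y_def)
    ultimately show ?thesis using R1 by (intro exI[of _ "cmod w0"]) auto
  qed
  then obtain R' where "s < R'" "R' < R" "\<And>w. w \<in> ball 0 R' \<Longrightarrow> f w \<noteq> 0" by blast
  moreover have "f holomorphic_on ball 0 R'"
    by (rule holomorphic_on_subset[OF empty(1)]) (use \<open>R' < R\<close> in auto)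
  ultimately show ?case using z s(1) by (intro circle_mean_zero_free) auto
next
  case (insert a Z)
  have a: "cmod a < s" "f a = 0" using insert by auto
  have holf: "f holomorphic_on ball 0 R" by fact
  have nc: "\<not> f constant_on ball 0 R"
  proof
    assume "f constant_on ball 0 R"
    then have "f (of_real s) = f a" using a s unfolding constant_on_def by auto
    then have "of_real s \<in> {w \<in> cball 0 s. f w = 0}" using a s by auto
    then have "complex_of_real s \<in> ball 0 s" using insert by blast
    then show False using s by simp
  qed
  have aR: "a \<in> ball 0 R" using a s by simp
  obtain g0 r n where g0: "0 < n"  "0 < r"  "ball a r \<subseteq> ball 0 R" "g0 holomorphic_on ball a r"
            "\<And>w. w \<in> ball a r \<Longrightarrow> f w = (w - a)^n * g0 w"
            "\<And>w. w \<in> ball a r \<Longrightarrow> g0 w \<noteq> 0"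
    by (rule holomorphic_factor_zero_nonconstant[OF holf open_ball connected_ball aR a(2) nc]) (rule that; assumption)
  define g where "g = (\<lambda>w. if w \<in> ball a r then g0 w else f w / (w - a)^n)"
  have "g holomorphic_on (ball a r \<union> (ball 0 R - {a}))" unfolding g_def
  proof (rule holomorphic_on_If_Un)
    show "(\<lambda>w. f w / (w - a)^n) holomorphic_on (ball 0 R - {a})"
      by (intro holomorphic_intros holomorphic_on_subset[OF holf]) auto
    show "open (ball 0 R - {a})" by (simp add: open_delete)
    fix w assume "w \<in> ball a r" "w \<in> ball 0 R - {a}"
    then show "g0 w = f w / (w - a)^n" using g0(5)[of w] by (auto simp: field_simps)
  qed (use g0 in auto)
  moreover have "ball 0 R \<subseteq> ball a r \<union> (ball 0 R - {a})" using g0 by auto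
  ultimately have holg: "g holomorphic_on ball 0 R" by (rule holomorphic_on_subset)
  have fg: "f w = (w - a)^n * g w" for w
    using g0(5)[of w] g0(1,2) a by (cases "w = a") (auto simp: g_def)
  have ga: "g a \<noteq> 0" using g0(6)[of a] g0(2) by (simp add: g_def)
  \<comment> \<open>\<open>(w - a) / B w\<close> is the Blaschke factor at \<open>a\<close> for the
    disc of radius \<open>s\<close>. In the identity \<open>Bsq\<close> the last term vanishes on
    the circle and is nonnegative inside, which gives both comparisons below.\<close>
  define B where "B = (\<lambda>w. (complex_of_real (s\<^sup>2) - cnj a * w) / of_real s)"
  define h where "h = (\<lambda>w. B w ^ n * g w)"
  have holh: "h holomorphic_on ball 0 R" unfolding h_def B_def
    by (intro holomorphic_intros holg) (use s in auto)
  have Bsq: "(cmod (B w))\<^sup>2 = (cmod (w - a))\<^sup>2 + (s\<^sup>2 - (cmod w)\<^sup>2) * (s\<^sup>2 - (cmod a)\<^sup>2) / s\<^sup>2" for w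
  proof -
    have "(cmod (complex_of_real (s\<^sup>2) - cnj a * w))\<^sup>2 = s\<^sup>2 * (cmod (w - a))\<^sup>2 + (s\<^sup>2 - (cmod w)\<^sup>2) * (s\<^sup>2 - (cmod a)\<^sup>2)"
      unfolding cmod_power2 by (simp add: power2_eq_square algebra_simps)
    then show ?thesis using s by (simp add: B_def norm_divide power_divide field_simps)
  qed
  have Bge: "cmod (w - a) \<le> cmod (B w)" if "cmod w \<le> s" for w
  proof -
    have "0 \<le> (s\<^sup>2 - (cmod w)\<^sup>2) * (s\<^sup>2 - (cmod a)\<^sup>2) / s\<^sup>2"
      using that a s by (intro divide_nonneg_nonneg mult_nonneg_nonneg) (auto intro!: power_mono)
    then have "(cmod (w - a))\<^sup>2 \<le> (cmod (B w))\<^sup>2" using Bsq[of w] by simp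
    then show ?thesis by (rule power2_le_imp_le) simp
  qed
  have Beq: "cmod (B w) = cmod (w - a)" if "cmod w = s" for w
  proof -
    have "(cmod (B w))\<^sup>2 = (cmod (w - a))\<^sup>2" unfolding Bsq that by simp
    then show ?thesis by (rule power2_eq_imp_eq) simp_all
  qed
  have "B w \<noteq> 0" if "cmod w \<le> s" for w
  proof (cases "w = a")
    case True
    then have "(cmod (B w))\<^sup>2 > 0" unfolding Bsq using a s by (auto intro!: divide_pos_pos mult_pos_pos simp: power_strict_mono)
    then show ?thesis by auto
  next
    case False then show ?thesis using Bge[OF that] by auto
  qed
  then have hz: "h w = 0 \<longleftrightarrow> g w = 0" if "cmod w \<le> s" for w
    using that g0(1) by (auto simp: h_def)
  have "w \<in> Z" if "cmod w \<le> s" "h w = 0" for w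
  proof -
    have "g w = 0" using hz that by simp
    then have "w \<noteq> a" "f w = 0" using ga fg by auto
    then show ?thesis using that insert.prems(2) by auto
  qed
  moreover have "cmod w \<le> s \<and> h w = 0" if "w \<in> Z" for w
  proof -
    have "w \<noteq> a" using that insert by auto
    have "w \<in> {w \<in> cball 0 s. f w = 0}" using that insert.prems(2) by auto
    then have "cmod w \<le> s" "f w = 0" by auto
    then show ?thesis using \<open>w \<noteq> a\<close> fg[of w] hz by auto
  qed
  ultimately have "{w \<in> cball 0 s. h w = 0} = Z" by auto
  from insert.IH[OF holh this] insert.prems
  have IH: "cmod (h z) powr \<beta> \<le> integral {0..1} (\<lambda>t. cmod (h (of_real s * cis (2*pi*t))) powr \<beta> *
           circle_kernel \<gamma> s z (of_real s * cis (2*pi*t)))" by auto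
  have eq: "cmod (h (of_real s * cis (2*pi*t))) = cmod (f (of_real s * cis (2*pi*t)))" for t
  proof -
    have "cmod (of_real s * cis (2*pi*t)) = s" using s by (simp add: norm_mult)
    from Beq[OF this] show ?thesis by (simp add: h_def fg norm_mult norm_power)
  qed
  have "cmod (f z) \<le> cmod (h z)" unfolding h_def fg norm_mult norm_power
    using Bge[of z] z by (intro mult_right_mono power_mono) auto
  then have "cmod (f z) powr \<beta> \<le> cmod (h z) powr \<beta>" using \<open>0 \<le> \<beta>\<close> by (intro powr_mono2) auto
  with IH show ?case unfolding eq by linarith
qed

text \<open>The form with a nonnegative integral is the one that rotation averaging and Fubini
  consume. Circles that meet a zero are excluded here; their radii form a null set and are discarded
  by \<open>AE_circle_nonzero\<close>.\<close>

lemma circle_mean: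
  fixes \<beta> :: real
  assumes f: "f holomorphic_on ball 0 R" and s: "0 < s" "s < R" and z: "cmod z < s" and "0 \<le> \<beta>"
    and nz: "\<And>w. cmod w = s \<Longrightarrow> f w \<noteq> 0"
  shows "ennreal (cmod (f z) powr \<beta>) \<le> (\<integral>\<^sup>+t. ennreal (cmod (f (of_real s * cis (2*pi*t))) powr \<beta> *
           circle_kernel \<gamma> s z (of_real s * cis (2*pi*t))) * indicator {0..1} t \<partial>lborel)"
proof -
  define W where "W = (\<lambda>t. complex_of_real s * cis (2 * pi * t))"
  have Ws: "cmod (W t) = s" for t using s by (simp add: W_def norm_mult)
  define Z where "Z = {w \<in> cball 0 s. f w = 0}"
  have "finite Z"
  proof (cases "Z = {}")
    case False
    then obtain a where a: "cmod a \<le> s" "f a = 0" by (auto simp: Z_def)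
    show ?thesis unfolding Z_def
    proof (rule holomorphic_compact_finite_zeros[OF f])
      show "\<not> f constant_on ball 0 R"
      proof
        assume "f constant_on ball 0 R"
        then have "f (of_real s) = f a" using a s unfolding constant_on_def by auto
        then show False using nz[of "of_real s"] a s by simp
      qed
    qed (use s in auto)
  qed simp
  have "Z \<subseteq> ball 0 s" unfolding Z_def using nz by force
  from circle_mean_finite_zeros[OF s z \<open>0 \<le> \<beta>\<close> \<open>finite Z\<close> f Z_def[symmetric] this, of \<gamma>]
  have le: "cmod (f z) powr \<beta> \<le> integral {0..1} (\<lambda>t. cmod (f (W t)) powr \<beta> * circle_kernel \<gamma> s z (W t))"
    by (simp add: W_def)
  have Wz: "W t \<noteq> z" for t using Ws[of t] z by auto
  have contW: "continuous_on A W" for A unfolding W_def by (intro continuous_intros)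
  have "continuous_on {0..1} (\<lambda>t. f (W t))"
    by (intro continuous_on_compose2[OF holomorphic_on_imp_continuous_on[OF f] contW]) (use Ws s in auto)
  then have "continuous_on {0..1} (\<lambda>t. cmod (f (W t)) powr \<beta> * circle_kernel \<gamma> s z (W t))" unfolding circle_kernel_def
    by (intro continuous_intros contW) (use Wz nz[OF Ws] in auto)
  then have "((\<lambda>t. cmod (f (W t)) powr \<beta> * circle_kernel \<gamma> s z (W t)) has_integral
      integral {0..1} (\<lambda>t. cmod (f (W t)) powr \<beta> * circle_kernel \<gamma> s z (W t))) {0..1}"
    by (intro integrable_integral integrable_continuous_real)
  then have "(\<integral>\<^sup>+t. ennreal (cmod (f (W t)) powr \<beta> * circle_kernel \<gamma> s z (W t)) * indicator {0..1} t \<partial>lborel) =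
     ennreal (integral {0..1} (\<lambda>t. cmod (f (W t)) powr \<beta> * circle_kernel \<gamma> s z (W t)))"
    using z s by (intro nn_integral_has_integral_lebesgue' mult_nonneg_nonneg) (auto simp: circle_kernel_def)
  then show ?thesis using le by (simp add: W_def ennreal_leI)
qed

section \<open>Normalized area measure\<close>

text \<open>Uniqueness of Haar measure made concrete. The rotated measure \<open>m\<close> is
  translation invariant, so the double integral of
  \<open>indicator A x * indicator B (y - x)\<close> against \<open>m\<close> and
  \<open>lborel\<close> can be evaluated in both orders; the unit ball \<open>B\<close> is preserved
  by the rotation and cancels.\<close>

lemma lborel_rotate:
  assumes c: "cmod c = 1"
  shows "distr lborel borel ((*) c) = lborel"
proof (rule measure_eqI)
  fix A :: "complex set" assume "A \<in> sets (distr lborel borel ((*) c))"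
  then have A[measurable]: "A \<in> sets borel" by simp
  define m where "m = distr lborel borel ((*) c)"
  have [measurable_cong, simp]: "sets m = sets borel" by (simp add: m_def)
  have c0: "c \<noteq> 0" using c by auto
  have m_int: "(\<integral>\<^sup>+x. F x \<partial>m) = (\<integral>\<^sup>+x. F (c * x) \<partial>lborel)" if [measurable]: "F \<in> borel_measurable borel" for F :: "complex \<Rightarrow> ennreal"
    unfolding m_def by (subst nn_integral_distr) auto
  interpret m: sigma_finite_measure m
  proof
    have fin: "emeasure m (ball 0 (real n)) \<noteq> \<infinity>" for n :: nat
    proof -
      have "(*) c -` ball 0 (real n) = ball 0 (real n)" by (auto simp: norm_mult c)
      then have "emeasure m (ball 0 (real n)) = emeasure lborel (ball 0 (real n) :: complex set)"
        by (simp add: m_def emeasure_distr)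
      then show ?thesis by (simp add: emeasure_ball)
    qed
    show "\<exists>A. countable A \<and> A \<subseteq> sets m \<and> \<Union>A = space m \<and> (\<forall>a\<in>A. emeasure m a \<noteq> \<infinity>)"
      by (rule exI[of _ "range (\<lambda>n::nat. ball 0 (real n))"])
         (use fin reals_Archimedean2 in \<open>auto simp: m_def\<close>)
  qed
  define B where "B = ball (0::complex) 1"
  have [measurable]: "B \<in> sets borel" by (simp add: B_def)
  have trans: "(\<integral>\<^sup>+x. F (x + y) \<partial>lborel) = (\<integral>\<^sup>+x. F x \<partial>lborel)" if [measurable]: "F \<in> borel_measurable borel" for F :: "complex \<Rightarrow> ennreal" and y
    by (subst (2) lborel_distr_plus[of y, symmetric], subst nn_integral_distr) (auto simp: add.commute)
  have transm: "(\<integral>\<^sup>+x. F (x + y) \<partial>m) = (\<integral>\<^sup>+x. F x \<partial>m)" if [measurable]: "F \<in> borel_measurable borel" for F :: "complex \<Rightarrow> ennreal" and y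
  proof -
    have "(\<integral>\<^sup>+x. F (x + y) \<partial>m) = (\<integral>\<^sup>+x. F (c * (x + y / c)) \<partial>lborel)"
      using c0 by (subst m_int) (auto simp: distrib_left)
    also have "\<dots> = (\<integral>\<^sup>+x. F (c * x) \<partial>lborel)" by (rule trans) simp
    also have "\<dots> = (\<integral>\<^sup>+x. F x \<partial>m)" by (subst m_int) auto
    finally show ?thesis .
  qed
  interpret lm: pair_sigma_finite lborel m ..
  have em: "emeasure m A = (\<integral>\<^sup>+x. indicator A x \<partial>m)" by simp
  have "emeasure m A * emeasure lborel B = (\<integral>\<^sup>+x. indicator A x * emeasure lborel B \<partial>m)"
    by (simp add: nn_integral_multc)
  also have "\<dots> = (\<integral>\<^sup>+x. indicator A x * (\<integral>\<^sup>+y. indicator B (y + (-x)) \<partial>lborel) \<partial>m)"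
    by (subst trans) auto
  also have "\<dots> = (\<integral>\<^sup>+x. (\<integral>\<^sup>+y. indicator A x * indicator B (y - x) \<partial>lborel) \<partial>m)"
    by (subst nn_integral_cmult[symmetric]) auto
  also have "\<dots> = (\<integral>\<^sup>+y. (\<integral>\<^sup>+x. indicator A x * indicator B (y - x) \<partial>m) \<partial>lborel)"
    by (subst lm.Fubini') auto
  \<comment> \<open>Translating \<open>x\<close> by \<open>y\<close> frees the second indicator of
    \<open>y\<close> and so separates the variables.\<close>
  also have "\<dots> = (\<integral>\<^sup>+y. (\<integral>\<^sup>+x. indicator A (x + y) * indicator B (y - (x + y)) \<partial>m) \<partial>lborel)"
    by (intro nn_integral_cong transm[symmetric]) measurable
  also have "\<dots> = (\<integral>\<^sup>+y. (\<integral>\<^sup>+x. indicator A (x + y) * indicator B (- x) \<partial>m) \<partial>lborel)"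
    by simp
  also have "\<dots> = (\<integral>\<^sup>+x. (\<integral>\<^sup>+y. indicator A (x + y) * indicator B (- x) \<partial>lborel) \<partial>m)"
    by (subst lm.Fubini') auto
  also have "\<dots> = (\<integral>\<^sup>+x. (\<integral>\<^sup>+y. indicator A (y + x) \<partial>lborel) * indicator B (- x) \<partial>m)"
    by (subst nn_integral_multc[symmetric]) (auto simp: add.commute)
  also have "\<dots> = (\<integral>\<^sup>+x. emeasure lborel A * indicator B (- x) \<partial>m)"
    by (subst trans) auto
  also have "\<dots> = emeasure lborel A * (\<integral>\<^sup>+x. indicator B (- x) \<partial>m)"
    by (subst nn_integral_cmult) auto
  also have "(\<integral>\<^sup>+x. indicator B (- x) \<partial>m) = (\<integral>\<^sup>+x. indicator B (- (c * x)) \<partial>lborel)"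
    by (subst m_int) auto
  also have "\<dots> = (\<integral>\<^sup>+x. indicator B x \<partial>lborel)"
    by (intro nn_integral_cong) (simp add: B_def indicator_def norm_mult c)
  finally have eq: "emeasure m A * emeasure lborel B = emeasure lborel A * emeasure lborel B" by simp
  have "emeasure lborel B = ennreal pi" by (simp add: B_def emeasure_ball unit_ball_vol_2)
  then have "emeasure m A = emeasure lborel A"
    using eq pi_gt_zero by (auto simp: mult.commute[of _ "ennreal pi"] ennreal_mult_cancel_left)
  then show "emeasure (distr lborel borel ((*) c)) A = emeasure lborel A" by (simp add: m_def)
qed simp

lemma lebesgue_rotate:
  assumes c: "cmod c = 1"
  shows "distr lebesgue lebesgue ((*) c) = lebesgue" "(*) c \<in> lebesgue \<rightarrow>\<^sub>M lebesgue"
proof -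
  have eq: "distr lebesgue lborel ((*) c) = lborel"
    using lborel_rotate[OF c] by (subst distr_completion) (auto cong: distr_cong)
  show "(*) c \<in> lebesgue \<rightarrow>\<^sub>M lebesgue"
    by (intro completion.measurable_completion2) (auto simp: eq measurable_completion)
  show "distr lebesgue lebesgue ((*) c) = lebesgue"
    by (subst completion.completion_distr_eq[symmetric]) (auto simp: eq measurable_completion)
qed

lemma space_dA [simp]: "space dA = unit_disc"
  by (simp add: dA_def space_scale_measure)

lemma sets_dA: "sets dA = sets (lebesgue_on unit_disc)"
  by (simp add: dA_def)

lemma measurable_dA: "measurable dA N = measurable (lebesgue_on unit_disc) N"
  by (rule measurable_cong_sets) (simp_all add: sets_dA)

lemma borel_sets_dA: "A \<in> sets borel \<Longrightarrow> A \<subseteq> unit_disc \<Longrightarrow> A \<in> sets dA"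
  by (simp add: sets_dA sets_restrict_space_iff)

lemma borel_measurable_dA_I: "f \<in> borel_measurable borel \<Longrightarrow> f \<in> borel_measurable dA"
  by (simp add: measurable_dA measurable_completion measurable_restrict_space1)

lemma measurable_id_dA: "(\<lambda>x. x) \<in> dA \<rightarrow>\<^sub>M borel"
  by (rule borel_measurable_dA_I) simp

lemma nn_integral_dA:
  assumes "F \<in> borel_measurable dA"
  shows "(\<integral>\<^sup>+z. F z \<partial>dA) = ennreal (1/pi) * (\<integral>\<^sup>+z. F z * indicator unit_disc z \<partial>lebesgue)"
  using assms unfolding measurable_dA unfolding dA_def
  by (subst nn_integral_scale_measure) (auto simp: nn_integral_restrict_space)

lemma emeasure_dA: "A \<in> sets dA \<Longrightarrow> emeasure dA A = ennreal (1/pi) * emeasure lebesgue A"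
  by (simp add: dA_def sets_restrict_space_iff emeasure_restrict_space)

lemma finite_measure_dA: "finite_measure dA"
proof
  show "emeasure dA (space dA) \<noteq> \<infinity>"
    by (simp add: emeasure_dA borel_sets_dA emeasure_ball ennreal_mult_eq_top_iff)
qed

lemma rotate_measurable_dA:
  assumes c: "cmod c = 1" shows "(*) c \<in> dA \<rightarrow>\<^sub>M dA"
proof -
  have "(*) c \<in> lebesgue_on unit_disc \<rightarrow>\<^sub>M lebesgue_on unit_disc"
    using lebesgue_rotate(2)[OF c] by (rule measurable_restrict_space3) (simp add: norm_mult c)
  then show ?thesis by (simp add: measurable_cong_sets[OF sets_dA sets_dA])
qed

lemma nn_integral_dA_rotate:
  assumes F: "F \<in> borel_measurable dA" and c: "cmod c = 1"
  shows "(\<integral>\<^sup>+z. F (c * z) \<partial>dA) = (\<integral>\<^sup>+z. F z \<partial>dA)"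
proof -
  have [measurable]: "(\<lambda>z. F z * indicator unit_disc z) \<in> borel_measurable lebesgue"
    using F by (simp add: measurable_dA borel_measurable_restrict_space_iff_ennreal)
  have "(\<integral>\<^sup>+z. F z * indicator unit_disc z \<partial>lebesgue) = (\<integral>\<^sup>+z. F z * indicator unit_disc z \<partial>distr lebesgue lebesgue ((*) c))"
    by (simp add: lebesgue_rotate(1)[OF c])
  also have "\<dots> = (\<integral>\<^sup>+z. F (c * z) * indicator unit_disc (c * z) \<partial>lebesgue)"
    using lebesgue_rotate(2)[OF c] by (subst nn_integral_distr) auto
  also have "\<dots> = (\<integral>\<^sup>+z. F (c * z) * indicator unit_disc z \<partial>lebesgue)"
    by (simp add: indicator_def norm_mult c)
  finally show ?thesis
    using F measurable_compose[OF rotate_measurable_dA[OF c] F] by (simp add: nn_integral_dA)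
qed

lemma sigma_finite_dA: "sigma_finite_measure dA"
  using finite_measure_dA by (rule finite_measure.axioms(1))

text \<open>Stands in for polar coordinates: for each fixed angle the rotation invariance of
  \<open>dA\<close> makes the integral independent of \<open>t\<close>, and the interval of angles
  has length one.\<close>

lemma radial_rotation_average:
  fixes \<sigma> \<Phi> :: "complex \<Rightarrow> ennreal"
  assumes \<sigma>[measurable]: "\<sigma> \<in> borel_measurable dA"
    and rad: "\<And>z. cmod z < 1 \<Longrightarrow> \<sigma> z = \<sigma> (of_real (cmod z))"
    and \<Phi>[measurable]: "\<Phi> \<in> borel_measurable borel"
  shows "(\<integral>\<^sup>+z. \<sigma> z * \<Phi> z \<partial>dA) =
    (\<integral>\<^sup>+z. \<sigma> z * (\<integral>\<^sup>+t. \<Phi> (z * cis (2*pi*t)) * indicator {0..1::real} t \<partial>lborel) \<partial>dA)"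
proof -
  interpret dA: sigma_finite_measure dA by (rule sigma_finite_dA)
  interpret P: pair_sigma_finite lborel dA ..
  note measurable_id_dA[measurable]
  have cis_meas[measurable]: "(\<lambda>t. cis (2*pi*t)) \<in> borel_measurable borel"
    by (intro borel_measurable_continuous_onI continuous_intros)
  have "(\<integral>\<^sup>+z. \<sigma> z * (\<integral>\<^sup>+t. \<Phi> (z * cis (2*pi*t)) * indicator {0..1::real} t \<partial>lborel) \<partial>dA) =
     (\<integral>\<^sup>+z. (\<integral>\<^sup>+t. \<sigma> z * (\<Phi> (z * cis (2*pi*t)) * indicator {0..1::real} t) \<partial>lborel) \<partial>dA)"
    by (subst nn_integral_cmult) auto
  also have "\<dots> = (\<integral>\<^sup>+t. (\<integral>\<^sup>+z. \<sigma> z * (\<Phi> (z * cis (2*pi*t)) * indicator {0..1::real} t) \<partial>dA) \<partial>lborel)"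
    by (subst P.Fubini') auto
  also have "\<dots> = (\<integral>\<^sup>+t. (\<integral>\<^sup>+z. \<sigma> z * \<Phi> z \<partial>dA) * indicator {0..1::real} t \<partial>lborel)"
  proof (intro nn_integral_cong)
    fix t :: real
    have "(\<integral>\<^sup>+z. \<sigma> z * (\<Phi> (z * cis (2*pi*t)) * indicator {0..1::real} t) \<partial>dA) =
       (\<integral>\<^sup>+z. \<sigma> (cis (2*pi*t) * z) * \<Phi> (cis (2*pi*t) * z) * indicator {0..1::real} t \<partial>dA)"
    proof (intro nn_integral_cong)
      fix z assume "z \<in> space dA"
      then have "cmod z < 1" by simp
      then have "\<sigma> (cis (2*pi*t) * z) = \<sigma> z"
        using rad[of z] rad[of "cis (2*pi*t) * z"] by (simp add: norm_mult)
      then show "\<sigma> z * (\<Phi> (z * cis (2*pi*t)) * indicator {0..1::real} t) =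
         \<sigma> (cis (2*pi*t) * z) * \<Phi> (cis (2*pi*t) * z) * indicator {0..1::real} t"
        by (simp add: mult_ac)
    qed
    also have "\<dots> = (\<integral>\<^sup>+z. \<sigma> z * \<Phi> z * indicator {0..1::real} t \<partial>dA)"
      by (subst nn_integral_dA_rotate) auto
    also have "\<dots> = (\<integral>\<^sup>+z. \<sigma> z * \<Phi> z \<partial>dA) * indicator {0..1::real} t"
      by (subst nn_integral_multc) auto
    finally show "(\<integral>\<^sup>+z. \<sigma> z * (\<Phi> (z * cis (2*pi*t)) * indicator {0..1::real} t) \<partial>dA) =
      (\<integral>\<^sup>+z. \<sigma> z * \<Phi> z \<partial>dA) * indicator {0..1::real} t" .
  qed
  also have "\<dots> = (\<integral>\<^sup>+z. \<sigma> z * \<Phi> z \<partial>dA)" by (subst nn_integral_cmult) auto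
  finally show ?thesis ..
qed

section \<open>Circles free of zeros and the radial submean inequality\<close>

lemma fsigma_ball: "fsigma (ball (0::complex) R)"
proof -
  have "ball (0::complex) R = (\<Union>n. cball 0 (R - 1 / real (Suc n)))"
  proof (intro equalityI subsetI)
    fix x :: complex assume "x \<in> ball 0 R"
    then have "0 < R - cmod x" by simp
    then obtain n where "1 / real (Suc n) < R - cmod x" using nat_approx_posE by blast
    then show "x \<in> (\<Union>n. cball 0 (R - 1 / real (Suc n)))" by (intro UN_I[of n]) auto
  next
    fix x :: complex assume "x \<in> (\<Union>n. cball 0 (R - 1 / real (Suc n)))"
    then obtain n where "cmod x \<le> R - 1 / real (Suc n)" by auto
    moreover have "1 / real (Suc n) > 0" by simp
    ultimately show "x \<in> ball 0 R" unfolding mem_ball_0 by linarith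
  qed
  moreover have "fsigma (\<Union>n. cball (0::complex) (R - 1 / real (Suc n)))" by (rule fsigma.intros) simp
  ultimately show ?thesis by simp
qed

text \<open>A non-constant holomorphic function has countably many zeros, so the circles about the
  origin through them are countably many null sets.\<close>

lemma AE_circle_nonzero:
  assumes f: "f holomorphic_on ball 0 R" and nz: "v \<in> ball 0 R" "f v \<noteq> 0"
  shows "AE w in lebesgue. cmod w < R \<longrightarrow> (\<forall>u. cmod u = cmod w \<longrightarrow> f u \<noteq> 0)"
proof (cases "f constant_on ball 0 R")
  case True
  then have "f u \<noteq> 0" if "cmod u < R" for u using nz that unfolding constant_on_def by auto
  then show ?thesis by (intro AE_I2) auto
next
  case False
  define Z where "Z = {z \<in> ball 0 R. f z = 0}"
  have "countable Z" unfolding Z_def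
    by (rule holomorphic_countable_zeros[OF f]) (use False fsigma_ball in auto)
  then have "negligible (\<Union>u\<in>Z. sphere (0::complex) (cmod u))"
    by (intro negligible_countable_Union) (auto intro: negligible_sphere)
  then have "(\<Union>u\<in>Z. sphere (0::complex) (cmod u)) \<in> null_sets lebesgue"
    by (simp add: negligible_iff_null_sets)
  moreover have "{w \<in> space lebesgue. \<not> (cmod w < R \<longrightarrow> (\<forall>u. cmod u = cmod w \<longrightarrow> f u \<noteq> 0))} \<subseteq> (\<Union>u\<in>Z. sphere 0 (cmod u))"
  proof
    fix w assume "w \<in> {w \<in> space lebesgue. \<not> (cmod w < R \<longrightarrow> (\<forall>u. cmod u = cmod w \<longrightarrow> f u \<noteq> 0))}"
    then obtain u where "cmod w < R" "cmod u = cmod w" "f u = 0" by auto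
    then show "w \<in> (\<Union>u\<in>Z. sphere 0 (cmod u))" by (intro UN_I[of u]) (auto simp: Z_def)
  qed
  ultimately show ?thesis by (rule AE_I')
qed

lemma AE_dA_I: "AE w in lebesgue. P w \<Longrightarrow> AE w in dA. P w"
proof -
  assume "AE w in lebesgue. P w"
  then obtain N where N: "{w. \<not> P w} \<subseteq> N" "N \<in> null_sets lebesgue"
    unfolding eventually_ae_filter by auto
  have "N \<inter> unit_disc \<in> null_sets lebesgue"
    using N(2) by (intro null_set_Int2) auto
  then have "N \<inter> unit_disc \<in> null_sets dA"
    by (auto simp: null_sets_def sets_dA sets_restrict_space_iff emeasure_dA)
  then show ?thesis by (rule AE_I') (use N in auto)
qed

lemma borel_measurable_holomorphic_indicator:
  assumes "f holomorphic_on A" "open A" shows "(\<lambda>w. f w * indicator A w) \<in> borel_measurable borel"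
proof -
  have "(\<lambda>w. f w * indicator A w) = (\<lambda>w. indicator A w *\<^sub>R f w)"
    by (auto simp: fun_eq_iff indicator_def)
  then show ?thesis
    using borel_measurable_continuous_on_indicator[of A f] assms
    by (simp add: holomorphic_on_imp_continuous_on)
qed

text \<open>The circle means integrated over the radius against a radial density. The density must
  live strictly outside the circle through \<open>z\<close>, since the kernel is available only for
  larger radii; otherwise it is arbitrary, and the two uses are the indicator of a ball and the
  weight cut off near the boundary.\<close>

lemma holomorphic_radial_submean:
  fixes \<sigma> :: "complex \<Rightarrow> ennreal" and \<beta> :: real
  assumes f: "f holomorphic_on ball 0 R" and "0 < \<beta>"
    and \<sigma>[measurable]: "\<sigma> \<in> borel_measurable dA"
    and rad: "\<And>w. cmod w < 1 \<Longrightarrow> \<sigma> w = \<sigma> (of_real (cmod w))"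
    and supp: "\<And>w. cmod w < 1 \<Longrightarrow> \<sigma> w \<noteq> 0 \<Longrightarrow> cmod z < cmod w \<and> cmod w < R"
  shows "ennreal (cmod (f z) powr \<beta>) * (\<integral>\<^sup>+w. \<sigma> w \<partial>dA) \<le>
    (\<integral>\<^sup>+w. \<sigma> w * ennreal (cmod (f w) powr \<beta> * circle_kernel \<gamma> (cmod w) z w) \<partial>dA)"
proof (cases "\<exists>v\<in>ball 0 R. f v \<noteq> 0")
  \<comment> \<open>A function vanishing on the whole ball has no good radii and is treated apart.
    If in addition \<open>z\<close> lies outside the ball, the support condition leaves no place for
    \<open>\<sigma>\<close> to be nonzero.\<close>
  case False
  show ?thesis
  proof (cases "z \<in> ball 0 R")
    case True
    then show ?thesis using False \<open>0 < \<beta>\<close> by simp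
  next
    case z: False
    have "(\<integral>\<^sup>+w. \<sigma> w \<partial>dA) = (\<integral>\<^sup>+w. 0 \<partial>dA)"
      using supp z by (intro nn_integral_cong) force
    then show ?thesis by simp
  qed
next
  case True
  then obtain v where v: "v \<in> ball 0 R" "f v \<noteq> 0" by blast
  note measurable_id_dA[measurable]
  define A where "A = ball (0::complex) R - cball 0 (cmod z)"
  have [measurable]: "A \<in> sets borel" by (simp add: A_def)
  have fm[measurable]: "(\<lambda>w. f w * indicator (ball 0 R) w) \<in> borel_measurable borel"
    by (rule borel_measurable_holomorphic_indicator[OF f]) simp
  define \<Phi> where "\<Phi> = (\<lambda>w. ennreal (cmod (f w * indicator (ball 0 R) w) powr \<beta> * circle_kernel \<gamma> (cmod w) z w) * indicator A w)"
  have [measurable]: "\<Phi> \<in> borel_measurable borel" unfolding \<Phi>_def circle_kernel_def by measurable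
  have ae: "AE w in dA. cmod w < R \<longrightarrow> (\<forall>u. cmod u = cmod w \<longrightarrow> f u \<noteq> 0)"
    using AE_circle_nonzero[OF f v] by (rule AE_dA_I)
  have 1: "ennreal (cmod (f z) powr \<beta>) * (\<integral>\<^sup>+w. \<sigma> w \<partial>dA) = (\<integral>\<^sup>+w. \<sigma> w * ennreal (cmod (f z) powr \<beta>) \<partial>dA)"
    by (subst nn_integral_cmult[symmetric]) (auto simp: mult.commute)
  have 2: "(\<integral>\<^sup>+w. \<sigma> w * ennreal (cmod (f z) powr \<beta>) \<partial>dA) \<le> (\<integral>\<^sup>+w. \<sigma> w * (\<integral>\<^sup>+t. \<Phi> (w * cis (2*pi*t)) * indicator {0..1::real} t \<partial>lborel) \<partial>dA)"
  proof (rule nn_integral_mono_AE, use ae AE_space in eventually_elim)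
    fix w assume nz: "cmod w < R \<longrightarrow> (\<forall>u. cmod u = cmod w \<longrightarrow> f u \<noteq> 0)" 
    assume "w \<in> space dA"
    then have w1: "cmod w < 1" by simp
    show "\<sigma> w * ennreal (cmod (f z) powr \<beta>) \<le> \<sigma> w * (\<integral>\<^sup>+t. \<Phi> (w * cis (2*pi*t)) * indicator {0..1::real} t \<partial>lborel)"
    proof (cases "\<sigma> w = 0")
      case False
      then have zw: "cmod z < cmod w" "cmod w < R" using supp w1 by auto
      define s where "s = cmod w"
      \<comment> \<open>The direction of \<open>w\<close>. Replacing \<open>f\<close> by its
        composition with multiplication by \<open>u\<close>, and \<open>z\<close> by
        \<open>z / u\<close>, starts the circle at \<open>w\<close>; distances and hence the kernel
        are unchanged.\<close>
      define u where "u = w / of_real s"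
      have s0: "0 < s" using zw by (auto simp: s_def intro: le_less_trans[OF norm_ge_zero])
      have u1: "cmod u = 1" using s0 by (simp add: u_def norm_divide s_def)
      then have u0: "u \<noteq> 0" by auto
      have wu: "w = of_real s * u" using s0 by (simp add: u_def)
      have "(f \<circ> (\<lambda>z. u * z)) holomorphic_on ball 0 R"
        by (rule holomorphic_on_compose_gen[OF _ f]) (auto simp: norm_mult u1 intro!: holomorphic_intros)
      then have fu: "(\<lambda>z. f (u * z)) holomorphic_on ball 0 R" by (simp add: o_def)
      have "ennreal (cmod (f (u * (z / u))) powr \<beta>) \<le> (\<integral>\<^sup>+t. ennreal (cmod (f (u * (of_real s * cis (2*pi*t)))) powr \<beta> *
           circle_kernel \<gamma> s (z / u) (of_real s * cis (2*pi*t))) * indicator {0..1} t \<partial>lborel)"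
      proof (rule circle_mean[OF fu s0, of "z / u" \<beta> \<gamma>])
        show "s < R" using zw(2) by (simp add: s_def)
        show "cmod (z / u) < s" using zw(1) by (simp add: s_def norm_divide u1)
        show "0 \<le> \<beta>" using \<open>0 < \<beta>\<close> by simp
        fix w' assume w': "cmod w' = s"
        have "cmod (u * w') = cmod w" by (simp add: norm_mult u1 w' s_def)
        then show "f (u * w') \<noteq> 0" using nz zw(2) by blast
      qed
      also have "\<dots> = (\<integral>\<^sup>+t. \<Phi> (w * cis (2*pi*t)) * indicator {0..1::real} t \<partial>lborel)"
      proof (intro nn_integral_cong arg_cong2[where f="(*)"] refl)
        fix t :: real
        have e: "u * (of_real s * cis (2*pi*t)) = w * cis (2*pi*t)" by (simp add: wu)
        have "of_real s * cis (2*pi*t) - z / u = (w * cis (2*pi*t) - z) / u"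
          unfolding wu using u0 by (simp add: diff_divide_distrib)
        then have "cmod (of_real s * cis (2*pi*t) - z / u) = cmod (w * cis (2*pi*t) - z)"
          by (simp add: norm_divide u1)
        then have k: "circle_kernel \<gamma> s (z / u) (of_real s * cis (2*pi*t)) = circle_kernel \<gamma> s z (w * cis (2*pi*t))"
          by (simp add: circle_kernel_def norm_divide u1)
        show "ennreal (cmod (f (u * (of_real s * cis (2*pi*t)))) powr \<beta> *
           circle_kernel \<gamma> s (z / u) (of_real s * cis (2*pi*t))) = \<Phi> (w * cis (2*pi*t))"
          unfolding e k using zw by (simp add: \<Phi>_def A_def norm_mult s_def)
      qed
      finally have "ennreal (cmod (f z) powr \<beta>) \<le> (\<integral>\<^sup>+t. \<Phi> (w * cis (2*pi*t)) * indicator {0..1::real} t \<partial>lborel)"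
        using u0 by simp
      then show ?thesis by (rule mult_left_mono) simp
    qed simp
  qed
  have 3: "(\<integral>\<^sup>+w. \<sigma> w * \<Phi> w \<partial>dA) = (\<integral>\<^sup>+w. \<sigma> w * (\<integral>\<^sup>+t. \<Phi> (w * cis (2*pi*t)) * indicator {0..1::real} t \<partial>lborel) \<partial>dA)"
    by (rule radial_rotation_average[OF \<sigma> rad]) auto
  have 4: "(\<integral>\<^sup>+w. \<sigma> w * \<Phi> w \<partial>dA) \<le> (\<integral>\<^sup>+w. \<sigma> w * ennreal (cmod (f w) powr \<beta> * circle_kernel \<gamma> (cmod w) z w) \<partial>dA)"
  proof (rule nn_integral_mono)
    fix w :: complex
    have "\<Phi> w \<le> ennreal (cmod (f w) powr \<beta> * circle_kernel \<gamma> (cmod w) z w)"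
      by (cases "w \<in> A") (simp_all add: \<Phi>_def A_def)
    then show "\<sigma> w * \<Phi> w \<le> \<sigma> w * ennreal (cmod (f w) powr \<beta> * circle_kernel \<gamma> (cmod w) z w)"
      by (rule mult_left_mono) simp
  qed
  show ?thesis using 2 4 unfolding 1 3 by (rule order_trans)
qed

section \<open>Pseudohyperbolic discs and averaging\<close>

lemma pseudo_disc_iff:
  assumes "cmod z < 1"
  shows "\<zeta> \<in> pseudo_disc z r \<longleftrightarrow> cmod \<zeta> < 1 \<and> cmod (z - \<zeta>) < r * cmod (1 - cnj z * \<zeta>)"
proof (cases "cmod \<zeta> < 1")
  case True
  have "cmod z * cmod \<zeta> < 1 * 1" using assms True by (intro mult_strict_mono') auto
  then have "cmod (cnj z * \<zeta>) < 1" by (simp add: norm_mult)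
  then have "1 - cnj z * \<zeta> \<noteq> 0" by auto
  then show ?thesis using True by (simp add: pseudo_disc_def norm_divide divide_less_eq)
qed (simp add: pseudo_disc_def)

lemma pseudo_disc_subset: "pseudo_disc z r \<subseteq> unit_disc"
  by (auto simp: pseudo_disc_def)

lemma pseudo_disc_commute:
  assumes "cmod z < 1" "cmod \<zeta> < 1"
  shows "\<zeta> \<in> pseudo_disc z r \<longleftrightarrow> z \<in> pseudo_disc \<zeta> r"
proof -
  have "1 - cnj \<zeta> * z = cnj (1 - cnj z * \<zeta>)" by simp
  then have "cmod (1 - cnj z * \<zeta>) = cmod (1 - cnj \<zeta> * z)" by (simp only: complex_mod_cnj)
  then show ?thesis using assms by (simp add: pseudo_disc_iff norm_minus_commute)
qed

lemma cmod_one_minus_ge: "cmod z \<le> 1 \<Longrightarrow> cmod \<zeta> \<le> 1 \<Longrightarrow> 1 - cmod z \<le> cmod (1 - cnj z * \<zeta>)"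
proof -
  assume a: "cmod z \<le> 1" "cmod \<zeta> \<le> 1"
  have "cmod (cnj z * \<zeta>) \<le> cmod z * 1" unfolding norm_mult complex_mod_cnj using a by (intro mult_left_mono) auto
  moreover have "1 - cmod (cnj z * \<zeta>) \<le> cmod (1 - cnj z * \<zeta>)"
    using norm_triangle_ineq2[of 1 "cnj z * \<zeta>"] by simp
  ultimately show ?thesis by simp
qed

lemma ball_subset_pseudo_disc:
  assumes "cmod z < 1" "0 < r" "r \<le> 1"
  shows "ball z (r * (1 - cmod z)) \<subseteq> pseudo_disc z r"
proof
  fix x assume "x \<in> ball z (r * (1 - cmod z))"
  then have x: "cmod (z - x) < r * (1 - cmod z)" by (simp add: dist_norm)
  also have "\<dots> \<le> 1 * (1 - cmod z)" using assms by (intro mult_right_mono) auto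
  finally have x1: "cmod x < 1" using norm_triangle_ineq2[of x z] by (simp add: norm_minus_commute)
  have "r * (1 - cmod z) \<le> r * cmod (1 - cnj z * x)"
    using assms x1 by (intro mult_left_mono cmod_one_minus_ge) auto
  then show "x \<in> pseudo_disc z r" unfolding pseudo_disc_iff[OF assms(1)] using x x1 by linarith
qed

text \<open>Writing \<open>1 - cnj z * \<zeta>\<close> as \<open>1 - |z|^2\<close> plus
  \<open>cnj z * (z - \<zeta>)\<close> bounds it by \<open>2 * (1 - |z|)\<close> plus the distance
  itself, which is absorbed on the left because \<open>r < 1\<close>.\<close>

lemma pseudo_disc_dist_le:
  assumes z: "cmod z < 1" and r: "0 < r" "r < 1" and "\<zeta> \<in> pseudo_disc z r"
  shows "cmod (z - \<zeta>) \<le> 2 * r / (1 - r) * (1 - cmod z)"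
proof -
  have \<zeta>: "cmod \<zeta> < 1" "cmod (z - \<zeta>) < r * cmod (1 - cnj z * \<zeta>)"
    using assms by (simp_all add: pseudo_disc_iff)
  have eq: "1 - cnj z * \<zeta> = of_real (1 - (cmod z)\<^sup>2) + cnj z * (z - \<zeta>)"
    using complex_norm_square[of z] by (simp add: algebra_simps)
  have "cmod (1 - cnj z * \<zeta>) \<le> cmod (of_real (1 - (cmod z)\<^sup>2)) + cmod (cnj z * (z - \<zeta>))"
    unfolding eq by (rule norm_triangle_ineq)
  also have "cmod (of_real (1 - (cmod z)\<^sup>2)) = 1 - (cmod z)\<^sup>2"
    using z by (simp only: norm_of_real) (simp add: power_le_one abs_square_le_1)
  also have "\<dots> \<le> 2 * (1 - cmod z)"
  proof -
    have "0 \<le> (1 - cmod z)\<^sup>2" by simp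
    then show ?thesis by (simp add: power2_eq_square algebra_simps)
  qed
  also have "cmod (cnj z * (z - \<zeta>)) \<le> 1 * cmod (z - \<zeta>)"
    unfolding norm_mult complex_mod_cnj using z by (intro mult_right_mono) auto
  finally have "r * cmod (1 - cnj z * \<zeta>) \<le> r * (2 * (1 - cmod z) + cmod (z - \<zeta>))"
    using r by (intro mult_left_mono) auto
  then have "cmod (z - \<zeta>) * (1 - r) \<le> 2 * r * (1 - cmod z)" using \<zeta>(2) by (simp add: algebra_simps)
  then show ?thesis using r by (simp add: field_simps)
qed

text \<open>Joint measurability in centre and point, as the exchanges of integration require; fixing
  either variable recovers the disc.\<close>

lemma pred_pseudo_disc:
  assumes [measurable]: "f \<in> borel_measurable N" "g \<in> borel_measurable N"
  shows "Measurable.pred N (\<lambda>x. g x \<in> pseudo_disc (f x) r)"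
proof -
  have [measurable]: "cnj \<in> borel_measurable borel"
    by (intro borel_measurable_continuous_onI continuous_intros)
  have "Measurable.pred N (\<lambda>x. cmod (g x) < 1 \<and> cmod ((f x - g x) / (1 - cnj (f x) * g x)) < r)"
    by measurable
  then show ?thesis by (simp add: pseudo_disc_def)
qed

lemma pseudo_disc_borel: "pseudo_disc z r \<in> sets borel"
proof -
  have "Measurable.pred borel (\<lambda>x. x \<in> pseudo_disc z r)"
    by (rule pred_pseudo_disc[where f = "\<lambda>x. z" and g = "\<lambda>x. x"]) simp_all
  from predE[OF this] show ?thesis by simp
qed

lemma pseudo_disc_sets_dA: "pseudo_disc z r \<in> sets dA"
  by (intro borel_sets_dA pseudo_disc_borel pseudo_disc_subset)

lemma space_borel_measure_on_disc: "borel_measure_on_disc \<mu> \<Longrightarrow> space \<mu> = unit_disc"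
  unfolding borel_measure_on_disc_def by (drule sets_eq_imp_space_eq) (simp add: space_restrict_space)

lemma sets_borel_measure_on_disc:
  "borel_measure_on_disc \<mu> \<Longrightarrow> A \<in> sets borel \<Longrightarrow> A \<subseteq> unit_disc \<Longrightarrow> A \<in> sets \<mu>"
  unfolding borel_measure_on_disc_def by (simp add: sets_restrict_space_iff)

lemma borel_measurable_on_disc:
  assumes "borel_measure_on_disc \<mu>" "f \<in> borel_measurable borel"
  shows "f \<in> borel_measurable \<mu>"
proof -
  have "f \<in> borel_measurable (restrict_space borel unit_disc)" using assms(2) by (rule measurable_restrict_space1)
  then show ?thesis using assms(1) unfolding borel_measure_on_disc_def
    by (simp cong: measurable_cong_sets)
qed

lemma borel_measurable_holomorphic_disc:
  assumes f: "f holomorphic_on unit_disc"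
  shows "f \<in> borel_measurable dA" and "borel_measure_on_disc \<mu> \<Longrightarrow> f \<in> borel_measurable \<mu>"
proof -
  have m: "(\<lambda>w. f w * indicator unit_disc w) \<in> borel_measurable borel"
    by (rule borel_measurable_holomorphic_indicator[OF f]) simp
  show "f \<in> borel_measurable dA"
    using borel_measurable_dA_I[OF m] by (rule measurable_cong[THEN iffD1, rotated]) simp
  assume \<mu>: "borel_measure_on_disc \<mu>"
  show "f \<in> borel_measurable \<mu>"
    using borel_measurable_on_disc[OF \<mu> m]
    by (rule measurable_cong[THEN iffD1, rotated]) (simp add: space_borel_measure_on_disc[OF \<mu>])
qed

section \<open>Oscillation on small discs and the averaging estimate\<close>

lemma holomorphic_oscillation:
  assumes f: "f holomorphic_on ball \<zeta> \<rho>" and B: "\<And>x. x \<in> ball \<zeta> \<rho> \<Longrightarrow> cmod (f x) \<le> B"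
    and z: "z \<in> ball \<zeta> (\<rho>/2)"
  shows "cmod (f z - f \<zeta>) \<le> 2 * B / \<rho> * cmod (z - \<zeta>)"
proof -
  have \<rho>: "0 < \<rho>" using z zero_le_dist[of \<zeta> z] unfolding mem_ball by linarith
  show ?thesis
  proof (rule field_differentiable_bound[where S = "ball \<zeta> (\<rho>/2)"])
    fix x assume x: "x \<in> ball \<zeta> (\<rho>/2)"
    have sub: "cball x (\<rho>/2) \<subseteq> ball \<zeta> \<rho>"
    proof
      fix y assume "y \<in> cball x (\<rho>/2)"
      then show "y \<in> ball \<zeta> \<rho>" using x dist_triangle[of \<zeta> y x] by simp
    qed
    have "x \<in> ball \<zeta> \<rho>" using subsetD[OF sub, of x] \<rho> by simp
    then show "(f has_field_derivative deriv f x) (at x within ball \<zeta> (\<rho>/2))"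
      using holomorphic_derivI[OF f open_ball] by blast
    have "cmod ((deriv ^^ 1) f x) \<le> fact 1 * B / (\<rho>/2) ^ 1"
    proof (rule Cauchy_inequality)
      show "f holomorphic_on ball x (\<rho>/2)" by (rule holomorphic_on_subset[OF f]) (use sub in auto)
      show "continuous_on (cball x (\<rho>/2)) f"
        by (rule continuous_on_subset[OF holomorphic_on_imp_continuous_on[OF f] sub])
      show "0 < \<rho>/2" using \<rho> by simp
      fix y assume "cmod (x - y) = \<rho>/2"
      then have "y \<in> cball x (\<rho>/2)" by (simp add: dist_norm)
      then show "cmod (f y) \<le> B" using B sub by blast
    qed
    then show "cmod (deriv f x) \<le> 2 * B / \<rho>" by (simp add: mult.commute)
  qed (use z \<rho> in auto)
qed

text \<open>Comparing the sum with twice the maximum works for exponents on both sides of 1, where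
  neither convexity nor subadditivity alone would.\<close>

lemma powr_sum_le:
  fixes a b p :: real assumes "0 \<le> a" "0 \<le> b" "0 < p"
  shows "(a + b) powr p \<le> 2 powr p * (a powr p + b powr p)"
proof -
  have "(a + b) powr p \<le> (2 * max a b) powr p" using assms by (intro powr_mono2) auto
  also have "\<dots> = 2 powr p * (max a b) powr p" using assms by (simp add: powr_mult)
  also have "\<dots> \<le> 2 powr p * (a powr p + b powr p)" by (intro mult_left_mono) (auto simp: max_def)
  finally show ?thesis .
qed

text \<open>Scaled and translated, this covers hyperbolic discs of any centre by a number of balls
  that depends on \<open>e\<close> alone.\<close>

lemma finite_ball_cover:
  fixes e :: real assumes "0 < e"
  obtains X :: "complex set" where "finite X" "X \<noteq> {}" "cball 0 1 \<subseteq> (\<Union>x\<in>X. ball x e)"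
proof -
  have c: "cball (0::complex) 1 \<subseteq> (\<Union>x\<in>cball 0 1. ball x e)" using assms by force
  have "\<exists>X\<subseteq>cball (0::complex) 1. finite X \<and> cball 0 1 \<subseteq> (\<Union>x\<in>X. ball x e)"
    by (rule compactE_image[OF compact_cball _ c]) auto
  then obtain X where X: "finite X" "cball (0::complex) 1 \<subseteq> (\<Union>x\<in>X. ball x e)" by blast
  have "X \<noteq> {}"
  proof
    assume "X = {}"
    then have "cball (0::complex) 1 = {}" using X(2) by simp
    then show False by simp
  qed
  then show ?thesis using that[OF X(1) _ X(2)] by simp
qed

lemma borel_measurable_weight: "weight \<omega> \<Longrightarrow> (\<lambda>z. ennreal (\<omega> z)) \<in> borel_measurable dA"
  unfolding weight_def by (intro measurable_compose[OF borel_measurable_integrable measurable_ennreal]) auto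

lemma weight_mass_mono: "A \<subseteq> B \<Longrightarrow> weight_mass \<omega> A \<le> weight_mass \<omega> B"
  unfolding weight_mass_def by (intro nn_integral_mono mult_left_mono) (auto simp: indicator_def)

lemma borel_measurable_weight_mass_pseudo:
  assumes \<omega>: "weight \<omega>" and f[measurable]: "f \<in> borel_measurable N"
  shows "(\<lambda>z. weight_mass \<omega> (pseudo_disc (f z) r)) \<in> borel_measurable N"
proof -
  interpret sigma_finite_measure dA by (rule sigma_finite_dA)
  note measurable_id_dA[measurable]
  note borel_measurable_weight[OF \<omega>, measurable]
  have [measurable]: "Measurable.pred (N \<Otimes>\<^sub>M dA) (\<lambda>x. snd x \<in> pseudo_disc (f (fst x)) r)"
    by (rule pred_pseudo_disc) auto
  have "(\<lambda>x. ennreal (\<omega> (snd x)) * indicator (pseudo_disc (f (fst x)) r) (snd x)) \<in> borel_measurable (N \<Otimes>\<^sub>M dA)"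
    unfolding indicator_def of_bool_def by measurable
  then have "(\<lambda>z. \<integral>\<^sup>+x. ennreal (\<omega> x) * indicator (pseudo_disc (f z) r) x \<partial>dA) \<in> borel_measurable N"
    by (intro borel_measurable_nn_integral) (simp add: split_beta')
  then show ?thesis by (simp add: weight_mass_def)
qed

lemma inverse_ennreal_antimono: "a \<le> b \<Longrightarrow> inverse b \<le> inverse (a::ennreal)"
  unfolding less_eq_ennreal.rep_eq inverse_ennreal.rep_eq
  by (rule ereal_inverse_antimono) (rule enn2ereal_nonneg)

text \<open>Both degenerate quotients, \<open>0 / 0\<close> and \<open>top / top\<close>, are 0, so
  sets of zero mass need no separate treatment.\<close>

lemma ennreal_divide_self_le: "(x::ennreal) / x \<le> 1"
proof (cases "x = 0 \<or> x = top")
  case True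
  then show ?thesis by (auto simp: divide_ennreal_def)
next
  case False
  then have "x / x = 1" by (intro ennreal_divide_self) (auto simp: less_top zero_less_iff_neq_zero)
  then show ?thesis by simp
qed

text \<open>No doubling of the weight is involved. The disc about \<open>\<zeta>\<close> is cut into
  boundedly many pieces \<open>B x\<close> so small that each lies in \<open>pseudo_disc z r\<close>
  for every one of its own points \<open>z\<close>. On a piece the denominator is at least the mass
  of the piece, so each piece contributes at most 1.\<close>

lemma pseudo_disc_ratio_integral_le:
  fixes X :: "complex set"
  assumes \<omega>: "weight \<omega>" and X: "finite X" "cball 0 1 \<subseteq> (\<Union>x\<in>X. ball x (1/24))"
    and r: "0 < r" "r \<le> 1/6" and \<zeta>: "cmod \<zeta> < 1"
  shows "(\<integral>\<^sup>+z. ennreal (\<omega> z) / weight_mass \<omega> (pseudo_disc z r) * indicator (pseudo_disc \<zeta> r) z \<partial>dA) \<le> of_nat (card X)"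
proof -
  note measurable_id_dA[measurable]
  \<comment> \<open>A Euclidean radius for the disc, because
    \<open>2 * r / (1 - r) \<le> 3 * r\<close>. Balls of radius \<open>t / 24\<close> have diameter
    \<open>t / 12 = r * (1 - |\<zeta>|) / 4\<close>, while \<open>1 - |z|\<close> is at least half
    of \<open>1 - |\<zeta>|\<close> throughout the disc; hence the 24.\<close>
  define t where "t = 3 * r * (1 - cmod \<zeta>)"
  have t: "0 < t" using r \<zeta> by (simp add: t_def)
  define B where "B = (\<lambda>x. ball (\<zeta> + of_real t * x) (t / 24) \<inter> pseudo_disc \<zeta> r)"
  note borel_measurable_weight[OF \<omega>, measurable]
  have [measurable]: "(\<lambda>z. weight_mass \<omega> (pseudo_disc z r)) \<in> borel_measurable dA"
    by (rule borel_measurable_weight_mass_pseudo[OF \<omega>]) measurable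
  have Bm[measurable]: "B x \<in> sets dA" for x
    unfolding B_def using pseudo_disc_borel[of \<zeta> r] pseudo_disc_subset[of \<zeta> r] by (intro borel_sets_dA) auto
  have dle: "cmod (z - \<zeta>) \<le> t" if "z \<in> pseudo_disc \<zeta> r" for z
  proof -
    have "cmod (\<zeta> - z) \<le> 2 * r / (1 - r) * (1 - cmod \<zeta>)"
      using that r \<zeta> by (intro pseudo_disc_dist_le) auto
    also have "2 * r / (1 - r) \<le> 3 * r"
    proof -
      have "2 * r \<le> 3 * r * (1 - r)" using r by (simp add: field_simps)
      then show ?thesis using r by (simp add: field_simps)
    qed
    finally show ?thesis using \<zeta> by (simp add: t_def norm_minus_commute mult_right_mono)
  qed
  have cover: "indicator (pseudo_disc \<zeta> r) z \<le> (\<Sum>x\<in>X. indicator (B x) z :: ennreal)" for z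
  proof (cases "z \<in> pseudo_disc \<zeta> r")
    case True
    have "(z - \<zeta>) / of_real t \<in> cball 0 1" using dle[OF True] t by (simp add: norm_divide)
    then obtain x where x: "x \<in> X" "(z - \<zeta>) / of_real t \<in> ball x (1/24)" using X(2) by blast
    have "\<zeta> + of_real t * x - z = of_real t * (x - (z - \<zeta>) / of_real t)" using t by (simp add: field_simps)
    then have "cmod (\<zeta> + of_real t * x - z) = t * cmod (x - (z - \<zeta>) / of_real t)"
      using t by (simp only: norm_mult norm_of_real abs_of_pos)
    also have "\<dots> < t * (1/24)" using x(2) t by (intro mult_strict_left_mono) (auto simp: dist_norm)
    finally have "z \<in> B x" using True by (simp add: B_def dist_norm)
    then have "1 \<le> (\<Sum>x\<in>X. indicator (B x) z :: ennreal)"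
      using member_le_sum[of x X "\<lambda>x. indicator (B x) z :: ennreal"] x(1) X(1) by simp
    then show ?thesis using True by simp
  qed simp
  have Bsub: "B x \<subseteq> pseudo_disc z r" if z: "z \<in> B x" for x z
  proof
    fix z' assume z': "z' \<in> B x"
    have z1: "cmod z < 1" "cmod z' < 1" using z z' pseudo_disc_subset[of \<zeta> r] by (auto simp: B_def)
    have "cmod (z - z') \<le> dist (\<zeta> + of_real t * x) z + dist (\<zeta> + of_real t * x) z'"
      using dist_triangle3[of z z'] by (simp add: dist_norm)
    then have le: "cmod (z - z') < t / 12" using z z' by (simp add: B_def)
    have "cmod z - cmod \<zeta> \<le> t" using dle[of z] z norm_triangle_ineq2[of z \<zeta>] by (simp add: B_def)
    moreover have "t \<le> (1 - cmod \<zeta>) / 2"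
    proof -
      have "3 * r * (1 - cmod \<zeta>) \<le> (1/2) * (1 - cmod \<zeta>)" using r \<zeta> by (intro mult_right_mono) auto
      then show ?thesis by (simp add: t_def)
    qed
    ultimately have "(1 - cmod \<zeta>) / 2 \<le> 1 - cmod z" by simp
    then have "r * ((1 - cmod \<zeta>) / 2) \<le> r * (1 - cmod z)" using r by (intro mult_left_mono) auto
    then have "t / 12 \<le> r * (1 - cmod z)" using t by (simp add: t_def)
    then have "z' \<in> ball z (r * (1 - cmod z))" using le by (simp add: dist_norm)
    then show "z' \<in> pseudo_disc z r" using ball_subset_pseudo_disc[of z r] z1 r by auto
  qed
  have one: "(\<integral>\<^sup>+z. ennreal (\<omega> z) / weight_mass \<omega> (pseudo_disc z r) * indicator (B x) z \<partial>dA) \<le> 1" for x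
  proof -
    have "(\<integral>\<^sup>+z. ennreal (\<omega> z) / weight_mass \<omega> (pseudo_disc z r) * indicator (B x) z \<partial>dA)
      \<le> (\<integral>\<^sup>+z. ennreal (\<omega> z) * indicator (B x) z / weight_mass \<omega> (B x) \<partial>dA)"
    proof (rule nn_integral_mono)
      fix z
      show "ennreal (\<omega> z) / weight_mass \<omega> (pseudo_disc z r) * indicator (B x) z \<le> ennreal (\<omega> z) * indicator (B x) z / weight_mass \<omega> (B x)"
      proof (cases "z \<in> B x")
        case True
        then have "weight_mass \<omega> (B x) \<le> weight_mass \<omega> (pseudo_disc z r)" using Bsub weight_mass_mono by blast
        then show ?thesis using True
          by (simp add: divide_ennreal_def mult_left_mono inverse_ennreal_antimono)
      qed simp
    qed
    also have "\<dots> = weight_mass \<omega> (B x) / weight_mass \<omega> (B x)"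
      unfolding weight_mass_def by (subst nn_integral_divide) auto
    also have "\<dots> \<le> 1" by (rule ennreal_divide_self_le)
    finally show ?thesis .
  qed
  have "(\<integral>\<^sup>+z. ennreal (\<omega> z) / weight_mass \<omega> (pseudo_disc z r) * indicator (pseudo_disc \<zeta> r) z \<partial>dA)
     \<le> (\<integral>\<^sup>+z. (\<Sum>x\<in>X. ennreal (\<omega> z) / weight_mass \<omega> (pseudo_disc z r) * indicator (B x) z) \<partial>dA)"
    by (intro nn_integral_mono) (simp add: sum_distrib_left[symmetric] mult_left_mono cover)
  also have "\<dots> = (\<Sum>x\<in>X. \<integral>\<^sup>+z. ennreal (\<omega> z) / weight_mass \<omega> (pseudo_disc z r) * indicator (B x) z \<partial>dA)"
    by (rule nn_integral_sum) measurable
  also have "\<dots> \<le> (\<Sum>x\<in>X. 1)" by (intro sum_mono one)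
  finally show ?thesis by simp
qed

text \<open>If \<open>U\<close> is finite, its p-th root bounds \<open>f\<close> on the Whitney
  ball, and Cauchy's estimate bounds the oscillation by \<open>6 * r / \<kappa>\<close> times that
  root: a factor 3 from the Euclidean size of the disc and 2 from passing to the half ball. If
  \<open>U\<close> is infinite, the right-hand side is infinite.\<close>

lemma oscillation_powr_le:
  fixes p \<kappa> r :: real and U :: ennreal
  assumes p: "0 < p" and \<kappa>: "0 < \<kappa>" "\<kappa> \<le> 1" and r: "0 < r" "r \<le> 1/6" "6 * r < \<kappa>"
    and f: "f holomorphic_on unit_disc" and \<zeta>: "cmod \<zeta> < 1"
    and U: "\<And>z. z \<in> ball \<zeta> (\<kappa> * (1 - cmod \<zeta>)) \<Longrightarrow> ennreal (cmod (f z) powr p) \<le> U"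
    and z: "z \<in> pseudo_disc \<zeta> r"
  shows "ennreal (cmod (f z) powr p) \<le>
    ennreal (2 powr p) * (ennreal (cmod (f \<zeta>) powr p) + ennreal ((6 * r / \<kappa>) powr p) * U)"
proof (cases U)
  case (real u)
  define \<rho> where "\<rho> = \<kappa> * (1 - cmod \<zeta>)"
  have \<rho>: "0 < \<rho>" using \<kappa> \<zeta> by (simp add: \<rho>_def)
  define B where "B = u powr (1/p)"
  have sub: "ball \<zeta> \<rho> \<subseteq> unit_disc"
    using ball_subset_pseudo_disc[OF \<zeta> \<kappa>] pseudo_disc_subset[of \<zeta> \<kappa>] by (auto simp: \<rho>_def)
  have B: "cmod (f x) \<le> B" if "x \<in> ball \<zeta> \<rho>" for x
  proof -
    have "cmod (f x) powr p \<le> u" using U[of x] that real by (simp add: \<rho>_def)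
    then have "(cmod (f x) powr p) powr (1/p) \<le> B" unfolding B_def using p by (intro powr_mono2) auto
    then show ?thesis using p by (simp add: powr_powr)
  qed
  have "cmod (\<zeta> - z) \<le> 2 * r / (1 - r) * (1 - cmod \<zeta>)"
    using z r \<zeta> by (intro pseudo_disc_dist_le) auto
  also have "2 * r / (1 - r) \<le> 3 * r"
  proof -
    have "2 * r \<le> 3 * r * (1 - r)" using r by (simp add: field_simps)
    then show ?thesis using r by (simp add: field_simps)
  qed
  finally have d: "cmod (z - \<zeta>) \<le> 3 * r * (1 - cmod \<zeta>)" using \<zeta> by (simp add: norm_minus_commute mult_right_mono)
  also have "\<dots> < \<kappa> / 2 * (1 - cmod \<zeta>)" using r \<zeta> by (intro mult_strict_right_mono) auto
  finally have zb: "z \<in> ball \<zeta> (\<rho>/2)" by (simp add: \<rho>_def dist_norm norm_minus_commute)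
  have "cmod (f z - f \<zeta>) \<le> 2 * B / \<rho> * cmod (z - \<zeta>)"
    by (rule holomorphic_oscillation[OF holomorphic_on_subset[OF f sub] B zb])
  also have "\<dots> \<le> 2 * B / \<rho> * (3 * r * (1 - cmod \<zeta>))"
    using d \<rho> by (intro mult_left_mono) (auto simp: B_def)
  also have "\<dots> = 6 * r / \<kappa> * B" using \<rho> \<kappa> \<zeta> by (simp add: \<rho>_def field_simps)
  finally have "cmod (f z) \<le> cmod (f \<zeta>) + 6 * r / \<kappa> * B"
    using norm_triangle_ineq2[of "f z" "f \<zeta>"] by linarith
  then have "cmod (f z) powr p \<le> (cmod (f \<zeta>) + 6 * r / \<kappa> * B) powr p" using p by (intro powr_mono2) auto
  also have "\<dots> \<le> 2 powr p * (cmod (f \<zeta>) powr p + (6 * r / \<kappa> * B) powr p)"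
    using r \<kappa> p by (intro powr_sum_le) (auto simp: B_def)
  also have "(6 * r / \<kappa> * B) powr p = (6 * r / \<kappa>) powr p * u"
    using r \<kappa> p real by (subst powr_mult) (auto simp: B_def powr_powr)
  finally show ?thesis using real
    by (simp add: ennreal_mult[symmetric] ennreal_plus[symmetric] del: ennreal_plus)
next
  case top
  then show ?thesis using r \<kappa> by (simp add: ennreal_mult_eq_top_iff ennreal_mult_top)
qed

lemma bergman_norm_p_restrict:
  "(\<integral>\<^sup>+z. F z * indicator unit_disc z \<partial>dA) = (\<integral>\<^sup>+z. F z \<partial>dA)"
  by (intro nn_integral_cong) simp

text \<open>The constant in front depends on the number of covering balls and on \<open>p\<close>
  but not on \<open>r\<close>. This is what allows \<open>r\<close> to be shrunk afterwards until
  the error term is harmless.\<close>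

lemma averaging_le:
  fixes p \<kappa> r M \<epsilon> :: real and U :: "complex \<Rightarrow> ennreal"
  assumes p: "0 < p" and \<omega>: "weight \<omega>" and \<mu>: "borel_measure_on_disc \<mu>" "sigma_finite_measure \<mu>"
    and \<kappa>: "0 < \<kappa>" "\<kappa> \<le> 1" and r: "0 < r" "r \<le> 1/6" "6 * r < \<kappa>"
    and X: "finite X" "cball (0::complex) 1 \<subseteq> (\<Union>x\<in>X. ball x (1/24))"
    and f: "f holomorphic_on unit_disc" and Um[measurable]: "U \<in> borel_measurable \<mu>"
    and U: "\<And>\<zeta> z. \<zeta> \<in> unit_disc \<Longrightarrow> z \<in> ball \<zeta> (\<kappa> * (1 - cmod \<zeta>)) \<Longrightarrow> ennreal (cmod (f z) powr p) \<le> U \<zeta>"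
    and G: "G \<in> sets dA" "\<And>z. z \<in> G \<Longrightarrow> L < disc_average \<omega> \<mu> r z"
  shows "L * (\<integral>\<^sup>+z\<in>G. ennreal (cmod (f z) powr p * \<omega> z) \<partial>dA) \<le>
     of_nat (card X) * ennreal (2 powr p) * ((\<integral>\<^sup>+z. ennreal (cmod (f z) powr p) \<partial>\<mu>)
       + ennreal ((6 * r / \<kappa>) powr p) * (\<integral>\<^sup>+z. U z \<partial>\<mu>))"
proof -
  interpret dA: sigma_finite_measure dA by (rule sigma_finite_dA)
  interpret \<mu>: sigma_finite_measure \<mu> by fact
  interpret P: pair_sigma_finite dA \<mu> ..
  note measurable_id_dA[measurable]
  note borel_measurable_weight[OF \<omega>, measurable]
  note borel_measurable_holomorphic_disc(1)[OF f, measurable]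
  note borel_measurable_holomorphic_disc(2)[OF f \<mu>(1), measurable]
  have [measurable]: "(\<lambda>x. x) \<in> borel_measurable \<mu>" by (rule borel_measurable_on_disc[OF \<mu>(1)]) simp
  define w where "w = (\<lambda>z. weight_mass \<omega> (pseudo_disc z r))"
  have [measurable]: "w \<in> borel_measurable dA" unfolding w_def
    by (rule borel_measurable_weight_mass_pseudo[OF \<omega>]) measurable
  have sp: "space \<mu> = unit_disc" by (rule space_borel_measure_on_disc[OF \<mu>(1)])
  define F where "F = (\<lambda>z. ennreal (cmod (f z) powr p) * ennreal (\<omega> z))"
  have Fm[measurable]: "F \<in> borel_measurable dA" unfolding F_def by measurable
  define V where "V = (\<lambda>\<zeta>. ennreal (2 powr p) * (ennreal (cmod (f \<zeta>) powr p) + ennreal ((6 * r / \<kappa>) powr p) * U \<zeta>))"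
  have Vm[measurable]: "V \<in> borel_measurable \<mu>" unfolding V_def by measurable
  define J where "J = (\<lambda>x::complex\<times>complex. indicator {y. snd y \<in> pseudo_disc (fst y) r} x :: ennreal)"
  have Jm[measurable]: "J \<in> borel_measurable (dA \<Otimes>\<^sub>M \<mu>)"
  proof -
    have [measurable]: "Measurable.pred (dA \<Otimes>\<^sub>M \<mu>) (\<lambda>y. snd y \<in> pseudo_disc (fst y) r)"
      by (rule pred_pseudo_disc) auto
    show ?thesis unfolding J_def indicator_def of_bool_def by measurable
  qed
  have J1: "J (z, \<zeta>) = indicator (pseudo_disc z r) \<zeta>" for z \<zeta> by (simp add: J_def indicator_def)
  have J2: "J (z, \<zeta>) = indicator (pseudo_disc \<zeta> r) z" if "cmod z < 1" "cmod \<zeta> < 1" for z \<zeta>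
    using pseudo_disc_commute[OF that] by (simp add: J_def indicator_def)
  have "L * (\<integral>\<^sup>+z\<in>G. ennreal (cmod (f z) powr p * \<omega> z) \<partial>dA) = (\<integral>\<^sup>+z. L * (F z * indicator G z) \<partial>dA)"
  proof -
    have "(\<integral>\<^sup>+z\<in>G. ennreal (cmod (f z) powr p * \<omega> z) \<partial>dA) = (\<integral>\<^sup>+z. F z * indicator G z \<partial>dA)"
      by (simp add: F_def ennreal_mult')
    then show ?thesis using G(1) by (subst nn_integral_cmult) auto
  qed
  also have "\<dots> \<le> (\<integral>\<^sup>+z. (\<integral>\<^sup>+\<zeta>. F z / w z * J (z, \<zeta>) \<partial>\<mu>) \<partial>dA)"
  proof (rule nn_integral_mono)
    fix z assume "z \<in> space dA"
    have ps: "pseudo_disc z r \<in> sets \<mu>"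
      by (intro sets_borel_measure_on_disc[OF \<mu>(1)] pseudo_disc_borel pseudo_disc_subset)
    have eq: "(\<integral>\<^sup>+\<zeta>. F z / w z * J (z, \<zeta>) \<partial>\<mu>) = F z / w z * emeasure \<mu> (pseudo_disc z r)"
      unfolding J1 using ps by (subst nn_integral_cmult) auto
    show "L * (F z * indicator G z) \<le> (\<integral>\<^sup>+\<zeta>. F z / w z * J (z, \<zeta>) \<partial>\<mu>)"
    proof (cases "z \<in> G")
      case True
      have "L \<le> emeasure \<mu> (pseudo_disc z r) / w z"
        using G(2)[OF True] by (simp add: disc_average_def w_def)
      then have "F z * L \<le> F z * (emeasure \<mu> (pseudo_disc z r) / w z)" by (rule mult_left_mono) simp
      then show ?thesis unfolding eq using True by (simp add: divide_ennreal_def mult_ac)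
    qed simp
  qed
  also have "\<dots> = (\<integral>\<^sup>+\<zeta>. (\<integral>\<^sup>+z. F z / w z * J (z, \<zeta>) \<partial>dA) \<partial>\<mu>)"
    by (subst P.Fubini') auto
  also have "\<dots> \<le> (\<integral>\<^sup>+\<zeta>. V \<zeta> * of_nat (card X) \<partial>\<mu>)"
  proof (rule nn_integral_mono)
    fix \<zeta> assume "\<zeta> \<in> space \<mu>"
    then have \<zeta>: "cmod \<zeta> < 1" by (simp add: sp)
    have [measurable]: "pseudo_disc \<zeta> r \<in> sets dA" by (rule pseudo_disc_sets_dA)
    have "(\<integral>\<^sup>+z. F z / w z * J (z, \<zeta>) \<partial>dA) \<le> (\<integral>\<^sup>+z. V \<zeta> * (ennreal (\<omega> z) / w z * indicator (pseudo_disc \<zeta> r) z) \<partial>dA)"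
    proof (rule nn_integral_mono)
      fix z assume "z \<in> space dA"
      then have z: "cmod z < 1" by simp
      show "F z / w z * J (z, \<zeta>) \<le> V \<zeta> * (ennreal (\<omega> z) / w z * indicator (pseudo_disc \<zeta> r) z)"
      proof (cases "z \<in> pseudo_disc \<zeta> r")
        case True
        have "ennreal (cmod (f z) powr p) \<le> V \<zeta>" unfolding V_def
          by (rule oscillation_powr_le[OF p \<kappa> r f \<zeta> U True]) (use \<zeta> in auto)
        then have "ennreal (cmod (f z) powr p) * (ennreal (\<omega> z) / w z) \<le> V \<zeta> * (ennreal (\<omega> z) / w z)"
          by (rule mult_right_mono) simp
        then show ?thesis using True J2[OF z \<zeta>] by (simp add: F_def divide_ennreal_def mult_ac)
      qed (simp add: J2[OF z \<zeta>])
    qed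
    also have "\<dots> = V \<zeta> * (\<integral>\<^sup>+z. ennreal (\<omega> z) / w z * indicator (pseudo_disc \<zeta> r) z \<partial>dA)"
      by (subst nn_integral_cmult) auto
    also have "\<dots> \<le> V \<zeta> * of_nat (card X)" unfolding w_def
      by (intro mult_left_mono pseudo_disc_ratio_integral_le[OF \<omega> X r(1,2) \<zeta>]) simp
    finally show "(\<integral>\<^sup>+z. F z / w z * J (z, \<zeta>) \<partial>dA) \<le> V \<zeta> * of_nat (card X)" .
  qed
  also have "\<dots> = of_nat (card X) * (\<integral>\<^sup>+\<zeta>. V \<zeta> \<partial>\<mu>)"
    by (subst nn_integral_multc) (auto simp: mult.commute)
  also have "(\<integral>\<^sup>+\<zeta>. V \<zeta> \<partial>\<mu>) = ennreal (2 powr p) * ((\<integral>\<^sup>+z. ennreal (cmod (f z) powr p) \<partial>\<mu>)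
       + ennreal ((6 * r / \<kappa>) powr p) * (\<integral>\<^sup>+z. U z \<partial>\<mu>))"
    unfolding V_def by (simp add: nn_integral_cmult nn_integral_add)
  finally show ?thesis by (simp add: mult.assoc)
qed

text \<open>The majorant is used twice: its values at the centres give the upper sampling
  inequality, and its integral controls the error term of the averaging estimate.\<close>

lemma sampling_from_majorant:
  fixes p \<kappa> K M \<epsilon> \<delta> :: real
  assumes p: "0 < p" and \<omega>: "weight \<omega>" and \<mu>: "borel_measure_on_disc \<mu>" "sigma_finite_measure \<mu>"
    and \<kappa>: "0 < \<kappa>" "\<kappa> \<le> 1" and K: "0 \<le> K"
    and maj: "\<And>f. f \<in> bergman_space p \<omega> \<Longrightarrow> \<exists>U\<in>borel_measurable \<mu>.
        (\<forall>\<zeta>\<in>unit_disc. \<forall>z\<in>ball \<zeta> (\<kappa> * (1 - cmod \<zeta>)). ennreal (cmod (f z) powr p) \<le> U \<zeta>) \<and>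
        (\<integral>\<^sup>+z. U z \<partial>\<mu>) \<le> ennreal K * bergman_norm_p p \<omega> f"
    and M: "maximal_norm \<omega> \<mu> = ennreal M" "0 < M" and \<epsilon>: "0 < \<epsilon>" and \<delta>: "0 < \<delta>"
  shows "\<exists>r. 0 < r \<and> r < 1 \<and> (dominating_set_with \<delta> p \<omega>
      {z\<in>unit_disc. disc_average \<omega> \<mu> r z > ennreal \<epsilon> * maximal_norm \<omega> \<mu>} \<longrightarrow> sampling_measure p \<omega> \<mu>)"
proof -
  obtain X :: "complex set" where X: "finite X" "X \<noteq> {}" "cball 0 1 \<subseteq> (\<Union>x\<in>X. ball x (1/24))"
    by (rule finite_ball_cover[of "1/24"]) auto
  define N where "N = real (card X)"
  have N: "0 < N" using X by (simp add: N_def card_gt_0_iff)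
  define A where "A = N * 2 powr p"
  have A: "0 < A" using N by (simp add: A_def)
  define L where "L = \<epsilon> * M"
  have L: "0 < L" using \<epsilon> M by (simp add: L_def)
  \<comment> \<open>Solves \<open>A * t powr p * (K + 1) = L * \<delta> / 2\<close>, so that the
    error eats at most half of the gain; \<open>K + 1\<close> instead of \<open>K\<close> keeps the
    quotient defined when \<open>K = 0\<close>.\<close>
  define t where "t = (L * \<delta> / (2 * A * (K + 1))) powr (1/p)"
  have t: "0 < t" using L \<delta> A K by (simp add: t_def)
  define r where "r = min (1/6) (min (\<kappa>/12) (\<kappa> * t / 6))"
  have r12: "r \<le> \<kappa> / 12" by (simp add: r_def)
  have "0 < \<kappa> * t" using \<kappa> t by simp
  then have "0 < r" using \<kappa> by (simp add: r_def)
  moreover have "r \<le> 1/6" "r \<le> \<kappa> * t / 6" by (simp_all add: r_def)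
  ultimately have r: "0 < r" "r \<le> 1/6" "6 * r < \<kappa>" "r \<le> \<kappa> * t / 6" using r12 \<kappa> by auto
  have "(6 * r / \<kappa>) powr p \<le> t powr p" using r \<kappa> p by (intro powr_mono2) (auto simp: field_simps)
  also have "\<dots> = L * \<delta> / (2 * A * (K + 1))" using L \<delta> A K p by (simp add: t_def powr_powr)
  finally have "A * ((6 * r / \<kappa>) powr p * K) \<le> A * (L * \<delta> / (2 * A * (K + 1)) * K)"
    using A K by (intro mult_left_mono mult_right_mono) auto
  also have "\<dots> = L * \<delta> / 2 * (K / (K + 1))"
  proof -
    have "A * (L * \<delta> / (2 * A * D) * K) = L * \<delta> / 2 * (K / D)" if "D \<noteq> 0" for D
      using A that by (simp add: field_simps)
    then show ?thesis using K by simp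
  qed
  also have "\<dots> \<le> L * \<delta> / 2 * 1" using L \<delta> K by (intro mult_left_mono) auto
  finally have small: "A * ((6 * r / \<kappa>) powr p * K) \<le> L * \<delta> / 2" by simp
  have "sampling_measure p \<omega> \<mu>" if dom: "dominating_set_with \<delta> p \<omega>
      {z\<in>unit_disc. disc_average \<omega> \<mu> r z > ennreal \<epsilon> * maximal_norm \<omega> \<mu>}"
    unfolding sampling_measure_def
  proof (intro exI conjI ballI)
    show "0 < L * \<delta> / (2 * A)" "0 < K + 1" using L \<delta> A K by auto
    define G where "G = {z\<in>unit_disc. disc_average \<omega> \<mu> r z > ennreal \<epsilon> * maximal_norm \<omega> \<mu>}"
    fix f assume f: "f \<in> bergman_space p \<omega>"
    obtain U where U: "U \<in> borel_measurable \<mu>"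
        "\<And>\<zeta> z. \<zeta> \<in> unit_disc \<Longrightarrow> z \<in> ball \<zeta> (\<kappa> * (1 - cmod \<zeta>)) \<Longrightarrow> ennreal (cmod (f z) powr p) \<le> U \<zeta>"
        "(\<integral>\<^sup>+z. U z \<partial>\<mu>) \<le> ennreal K * bergman_norm_p p \<omega> f"
      using maj[OF f] by blast
    have sp: "space \<mu> = unit_disc" by (rule space_borel_measure_on_disc[OF \<mu>(1)])
    define S where "S = (\<integral>\<^sup>+z. ennreal (cmod (f z) powr p) \<partial>\<mu>)"
    have "S \<le> (\<integral>\<^sup>+z. U z \<partial>\<mu>)" unfolding S_def
      by (intro nn_integral_mono U(2)) (use \<kappa> in \<open>auto simp: sp\<close>)
    then have SK: "S \<le> ennreal K * bergman_norm_p p \<omega> f" using U(3) by (rule order_trans)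
    also have "\<dots> \<le> ennreal (K + 1) * bergman_norm_p p \<omega> f" by (intro mult_right_mono ennreal_leI) auto
    finally show "(\<integral>\<^sup>+z. ennreal (cmod (f z) powr p) \<partial>\<mu>) \<le> ennreal (K + 1) * bergman_norm_p p \<omega> f" by (simp add: S_def)
    have fh: "f holomorphic_on unit_disc" and fin: "bergman_norm_p p \<omega> f < \<infinity>"
      using f by (auto simp: bergman_space_def)
    obtain n where n: "bergman_norm_p p \<omega> f = ennreal n" "0 \<le> n" using fin by (cases "bergman_norm_p p \<omega> f") auto
    \<comment> \<open>Finiteness of both the norm and the integral over \<open>\<mu>\<close> moves
      the inequality to the reals, where the error term can be subtracted.\<close>
    have "S < top" using SK n by (simp add: ennreal_mult[symmetric] K le_less_trans)
    then obtain s where s: "S = ennreal s" "0 \<le> s" by (cases S) auto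
    have GA: "G \<in> sets dA" and dG: "ennreal \<delta> * bergman_norm_p p \<omega> f \<le> (\<integral>\<^sup>+z\<in>G. ennreal (cmod (f z) powr p * \<omega> z) \<partial>dA)"
      using dom f unfolding dominating_set_with_def G_def by auto
    have "ennreal L * (ennreal \<delta> * bergman_norm_p p \<omega> f) \<le> ennreal L * (\<integral>\<^sup>+z\<in>G. ennreal (cmod (f z) powr p * \<omega> z) \<partial>dA)"
      by (intro mult_left_mono dG) simp
    also have "\<dots> \<le> of_nat (card X) * ennreal (2 powr p) * (S + ennreal ((6 * r / \<kappa>) powr p) * (\<integral>\<^sup>+z. U z \<partial>\<mu>))"
      unfolding S_def
    proof (rule averaging_le[OF p \<omega> \<mu> \<kappa> r(1-3) X(1,3) fh U(1,2) GA])
      fix z assume "z \<in> G"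
      then show "ennreal L < disc_average \<omega> \<mu> r z" using \<epsilon> M by (simp add: G_def L_def ennreal_mult')
    qed auto
    also have "\<dots> \<le> of_nat (card X) * ennreal (2 powr p) * (S + ennreal ((6 * r / \<kappa>) powr p) * (ennreal K * bergman_norm_p p \<omega> f))"
      by (intro mult_left_mono add_left_mono U(3)) auto
    also have "\<dots> = ennreal (A * (s + (6 * r / \<kappa>) powr p * (K * n)))"
      using K n s N by (simp add: A_def N_def ennreal_mult ennreal_of_nat_eq_real_of_nat)
    finally have "ennreal (L * (\<delta> * n)) \<le> ennreal (A * (s + (6 * r / \<kappa>) powr p * (K * n)))"
      using L \<delta> n by (simp add: ennreal_mult')
    then have "L * (\<delta> * n) \<le> A * (s + (6 * r / \<kappa>) powr p * (K * n))"
      using A K s n by (subst (asm) ennreal_le_iff) auto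
    also have "\<dots> = A * s + A * ((6 * r / \<kappa>) powr p * K) * n" by (simp add: algebra_simps)
    also have "\<dots> \<le> A * s + L * \<delta> / 2 * n" using small n by (intro add_left_mono mult_right_mono) auto
    finally have "L * \<delta> / 2 * n \<le> A * s" by (simp add: algebra_simps)
    then have "L * \<delta> / (2 * A) * n \<le> s" using A by (simp add: field_simps)
    then show "ennreal (L * \<delta> / (2 * A)) * bergman_norm_p p \<omega> f \<le> (\<integral>\<^sup>+z. ennreal (cmod (f z) powr p) \<partial>\<mu>)"
      using n L \<delta> A s by (simp add: S_def[symmetric] ennreal_mult[symmetric] ennreal_leI)
  qed
  then show ?thesis using r by (intro exI[of _ r]) auto
qed

section \<open>The majorant for weights in the class C-infinity\<close>

lemma nn_integral_lebesgue_translate: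
  fixes F :: "complex \<Rightarrow> ennreal"
  assumes [measurable]: "F \<in> borel_measurable borel"
  shows "(\<integral>\<^sup>+w. F (z + w) \<partial>lebesgue) = (\<integral>\<^sup>+w. F w \<partial>lebesgue)"
proof -
  have "(\<integral>\<^sup>+w. F w \<partial>lborel) = (\<integral>\<^sup>+w. F w \<partial>distr lborel borel ((+) z))"
    by (simp add: lborel_distr_plus)
  also have "\<dots> = (\<integral>\<^sup>+w. F (z + w) \<partial>lborel)" by (subst nn_integral_distr) auto
  finally show ?thesis by (simp add: nn_integral_completion)
qed

lemma emeasure_dA_ball:
  assumes "ball z \<rho> \<subseteq> unit_disc" "0 \<le> \<rho>"
  shows "emeasure dA (ball z \<rho>) = ennreal (\<rho>\<^sup>2)"
proof -
  have "emeasure dA (ball z \<rho>) = ennreal (1/pi) * ennreal (pi * \<rho>\<^sup>2)"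
    using assms by (subst emeasure_dA)
      (auto simp: borel_sets_dA emeasure_ball unit_ball_vol_2)
  then show ?thesis by (simp add: ennreal_mult[symmetric])
qed

text \<open>The case \<open>\<gamma> = 0\<close> with centre 0, where the kernel is identically 1:
  the area submean property of a power of |f| with any positive exponent.\<close>

lemma holomorphic_ball_submean:
  fixes \<beta> :: real
  assumes f: "f holomorphic_on unit_disc" and \<beta>: "0 < \<beta>" and \<rho>: "0 < \<rho>" "\<rho> \<le> 1" and sub: "ball z \<rho> \<subseteq> unit_disc"
  shows "ennreal (cmod (f z) powr \<beta>) * ennreal (\<rho>\<^sup>2) \<le>
    (\<integral>\<^sup>+w. ennreal (cmod (f w) powr \<beta>) * indicator (ball z \<rho>) w \<partial>dA)"
proof -
  have b01: "ball (0::complex) \<rho> \<subseteq> unit_disc" using \<rho> by auto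
  have "(f \<circ> (\<lambda>w. z + w)) holomorphic_on ball 0 \<rho>"
  proof (rule holomorphic_on_compose_gen[OF _ f])
    show "(\<lambda>w. z + w) ` ball 0 \<rho> \<subseteq> unit_disc"
    proof
      fix y assume "y \<in> (\<lambda>w. z + w) ` ball 0 \<rho>"
      then have "y \<in> ball z \<rho>" by (auto simp: dist_norm)
      then show "y \<in> unit_disc" using sub by blast
    qed
  qed (intro holomorphic_intros)
  then have h: "(\<lambda>w. f (z + w)) holomorphic_on ball 0 \<rho>" by (simp add: o_def)
  \<comment> \<open>The origin is left out because the radial inequality wants its density strictly
    outside the centre.\<close>
  define \<sigma> where "\<sigma> = (\<lambda>w::complex. indicator (ball 0 \<rho> - {0}) w :: ennreal)"
  have [measurable]: "ball 0 \<rho> - {0} \<in> sets dA" using \<rho> by (intro borel_sets_dA) auto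
  have sm[measurable]: "\<sigma> \<in> borel_measurable dA" unfolding \<sigma>_def by measurable
  define g where "g = (\<lambda>w. f w * indicator unit_disc w)"
  have fm[measurable]: "g \<in> borel_measurable borel"
    unfolding g_def by (rule borel_measurable_holomorphic_indicator[OF f]) simp
  have "(\<integral>\<^sup>+w. \<sigma> w \<partial>dA) = emeasure dA (ball 0 \<rho> - {0})" unfolding \<sigma>_def by simp
  also have "\<dots> = emeasure dA (ball 0 \<rho>)"
  proof (rule emeasure_Diff_null_set)
    show "{0} \<in> null_sets dA" by (auto simp: null_sets_def borel_sets_dA emeasure_dA)
    show "ball 0 \<rho> \<in> sets dA" using b01 by (intro borel_sets_dA) auto
  qed
  also have "\<dots> = ennreal (\<rho>\<^sup>2)" by (rule emeasure_dA_ball) (use \<rho> b01 in auto)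
  finally have i: "(\<integral>\<^sup>+w. \<sigma> w \<partial>dA) = ennreal (\<rho>\<^sup>2)" .
  define H where "H = (\<lambda>w. ennreal (cmod (g w) powr \<beta>) * indicator (ball z \<rho>) w)"
  have [measurable]: "ball z \<rho> \<in> sets borel" by simp
  have Hm[measurable]: "H \<in> borel_measurable borel" unfolding H_def by measurable
  have "ennreal (cmod (f (z + 0)) powr \<beta>) * (\<integral>\<^sup>+w. \<sigma> w \<partial>dA) \<le>
    (\<integral>\<^sup>+w. \<sigma> w * ennreal (cmod (f (z + w)) powr \<beta> * circle_kernel 0 (cmod w) 0 w) \<partial>dA)"
    by (rule holomorphic_radial_submean[OF h \<beta> sm]) (use \<beta> in \<open>auto simp: \<sigma>_def indicator_def split: if_splits\<close>)
  also have "\<dots> \<le> (\<integral>\<^sup>+w. H (z + w) \<partial>dA)"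
  proof (rule nn_integral_mono)
    fix w show "\<sigma> w * ennreal (cmod (f (z + w)) powr \<beta> * circle_kernel 0 (cmod w) 0 w) \<le> H (z + w)"
    proof (cases "w \<in> ball 0 \<rho> - {0}")
      case True
      then have "z + w \<in> ball z \<rho>" by (simp add: dist_norm)
      moreover from this have "z + w \<in> unit_disc" using sub by blast
      ultimately show ?thesis using True by (simp add: \<sigma>_def H_def g_def circle_kernel_def)
    qed (simp add: \<sigma>_def)
  qed
  also have "\<dots> \<le> ennreal (1/pi) * (\<integral>\<^sup>+w. H (z + w) \<partial>lebesgue)"
    by (subst nn_integral_dA) (auto simp: borel_measurable_dA_I intro!: mult_left_mono nn_integral_mono simp: indicator_def)
  also have "\<dots> = ennreal (1/pi) * (\<integral>\<^sup>+w. H w \<partial>lebesgue)"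
    by (simp add: nn_integral_lebesgue_translate)
  also have "(\<integral>\<^sup>+w. H w \<partial>lebesgue) = (\<integral>\<^sup>+w. H w * indicator unit_disc w \<partial>lebesgue)"
    by (intro nn_integral_cong) (simp add: H_def g_def indicator_def)
  also have "ennreal (1/pi) * \<dots> = (\<integral>\<^sup>+w. H w \<partial>dA)"
    by (subst nn_integral_dA) (auto intro: borel_measurable_dA_I)
  also have "\<dots> = (\<integral>\<^sup>+w. ennreal (cmod (f w) powr \<beta>) * indicator (ball z \<rho>) w \<partial>dA)"
    by (intro nn_integral_cong) (simp add: H_def g_def)
  finally show ?thesis by (simp add: i)
qed

lemma weight_mass_finite: "weight \<omega> \<Longrightarrow> weight_mass \<omega> E < \<infinity>"
proof -
  assume \<omega>: "weight \<omega>"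
  have "weight_mass \<omega> E \<le> (\<integral>\<^sup>+z. ennreal (\<omega> z) \<partial>dA)"
    unfolding weight_mass_def by (intro nn_integral_mono) (simp add: indicator_def)
  also have "\<dots> = (\<integral>\<^sup>+z. ennreal (norm (\<omega> z)) \<partial>dA)"
    using \<omega> by (intro nn_integral_cong) (auto simp: weight_def)
  also have "\<dots> < \<infinity>" using \<omega> by (auto simp: weight_def integrable_iff_bounded)
  finally show ?thesis .
qed

lemma weight_mass_pos:
  assumes \<omega>: "weight \<omega>" "AE z in dA. 0 < \<omega> z" and E: "E \<in> sets dA" "emeasure dA E \<noteq> 0"
  shows "0 < weight_mass \<omega> E"
proof (rule ccontr)
  assume "\<not> 0 < weight_mass \<omega> E"
  then have "(\<integral>\<^sup>+z. ennreal (\<omega> z) * indicator E z \<partial>dA) = 0" by (simp add: weight_mass_def)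
  then have "AE z in dA. ennreal (\<omega> z) * indicator E z = 0"
    using borel_measurable_weight[OF \<omega>(1)] E(1) by (subst (asm) nn_integral_0_iff_AE) auto
  with \<omega>(2) have "AE z in dA. z \<notin> E"
    by eventually_elim (auto simp: indicator_def ennreal_eq_0_iff split: if_splits)
  then have "E \<in> null_sets dA" using E(1) by (subst (asm) AE_iff_null_sets[symmetric]) auto
  then show False using E(2) by auto
qed

text \<open>Hoelder's inequality for \<open>u * \<omega> powr (1/q)\<close> against
  \<open>\<omega> powr (-1/q)\<close>, with the second factor replaced through the
  \<open>C_class\<close> bound. It is derived from Young's inequality with a free parameter, since
  nothing is known about the integrability of \<open>u powr q * \<omega>\<close>, whose integral may
  be infinite.\<close>

lemma C_class_holder_disc:
  fixes q r C :: real and u :: "complex \<Rightarrow> real"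
  assumes q: "1 < q" and \<omega>: "weight \<omega>" "AE z in dA. 0 < \<omega> z" and C: "0 < C"
    and E: "E \<in> sets dA" "emeasure dA E \<noteq> 0"
    and int: "set_integrable dA E (\<lambda>\<zeta>. \<omega> \<zeta> powr (- ((q / (q - 1)) / q)))"
    and le: "(LINT \<zeta>:E|dA. \<omega> \<zeta>) powr (1 / q) *
          (LINT \<zeta>:E|dA. \<omega> \<zeta> powr (- ((q / (q - 1)) / q))) powr (1 / (q / (q - 1))) \<le> C"
    and u[measurable]: "u \<in> borel_measurable dA" "\<And>z. 0 \<le> u z"
    and a: "0 \<le> a" "ennreal a \<le> (\<integral>\<^sup>+z. ennreal (u z) * indicator E z \<partial>dA)"
  shows "ennreal (a powr q) * weight_mass \<omega> E \<le> ennreal (C powr q) * (\<integral>\<^sup>+z. ennreal (u z powr q * \<omega> z) * indicator E z \<partial>dA)"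
proof -
  define q' where "q' = q / (q - 1)"
  have q': "1 < q'" "1/q + 1/q' = 1" using q by (auto simp: q'_def field_simps)
  note [measurable] = E(1) borel_measurable_weight[OF \<omega>(1)]
  have [measurable]: "\<omega> \<in> borel_measurable dA" using \<omega>(1) by (auto simp: weight_def)
  define \<Omega> where "\<Omega> = (LINT \<zeta>:E|dA. \<omega> \<zeta>)"
  define K where "K = (LINT \<zeta>:E|dA. \<omega> \<zeta> powr (- (q' / q)))"
  have \<Omega>: "weight_mass \<omega> E = ennreal \<Omega>"
  proof -
    have "weight_mass \<omega> E = (\<integral>\<^sup>+z. ennreal (indicator E z *\<^sub>R \<omega> z) \<partial>dA)"
      unfolding weight_mass_def by (intro nn_integral_cong) (auto simp: indicator_def)
    also have "\<dots> = ennreal (LINT z|dA. indicator E z *\<^sub>R \<omega> z)"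
    proof (rule nn_integral_eq_integral)
      show "integrable dA (\<lambda>z. indicator E z *\<^sub>R \<omega> z)"
        using \<omega>(1) E(1) by (intro integrable_mult_indicator) (auto simp: weight_def)
      show "AE z in dA. 0 \<le> indicator E z *\<^sub>R \<omega> z"
        using \<omega>(2) by eventually_elim (auto simp: indicator_def)
    qed
    finally show ?thesis by (simp add: \<Omega>_def set_lebesgue_integral_def)
  qed
  have \<Omega>0: "0 < \<Omega>" using weight_mass_pos[OF \<omega> E] \<Omega> by simp
  have Kn: "(\<integral>\<^sup>+z. ennreal (\<omega> z powr (- (q' / q))) * indicator E z \<partial>dA) = ennreal K"
  proof -
    have "(\<integral>\<^sup>+z. ennreal (\<omega> z powr (- (q' / q))) * indicator E z \<partial>dA) = (\<integral>\<^sup>+z. ennreal (indicator E z *\<^sub>R (\<omega> z powr (- (q' / q)))) \<partial>dA)"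
      by (intro nn_integral_cong) (auto simp: indicator_def)
    also have "\<dots> = ennreal (LINT z|dA. indicator E z *\<^sub>R (\<omega> z powr (- (q' / q))))"
      using int by (intro nn_integral_eq_integral) (auto simp: set_integrable_def q'_def)
    finally show ?thesis by (simp add: K_def set_lebesgue_integral_def)
  qed
  have K0: "0 < K"
  proof (rule ccontr)
    assume "\<not> 0 < K"
    then have "(\<integral>\<^sup>+z. ennreal (\<omega> z powr (- (q' / q))) * indicator E z \<partial>dA) = 0"
      using Kn by (simp add: ennreal_neg)
    then have "AE z in dA. ennreal (\<omega> z powr (- (q' / q))) * indicator E z = 0"
      by (subst (asm) nn_integral_0_iff_AE) auto
    with \<omega>(2) have "AE z in dA. z \<notin> E"
      by eventually_elim (auto simp: indicator_def ennreal_eq_0_iff split: if_splits)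
    then have "E \<in> null_sets dA" using E(1) by (subst (asm) AE_iff_null_sets[symmetric]) auto
    then show False using E(2) by auto
  qed
  define J where "J = (\<integral>\<^sup>+z. ennreal (u z powr q * \<omega> z) * indicator E z \<partial>dA)"
  have main: "a \<le> C * h" if h: "0 < h" "J \<le> ennreal (h powr q * \<Omega>)" for h
  proof -
    \<comment> \<open>The parameter minimising the sum of the two Young terms, by
      \<open>q + q' = q * q'\<close>; at this value both are multiples of
      \<open>h * \<Omega> powr (1/q) * K powr (1/q')\<close>.\<close>
    define t where "t = (K / (h powr q * \<Omega>)) powr (1 / (q * q'))"
    have t: "0 < t" using K0 h \<Omega>0 by (simp add: t_def)
    have pw: "u z \<le> t powr q / q * (u z powr q * \<omega> z) + t powr (-q') / q' * \<omega> z powr (- (q' / q))" if "0 < \<omega> z" for z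
    proof -
      have "(t * u z * \<omega> z powr (1/q)) * (\<omega> z powr (-1/q) / t) \<le>
         (t * u z * \<omega> z powr (1/q)) powr q / q + (\<omega> z powr (-1/q) / t) powr q' / q'"
        using q q' t u by (intro Youngs_inequality) auto
      moreover have "(t * u z * \<omega> z powr (1/q)) * (\<omega> z powr (-1/q) / t) = u z"
        using t that by (simp add: powr_minus_divide)
      moreover have "(t * u z * \<omega> z powr (1/q)) powr q = t powr q * (u z powr q * \<omega> z)"
        using t that u q by (simp add: powr_mult powr_powr)
      moreover have "(\<omega> z powr (-1/q) / t) powr q' = t powr (-q') * \<omega> z powr (- (q' / q))"
        using t that by (simp add: powr_divide powr_powr powr_minus powr_mult divide_simps)
      ultimately show ?thesis by simp
    qed
    have "ennreal a \<le> (\<integral>\<^sup>+z. ennreal (u z) * indicator E z \<partial>dA)" by (rule a)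
    also have "\<dots> \<le> (\<integral>\<^sup>+z. ennreal (t powr q / q) * (ennreal (u z powr q * \<omega> z) * indicator E z) +
         ennreal (t powr (-q') / q') * (ennreal (\<omega> z powr (- (q' / q))) * indicator E z) \<partial>dA)"
    proof (intro nn_integral_mono_AE, use \<omega>(2) in eventually_elim)
      fix z assume w: "0 < \<omega> z"
      show "ennreal (u z) * indicator E z \<le> ennreal (t powr q / q) * (ennreal (u z powr q * \<omega> z) * indicator E z) +
         ennreal (t powr (-q') / q') * (ennreal (\<omega> z powr (- (q' / q))) * indicator E z)"
      proof (cases "z \<in> E")
        case True
        have "ennreal (u z) \<le> ennreal (t powr q / q * (u z powr q * \<omega> z) + t powr (-q') / q' * \<omega> z powr (- (q' / q)))"
          by (rule ennreal_leI[OF pw[OF w]])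
        also have "\<dots> = ennreal (t powr q / q) * ennreal (u z powr q * \<omega> z) + ennreal (t powr (-q') / q') * ennreal (\<omega> z powr (- (q' / q)))"
          using w q q' by (simp only: ennreal_plus ennreal_mult' divide_nonneg_pos powr_ge_zero mult_nonneg_nonneg less_imp_le less_trans[OF zero_less_one])
        finally show ?thesis using True by simp
      qed simp
    qed
    also have "\<dots> = ennreal (t powr q / q) * J + ennreal (t powr (-q') / q') * ennreal K"
      unfolding J_def Kn[symmetric] by (subst nn_integral_add) (auto simp: nn_integral_cmult)
    also have "\<dots> \<le> ennreal (t powr q / q) * ennreal (h powr q * \<Omega>) + ennreal (t powr (-q') / q') * ennreal K"
      by (intro add_mono mult_left_mono h) auto
    also have "\<dots> = ennreal (t powr q / q * (h powr q * \<Omega>) + t powr (-q') / q' * K)"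
      using q q' K0 \<Omega>0 h by (simp add: ennreal_mult'[symmetric] ennreal_plus[symmetric] del: ennreal_plus)
    finally have "a \<le> t powr q / q * (h powr q * \<Omega>) + t powr (-q') / q' * K"
      using q q' K0 \<Omega>0 h by (subst (asm) ennreal_le_iff) (auto intro!: add_nonneg_nonneg)
    also have "t powr q = (K / (h powr q * \<Omega>)) powr (1/q')" unfolding t_def using q q' by (simp add: powr_powr)
    also have "\<dots> / q * (h powr q * \<Omega>) = h * (\<Omega> powr (1/q) * K powr (1/q')) / q"
    proof -
      have "1/q' = 1 - 1/q" using q' by simp
      then have e: "(h powr q * \<Omega>) powr (1/q') = (h powr q * \<Omega>) / (h * \<Omega> powr (1/q))"
        using h \<Omega>0 q by (simp add: powr_diff powr_mult powr_powr)
      have "(K / (h powr q * \<Omega>)) powr (1/q') * (h powr q * \<Omega>) = K powr (1/q') / (h powr q * \<Omega>) powr (1/q') * (h powr q * \<Omega>)"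
        using h \<Omega>0 K0 by (simp add: powr_divide)
      also have "\<dots> = h * (\<Omega> powr (1/q) * K powr (1/q'))" unfolding e using h \<Omega>0 by (simp add: field_simps)
      finally show ?thesis by (simp add: field_simps)
    qed
    also have "t powr (-q') / q' * K = h * (\<Omega> powr (1/q) * K powr (1/q')) / q'"
    proof -
      have "t powr (-q') = (K / (h powr q * \<Omega>)) powr (- (1/q))" unfolding t_def using q q' by (simp add: powr_powr)
      also have "\<dots> = (h powr q * \<Omega>) powr (1/q) / K powr (1/q)"
        using h \<Omega>0 K0 by (simp add: powr_minus powr_divide inverse_eq_divide)
      also have "(h powr q * \<Omega>) powr (1/q) = h * \<Omega> powr (1/q)" using h \<Omega>0 q by (simp add: powr_mult powr_powr)
      finally have 1: "t powr (-q') = h * \<Omega> powr (1/q) / K powr (1/q)" .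
      have "1/q' = 1 - 1/q" using q' by simp
      then have "K powr (1/q') = K / K powr (1/q)" using K0 by (simp add: powr_diff)
      then show ?thesis unfolding 1 by simp
    qed
    also have "h * (\<Omega> powr (1/q) * K powr (1/q')) / q + h * (\<Omega> powr (1/q) * K powr (1/q')) / q'
      = h * (\<Omega> powr (1/q) * K powr (1/q')) * (1/q + 1/q')" by (simp add: field_simps)
    also have "\<dots> = h * (\<Omega> powr (1/q) * K powr (1/q'))" using q' by simp
    also have "\<dots> \<le> h * C" using le h by (intro mult_left_mono) (auto simp: \<Omega>_def K_def q'_def)
    finally show ?thesis by (simp add: mult.commute)
  qed
  show ?thesis
  proof (cases J)
    case top
    then show ?thesis using C by (simp add: J_def[symmetric] ennreal_mult_top)
  next
    case (real j)
    have "a powr q * \<Omega> \<le> C powr q * j"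
    proof (rule ccontr)
      assume "\<not> a powr q * \<Omega> \<le> C powr q * j"
      then have lt: "C powr q * j < a powr q * \<Omega>" by simp
      \<comment> \<open>\<open>main\<close> asks for a positive \<open>h\<close>, but
        \<open>j\<close> may be 0. The midpoint \<open>j'\<close> of \<open>j\<close> and
        \<open>Q\<close> is positive and still below \<open>Q\<close>, which is enough for the
        contradiction.\<close>
      define Q where "Q = a powr q * \<Omega> / C powr q"
      define j' where "j' = (j + Q) / 2"
      have "j < Q" using lt C by (simp add: Q_def field_simps)
      then have j': "j \<le> j'" "j' < Q" "0 < j'" using real by (auto simp: j'_def)
      define h where "h = (j' / \<Omega>) powr (1/q)"
      have h: "0 < h" "h powr q * \<Omega> = j'" using j' \<Omega>0 q by (auto simp: h_def powr_powr)
      have "a \<le> C * h" using main[OF h(1)] h(2) j' real by (simp add: ennreal_leI)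
      then have "a powr q \<le> (C * h) powr q" using a q by (intro powr_mono2) auto
      also have "\<dots> = C powr q * (j' / \<Omega>)" using C h \<Omega>0 by (simp add: powr_mult field_simps)
      also have "\<dots> < C powr q * (Q / \<Omega>)"
        using j' C \<Omega>0 by (intro mult_strict_left_mono divide_strict_right_mono) auto
      finally show False using C \<Omega>0 by (simp add: Q_def)
    qed
    then show ?thesis using real \<Omega>0 C by (simp add: J_def[symmetric] \<Omega> ennreal_mult[symmetric] ennreal_leI)
  qed
qed

definition whitney_ball :: "real \<Rightarrow> complex \<Rightarrow> complex set" where
  "whitney_ball \<kappa> z = ball z (\<kappa> * (1 - cmod z))"

lemma whitney_ball_subset:
  assumes "cmod z < 1" "0 < \<kappa>" "\<kappa> \<le> r" "r \<le> 1"
  shows "whitney_ball \<kappa> z \<subseteq> pseudo_disc z r"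
proof -
  have "\<kappa> * (1 - cmod z) \<le> r * (1 - cmod z)" using assms by (intro mult_right_mono) auto
  then have "whitney_ball \<kappa> z \<subseteq> ball z (r * (1 - cmod z))" by (auto simp: whitney_ball_def)
  then show ?thesis using ball_subset_pseudo_disc[of z r] assms by auto
qed

text \<open>Two tests of the same Hoelder inequality: the indicator of a Whitney ball shows that the
  ball carries a fixed share of the mass of the disc, and \<open>|f| powr (p/q)\<close>, with its
  submean property, gives a weighted submean inequality for \<open>|f| powr p\<close>. Both areas
  are comparable to \<open>(1 - |y|)^2\<close>, and \<open>K\<close> records their ratio.\<close>

lemma C_class_doubling_submean:
  fixes q p :: real
  assumes q: "1 < q" and \<omega>C: "\<omega> \<in> C_class q" and p: "0 < p"
  obtains r K where "0 < r" "r < 1"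
    "\<And>\<kappa>. 0 < \<kappa> \<Longrightarrow> \<kappa> \<le> 1 \<Longrightarrow> 0 < K \<kappa>"
    "\<And>\<kappa> y. 0 < \<kappa> \<Longrightarrow> \<kappa> \<le> 1 \<Longrightarrow> cmod y < 1 \<Longrightarrow> whitney_ball \<kappa> y \<subseteq> pseudo_disc y r \<Longrightarrow>
        weight_mass \<omega> (pseudo_disc y r) \<le> ennreal (K \<kappa>) * weight_mass \<omega> (whitney_ball \<kappa> y)"
    "\<And>\<kappa> y z f. 0 < \<kappa> \<Longrightarrow> \<kappa> \<le> 1 \<Longrightarrow> cmod y < 1 \<Longrightarrow> ball z (\<kappa> * (1 - cmod y)) \<subseteq> pseudo_disc y r \<Longrightarrow> f holomorphic_on unit_disc \<Longrightarrow>
        ennreal (cmod (f z) powr p) * weight_mass \<omega> (pseudo_disc y r) \<le>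
          ennreal (K \<kappa>) * (\<integral>\<^sup>+w. ennreal (cmod (f w) powr p * \<omega> w) * indicator (pseudo_disc y r) w \<partial>dA)"
proof -
  have \<omega>: "weight \<omega>" "AE z in dA. 0 < \<omega> z" using \<omega>C by (auto simp: C_class_def)
  obtain r C where r: "0 < r" "r < 1" and C: "0 < C"
    and Cq: "\<And>z. z \<in> unit_disc \<Longrightarrow> set_integrable dA (pseudo_disc z r) (\<lambda>\<zeta>. \<omega> \<zeta> powr (- ((q / (q - 1)) / q))) \<and>
          (LINT \<zeta>:pseudo_disc z r|dA. \<omega> \<zeta>) powr (1 / q) *
          (LINT \<zeta>:pseudo_disc z r|dA. \<omega> \<zeta> powr (- ((q / (q - 1)) / q))) powr (1 / (q / (q - 1)))
            \<le> C * measure lebesgue (pseudo_disc z r)"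
    using \<omega>C unfolding C_class_def Let_def by auto
  define R where "R = 2 * r / (1 - r)"
  have R: "0 < R" using r by (simp add: R_def)
  define C' where "C' = C * (pi * (2 * R)\<^sup>2)"
  have C': "0 < C'" using C R by (simp add: C'_def)
  have holder: "ennreal (a powr q) * weight_mass \<omega> (pseudo_disc y r) \<le> ennreal ((C' * (1 - cmod y)\<^sup>2) powr q) *
      (\<integral>\<^sup>+z. ennreal (u z powr q * \<omega> z) * indicator (pseudo_disc y r) z \<partial>dA)"
    if y: "cmod y < 1" and u: "u \<in> borel_measurable dA" "\<And>z. 0 \<le> u z" and a: "0 \<le> a" "ennreal a \<le> (\<integral>\<^sup>+z. ennreal (u z) * indicator (pseudo_disc y r) z \<partial>dA)"
    for y a and u :: "complex \<Rightarrow> real"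
  proof (rule C_class_holder_disc[OF q \<omega> _ _ _ _ _ u a])
    show "0 < C' * (1 - cmod y)\<^sup>2" using C' y by simp
    show s: "pseudo_disc y r \<in> sets dA" by (rule pseudo_disc_sets_dA)
    have bs: "ball y (r * (1 - cmod y)) \<subseteq> pseudo_disc y r" using ball_subset_pseudo_disc[of y r] y r by simp
    then have "emeasure dA (ball y (r * (1 - cmod y))) \<le> emeasure dA (pseudo_disc y r)"
      by (rule emeasure_mono[OF _ s])
    moreover have "emeasure dA (ball y (r * (1 - cmod y))) = ennreal ((r * (1 - cmod y))\<^sup>2)"
      using bs pseudo_disc_subset[of y r] r y by (intro emeasure_dA_ball) auto
    moreover have "0 < (r * (1 - cmod y))\<^sup>2" using r y by simp
    ultimately show "emeasure dA (pseudo_disc y r) \<noteq> 0" by (metis ennreal_eq_0_iff le_zero_eq not_le)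
    show "set_integrable dA (pseudo_disc y r) (\<lambda>\<zeta>. \<omega> \<zeta> powr (- ((q / (q - 1)) / q)))" using Cq[of y] y by auto
    have "pseudo_disc y r \<subseteq> cball y (R * (1 - cmod y))"
      using pseudo_disc_dist_le[OF y r] by (auto simp: R_def dist_norm)
    also have "\<dots> \<subseteq> ball y (2 * R * (1 - cmod y))"
    proof -
      have "0 < R * (1 - cmod y)" using R y by simp
      then show ?thesis by (auto simp: mult.assoc)
    qed
    finally have "measure lebesgue (pseudo_disc y r) \<le> measure lebesgue (ball y (2 * R * (1 - cmod y)))"
      using pseudo_disc_borel by (intro measure_mono_fmeasurable) auto
    also have "\<dots> = pi * (2 * R)\<^sup>2 * (1 - cmod y)\<^sup>2"
      using R y by (simp add: content_ball unit_ball_vol_2 power_mult_distrib)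
    finally have "C * measure lebesgue (pseudo_disc y r) \<le> C' * (1 - cmod y)\<^sup>2"
      using C by (simp add: C'_def)
    then show "(LINT \<zeta>:pseudo_disc y r|dA. \<omega> \<zeta>) powr (1 / q) *
          (LINT \<zeta>:pseudo_disc y r|dA. \<omega> \<zeta> powr (- ((q / (q - 1)) / q))) powr (1 / (q / (q - 1))) \<le> C' * (1 - cmod y)\<^sup>2"
      using Cq[of y] y by auto
  qed
  define K where "K = (\<lambda>\<kappa>. (C' / \<kappa>\<^sup>2) powr q)"
  have Kpos: "0 < K \<kappa>" if "0 < \<kappa>" for \<kappa> using that C' by (simp add: K_def)
  \<comment> \<open>Divides out the common area factor. The free \<open>x\<close> lets one
    computation serve both tests, with \<open>x = 1\<close> and with
    \<open>x = |f z| powr (p/q)\<close>.\<close>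
  have cancel: "X * W \<le> ennreal (K \<kappa>) * Y"
    if "0 < \<kappa>" "cmod y < 1" "ennreal (x powr q * (((\<kappa> * (1 - cmod y))\<^sup>2) powr q)) * W \<le> ennreal ((C' * (1 - cmod y)\<^sup>2) powr q) * Y" "X = ennreal (x powr q)"
    for X W Y x \<kappa> y
  proof -
    define b where "b = ((\<kappa> * (1 - cmod y))\<^sup>2) powr q"
    have b: "0 < b" using that by (simp add: b_def)
    have e: "(C' * (1 - cmod y)\<^sup>2) powr q = b * K \<kappa>"
    proof -
      have "C' * (1 - cmod y)\<^sup>2 = (\<kappa> * (1 - cmod y))\<^sup>2 * (C' / \<kappa>\<^sup>2)" using that by (simp add: power_mult_distrib)
      then have "(C' * (1 - cmod y)\<^sup>2) powr q = ((\<kappa> * (1 - cmod y))\<^sup>2 * (C' / \<kappa>\<^sup>2)) powr q" by (rule arg_cong)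
      also have "\<dots> = ((\<kappa> * (1 - cmod y))\<^sup>2) powr q * (C' / \<kappa>\<^sup>2) powr q"
        by (rule powr_mult)
      finally show ?thesis by (simp only: b_def K_def)
    qed
    have "ennreal b * (X * W) \<le> ennreal b * (ennreal (K \<kappa>) * Y)"
      using that(3) b Kpos[OF that(1)] unfolding e that(4) b_def[symmetric]
      by (simp add: ennreal_mult'' ennreal_mult' mult_ac)
    then have "ennreal (1/b) * (ennreal b * (X * W)) \<le> ennreal (1/b) * (ennreal b * (ennreal (K \<kappa>) * Y))"
      by (rule mult_left_mono) simp
    then show ?thesis using b by (simp add: mult.assoc[symmetric] ennreal_mult[symmetric])
  qed
  show thesis
  proof (rule that[OF r, of K])
    show "0 < K \<kappa>" if "0 < \<kappa>" for \<kappa> by (rule Kpos[OF that])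
    fix \<kappa> :: real and y :: complex
    assume \<kappa>: "0 < \<kappa>" "\<kappa> \<le> 1" and y: "cmod y < 1"
    have \<rho>: "0 < \<kappa> * (1 - cmod y)" "\<kappa> * (1 - cmod y) \<le> 1"
      using \<kappa> y mult_mono[of \<kappa> 1 "1 - cmod y" 1] by auto
    {
      assume sub: "whitney_ball \<kappa> y \<subseteq> pseudo_disc y r"
      let ?B = "whitney_ball \<kappa> y"
      have Bu: "?B \<subseteq> unit_disc" using sub pseudo_disc_subset by blast
      have Bs: "?B \<in> sets dA" using Bu by (intro borel_sets_dA) (auto simp: whitney_ball_def)
      have i1: "(\<integral>\<^sup>+z. ennreal (indicator ?B z) * indicator (pseudo_disc y r) z \<partial>dA) = emeasure dA ?B"
      proof -
        have "(\<integral>\<^sup>+z. ennreal (indicator ?B z) * indicator (pseudo_disc y r) z \<partial>dA) = (\<integral>\<^sup>+z. indicator ?B z \<partial>dA)"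
          using sub by (intro nn_integral_cong) (auto simp: indicator_def)
        then show ?thesis using Bs by simp
      qed
      also have "\<dots> = ennreal ((\<kappa> * (1 - cmod y))\<^sup>2)"
        using Bu \<rho> unfolding whitney_ball_def by (intro emeasure_dA_ball) auto
      finally have i1: "(\<integral>\<^sup>+z. ennreal (indicator ?B z) * indicator (pseudo_disc y r) z \<partial>dA) = ennreal ((\<kappa> * (1 - cmod y))\<^sup>2)" .
      have i2: "(\<integral>\<^sup>+z. ennreal (indicator ?B z powr q * \<omega> z) * indicator (pseudo_disc y r) z \<partial>dA) = weight_mass \<omega> ?B"
        unfolding weight_mass_def using sub by (intro nn_integral_cong) (auto simp: indicator_def)
      have "ennreal (((\<kappa> * (1 - cmod y))\<^sup>2) powr q) * weight_mass \<omega> (pseudo_disc y r) \<le> ennreal ((C' * (1 - cmod y)\<^sup>2) powr q) *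
         (\<integral>\<^sup>+z. ennreal (indicator ?B z powr q * \<omega> z) * indicator (pseudo_disc y r) z \<partial>dA)"
        by (rule holder[OF y]) (use Bs i1 in auto)
      then have "1 * weight_mass \<omega> (pseudo_disc y r) \<le> ennreal (K \<kappa>) * weight_mass \<omega> ?B"
        unfolding i2 by (intro cancel[where x = 1, OF \<kappa>(1) y]) auto
      then show "weight_mass \<omega> (pseudo_disc y r) \<le> ennreal (K \<kappa>) * weight_mass \<omega> ?B" by simp
    }
    fix z f
    assume sub: "ball z (\<kappa> * (1 - cmod y)) \<subseteq> pseudo_disc y r" and f: "f holomorphic_on unit_disc"
    have bu: "ball z (\<kappa> * (1 - cmod y)) \<subseteq> unit_disc" using sub pseudo_disc_subset by blast
    define u where "u = (\<lambda>w. cmod (f w) powr (p/q))"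
    have um: "u \<in> borel_measurable dA" unfolding u_def
      using borel_measurable_holomorphic_disc(1)[OF f] by measurable
    have "ennreal (cmod (f z) powr (p/q)) * ennreal ((\<kappa> * (1 - cmod y))\<^sup>2) \<le>
      (\<integral>\<^sup>+w. ennreal (cmod (f w) powr (p/q)) * indicator (ball z (\<kappa> * (1 - cmod y))) w \<partial>dA)"
      by (rule holomorphic_ball_submean[OF f _ \<rho> bu]) (use p q in simp)
    also have "\<dots> \<le> (\<integral>\<^sup>+w. ennreal (u w) * indicator (pseudo_disc y r) w \<partial>dA)"
      unfolding u_def using sub by (intro nn_integral_mono mult_left_mono) (auto simp: indicator_def)
    finally have ale: "ennreal (cmod (f z) powr (p/q) * (\<kappa> * (1 - cmod y))\<^sup>2) \<le> (\<integral>\<^sup>+w. ennreal (u w) * indicator (pseudo_disc y r) w \<partial>dA)"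
      by (simp add: ennreal_mult)
    have up: "u w powr q = cmod (f w) powr p" for w unfolding u_def using q by (simp add: powr_powr)
    have "ennreal ((cmod (f z) powr (p/q) * (\<kappa> * (1 - cmod y))\<^sup>2) powr q) * weight_mass \<omega> (pseudo_disc y r) \<le> ennreal ((C' * (1 - cmod y)\<^sup>2) powr q) *
         (\<integral>\<^sup>+w. ennreal (u w powr q * \<omega> w) * indicator (pseudo_disc y r) w \<partial>dA)"
      by (rule holder[OF y um _ _ ale]) (auto simp: u_def)
    then show "ennreal (cmod (f z) powr p) * weight_mass \<omega> (pseudo_disc y r) \<le>
          ennreal (K \<kappa>) * (\<integral>\<^sup>+w. ennreal (cmod (f w) powr p * \<omega> w) * indicator (pseudo_disc y r) w \<partial>dA)"
      unfolding up using q by (intro cancel[where x = "cmod (f z) powr (p/q)", OF \<kappa>(1) y]) (auto simp: powr_mult powr_powr)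
  qed
qed

section \<open>Chains and coverings by Whitney balls\<close>

lemma pseudo_disc_gap:
  assumes z: "cmod z < 1" and R: "0 < R" "R < 1" and x: "x \<in> pseudo_disc z R"
  shows "1 - cmod z \<le> (1 + 2 * R / (1 - R)) * (1 - cmod x)"
proof -
  have x1: "cmod x < 1" using x pseudo_disc_subset by (auto simp: pseudo_disc_def)
  then have "z \<in> pseudo_disc x R" using pseudo_disc_commute z x by blast
  then have "cmod (x - z) \<le> 2 * R / (1 - R) * (1 - cmod x)" by (rule pseudo_disc_dist_le[OF x1 R])
  moreover have "cmod x - cmod z \<le> cmod (x - z)" by (rule norm_triangle_ineq2)
  ultimately show ?thesis by (simp add: algebra_simps)
qed

text \<open>A Harnack chain along the segment from \<open>z\<close> to \<open>x\<close>. By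
  convexity of the norm every point of the segment keeps distance at least
  \<open>c * (1 - |z|)\<close> from the circle, so \<open>n\<close> equal steps with
  \<open>A / n < \<kappa> * c\<close> stay in successive Whitney balls. The number of steps depends
  on \<open>\<kappa>\<close> and \<open>R\<close> only.\<close>

lemma chain_comparison:
  fixes m :: "complex \<Rightarrow> ennreal"
  assumes \<kappa>: "0 < \<kappa>" and K: "1 \<le> K" and R: "0 < R" "R < 1"
    and m: "\<And>x y. cmod y < 1 \<Longrightarrow> x \<in> whitney_ball \<kappa> y \<Longrightarrow> cmod x < 1 \<Longrightarrow> m x \<le> ennreal K * m y"
  obtains L where "1 \<le> L" "\<And>z x. cmod z < 1 \<Longrightarrow> x \<in> pseudo_disc z R \<Longrightarrow> m x \<le> ennreal L * m z"
proof -
  define A where "A = 2 * R / (1 - R)"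
  have A: "0 < A" using R by (simp add: A_def)
  define c where "c = 1 / (1 + A)"
  have c: "0 < c" "c \<le> 1" using A by (auto simp: c_def)
  obtain n :: nat where n: "A / (\<kappa> * c) < real n" using reals_Archimedean2 by blast
  have "0 < A / (\<kappa> * c)" using A \<kappa> c by simp
  with n have n0: "0 < n" by (cases n) auto
  show thesis
  proof (rule that[of "K ^ n"])
    show "1 \<le> K ^ n" using K by (rule one_le_power)
    fix z x assume z: "cmod z < 1" and x: "x \<in> pseudo_disc z R"
    have x1: "cmod x < 1" using x by (simp add: pseudo_disc_def)
    have d: "cmod (x - z) \<le> A * (1 - cmod z)"
      using pseudo_disc_dist_le[OF z R x] by (simp add: A_def norm_minus_commute)
    have "1 - cmod z \<le> (1 + A) * (1 - cmod x)" using pseudo_disc_gap[OF z R x] by (simp add: A_def)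
    then have cx: "c * (1 - cmod z) \<le> 1 - cmod x" using A by (simp add: c_def field_simps)
    have cz: "c * (1 - cmod z) \<le> 1 - cmod z" using c z mult_right_mono[of c 1 "1 - cmod z"] by simp
    define y where "y = (\<lambda>i::nat. z + of_real (real i / real n) * (x - z))"
    have yb: "c * (1 - cmod z) \<le> 1 - cmod (y i)" if "i \<le> n" for i
    proof -
      define t where "t = real i / real n"
      have t: "0 \<le> t" "t \<le> 1" using that n0 by (auto simp: t_def)
      have "y i = z + of_real t * (x - z)" by (simp add: y_def t_def)
      then have "y i = of_real (1 - t) * z + of_real t * x" by (simp add: algebra_simps)
      then have "cmod (y i) \<le> cmod (of_real (1 - t) * z) + cmod (of_real t * x)"
        by (simp only: norm_triangle_ineq)
      also have "\<dots> = (1 - t) * cmod z + t * cmod x" using t by (simp only: norm_mult norm_of_real)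
      finally have "(1 - t) * (1 - cmod z) + t * (1 - cmod x) \<le> 1 - cmod (y i)" by (simp add: algebra_simps)
      moreover have "(1 - t) * (c * (1 - cmod z)) + t * (c * (1 - cmod z)) \<le> (1 - t) * (1 - cmod z) + t * (1 - cmod x)"
        using t cx cz by (intro add_mono mult_left_mono) auto
      ultimately show ?thesis by (simp add: algebra_simps)
    qed
    have c0: "0 < c * (1 - cmod z)" using c z by simp
    have y1: "cmod (y i) < 1" if "i \<le> n" for i using yb[OF that] c0 by linarith
    have step: "m (y (Suc i)) \<le> ennreal K * m (y i)" if "Suc i \<le> n" for i
    proof (rule m)
      show "cmod (y i) < 1" "cmod (y (Suc i)) < 1" using y1 that by auto
      have "y i - y (Suc i) = - of_real (1 / real n) * (x - z)" using n0 by (simp add: y_def field_simps)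
      then have "cmod (y i - y (Suc i)) = (1 / real n) * cmod (x - z)" by (simp add: norm_mult norm_divide)
      also have "\<dots> \<le> (1 / real n) * (A * (1 - cmod z))" using d by (intro mult_left_mono) auto
      also have "\<dots> = A / real n * (1 - cmod z)" by simp
      also have "\<dots> < \<kappa> * c * (1 - cmod z)"
      proof (rule mult_strict_right_mono)
        show "A / real n < \<kappa> * c" using n n0 \<kappa> c by (simp add: field_simps)
      qed (use z in simp)
      also have "\<dots> \<le> \<kappa> * (1 - cmod (y i))" using yb[of i] that \<kappa> by (simp add: mult.assoc)
      finally show "y (Suc i) \<in> whitney_ball \<kappa> (y i)" by (simp add: whitney_ball_def dist_norm)
    qed
    have "i \<le> n \<Longrightarrow> m (y i) \<le> ennreal (K ^ i) * m z" for i
    proof (induction i)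
      case 0
      then show ?case by (simp add: y_def)
    next
      case (Suc i)
      have "m (y (Suc i)) \<le> ennreal K * m (y i)" by (rule step) (use Suc in auto)
      also have "\<dots> \<le> ennreal K * (ennreal (K ^ i) * m z)" using Suc by (intro mult_left_mono) auto
      also have "\<dots> = ennreal (K ^ Suc i) * m z" using K by (simp add: ennreal_mult mult.assoc)
      finally show ?case .
    qed
    from this[of n] show "m x \<le> ennreal (K ^ n) * m z" using n0 by (simp add: y_def)
  qed
qed

text \<open>The balls of a scaled finite cover are recentred at points of the disc itself, because
  comparison chains reach only points of the disc. Recentring doubles the radius, and
  \<open>e\<close> is chosen so that the doubled and rescaled radius is
  \<open>\<kappa> * c * (1 - |z|)\<close>.\<close>

lemma whitney_cover:
  assumes \<kappa>: "0 < \<kappa>" and R: "0 < R" "R < 1"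
  obtains N where "\<And>z. cmod z < 1 \<Longrightarrow> \<exists>Y. finite Y \<and> card Y \<le> N \<and> Y \<subseteq> pseudo_disc z R \<and>
     pseudo_disc z R \<subseteq> (\<Union>y\<in>Y. whitney_ball \<kappa> y)"
proof -
  define A where "A = 2 * R / (1 - R)"
  have A: "0 < A" using R by (simp add: A_def)
  define c where "c = 1 / (1 + A)"
  have c: "0 < c" using A by (auto simp: c_def)
  define e where "e = \<kappa> * c / (2 * A)"
  have e: "0 < e" using \<kappa> c A by (simp add: e_def)
  obtain X :: "complex set" where X: "finite X" "cball 0 1 \<subseteq> (\<Union>x\<in>X. ball x e)"
    by (rule finite_ball_cover[OF e])
  show thesis
  proof (rule that[of "card X"])
    fix z assume z: "cmod z < 1"
    define t where "t = A * (1 - cmod z)"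
    have t: "0 < t" using A z by (simp add: t_def)
    define P where "P = (\<lambda>x. {w \<in> pseudo_disc z R. (w - z) / of_real t \<in> ball x e})"
    define X' where "X' = {x \<in> X. P x \<noteq> {}}"
    define w where "w = (\<lambda>x. SOME w. w \<in> P x)"
    have w: "w x \<in> P x" if "x \<in> X'" for x using that unfolding X'_def w_def by (auto intro: someI_ex)
    show "\<exists>Y. finite Y \<and> card Y \<le> card X \<and> Y \<subseteq> pseudo_disc z R \<and> pseudo_disc z R \<subseteq> (\<Union>y\<in>Y. whitney_ball \<kappa> y)"
    proof (intro exI[of _ "w ` X'"] conjI)
      show "finite (w ` X')" using X(1) by (simp add: X'_def)
      have "card (w ` X') \<le> card X'" using X(1) by (intro card_image_le) (simp add: X'_def)
      also have "\<dots> \<le> card X" using X(1) by (intro card_mono) (auto simp: X'_def)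
      finally show "card (w ` X') \<le> card X" .
      show "w ` X' \<subseteq> pseudo_disc z R" using w by (auto simp: P_def)
      show "pseudo_disc z R \<subseteq> (\<Union>y\<in>w ` X'. whitney_ball \<kappa> y)"
      proof
        fix v assume v: "v \<in> pseudo_disc z R"
        have "cmod (v - z) \<le> t" using pseudo_disc_dist_le[OF z R v] by (simp add: A_def t_def norm_minus_commute)
        then have "(v - z) / of_real t \<in> cball 0 1" using t by (simp add: norm_divide)
        then obtain x where x: "x \<in> X" "(v - z) / of_real t \<in> ball x e" using X(2) by blast
        then have "v \<in> P x" using v by (simp add: P_def)
        then have xX: "x \<in> X'" using x by (auto simp: X'_def)
        have wP: "w x \<in> pseudo_disc z R" "(w x - z) / of_real t \<in> ball x e" using w[OF xX] by (auto simp: P_def)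
        have eq: "w x - v = of_real t * ((w x - z) / of_real t - (v - z) / of_real t)"
          using t by (simp add: field_simps)
        have "dist ((w x - z) / of_real t) ((v - z) / of_real t) < 2 * e"
          using dist_triangle3[of "(w x - z) / of_real t" "(v - z) / of_real t" x] x(2) wP(2) by simp
        then have "t * cmod ((w x - z) / of_real t - (v - z) / of_real t) < t * (2 * e)"
          using t by (intro mult_strict_left_mono) (auto simp: dist_norm)
        then have "cmod (w x - v) < t * (2 * e)"
          using t by (subst eq) (simp only: norm_mult norm_of_real abs_of_pos)
        also have "\<dots> = \<kappa> * (c * (1 - cmod z))" using A by (simp add: t_def e_def)
        also have "\<dots> \<le> \<kappa> * (1 - cmod (w x))"
        proof (rule mult_left_mono)
          have "1 - cmod z \<le> (1 + A) * (1 - cmod (w x))" using pseudo_disc_gap[OF z R wP(1)] by (simp add: A_def)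
          then show "c * (1 - cmod z) \<le> 1 - cmod (w x)" using A by (simp add: c_def field_simps)
        qed (use \<kappa> in simp)
        finally have "v \<in> whitney_ball \<kappa> (w x)" by (simp add: whitney_ball_def dist_norm)
        then show "v \<in> (\<Union>y\<in>w ` X'. whitney_ball \<kappa> y)" using xX by blast
      qed
    qed
  qed
qed

text \<open>Kept general in \<open>\<nu>\<close> because it is applied both to the weighted area and
  to \<open>\<mu>\<close>, with different radii. The summand 1 in the constant makes it positive in
  degenerate cases.\<close>

lemma emeasure_pseudo_disc_le:
  fixes m :: "complex \<Rightarrow> ennreal"
  assumes \<nu>: "\<And>A. A \<in> sets borel \<Longrightarrow> A \<subseteq> unit_disc \<Longrightarrow> A \<in> sets \<nu>"
    and \<kappa>: "0 < \<kappa>" "\<kappa> \<le> 1" and R: "0 < R" "R < 1" and K: "0 \<le> K" and L: "0 \<le> L"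
    and m: "\<And>z x. cmod z < 1 \<Longrightarrow> x \<in> pseudo_disc z R \<Longrightarrow> m x \<le> ennreal L * m z"
    and le: "\<And>x. cmod x < 1 \<Longrightarrow> emeasure \<nu> (whitney_ball \<kappa> x) \<le> ennreal K * m x"
  obtains C where "0 < C" "\<And>z. cmod z < 1 \<Longrightarrow> emeasure \<nu> (pseudo_disc z R) \<le> ennreal C * m z"
proof -
  obtain N where N: "\<And>z. cmod z < 1 \<Longrightarrow> \<exists>Y. finite Y \<and> card Y \<le> N \<and> Y \<subseteq> pseudo_disc z R \<and>
     pseudo_disc z R \<subseteq> (\<Union>y\<in>Y. whitney_ball \<kappa> y)"
    by (rule whitney_cover[OF \<kappa>(1) R]) blast
  show thesis
  proof (rule that[of "real N * (K * L) + 1"])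
    show "0 < real N * (K * L) + 1" using K L by (intro add_nonneg_pos) auto
    fix z assume z: "cmod z < 1"
    from N[OF z] obtain Y where Y: "finite Y" "card Y \<le> N" "Y \<subseteq> pseudo_disc z R" "pseudo_disc z R \<subseteq> (\<Union>y\<in>Y. whitney_ball \<kappa> y)"
      by blast
    have y1: "cmod y < 1" if "y \<in> Y" for y using that Y(3) by (auto simp: pseudo_disc_def)
    have wb: "whitney_ball \<kappa> y \<in> sets \<nu>" if "y \<in> Y" for y
    proof (rule \<nu>)
      show "whitney_ball \<kappa> y \<subseteq> unit_disc"
        using whitney_ball_subset[of y \<kappa> 1] y1[OF that] \<kappa> pseudo_disc_subset[of y 1] by simp
    qed (simp add: whitney_ball_def)
    have "emeasure \<nu> (pseudo_disc z R) \<le> emeasure \<nu> (\<Union>y\<in>Y. whitney_ball \<kappa> y)"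
      using Y(1) wb by (intro emeasure_mono Y(4)) auto
    also have "\<dots> \<le> (\<Sum>y\<in>Y. emeasure \<nu> (whitney_ball \<kappa> y))"
      using Y(1) wb by (intro emeasure_subadditive_finite) auto
    also have "\<dots> \<le> (\<Sum>y\<in>Y. ennreal (K * L) * m z)"
    proof (rule sum_mono)
      fix y assume y: "y \<in> Y"
      have "emeasure \<nu> (whitney_ball \<kappa> y) \<le> ennreal K * m y" by (rule le[OF y1[OF y]])
      also have "\<dots> \<le> ennreal K * (ennreal L * m z)" using y Y(3) by (intro mult_left_mono m z) auto
      finally show "emeasure \<nu> (whitney_ball \<kappa> y) \<le> ennreal (K * L) * m z" using K L by (simp add: ennreal_mult mult.assoc)
    qed
    also have "\<dots> = of_nat (card Y) * (ennreal (K * L) * m z)" by simp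
    also have "\<dots> \<le> of_nat N * (ennreal (K * L) * m z)" using Y(2) by (intro mult_right_mono) auto
    also have "\<dots> = ennreal (real N * (K * L)) * m z"
      using K L by (simp add: ennreal_mult ennreal_of_nat_eq_real_of_nat mult.assoc)
    also have "\<dots> \<le> ennreal (real N * (K * L) + 1) * m z" by (intro mult_right_mono ennreal_leI) auto
    finally show "emeasure \<nu> (pseudo_disc z R) \<le> ennreal (real N * (K * L) + 1) * m z" .
  qed
qed

lemma borel_measurable_weight_mass_whitney:
  assumes \<omega>: "weight \<omega>" and f[measurable]: "f \<in> borel_measurable N"
  shows "(\<lambda>z. weight_mass \<omega> (whitney_ball \<kappa> (f z))) \<in> borel_measurable N"
proof -
  interpret sigma_finite_measure dA by (rule sigma_finite_dA)
  note measurable_id_dA[measurable]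
  note borel_measurable_weight[OF \<omega>, measurable]
  have "(\<lambda>x. ennreal (\<omega> (snd x)) * indicator (whitney_ball \<kappa> (f (fst x))) (snd x)) \<in> borel_measurable (N \<Otimes>\<^sub>M dA)"
    unfolding indicator_def of_bool_def whitney_ball_def mem_ball by measurable
  then have "(\<lambda>z. \<integral>\<^sup>+x. ennreal (\<omega> x) * indicator (whitney_ball \<kappa> (f z)) x \<partial>dA) \<in> borel_measurable N"
    by (intro borel_measurable_nn_integral) (simp add: split_beta')
  then show ?thesis by (simp add: weight_mass_def)
qed

text \<open>Lindelof's theorem extracts countably many Whitney balls covering the disc, each of
  finite measure; Fubini then becomes available for \<open>\<mu>\<close>.\<close>

lemma sigma_finite_measure_on_disc:
  assumes \<mu>: "borel_measure_on_disc \<mu>" and \<kappa>: "0 < \<kappa>" "\<kappa> \<le> 1"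
    and fin: "\<And>z. cmod z < 1 \<Longrightarrow> emeasure \<mu> (whitney_ball \<kappa> z) < \<infinity>"
  shows "sigma_finite_measure \<mu>"
proof
  have sub: "whitney_ball \<kappa> z \<subseteq> unit_disc" if "cmod z < 1" for z
    using whitney_ball_subset[OF that \<kappa>] pseudo_disc_subset[of z 1] by simp
  obtain F where F: "F \<subseteq> whitney_ball \<kappa> ` unit_disc" "countable F" "\<Union>F = \<Union>(whitney_ball \<kappa> ` unit_disc)"
    by (rule Lindelof[of "whitney_ball \<kappa> ` unit_disc"]) (auto simp: whitney_ball_def)
  have "\<Union>(whitney_ball \<kappa> ` unit_disc) = unit_disc"
  proof
    have "whitney_ball \<kappa> z \<subseteq> unit_disc" if "z \<in> unit_disc" for z using sub that by simp
    then show "\<Union>(whitney_ball \<kappa> ` unit_disc) \<subseteq> unit_disc" by blast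
    show "unit_disc \<subseteq> \<Union>(whitney_ball \<kappa> ` unit_disc)"
    proof
      fix z :: complex assume "z \<in> unit_disc"
      then show "z \<in> \<Union>(whitney_ball \<kappa> ` unit_disc)"
        using \<kappa> by (intro UN_I[of z]) (auto simp: whitney_ball_def)
    qed
  qed
  moreover have "a \<in> sets \<mu> \<and> emeasure \<mu> a \<noteq> \<infinity>" if "a \<in> F" for a
  proof -
    have "a \<in> whitney_ball \<kappa> ` unit_disc" using F(1) that by blast
    then obtain z where z: "cmod z < 1" "a = whitney_ball \<kappa> z" by auto
    then show ?thesis using fin[of z] sub[of z]
      by (auto intro!: sets_borel_measure_on_disc[OF \<mu>] simp: whitney_ball_def)
  qed
  ultimately show "\<exists>A. countable A \<and> A \<subseteq> sets \<mu> \<and> \<Union>A = space \<mu> \<and> (\<forall>a\<in>A. emeasure \<mu> a \<noteq> \<infinity>)"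
    using F(2,3) space_borel_measure_on_disc[OF \<mu>] by (intro exI[of _ F]) auto
qed

text \<open>The majorant at \<open>\<zeta>\<close> is the average of \<open>|f| powr p\<close> over
  the hyperbolic disc about \<open>\<zeta>\<close>, normalised by the mass \<open>m \<zeta>\<close>
  of a Whitney ball. After an exchange of integrals, \<open>m \<zeta>\<close> is replaced by
  \<open>m z\<close> through the chain comparison and cancels against the bound for
  \<open>\<mu>\<close> on the disc about \<open>z\<close>.\<close>

lemma C_infinity_majorant:
  fixes p r0 C0 :: real
  assumes p: "0 < p" and \<mu>: "borel_measure_on_disc \<mu>" and \<omega>C: "\<omega> \<in> C_infinity"
    and r0: "0 < r0" "r0 < 1" and C0: "0 < C0"
    and le0: "\<And>a. a \<in> unit_disc - {0} \<Longrightarrow> emeasure \<mu> (pseudo_disc a r0) \<le> ennreal C0 * weight_mass \<omega> (pseudo_disc a r0)"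
  obtains \<kappa> K :: real where "0 < \<kappa>" "\<kappa> \<le> 1" "0 \<le> K" "sigma_finite_measure \<mu>"
    "\<And>f. f \<in> bergman_space p \<omega> \<Longrightarrow> \<exists>U\<in>borel_measurable \<mu>.
        (\<forall>\<zeta>\<in>unit_disc. \<forall>z\<in>ball \<zeta> (\<kappa> * (1 - cmod \<zeta>)). ennreal (cmod (f z) powr p) \<le> U \<zeta>) \<and>
        (\<integral>\<^sup>+z. U z \<partial>\<mu>) \<le> ennreal K * bergman_norm_p p \<omega> f"
proof -
  obtain q where q: "1 < q" "\<omega> \<in> C_class q" using \<omega>C by (auto simp: C_infinity_def)
  have \<omega>: "weight \<omega>" "AE z in dA. 0 < \<omega> z" using q(2) by (auto simp: C_class_def)
  obtain r K0 where r: "0 < r" "r < 1"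
    and K0: "\<And>\<kappa>. 0 < \<kappa> \<Longrightarrow> \<kappa> \<le> 1 \<Longrightarrow> 0 < K0 \<kappa>"
    and dbl: "\<And>\<kappa> y. 0 < \<kappa> \<Longrightarrow> \<kappa> \<le> 1 \<Longrightarrow> cmod y < 1 \<Longrightarrow> whitney_ball \<kappa> y \<subseteq> pseudo_disc y r \<Longrightarrow>
        weight_mass \<omega> (pseudo_disc y r) \<le> ennreal (K0 \<kappa>) * weight_mass \<omega> (whitney_ball \<kappa> y)"
    and sm: "\<And>\<kappa> y z f. 0 < \<kappa> \<Longrightarrow> \<kappa> \<le> 1 \<Longrightarrow> cmod y < 1 \<Longrightarrow> ball z (\<kappa> * (1 - cmod y)) \<subseteq> pseudo_disc y r \<Longrightarrow> f holomorphic_on unit_disc \<Longrightarrow>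
        ennreal (cmod (f z) powr p) * weight_mass \<omega> (pseudo_disc y r) \<le>
          ennreal (K0 \<kappa>) * (\<integral>\<^sup>+w. ennreal (cmod (f w) powr p * \<omega> w) * indicator (pseudo_disc y r) w \<partial>dA)"
    by (rule C_class_doubling_submean[OF q p]) (rule that; assumption)
  \<comment> \<open>The 8 leaves room twice: a slightly enlarged \<open>\<kappa>\<close>-ball about
    any point of a Whitney ball stays in the disc of radius \<open>r\<close>, since
    \<open>\<kappa> * (2 + \<kappa>) \<le> r\<close>; and the ball about 0 fits into a disc of
    radius \<open>r0\<close> about a nearby centre, since
    \<open>2 * \<kappa> \<le> r0 * (1 - \<kappa>)\<close>.\<close>
  define \<kappa> where "\<kappa> = min r r0 / 8"
  have \<kappa>: "0 < \<kappa>" "\<kappa> \<le> 1" "8 * \<kappa> \<le> r" "8 * \<kappa> \<le> r0" using r r0 by (auto simp: \<kappa>_def)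
  define m where "m = (\<lambda>z. weight_mass \<omega> (whitney_ball \<kappa> z))"
  define K where "K = max 1 (K0 \<kappa>)"
  have K: "1 \<le> K" "K0 \<kappa> \<le> K" by (auto simp: K_def)
  have wsub: "whitney_ball \<kappa> y \<subseteq> pseudo_disc y r" if "cmod y < 1" for y
    using whitney_ball_subset[OF that \<kappa>(1), of r] \<kappa> r by simp
  have wu: "whitney_ball \<kappa> y \<subseteq> unit_disc" if "cmod y < 1" for y
    using wsub[OF that] pseudo_disc_subset by blast
  have d: "weight_mass \<omega> (pseudo_disc y r) \<le> ennreal K * m y" if "cmod y < 1" for y
  proof -
    have "weight_mass \<omega> (pseudo_disc y r) \<le> ennreal (K0 \<kappa>) * m y"
      unfolding m_def by (rule dbl[OF \<kappa>(1,2) that wsub[OF that]])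
    also have "\<dots> \<le> ennreal K * m y" using K by (intro mult_right_mono ennreal_leI) auto
    finally show ?thesis .
  qed
  have inball: "ball x (\<kappa> * (1 - cmod y) * (1 + \<kappa>)) \<subseteq> pseudo_disc y r" if y: "cmod y < 1" and x: "x \<in> whitney_ball \<kappa> y" for x y
  proof -
    have "ball x (\<kappa> * (1 - cmod y) * (1 + \<kappa>)) \<subseteq> ball y (r * (1 - cmod y))"
    proof
      fix w assume "w \<in> ball x (\<kappa> * (1 - cmod y) * (1 + \<kappa>))"
      then have "dist y w < \<kappa> * (1 - cmod y) + \<kappa> * (1 - cmod y) * (1 + \<kappa>)"
        using x dist_triangle[of y w x] by (simp add: whitney_ball_def)
      also have "\<dots> = (\<kappa> * (2 + \<kappa>)) * (1 - cmod y)" by (simp add: algebra_simps)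
      also have "\<dots> \<le> r * (1 - cmod y)"
      proof (rule mult_right_mono)
        have "\<kappa> * (2 + \<kappa>) \<le> \<kappa> * 8" using \<kappa> by (intro mult_left_mono) auto
        then show "\<kappa> * (2 + \<kappa>) \<le> r" using \<kappa>(3) by linarith
      qed (use y in simp)
      finally show "w \<in> ball y (r * (1 - cmod y))" by simp
    qed
    also have "\<dots> \<subseteq> pseudo_disc y r" using ball_subset_pseudo_disc[of y r] y r by simp
    finally show ?thesis .
  qed
  have step: "m x \<le> ennreal K * m y" if y: "cmod y < 1" and x: "x \<in> whitney_ball \<kappa> y" for x y
  proof -
    have "cmod y - cmod x \<le> dist y x" using norm_triangle_ineq2[of y x] by (simp add: dist_norm)
    then have "1 - cmod x \<le> (1 - cmod y) * (1 + \<kappa>)" using x by (simp add: whitney_ball_def algebra_simps)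
    then have "\<kappa> * (1 - cmod x) \<le> \<kappa> * ((1 - cmod y) * (1 + \<kappa>))" using \<kappa> by (intro mult_left_mono) auto
    then have "whitney_ball \<kappa> x \<subseteq> ball x (\<kappa> * (1 - cmod y) * (1 + \<kappa>))" by (auto simp: whitney_ball_def mult.assoc)
    then have "m x \<le> weight_mass \<omega> (pseudo_disc y r)"
      unfolding m_def using inball[OF y x] by (intro weight_mass_mono) auto
    also have "\<dots> \<le> ennreal K * m y" by (rule d[OF y])
    finally show ?thesis .
  qed
  obtain L where L: "1 \<le> L" "\<And>z x. cmod z < 1 \<Longrightarrow> x \<in> pseudo_disc z r \<Longrightarrow> m x \<le> ennreal L * m z"
    by (rule chain_comparison[OF \<kappa>(1) K(1) r, of m]) (use step in auto)
  \<comment> \<open>The radius belonging to the class and the radius \<open>r0\<close> of the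
    hypothesis on \<open>\<mu>\<close> are unrelated. The function \<open>m\<close> is the common
    yardstick, comparable across discs of either size.\<close>
  obtain L0 where L0: "1 \<le> L0" "\<And>z x. cmod z < 1 \<Longrightarrow> x \<in> pseudo_disc z r0 \<Longrightarrow> m x \<le> ennreal L0 * m z"
    by (rule chain_comparison[OF \<kappa>(1) K(1) r0, of m]) (use step in auto)
  define \<nu> where "\<nu> = density dA (\<lambda>z. ennreal (\<omega> z))"
  have \<nu>: "emeasure \<nu> E = weight_mass \<omega> E" if "E \<in> sets dA" for E
    unfolding \<nu>_def weight_mass_def using borel_measurable_weight[OF \<omega>(1)] that by (rule emeasure_density)
  obtain C1 where C1: "0 < C1" "\<And>z. cmod z < 1 \<Longrightarrow> emeasure \<nu> (pseudo_disc z r0) \<le> ennreal C1 * m z"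
  proof (rule emeasure_pseudo_disc_le[of \<nu>, OF _ \<kappa>(1,2) r0 _ _ L0(2), where K = 1])
    show "A \<in> sets \<nu>" if "A \<in> sets borel" "A \<subseteq> unit_disc" for A
      using borel_sets_dA[OF that] by (simp add: \<nu>_def)
    show "emeasure \<nu> (whitney_ball \<kappa> x) \<le> ennreal 1 * m x" if "cmod x < 1" for x
      using wu[OF that] by (subst \<nu>) (auto simp: m_def whitney_ball_def intro!: borel_sets_dA)
  qed (use L0 in auto)
  have \<mu>disc: "emeasure \<mu> (pseudo_disc z r0) \<le> ennreal (C0 * C1) * m z" if z: "cmod z < 1" "z \<noteq> 0" for z
  proof -
    have "emeasure \<mu> (pseudo_disc z r0) \<le> ennreal C0 * weight_mass \<omega> (pseudo_disc z r0)"
      by (rule le0) (use z in auto)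
    also have "\<dots> \<le> ennreal C0 * (ennreal C1 * m z)"
      using C1(2)[OF z(1)] by (intro mult_left_mono) (auto simp: \<nu> pseudo_disc_sets_dA)
    finally show ?thesis using C0 C1 by (simp add: ennreal_mult mult.assoc)
  qed
  define K2 where "K2 = C0 * C1 * L0"
  have K2: "0 < K2" "C0 * C1 \<le> K2" using C0 C1 L0(1) mult_left_mono[of 1 L0 "C0 * C1"] by (auto simp: K2_def)
  have pdm: "pseudo_disc z R \<in> sets \<mu>" for z R
    by (intro sets_borel_measure_on_disc[OF \<mu>] pseudo_disc_borel pseudo_disc_subset)
  have \<mu>ball: "emeasure \<mu> (whitney_ball \<kappa> z) \<le> ennreal K2 * m z" if z: "cmod z < 1" for z
  proof (cases "z = 0")
    case False
    have "emeasure \<mu> (whitney_ball \<kappa> z) \<le> emeasure \<mu> (pseudo_disc z r0)"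
      using whitney_ball_subset[OF z \<kappa>(1), of r0] \<kappa> r0 pdm by (intro emeasure_mono) auto
    also have "\<dots> \<le> ennreal (C0 * C1) * m z" by (rule \<mu>disc[OF z False])
    also have "\<dots> \<le> ennreal K2 * m z" by (intro mult_right_mono ennreal_leI K2) auto
    finally show ?thesis .
  next
    case True
    \<comment> \<open>The hypothesis says nothing about discs centred at 0, so the ball about 0 is
      caught by a disc with the nearby centre \<open>\<kappa>\<close>.\<close>
    define a where "a = complex_of_real \<kappa>"
    have a: "cmod a < 1" "a \<noteq> 0" "cmod a = \<kappa>" using \<kappa> r r0 by (auto simp: a_def)
    have "whitney_ball \<kappa> z \<subseteq> ball a (r0 * (1 - cmod a))"
    proof
      fix w assume "w \<in> whitney_ball \<kappa> z"
      then have "cmod w < \<kappa>" by (simp add: whitney_ball_def True)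
      then have "dist a w < 2 * \<kappa>" using norm_triangle_ineq4[of a w] a by (simp add: dist_norm)
      also have "2 * \<kappa> \<le> r0 * (1 - \<kappa>)"
      proof -
        have "r0 * \<kappa> \<le> 1 * \<kappa>" using r0 \<kappa> by (intro mult_right_mono) auto
        moreover have "r0 * (1 - \<kappa>) = r0 - r0 * \<kappa>" by (simp add: algebra_simps)
        ultimately show ?thesis using \<kappa>(1,4) by linarith
      qed
      finally show "w \<in> ball a (r0 * (1 - cmod a))" by (simp add: a)
    qed
    also have "\<dots> \<subseteq> pseudo_disc a r0" using ball_subset_pseudo_disc[of a r0] a r0 by simp
    finally have "emeasure \<mu> (whitney_ball \<kappa> z) \<le> emeasure \<mu> (pseudo_disc a r0)"
      using pdm by (intro emeasure_mono) auto
    also have "\<dots> \<le> ennreal (C0 * C1) * m a" by (rule \<mu>disc[OF a(1,2)])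
    also have "\<dots> \<le> ennreal (C0 * C1) * (ennreal L0 * m z)"
    proof (intro mult_left_mono L0(2)[OF z])
      show "a \<in> pseudo_disc z r0" using a \<kappa> by (simp add: True pseudo_disc_iff)
    qed simp
    also have "\<dots> = ennreal K2 * m z" using C0 C1 L0 by (simp add: K2_def ennreal_mult mult.assoc)
    finally show ?thesis .
  qed
  have mfin: "m z < \<infinity>" for z unfolding m_def by (rule weight_mass_finite[OF \<omega>(1)])
  have mpos: "0 < m z" if z: "cmod z < 1" for z unfolding m_def
  proof (rule weight_mass_pos[OF \<omega>])
    show "whitney_ball \<kappa> z \<in> sets dA" using wu[OF z] by (intro borel_sets_dA) (auto simp: whitney_ball_def)
    have "emeasure dA (whitney_ball \<kappa> z) = ennreal ((\<kappa> * (1 - cmod z))\<^sup>2)"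
      unfolding whitney_ball_def using wu[OF z] \<kappa> z by (intro emeasure_dA_ball) (auto simp: whitney_ball_def)
    then show "emeasure dA (whitney_ball \<kappa> z) \<noteq> 0" using \<kappa> z by simp
  qed
  have sf: "sigma_finite_measure \<mu>"
  proof (rule sigma_finite_measure_on_disc[OF \<mu> \<kappa>(1,2)])
    fix z assume "cmod z < 1"
    from \<mu>ball[OF this] show "emeasure \<mu> (whitney_ball \<kappa> z) < \<infinity>"
      using mfin[of z] by (simp add: ennreal_mult_less_top le_less_trans)
  qed
  obtain C2 where C2: "0 < C2" "\<And>z. cmod z < 1 \<Longrightarrow> emeasure \<mu> (pseudo_disc z r) \<le> ennreal C2 * m z"
    by (rule emeasure_pseudo_disc_le[of \<mu>, OF sets_borel_measure_on_disc[OF \<mu>] \<kappa>(1,2) r _ _ L(2) \<mu>ball])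
       (use L K2 in auto)
  interpret dA: sigma_finite_measure dA by (rule sigma_finite_dA)
  interpret \<mu>: sigma_finite_measure \<mu> by (rule sf)
  interpret P: pair_sigma_finite dA \<mu> ..
  have id\<mu>: "(\<lambda>x. x) \<in> borel_measurable \<mu>" by (rule borel_measurable_on_disc[OF \<mu>]) simp
  show thesis
  proof (rule that[OF \<kappa>(1,2) _ sf, of "K * (L * C2)"])
    show "0 \<le> K * (L * C2)" using K L C2 by simp
    fix f assume "f \<in> bergman_space p \<omega>"
    then have f: "f holomorphic_on unit_disc" by (simp add: bergman_space_def)
    note measurable_id_dA[measurable] id\<mu>[measurable]
    note borel_measurable_weight[OF \<omega>(1), measurable]
    note borel_measurable_holomorphic_disc(1)[OF f, measurable]
    define F where "F = (\<lambda>z. ennreal (cmod (f z) powr p) * ennreal (\<omega> z))"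
    have Fm[measurable]: "F \<in> borel_measurable dA" unfolding F_def by measurable
    have F: "ennreal (cmod (f z) powr p * \<omega> z) = F z" for z by (simp add: F_def ennreal_mult')
    have mm[measurable]: "m \<in> borel_measurable \<mu>" unfolding m_def
      by (rule borel_measurable_weight_mass_whitney[OF \<omega>(1) id\<mu>])
    define J where "J = (\<lambda>x::complex\<times>complex. indicator {y. snd y \<in> pseudo_disc (fst y) r} x :: ennreal)"
    have Jm[measurable]: "J \<in> borel_measurable (dA \<Otimes>\<^sub>M \<mu>)"
    proof -
      have [measurable]: "Measurable.pred (dA \<Otimes>\<^sub>M \<mu>) (\<lambda>y. snd y \<in> pseudo_disc (fst y) r)"
        by (rule pred_pseudo_disc) auto
      show ?thesis unfolding J_def indicator_def of_bool_def by measurable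
    qed
    have J1: "J (z, \<zeta>) = indicator (pseudo_disc z r) \<zeta>" for z \<zeta> by (simp add: J_def indicator_def)
    have J2: "J (z, \<zeta>) = indicator (pseudo_disc \<zeta> r) z" if "cmod z < 1" "cmod \<zeta> < 1" for z \<zeta>
      using pseudo_disc_commute[OF that] by (simp add: J_def indicator_def)
    \<comment> \<open>Written as an integral over the product kernel \<open>J\<close>, so that its
      measurability and the exchange of integrals come from the same function.\<close>
    define U where "U = (\<lambda>\<zeta>. (\<integral>\<^sup>+z. ennreal K * F z / m \<zeta> * J (z, \<zeta>) \<partial>dA))"
    have Um: "U \<in> borel_measurable \<mu>"
    proof -
      have "(\<lambda>x. ennreal K * F (snd x) / m (fst x) * J (snd x, fst x)) \<in> borel_measurable (\<mu> \<Otimes>\<^sub>M dA)"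
        by measurable
      then show ?thesis unfolding U_def by (intro dA.borel_measurable_nn_integral) (simp add: split_beta')
    qed
    have sp: "space \<mu> = unit_disc" by (rule space_borel_measure_on_disc[OF \<mu>])
    have U1: "ennreal (cmod (f z) powr p) \<le> U \<zeta>" if \<zeta>: "cmod \<zeta> < 1" and z: "z \<in> ball \<zeta> (\<kappa> * (1 - cmod \<zeta>))" for \<zeta> z
    proof -
      have zw: "z \<in> whitney_ball \<kappa> \<zeta>" using z by (simp add: whitney_ball_def)
      have "\<kappa> * (1 - cmod \<zeta>) * 1 \<le> \<kappa> * (1 - cmod \<zeta>) * (1 + \<kappa>)" using \<kappa> \<zeta> by (intro mult_left_mono) auto
      then have "ball z (\<kappa> * (1 - cmod \<zeta>)) \<subseteq> ball z (\<kappa> * (1 - cmod \<zeta>) * (1 + \<kappa>))" by (intro subset_ball) simp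
      then have sub: "ball z (\<kappa> * (1 - cmod \<zeta>)) \<subseteq> pseudo_disc \<zeta> r" using inball[OF \<zeta> zw] by blast
      define I where "I = (\<integral>\<^sup>+w. F w * indicator (pseudo_disc \<zeta> r) w \<partial>dA)"
      have "ennreal (cmod (f z) powr p) * m \<zeta> \<le> ennreal (cmod (f z) powr p) * weight_mass \<omega> (pseudo_disc \<zeta> r)"
        unfolding m_def by (intro mult_left_mono weight_mass_mono wsub \<zeta>) simp
      also have "\<dots> \<le> ennreal (K0 \<kappa>) * I" using sm[OF \<kappa>(1,2) \<zeta> sub f] by (simp add: F I_def)
      also have "\<dots> \<le> ennreal K * I" by (intro mult_right_mono ennreal_leI K) simp
      finally have le: "ennreal (cmod (f z) powr p) * m \<zeta> / m \<zeta> \<le> ennreal K * I / m \<zeta>"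
        by (rule divide_right_mono_ennreal)
      have "ennreal (cmod (f z) powr p) = ennreal (cmod (f z) powr p) * m \<zeta> / m \<zeta>"
        using mpos[OF \<zeta>] mfin[of \<zeta>] by (simp add: ennreal_times_divide[symmetric])
      also have "\<dots> \<le> ennreal K * I / m \<zeta>" by (rule le)
      also have "\<dots> = U \<zeta>"
      proof -
        have [measurable]: "pseudo_disc \<zeta> r \<in> sets dA" by (rule pseudo_disc_sets_dA)
        have "U \<zeta> = (\<integral>\<^sup>+z. ennreal K * (F z * indicator (pseudo_disc \<zeta> r) z) / m \<zeta> \<partial>dA)"
          unfolding U_def using \<zeta> by (intro nn_integral_cong) (simp add: J2 divide_ennreal_def mult_ac)
        also have "\<dots> = ennreal K * I / m \<zeta>" unfolding I_def
          by (subst nn_integral_divide) (auto simp: nn_integral_cmult)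
        finally show ?thesis ..
      qed
      finally show ?thesis .
    qed
    have "(\<integral>\<^sup>+\<zeta>. U \<zeta> \<partial>\<mu>) = (\<integral>\<^sup>+z. (\<integral>\<^sup>+\<zeta>. ennreal K * F z / m \<zeta> * J (z, \<zeta>) \<partial>\<mu>) \<partial>dA)"
      unfolding U_def by (subst P.Fubini') auto
    also have "\<dots> \<le> (\<integral>\<^sup>+z. ennreal (K * (L * C2)) * F z \<partial>dA)"
    proof (rule nn_integral_mono)
      fix z assume "z \<in> space dA"
      then have z: "cmod z < 1" by simp
      note pdm[measurable]
      have "(\<integral>\<^sup>+\<zeta>. ennreal K * F z / m \<zeta> * J (z, \<zeta>) \<partial>\<mu>) \<le> (\<integral>\<^sup>+\<zeta>. ennreal K * F z * (ennreal L / m z) * indicator (pseudo_disc z r) \<zeta> \<partial>\<mu>)"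
      proof (rule nn_integral_mono)
        fix \<zeta> assume "\<zeta> \<in> space \<mu>"
        then have \<zeta>: "cmod \<zeta> < 1" by (simp add: sp)
        show "ennreal K * F z / m \<zeta> * J (z, \<zeta>) \<le> ennreal K * F z * (ennreal L / m z) * indicator (pseudo_disc z r) \<zeta>"
        proof (cases "\<zeta> \<in> pseudo_disc z r")
          case True
          then have "z \<in> pseudo_disc \<zeta> r" using pseudo_disc_commute[OF z \<zeta>] by simp
          then have "m z \<le> ennreal L * m \<zeta>" by (rule L(2)[OF \<zeta>])
          then have "m z / m z / m \<zeta> \<le> ennreal L * m \<zeta> / m z / m \<zeta>" by (intro divide_right_mono_ennreal)
          moreover have "m z / m z = 1" using mpos[OF z] mfin[of z] by (simp add: less_top)
          moreover have "ennreal L * m \<zeta> / m z / m \<zeta> = ennreal L / m z"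
          proof -
            have "ennreal L * m \<zeta> / m z / m \<zeta> = (ennreal L / m z) * (m \<zeta> / m \<zeta>)" by (simp add: divide_ennreal_def mult_ac)
            also have "m \<zeta> / m \<zeta> = 1" using mpos[OF \<zeta>] mfin[of \<zeta>] by (simp add: less_top)
            finally show ?thesis by simp
          qed
          ultimately have "1 / m \<zeta> \<le> ennreal L / m z" by simp
          then have "ennreal K * F z * (1 / m \<zeta>) \<le> ennreal K * F z * (ennreal L / m z)" by (rule mult_left_mono) simp
          then show ?thesis using True by (simp add: J1 divide_ennreal_def)
        qed (simp add: J1)
      qed
      also have "\<dots> = ennreal K * F z * (ennreal L / m z) * emeasure \<mu> (pseudo_disc z r)"
        by (subst nn_integral_cmult) auto
      also have "\<dots> \<le> ennreal K * F z * (ennreal L / m z) * (ennreal C2 * m z)"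
        by (intro mult_left_mono C2(2) z) simp
      also have "\<dots> = ennreal K * F z * ennreal L * ennreal C2 * (m z / m z)" by (simp add: divide_ennreal_def mult_ac)
      also have "\<dots> = ennreal (K * (L * C2)) * F z" using mpos[OF z] mfin[of z] K L C2
        by (simp add: ennreal_mult less_top mult_ac)
      finally show "(\<integral>\<^sup>+\<zeta>. ennreal K * F z / m \<zeta> * J (z, \<zeta>) \<partial>\<mu>) \<le> ennreal (K * (L * C2)) * F z" .
    qed
    also have "\<dots> = ennreal (K * (L * C2)) * bergman_norm_p p \<omega> f"
      by (subst nn_integral_cmult) (auto simp: bergman_norm_p_def F)
    finally have U2: "(\<integral>\<^sup>+\<zeta>. U \<zeta> \<partial>\<mu>) \<le> ennreal (K * (L * C2)) * bergman_norm_p p \<omega> f" .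
    show "\<exists>U\<in>borel_measurable \<mu>.
        (\<forall>\<zeta>\<in>unit_disc. \<forall>z\<in>ball \<zeta> (\<kappa> * (1 - cmod \<zeta>)). ennreal (cmod (f z) powr p) \<le> U \<zeta>) \<and>
        (\<integral>\<^sup>+z. U z \<partial>\<mu>) \<le> ennreal (K * (L * C2)) * bergman_norm_p p \<omega> f"
      using Um U1 U2 by (intro bexI[of _ U]) auto
  qed
qed

section \<open>Radial weights with the doubling property\<close>

lemma borel_measurable_cmod_dA: "cmod \<in> borel_measurable dA"
  by (rule borel_measurable_dA_I) simp

text \<open>Polar coordinates for functions of the modulus: both measures give the half-line below
  \<open>s\<close> the mass \<open>s^2\<close> for \<open>s\<close> between 0 and 1, and these
  half-lines are an intersection-stable generator.\<close>

lemma distr_dA_cmod: "distr dA borel cmod = density lborel (\<lambda>s. ennreal (2 * s) * indicator {0..<1} s)"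
  (is "?M = ?N")
proof -
  note borel_measurable_cmod_dA[measurable]
  have lt: "cmod x < s \<longleftrightarrow> cmod x < max 0 s" for x s
    unfolding max_def by (smt (verit) norm_ge_zero)
  have M: "emeasure ?M {..<s} = ennreal ((min 1 (max 0 s))\<^sup>2)" for s
  proof -
    have "emeasure ?M {..<s} = emeasure dA (ball 0 (min 1 (max 0 s)))"
    proof (subst emeasure_distr)
      have "cmod -` {..<s} \<inter> space dA = ball 0 (min 1 (max 0 s))"
        using lt by auto
      then show "emeasure dA (cmod -` {..<s} \<inter> space dA) = emeasure dA (ball 0 (min 1 (max 0 s)))" by simp
    qed auto
    also have "\<dots> = ennreal (1/pi) * ennreal (pi * (min 1 (max 0 s))\<^sup>2)"
    proof (subst emeasure_dA)
      show "ball 0 (min 1 (max 0 s)) \<in> sets dA" by (rule borel_sets_dA) auto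
    qed (simp add: emeasure_ball unit_ball_vol_2)
    finally show ?thesis by (simp add: ennreal_mult[symmetric])
  qed
  have N: "emeasure ?N {..<s} = ennreal ((min 1 (max 0 s))\<^sup>2)" for s
  proof -
    define t where "t = min 1 (max 0 s)"
    have t: "0 \<le> t" by (simp add: t_def)
    have "emeasure ?N {..<s} = (\<integral>\<^sup>+x. ennreal (2 * x) * indicator {0..<1} x * indicator {..<s} x \<partial>lborel)"
      by (subst emeasure_density) auto
    also have "\<dots> = (\<integral>\<^sup>+x. ennreal (2 * x) * indicator {0..t} x \<partial>lborel)"
    proof (rule nn_integral_cong_AE)
      have "AE x in lborel. x \<noteq> t" by (rule AE_lborel_singleton)
      then show "AE x in lborel. ennreal (2 * x) * indicator {0..<1} x * indicator {..<s} x = ennreal (2 * x) * indicator {0..t} x"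
      proof eventually_elim
        case (elim x)
        then show ?case by (cases "x \<le> 0") (auto simp: indicator_def t_def min_def max_def ennreal_neg)
      qed
    qed
    also have "\<dots> = ennreal (t\<^sup>2 - 0\<^sup>2)"
      by (rule nn_integral_FTC_Icc) (auto intro!: derivative_eq_intros t)
    finally show ?thesis by (simp add: t_def)
  qed
  show ?thesis
  proof (rule measure_eqI_generator_eq[where E = "range lessThan" and A = "\<lambda>n. {..<real n}" and \<Omega> = UNIV])
    show "Int_stable (range lessThan :: real set set)"
    proof (rule Int_stableI)
      fix a b :: "real set" assume "a \<in> range lessThan" "b \<in> range lessThan"
      then obtain s t where "a = {..<s}" "b = {..<t}" by auto
      then have "a \<inter> b = {..<min s t}" by auto
      then show "a \<inter> b \<in> range lessThan" by simp
    qed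
    show "sets ?M = sigma_sets UNIV (range lessThan)" "sets ?N = sigma_sets UNIV (range lessThan)"
      by (simp_all add: borel_Iio)
    show "(\<Union>n. {..<real n}) = UNIV" using reals_Archimedean2 by auto
  qed (auto simp: M N)
qed

text \<open>A section of a Lebesgue set need not be measurable, so the radial profile has to be
  recovered differently. Compact subsets of the planar set have compact images under the modulus,
  and these lie in \<open>A\<close>. Exhausting the planar sets over \<open>A\<close> and over its
  complement from inside in this way squeezes \<open>A\<close> between Borel sets.\<close>

lemma radial_set_measurable:
  assumes A: "A \<subseteq> {0..<1}" and E: "{z \<in> unit_disc. cmod z \<in> A} \<in> sets lebesgue"
  shows "A \<in> sets lebesgue"
proof -
  note borel_measurable_cmod_dA[measurable]
  have inner: "\<exists>K. K \<in> sets borel \<and> K \<subseteq> B \<and> emeasure lebesgue ({z \<in> unit_disc. cmod z \<in> B} - cmod -` K) < ennreal e"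
    if B: "{z \<in> unit_disc. cmod z \<in> B} \<in> sets lebesgue" and e: "0 < e" for B :: "real set" and e :: real
  proof -
    obtain T where T: "closed T" "T \<subseteq> {z \<in> unit_disc. cmod z \<in> B}" "{z \<in> unit_disc. cmod z \<in> B} - T \<in> lmeasurable"
      "emeasure lebesgue ({z \<in> unit_disc. cmod z \<in> B} - T) < ennreal e"
      using sets_lebesgue_inner_closed[OF B e] by blast
    have "bounded T" by (rule bounded_subset[OF bounded_ball[of 0 1]]) (use T(2) in auto)
    then have "compact T" using T(1) by (simp add: compact_eq_bounded_closed)
    then have K: "compact (cmod ` T)" by (intro compact_continuous_image continuous_intros)
    then have Kb: "cmod ` T \<in> sets borel" by (simp add: compact_imp_closed borel_closed)
    have "emeasure lebesgue ({z \<in> unit_disc. cmod z \<in> B} - cmod -` (cmod ` T)) \<le> emeasure lebesgue ({z \<in> unit_disc. cmod z \<in> B} - T)"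
      using T(3) by (intro emeasure_mono) auto
    then show ?thesis using T(2,4) Kb by (intro exI[of _ "cmod ` T"]) auto
  qed
  define A' where "A' = {0..<1} - A"
  have eqA': "{z \<in> unit_disc. cmod z \<in> A'} = unit_disc - {z \<in> unit_disc. cmod z \<in> A}" by (auto simp: A'_def)
  have E': "{z \<in> unit_disc. cmod z \<in> A'} \<in> sets lebesgue" unfolding eqA' using E by auto
  have "\<forall>n. \<exists>K. K \<in> sets borel \<and> K \<subseteq> A \<and> emeasure lebesgue ({z \<in> unit_disc. cmod z \<in> A} - cmod -` K) < ennreal (1 / real (Suc n))"
    using inner[OF E] by simp
  from choice[OF this] obtain K where Kall: "\<forall>n. K n \<in> sets borel \<and> K n \<subseteq> A \<and> emeasure lebesgue ({z \<in> unit_disc. cmod z \<in> A} - cmod -` K n) < ennreal (1 / real (Suc n))" ..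
  then have K: "\<And>n. K n \<in> sets borel" "\<And>n. K n \<subseteq> A"
    "\<And>n. emeasure lebesgue ({z \<in> unit_disc. cmod z \<in> A} - cmod -` K n) < ennreal (1 / real (Suc n))" by blast+
  have "\<forall>n. \<exists>K. K \<in> sets borel \<and> K \<subseteq> A' \<and> emeasure lebesgue ({z \<in> unit_disc. cmod z \<in> A'} - cmod -` K) < ennreal (1 / real (Suc n))"
    using inner[OF E'] by simp
  from choice[OF this] obtain L where Lall: "\<forall>n. L n \<in> sets borel \<and> L n \<subseteq> A' \<and> emeasure lebesgue ({z \<in> unit_disc. cmod z \<in> A'} - cmod -` L n) < ennreal (1 / real (Suc n))" ..
  then have L: "\<And>n. L n \<in> sets borel" "\<And>n. L n \<subseteq> A'"
    "\<And>n. emeasure lebesgue ({z \<in> unit_disc. cmod z \<in> A'} - cmod -` L n) < ennreal (1 / real (Suc n))" by blast+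
  define U where "U = (\<Union>n. K n)"
  define V where "V = (\<Union>n. L n)"
  \<comment> \<open>The radii reached by neither exhaustion. The part of the disc above them is
    null, hence so is \<open>Z\<close>, and \<open>A\<close> differs from the Borel set
    \<open>U\<close> by a subset of \<open>Z\<close>.\<close>
  define Z where "Z = {0..<1} - U - V"
  have Ub: "U \<in> sets borel" "V \<in> sets borel" using K(1) L(1) by (auto simp: U_def V_def)
  then have Zb[measurable]: "Z \<in> sets borel" by (auto simp: Z_def)
  have pre: "cmod -` Z \<inter> unit_disc \<in> sets borel"
    using measurable_sets[of cmod borel borel Z] by auto
  have small: "emeasure lebesgue (cmod -` Z \<inter> unit_disc) \<le> ennreal (2 / real (Suc n))" for n
  proof -
    have Km: "{z \<in> unit_disc. cmod z \<in> A} - cmod -` K n \<in> sets lebesgue"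
      "{z \<in> unit_disc. cmod z \<in> A'} - cmod -` L n \<in> sets lebesgue"
      using E E' measurable_sets[of cmod borel borel] K(1) L(1) by auto
    have "emeasure lebesgue (cmod -` Z \<inter> unit_disc) \<le> emeasure lebesgue (({z \<in> unit_disc. cmod z \<in> A} - cmod -` K n) \<union> ({z \<in> unit_disc. cmod z \<in> A'} - cmod -` L n))"
      using Km by (intro emeasure_mono) (auto simp: Z_def U_def V_def A'_def)
    also have "\<dots> \<le> emeasure lebesgue ({z \<in> unit_disc. cmod z \<in> A} - cmod -` K n) + emeasure lebesgue ({z \<in> unit_disc. cmod z \<in> A'} - cmod -` L n)"
      using Km by (rule emeasure_subadditive)
    also have "\<dots> \<le> ennreal (1 / real (Suc n)) + ennreal (1 / real (Suc n))"
      using K(3) L(3) by (intro add_mono less_imp_le)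
    also have "\<dots> = ennreal (2 / real (Suc n))" by (simp add: ennreal_plus[symmetric] del: ennreal_plus)
    finally show ?thesis .
  qed
  have "(\<lambda>n. ennreal (2 / real (Suc n))) \<longlonglongrightarrow> ennreal 0"
    by (intro tendsto_ennrealI LIMSEQ_Suc[OF lim_const_over_n])
  then have "emeasure lebesgue (cmod -` Z \<inter> unit_disc) \<le> ennreal 0"
    by (rule LIMSEQ_le_const) (use small in blast)
  then have "emeasure dA (cmod -` Z \<inter> unit_disc) = 0"
    using pre by (subst emeasure_dA) (auto simp: borel_sets_dA)
  then have "emeasure (distr dA borel cmod) Z = 0"
    by (subst emeasure_distr) auto
  then have "AE x in lborel. x \<in> Z \<longrightarrow> ennreal (2 * x) * indicator {0..<1} x = 0"
  proof -
    assume "emeasure (distr dA borel cmod) Z = 0"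
    then have "(\<integral>\<^sup>+x. ennreal (2 * x) * indicator {0..<1} x * indicator Z x \<partial>lborel) = 0"
      unfolding distr_dA_cmod by (subst (asm) emeasure_density) auto
    then have "AE x in lborel. ennreal (2 * x) * indicator {0..<1} x * indicator Z x = 0"
      by (subst (asm) nn_integral_0_iff_AE) auto
    then show ?thesis by eventually_elim (auto simp: indicator_def)
  qed
  moreover have "AE x in lborel. x \<noteq> (0::real)" by (rule AE_lborel_singleton)
  ultimately have "AE x in lborel. x \<notin> Z"
  proof eventually_elim
    case (elim x)
    then show ?case by (auto simp: Z_def ennreal_eq_0_iff)
  qed
  then have "Z \<in> null_sets lborel" by (subst (asm) AE_iff_null_sets[symmetric]) auto
  moreover have "A - U \<subseteq> Z"
    using L(2) A by (auto simp: Z_def V_def A'_def)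
  ultimately have "A - U \<in> sets lebesgue" by (rule null_sets_completion)
  moreover have "U \<in> sets lebesgue" using Ub(1) by auto
  ultimately have "(A - U) \<union> U \<in> sets lebesgue" by (rule sets.Un)
  moreover have "(A - U) \<union> U = A" using K(2) by (auto simp: U_def)
  ultimately show ?thesis by simp
qed

lemma radial_cmod: "radial \<omega> \<Longrightarrow> cmod z < 1 \<Longrightarrow> \<omega> (of_real (cmod z)) = \<omega> z"
  unfolding radial_def by (metis mem_ball_0)

text \<open>\<open>weight\<close> speaks of measurability in the disc, whereas
  \<open>weight_tail\<close> integrates the profile along a radius; the superlevel sets carry the
  property over.\<close>

lemma radial_borel_version:
  assumes \<omega>: "weight \<omega>" and rad: "radial \<omega>"
  shows "(\<lambda>s. ennreal (\<omega> (of_real s)) * indicator {0..<1} s) \<in> borel_measurable lebesgue"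
proof -
  have [measurable]: "\<omega> \<in> borel_measurable dA" using \<omega> by (auto simp: weight_def)
  have "(\<lambda>s. \<omega> (of_real s)) \<in> borel_measurable (lebesgue_on {0..<1})"
  proof (rule borel_measurable_iff_greater[THEN iffD2, rule_format])
    fix a
    define A where "A = {s \<in> {0..<1}. a < \<omega> (of_real s)}"
    have "{z \<in> space dA. a < \<omega> z} \<in> sets dA" by measurable
    moreover have "{z \<in> space dA. a < \<omega> z} = {z \<in> unit_disc. cmod z \<in> A}"
      by (auto simp: A_def radial_cmod[OF rad])
    ultimately have "{z \<in> unit_disc. cmod z \<in> A} \<in> sets lebesgue"
      by (simp add: sets_dA sets_restrict_space_iff)
    then have "A \<in> sets lebesgue" by (intro radial_set_measurable) (auto simp: A_def)
    then show "{w \<in> space (lebesgue_on {0..<1}). a < \<omega> (of_real w)} \<in> sets (lebesgue_on {0..<1})"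
      by (auto simp: sets_restrict_space_iff A_def)
  qed
  then have "(\<lambda>s. ennreal (\<omega> (of_real s))) \<in> borel_measurable (lebesgue_on {0..<1})"
    by (rule measurable_compose) (rule measurable_ennreal)
  then show ?thesis by (simp add: borel_measurable_restrict_space_iff_ennreal)
qed

lemma radial_borel_version_tail:
  assumes \<omega>: "weight \<omega>" and rad: "radial \<omega>"
  shows "(\<lambda>s. ennreal (\<omega> (of_real s)) * indicator {0..<1} s * indicator {r..} s) \<in> borel_measurable lebesgue"
proof -
  define h where "h = (\<lambda>s. ennreal (\<omega> (of_real s)) * indicator {0..<1} s)"
  have [measurable]: "h \<in> borel_measurable lebesgue"
    unfolding h_def by (rule radial_borel_version[OF assms])
  have [measurable]: "{r..} \<in> sets lebesgue" by auto
  have "(\<lambda>s. h s * indicator {r..} s) \<in> borel_measurable lebesgue" by measurable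
  then show ?thesis by (simp add: h_def)
qed

lemma weight_mass_annulus:
  assumes \<omega>: "weight \<omega>" and rad: "radial \<omega>" and r: "0 \<le> r"
  shows "weight_mass \<omega> {z \<in> unit_disc. r \<le> cmod z} =
    (\<integral>\<^sup>+s. ennreal (\<omega> (of_real s)) * ennreal (2 * s) * indicator {r..<1} s \<partial>lebesgue)"
proof -
  note borel_measurable_cmod_dA[measurable]
  define h where "h = (\<lambda>s. ennreal (\<omega> (of_real s)) * indicator {0..<1} s * indicator {r..} s)"
  have hm: "h \<in> borel_measurable lebesgue"
    unfolding h_def by (rule radial_borel_version_tail[OF \<omega> rad])
  \<comment> \<open>The profile is only Lebesgue measurable, but transport under the modulus wants a
    Borel function; a Borel version agrees with it almost everywhere on both sides.\<close>
  obtain h' where h'[measurable]: "h' \<in> borel_measurable lborel" and ae: "AE x in lborel. h x = h' x"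
    using completion_ex_borel_measurable[OF hm] by auto
  have ae2: "AE x in distr dA borel cmod. h x = h' x"
    unfolding distr_dA_cmod by (subst AE_density) (use ae in auto)
  have ae3: "AE z in dA. h (cmod z) = h' (cmod z)"
    by (rule AE_distrD[OF _ ae2]) measurable
  have "weight_mass \<omega> {z \<in> unit_disc. r \<le> cmod z} = (\<integral>\<^sup>+z. h (cmod z) \<partial>dA)"
    unfolding weight_mass_def h_def
    by (intro nn_integral_cong) (auto simp: indicator_def radial_cmod[OF rad])
  also have "\<dots> = (\<integral>\<^sup>+z. h' (cmod z) \<partial>dA)" by (rule nn_integral_cong_AE[OF ae3])
  also have "\<dots> = (\<integral>\<^sup>+s. h' s \<partial>distr dA borel cmod)" by (subst nn_integral_distr) auto
  also have "\<dots> = (\<integral>\<^sup>+s. ennreal (2 * s) * indicator {0..<1} s * h' s \<partial>lborel)"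
    unfolding distr_dA_cmod by (subst nn_integral_density) auto
  also have "\<dots> = (\<integral>\<^sup>+s. ennreal (2 * s) * indicator {0..<1} s * h s \<partial>lborel)"
    by (rule nn_integral_cong_AE) (use ae in eventually_elim, simp)
  also have "\<dots> = (\<integral>\<^sup>+s. ennreal (\<omega> (of_real s)) * ennreal (2 * s) * indicator {r..<1} s \<partial>lborel)"
    using r by (intro nn_integral_cong) (auto simp: h_def indicator_def mult_ac)
  finally show ?thesis by (simp add: nn_integral_completion)
qed

text \<open>Polar coordinates bring in the factor \<open>2 * s\<close>, which is at most 2 and, from
  radius 1/2 on, at least 1. The midpoint \<open>(1 + r) / 2\<close> is never below 1/2, so the
  doubling condition for tails passes to annuli at the cost of a factor 2.\<close>

lemma D_hat_annulus_doubling: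
  assumes "\<omega> \<in> D_hat"
  obtains C :: real where "1 \<le> C" "\<And>r. 0 \<le> r \<Longrightarrow> r < 1 \<Longrightarrow>
    weight_mass \<omega> {z \<in> unit_disc. r \<le> cmod z} \<le> ennreal C * weight_mass \<omega> {z \<in> unit_disc. (1 + r) / 2 \<le> cmod z}"
proof -
  have \<omega>: "weight \<omega>" "radial \<omega>" using assms by (auto simp: D_hat_def)
  obtain C where C: "1 \<le> C" "\<And>r. 0 \<le> r \<Longrightarrow> r < 1 \<Longrightarrow>
        weight_tail \<omega> (of_real r) \<le> ennreal C * weight_tail \<omega> (of_real ((1 + r) / 2))"
    using assms by (auto simp: D_hat_def)
  have upper: "weight_mass \<omega> {z \<in> unit_disc. r \<le> cmod z} \<le> 2 * weight_tail \<omega> (of_real r)" if r: "0 \<le> r" for r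
  proof -
    have "weight_mass \<omega> {z \<in> unit_disc. r \<le> cmod z} \<le> (\<integral>\<^sup>+s. 2 * (ennreal (\<omega> (of_real s)) * indicator {r..<1} s) \<partial>lebesgue)"
      unfolding weight_mass_annulus[OF \<omega> r]
    proof (rule nn_integral_mono)
      fix s :: real
      show "ennreal (\<omega> (of_real s)) * ennreal (2 * s) * indicator {r..<1} s \<le> 2 * (ennreal (\<omega> (of_real s)) * indicator {r..<1} s)"
      proof (cases "s \<in> {r..<1}")
        case True
        then have "ennreal (2 * s) \<le> ennreal 2" by (intro ennreal_leI) auto
        then have "ennreal (\<omega> (of_real s)) * ennreal (2 * s) \<le> ennreal (\<omega> (of_real s)) * ennreal 2" by (rule mult_left_mono) simp
        then show ?thesis using True by (simp add: mult.commute)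
      qed simp
    qed
    also have "\<dots> = 2 * weight_tail \<omega> (of_real r)"
    proof -
      have "(\<lambda>s. ennreal (\<omega> (of_real s)) * indicator {0..<1} s * indicator {r..} s) \<in> borel_measurable lebesgue"
        by (rule radial_borel_version_tail[OF \<omega>])
      also have "(\<lambda>s. ennreal (\<omega> (of_real s)) * indicator {0..<1} s * indicator {r..} s) = (\<lambda>s. ennreal (\<omega> (of_real s)) * indicator {r..<1} s)"
        using r by (auto simp: indicator_def)
      finally show ?thesis using r unfolding weight_tail_def by (subst nn_integral_cmult) auto
    qed
    finally show ?thesis .
  qed
  have lower: "weight_tail \<omega> (of_real r) \<le> weight_mass \<omega> {z \<in> unit_disc. r \<le> cmod z}" if r: "1/2 \<le> r" for r
  proof -
    have r0: "0 \<le> r" using r by simp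
    show ?thesis unfolding weight_mass_annulus[OF \<omega> r0] weight_tail_def
    proof (rule nn_integral_mono)
      fix s :: real
      show "ennreal (\<omega> (of_real s)) * indicator {cmod (of_real r)..<1} s \<le> ennreal (\<omega> (of_real s)) * ennreal (2 * s) * indicator {r..<1} s"
      proof (cases "s \<in> {r..<1}")
        case True
        then have "ennreal 1 \<le> ennreal (2 * s)" using r by (intro ennreal_leI) auto
        then have "ennreal (\<omega> (of_real s)) * ennreal 1 \<le> ennreal (\<omega> (of_real s)) * ennreal (2 * s)" by (rule mult_left_mono) simp
        then show ?thesis using True r0 by simp
      qed (use r0 in simp)
    qed
  qed
  show thesis
  proof (rule that[of "2 * C"])
    show "1 \<le> 2 * C" using C by simp
    fix r :: real assume r: "0 \<le> r" "r < 1"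
    have "weight_mass \<omega> {z \<in> unit_disc. r \<le> cmod z} \<le> 2 * weight_tail \<omega> (of_real r)" by (rule upper[OF r(1)])
    also have "\<dots> \<le> 2 * (ennreal C * weight_tail \<omega> (of_real ((1 + r) / 2)))" by (intro mult_left_mono C(2) r) simp
    also have "\<dots> \<le> 2 * (ennreal C * weight_mass \<omega> {z \<in> unit_disc. (1 + r) / 2 \<le> cmod z})"
      using r by (intro mult_left_mono lower) auto
    also have "\<dots> = ennreal (2 * C) * weight_mass \<omega> {z \<in> unit_disc. (1 + r) / 2 \<le> cmod z}"
      using C by (simp add: ennreal_mult mult.assoc)
    finally show "weight_mass \<omega> {z \<in> unit_disc. r \<le> cmod z} \<le> ennreal (2 * C) * weight_mass \<omega> {z \<in> unit_disc. (1 + r) / 2 \<le> cmod z}" .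
  qed
qed

section \<open>The dyadic Carleson embedding\<close>

text \<open>\<open>d\<close> counts the generations included, starting with the node itself. Nodes
  are indexed by all integers; the tents identify indices modulo \<open>2^n\<close>, so no range has
  to be carried along.\<close>

primrec subtree_sum :: "(nat \<Rightarrow> int \<Rightarrow> real) \<Rightarrow> nat \<Rightarrow> nat \<Rightarrow> int \<Rightarrow> real" where
  "subtree_sum a 0 n j = 0"
| "subtree_sum a (Suc d) n j = a n j + subtree_sum a d (Suc n) (2 * j) + subtree_sum a d (Suc n) (2 * j + 1)"

lemma subtree_sum_nonneg: "(\<And>n j. 0 \<le> a n j) \<Longrightarrow> 0 \<le> subtree_sum a d n j"
  by (induction d arbitrary: n j) auto

text \<open>Cauchy-Schwarz for two terms, that is, the joint convexity of \<open>g^2 / w\<close>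
  written without division so that \<open>w = 0\<close> is allowed.\<close>

lemma square_sum_le:
  fixes g1 g2 h1 h2 w1 w2 :: real
  assumes "g1\<^sup>2 \<le> h1 * w1" "g2\<^sup>2 \<le> h2 * w2" "0 \<le> h1" "0 \<le> h2" "0 \<le> w1" "0 \<le> w2"
  shows "(g1 + g2)\<^sup>2 \<le> (h1 + h2) * (w1 + w2)"
proof -
  have "(g1 * g2)\<^sup>2 = g1\<^sup>2 * g2\<^sup>2" by (simp add: power_mult_distrib)
  also have "\<dots> \<le> (h1 * w1) * (h2 * w2)" using assms by (intro mult_mono) auto
  also have "\<dots> \<le> ((h1 * w2 + h2 * w1) / 2)\<^sup>2"
  proof -
    have "0 \<le> (h1 * w2 - h2 * w1)\<^sup>2" by simp
    then show ?thesis by (simp add: power2_eq_square algebra_simps)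
  qed
  finally have "\<bar>g1 * g2\<bar> \<le> \<bar>(h1 * w2 + h2 * w1) / 2\<bar>" by (simp only: abs_le_square_iff)
  moreover have "0 \<le> h1 * w2 + h2 * w1" using assms by simp
  ultimately have "2 * (g1 * g2) \<le> h1 * w2 + h2 * w1" by (simp add: abs_le_iff)
  then show ?thesis using assms(1,2) by (simp add: power2_eq_square algebra_simps)
qed

text \<open>The right-hand side is a Bellman function of the node: it dominates the sum over its two
  children, and raising the Carleson mass by \<open>a n j\<close> pays for the new term.\<close>

lemma dyadic_carleson_embedding:
  fixes a W G H W0 G0 H0 :: "nat \<Rightarrow> int \<Rightarrow> real"
  assumes a: "\<And>n j. 0 \<le> a n j" and W: "\<And>n j. 0 < W n j" and H: "\<And>n j. 0 \<le> H n j" "\<And>n j. 0 \<le> H0 n j" and W0: "\<And>n j. 0 \<le> W0 n j"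
    and Ws: "\<And>n j. W n j = W0 n j + W (Suc n) (2 * j) + W (Suc n) (2 * j + 1)"
    and Gs: "\<And>n j. G n j = G0 n j + G (Suc n) (2 * j) + G (Suc n) (2 * j + 1)"
    and Hs: "\<And>n j. H n j = H0 n j + H (Suc n) (2 * j) + H (Suc n) (2 * j + 1)"
    and CS: "\<And>n j. (G n j)\<^sup>2 \<le> H n j * W n j" "\<And>n j. (G0 n j)\<^sup>2 \<le> H0 n j * W0 n j"
    and car: "\<And>d n j. subtree_sum a d n j \<le> W n j"
  shows "subtree_sum (\<lambda>n j. a n j * (G n j / W n j)\<^sup>2) d n j \<le> 4 * (H n j - (G n j)\<^sup>2 / (W n j + subtree_sum a d n j))"
proof (induction d arbitrary: n j)
  case 0
  have "(G n j)\<^sup>2 / W n j \<le> H n j" using CS(1)[of n j] W[of n j] by (simp add: divide_le_eq)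
  then show ?case by simp
next
  case (Suc d)
  define m1 where "m1 = subtree_sum a d (Suc n) (2 * j)"
  define m2 where "m2 = subtree_sum a d (Suc n) (2 * j + 1)"
  define W1 W2 where "W1 = W (Suc n) (2 * j)" "W2 = W (Suc n) (2 * j + 1)"
  define G1 G2 where "G1 = G (Suc n) (2 * j)" "G2 = G (Suc n) (2 * j + 1)"
  define H1 H2 where "H1 = H (Suc n) (2 * j)" "H2 = H (Suc n) (2 * j + 1)"
  note d = W1_W2_def G1_G2_def H1_H2_def
  have m: "0 \<le> m1" "0 \<le> m2" unfolding m1_def m2_def by (intro subtree_sum_nonneg a)+
  have Wp: "0 < W1" "0 < W2" unfolding d by (rule W)+
  define S where "S = W n j + m1 + m2"
  have S: "0 < S" using W[of n j] m by (simp add: S_def)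
  have k1: "G1\<^sup>2 \<le> (G1\<^sup>2 / (W1 + m1)) * (W1 + m1)" "G2\<^sup>2 \<le> (G2\<^sup>2 / (W2 + m2)) * (W2 + m2)"
    using Wp m by auto
  have q1: "0 \<le> G1\<^sup>2 / (W1 + m1)" "0 \<le> G2\<^sup>2 / (W2 + m2)" using Wp m by auto
  \<comment> \<open>The part of the node outside its children is merged first with the left and then
    with the right child.\<close>
  have A1: "(G0 n j + G1)\<^sup>2 \<le> (H0 n j + G1\<^sup>2 / (W1 + m1)) * (W0 n j + (W1 + m1))"
    by (rule square_sum_le[OF CS(2) k1(1)]) (use H W0 q1 Wp m in auto)
  have "((G0 n j + G1) + G2)\<^sup>2 \<le> ((H0 n j + G1\<^sup>2 / (W1 + m1)) + G2\<^sup>2 / (W2 + m2)) * ((W0 n j + (W1 + m1)) + (W2 + m2))"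
    by (rule square_sum_le[OF A1 k1(2)]) (use H(2)[of n j] W0[of n j] q1 Wp m in auto)
  also have "(W0 n j + (W1 + m1)) + (W2 + m2) = S" using Ws[of n j] by (simp add: S_def d)
  also have "(G0 n j + G1) + G2 = G n j" using Gs[of n j] by (simp add: d)
  finally have main: "(G n j)\<^sup>2 / S \<le> H0 n j + G1\<^sup>2 / (W1 + m1) + G2\<^sup>2 / (W2 + m2)"
    using S by (simp add: divide_le_eq)
  have Sa: "S + a n j \<le> 2 * W n j" using car[of "Suc d" n j] by (simp add: S_def m1_def m2_def)
  \<comment> \<open>The drop of \<open>1 / S\<close> when \<open>a n j\<close> is added to
    \<open>S\<close> is \<open>a n j / (S * (S + a n j))\<close>. The Carleson condition bounds both
    factors of the denominator by \<open>2 * W n j\<close>, which is where the factor 4 comes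
    from.\<close>
  have gain: "a n j * (G n j / W n j)\<^sup>2 \<le> 4 * ((G n j)\<^sup>2 / S) - 4 * ((G n j)\<^sup>2 / (S + a n j))"
  proof -
    have p: "0 < S + a n j" using S a[of n j] by simp
    have "S * (S + a n j) \<le> (2 * W n j) * (2 * W n j)"
      using Sa S a[of n j] by (intro mult_mono) auto
    then have "4 * a n j * (G n j)\<^sup>2 / ((2 * W n j) * (2 * W n j)) \<le> 4 * a n j * (G n j)\<^sup>2 / (S * (S + a n j))"
      using S p a[of n j] W[of n j] by (intro divide_left_mono mult_pos_pos) auto
    also have "\<dots> = 4 * ((G n j)\<^sup>2 / S) - 4 * ((G n j)\<^sup>2 / (S + a n j))"
      using S p by (simp add: field_simps)
    finally show ?thesis by (simp add: power_divide power2_eq_square)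
  qed
  have "subtree_sum (\<lambda>n j. a n j * (G n j / W n j)\<^sup>2) (Suc d) n j \<le>
     a n j * (G n j / W n j)\<^sup>2 + 4 * (H1 - G1\<^sup>2 / (W1 + m1)) + 4 * (H2 - G2\<^sup>2 / (W2 + m2))"
    using Suc.IH[of "Suc n" "2 * j"] Suc.IH[of "Suc n" "2 * j + 1"] by (simp add: d m1_def m2_def)
  also have "\<dots> \<le> 4 * (H n j - (G n j)\<^sup>2 / (S + a n j))"
    using main gain Hs[of n j] by (simp add: d)
  also have "S + a n j = W n j + subtree_sum a (Suc d) n j" by (simp add: S_def m1_def m2_def)
  finally show ?case .
qed

lemma atLeastLessThan_split_int:
  fixes f :: "int \<Rightarrow> 'a::comm_monoid_add" assumes "a \<le> b" "b \<le> c"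
  shows "sum f {a..<c} = sum f {a..<b} + sum f {b..<c}"
proof -
  have "{a..<c} = {a..<b} \<union> {b..<c}" using assms by auto
  then show ?thesis by (simp add: sum.union_disjoint ivl_disj_int)
qed

lemma subtree_sum_eq:
  "subtree_sum f d n j = (\<Sum>i<d. \<Sum>l\<in>{j * 2 ^ i..<(j + 1) * 2 ^ i}. f (n + i) l)"
proof (induction d arbitrary: n j)
  case (Suc d)
  have step: "(\<Sum>l\<in>{(2 * j) * 2 ^ i..<(2 * j + 1) * 2 ^ i}. f (Suc n + i) l) +
      (\<Sum>l\<in>{(2 * j + 1) * 2 ^ i..<(2 * j + 1 + 1) * 2 ^ i}. f (Suc n + i) l) =
     (\<Sum>l\<in>{j * 2 ^ Suc i..<(j + 1) * 2 ^ Suc i}. f (n + Suc i) l)" for i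
  proof -
    have "(\<Sum>l\<in>{(2 * j) * 2 ^ i..<(2 * j + 1 + 1) * 2 ^ i}. f (Suc n + i) l) =
      (\<Sum>l\<in>{(2 * j) * 2 ^ i..<(2 * j + 1) * 2 ^ i}. f (Suc n + i) l) +
      (\<Sum>l\<in>{(2 * j + 1) * 2 ^ i..<(2 * j + 1 + 1) * 2 ^ i}. f (Suc n + i) l)"
      by (rule atLeastLessThan_split_int) (auto simp: algebra_simps)
    then show ?thesis by (simp add: algebra_simps)
  qed
  have "subtree_sum f (Suc d) n j = f n j + (\<Sum>i<d. (\<Sum>l\<in>{(2 * j) * 2 ^ i..<(2 * j + 1) * 2 ^ i}. f (Suc n + i) l) +
      (\<Sum>l\<in>{(2 * j + 1) * 2 ^ i..<(2 * j + 1 + 1) * 2 ^ i}. f (Suc n + i) l))"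
    unfolding subtree_sum.simps Suc.IH by (simp only: sum.distrib add.assoc)
  also have "\<dots> = f n j + (\<Sum>i<d. \<Sum>l\<in>{j * 2 ^ Suc i..<(j + 1) * 2 ^ Suc i}. f (n + Suc i) l)"
    by (simp only: step)
  also have "\<dots> = (\<Sum>i<Suc d. \<Sum>l\<in>{j * 2 ^ i..<(j + 1) * 2 ^ i}. f (n + i) l)"
  proof -
    have "{j..<j + 1} = {j}" by auto
    then show ?thesis by (subst sum.lessThan_Suc_shift) simp
  qed
  finally show ?case .
qed simp

section \<open>Dyadic tents and Carleson squares\<close>

text \<open>A crude form of Jordan's inequality, split at pi/3: below it the cosine is at least 1/2,
  above it the sine is at least sqrt 3 / 2.\<close>

lemma sin_ge_third:
  fixes y :: real assumes "0 \<le> y" "y \<le> pi / 2"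
  shows "y / 3 \<le> sin y"
proof (cases "y \<le> pi / 3")
  case True
  show ?thesis
  proof (cases "y = 0")
    case False
    then have y: "0 < y" using assms by simp
    obtain x where x: "0 < x" "x < y" "sin y - sin 0 = (y - 0) * cos x"
      using MVT2[OF y, of sin cos] by (auto intro!: derivative_eq_intros)
    have "cos (pi / 3) \<le> cos x" using x True by (intro cos_monotone_0_pi_le) auto
    then have "1 / 2 \<le> cos x" by (simp add: cos_60)
    then have "y * (1 / 2) \<le> y * cos x" using y by (intro mult_left_mono) auto
    then show ?thesis using x y by simp
  qed simp
next
  case False
  have "sin (pi / 3) \<le> sin y" using False assms by (intro sin_monotone_2pi_le) auto
  then have "sqrt 3 / 2 \<le> sin y" by (simp add: sin_60)
  moreover have "(4::real) / 3 \<le> sqrt 3" by (rule real_le_rsqrt) (simp add: power2_eq_square)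
  moreover have "y / 3 \<le> 4 / 6" using assms pi_less_4 by simp
  ultimately show ?thesis by simp
qed

lemma cmod_cis_minus_one_ge:
  assumes "\<bar>x\<bar> \<le> pi" shows "\<bar>x\<bar> / 3 \<le> cmod (cis x - 1)"
proof -
  have "(cmod (cis x - 1))\<^sup>2 = (cos x - 1)\<^sup>2 + (sin x)\<^sup>2" by (simp add: cmod_power2)
  also have "\<dots> = 2 - 2 * cos x" using sin_cos_squared_add[of x] by (simp add: power2_eq_square algebra_simps)
  also have "\<dots> = (2 * sin (\<bar>x\<bar> / 2))\<^sup>2"
    using cos_double_sin[of "\<bar>x\<bar> / 2"] by (simp add: power_mult_distrib)
  finally have "cmod (cis x - 1) = \<bar>2 * sin (\<bar>x\<bar> / 2)\<bar>" by (metis abs_norm_cancel power2_eq_iff_nonneg abs_ge_zero norm_ge_zero power2_abs)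
  moreover have "(\<bar>x\<bar> / 2) / 3 \<le> sin (\<bar>x\<bar> / 2)" using assms by (intro sin_ge_third) auto
  ultimately show ?thesis by linarith
qed

text \<open>The law of cosines in the form \<open>(|w| - |z|)^2 + |w| * |z| * |cis t - 1|^2\<close>,
  of which only the angular term is kept.\<close>

lemma cmod_diff_rcis_ge:
  assumes "\<bar>t\<bar> \<le> pi" "0 \<le> r" "r \<le> cmod w" "r \<le> cmod z" "w = rcis (cmod w) (s + t)" "z = rcis (cmod z) s"
  shows "r * (\<bar>t\<bar> / 3) \<le> cmod (w - z)"
proof -
  have "(cmod (w - z))\<^sup>2 = (cmod w - cmod z)\<^sup>2 + cmod w * cmod z * (cmod (cis t - 1))\<^sup>2"
  proof -
    have "w - z = cis s * (of_real (cmod w) * cis t - of_real (cmod z))"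
      by (subst assms(5), subst assms(6)) (simp add: rcis_def cis_mult[symmetric] algebra_simps)
    then have "(cmod (w - z))\<^sup>2 = (cmod (of_real (cmod w) * cis t - of_real (cmod z)))\<^sup>2" by (simp add: norm_mult)
    also have "\<dots> = (cmod w * cos t - cmod z)\<^sup>2 + (cmod w * sin t)\<^sup>2" by (simp add: cmod_power2)
    also have "\<dots> = (cmod w)\<^sup>2 * ((sin t)\<^sup>2 + (cos t)\<^sup>2) - 2 * cmod w * cmod z * cos t + (cmod z)\<^sup>2"
      by algebra
    finally have 1: "(cmod (w - z))\<^sup>2 = (cmod w)\<^sup>2 - 2 * cmod w * cmod z * cos t + (cmod z)\<^sup>2" by simp
    have "(cmod (cis t - 1))\<^sup>2 = (cos t - 1)\<^sup>2 + (sin t)\<^sup>2" by (simp add: cmod_power2)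
    also have "\<dots> = 2 - 2 * cos t" using sin_cos_squared_add[of t] by (simp add: power2_eq_square algebra_simps)
    finally have 2: "(cmod (cis t - 1))\<^sup>2 = 2 - 2 * cos t" .
    show ?thesis unfolding 1 2 by algebra
  qed
  also have "\<dots> \<ge> 0 + r * r * (\<bar>t\<bar> / 3)\<^sup>2"
    using cmod_cis_minus_one_ge[OF assms(1)] assms(2-4)
    by (intro add_mono mult_mono power_mono) auto
  finally have f: "0 + r * r * (\<bar>t\<bar> / 3)\<^sup>2 \<le> (cmod (w - z))\<^sup>2" .
  have "(r * x)\<^sup>2 = 0 + r * r * x\<^sup>2" for x :: real by (simp add: power2_eq_square)
  then have e: "(r * (\<bar>t\<bar> / 3))\<^sup>2 = 0 + r * r * (\<bar>t\<bar> / 3)\<^sup>2" .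
  have "(r * (\<bar>t\<bar> / 3))\<^sup>2 \<le> (cmod (w - z))\<^sup>2" unfolding e by (rule f)
  then show ?thesis by (rule power2_le_imp_le) simp
qed

section \<open>Dyadic annuli, cells and tents\<close>

definition cell :: "nat \<Rightarrow> complex \<Rightarrow> int" where
  "cell n z = \<lfloor>2 ^ n * (Arg z / (2 * pi))\<rfloor>"

definition annulus :: "nat \<Rightarrow> complex set" where
  "annulus n = {z \<in> unit_disc. 1 - (1/2) ^ n \<le> cmod z}"

text \<open>Cells are compared modulo \<open>2^n\<close> because the principal argument jumps at the
  negative axis: with residues the cells close up to a circle, and neighbours \<open>j - 1\<close>
  and \<open>j + 1\<close> need no special case at the cut. For \<open>n = 0\<close> the condition
  is void and the tent is the whole disc.\<close>

definition tent :: "nat \<Rightarrow> int \<Rightarrow> complex set" where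
  "tent n j = {z \<in> annulus n. 2 ^ n dvd cell n z - j}"

text \<open>The generation of \<open>z\<close>: the largest \<open>n\<close> with \<open>z\<close>
  in \<open>annulus n\<close>.\<close>

definition level :: "complex \<Rightarrow> nat" where
  "level z = (LEAST n. cmod z < 1 - (1/2) ^ Suc n)"

lemma level_bounds:
  assumes "cmod z < 1"
  shows "1 - (1/2) ^ level z \<le> cmod z" "cmod z < 1 - (1/2) ^ Suc (level z)"
proof -
  obtain n where "(1/2::real) ^ n < 1 - cmod z" using real_arch_pow_inv[of "1 - cmod z" "1/2"] assms by auto
  moreover have "(1/2::real) ^ Suc n \<le> (1/2) ^ n" by simp
  ultimately have ex: "cmod z < 1 - (1/2) ^ Suc n" by linarith
  then show "cmod z < 1 - (1/2) ^ Suc (level z)" unfolding level_def by (rule LeastI)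
  show "1 - (1/2) ^ level z \<le> cmod z"
  proof (cases "level z")
    case (Suc k)
    then have "\<not> cmod z < 1 - (1/2) ^ Suc k" using not_less_Least[of k "\<lambda>n. cmod z < 1 - (1/2) ^ Suc n"] by (simp add: level_def)
    then show ?thesis using Suc by simp
  qed simp
qed

lemma level_ge_iff:
  assumes "cmod z < 1" shows "n \<le> level z \<longleftrightarrow> 1 - (1/2) ^ n \<le> cmod z"
proof
  assume "n \<le> level z"
  then have "(1/2::real) ^ level z \<le> (1/2) ^ n" by (rule power_decreasing) auto
  then show "1 - (1/2) ^ n \<le> cmod z" using level_bounds(1)[OF assms] by linarith
next
  assume h: "1 - (1/2) ^ n \<le> cmod z"
  show "n \<le> level z"
  proof (rule ccontr)
    assume "\<not> n \<le> level z"
    then have "(1/2::real) ^ n \<le> (1/2) ^ Suc (level z)" by (intro power_decreasing) auto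
    then show False using h level_bounds(2)[OF assms] by linarith
  qed
qed

lemma annulus_iff_level: "cmod z < 1 \<Longrightarrow> z \<in> annulus n \<longleftrightarrow> n \<le> level z"
  by (simp add: annulus_def level_ge_iff)

lemma annulus_subset: "annulus n \<subseteq> unit_disc" by (auto simp: annulus_def)

lemma tent_subset: "tent n j \<subseteq> annulus n" by (auto simp: tent_def)

lemma annulus_0: "annulus 0 = unit_disc" by (auto simp: annulus_def)

lemma tent_0: "tent 0 j = unit_disc" by (auto simp: tent_def annulus_0)

lemma annulus_mono: "m \<le> n \<Longrightarrow> annulus n \<subseteq> annulus m"
proof
  fix z assume "m \<le> n" and z: "z \<in> annulus n"
  then have p: "(1/2::real) ^ n \<le> (1/2) ^ m" by (intro power_decreasing) auto
  have "cmod z < 1" "1 - (1/2) ^ n \<le> cmod z" using z by (auto simp: annulus_def)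
  moreover from this(2) p have "1 - (1/2) ^ m \<le> cmod z" by linarith
  ultimately show "z \<in> annulus m" by (simp add: annulus_def)
qed

text \<open>The argument is continuous off the nonpositive real axis and on that axis takes only the
  values pi and, at the origin, 0.\<close>

lemma borel_measurable_Arg: "Arg \<in> borel_measurable borel"
proof -
  have eq: "Arg = (\<lambda>z. if z \<in> \<real>\<^sub>\<le>\<^sub>0 then (if z = 0 then 0 else pi) else indicator (- \<real>\<^sub>\<le>\<^sub>0) z *\<^sub>R Arg z)"
  proof
    fix z :: complex
    show "Arg z = (if z \<in> \<real>\<^sub>\<le>\<^sub>0 then (if z = 0 then 0 else pi) else indicator (- \<real>\<^sub>\<le>\<^sub>0) z *\<^sub>R Arg z)"
    proof (cases "z \<in> \<real>\<^sub>\<le>\<^sub>0 \<and> z \<noteq> 0")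
      case True
      then have "Re z < 0 \<and> Im z = 0" by (auto simp: complex_nonpos_Reals_iff complex_eq_iff)
      then show ?thesis using True by (simp add: Arg_eq_pi)
    qed (auto simp: Arg_zero)
  qed
  have 1: "(\<lambda>z. indicator (- \<real>\<^sub>\<le>\<^sub>0) z *\<^sub>R Arg z) \<in> borel_measurable borel"
    by (rule borel_measurable_continuous_on_indicator[OF _ continuous_on_Arg]) (auto simp: closed_nonpos_Reals_complex open_Compl borel_open)
  have "{z \<in> space borel. z \<in> (\<real>\<^sub>\<le>\<^sub>0 :: complex set)} \<in> sets borel" by (simp add: closed_nonpos_Reals_complex borel_closed)
  then have "(\<lambda>z. if z \<in> \<real>\<^sub>\<le>\<^sub>0 then (if z = 0 then 0 else pi) else indicator (- \<real>\<^sub>\<le>\<^sub>0) z *\<^sub>R Arg z) \<in> borel_measurable borel"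
    by (intro measurable_If 1) measurable
  then show ?thesis by (subst eq)
qed

lemma cell_measurable: "{z. P (cell n z)} \<in> sets borel"
proof -
  note borel_measurable_Arg[measurable]
  have "(\<lambda>z. cell n z) \<in> borel \<rightarrow>\<^sub>M count_space UNIV" unfolding cell_def by measurable
  from measurable_sets[OF this, of "{i. P i}"] show ?thesis by (simp add: vimage_def)
qed

lemma annulus_borel: "annulus n \<in> sets borel"
proof -
  have "annulus n = unit_disc \<inter> cmod -` {1 - (1/2) ^ n..}" by (auto simp: annulus_def)
  moreover have "cmod -` {1 - (1/2) ^ n..} \<in> sets borel" using measurable_sets[of cmod borel borel "{1 - (1/2) ^ n..}"] by simp
  ultimately show ?thesis by auto
qed

lemma tent_borel: "tent n j \<in> sets borel"
proof -
  have "tent n j = annulus n \<inter> {z. 2 ^ n dvd cell n z - j}" by (auto simp: tent_def)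
  then show ?thesis using annulus_borel cell_measurable[of "\<lambda>i. 2 ^ n dvd i - j"] by auto
qed

lemma cell_Suc: "cell n z = cell (Suc n) z div 2"
proof -
  define x where "x = 2 ^ n * (Arg z / (2 * pi))"
  have "cell (Suc n) z = \<lfloor>2 * x\<rfloor>" "cell n z = \<lfloor>x\<rfloor>" by (simp_all add: cell_def x_def mult.assoc)
  moreover have "\<lfloor>2 * x\<rfloor> div 2 = \<lfloor>2 * x / 2\<rfloor>" using floor_divide_real_eq_div[of 2 "2 * x"] by simp
  ultimately show ?thesis by simp
qed

lemma dvd_diff_div2:
  assumes "(2::int) ^ Suc n dvd c - j" shows "2 ^ n dvd c div 2 - j div 2" "even (c - j)"
proof -
  obtain k where k: "c = j + 2 * (2 ^ n * k)" using assms by (auto simp: dvd_def algebra_simps)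
  then have "c div 2 = j div 2 + 2 ^ n * k" by simp
  then show "2 ^ n dvd c div 2 - j div 2" by simp
  show "even (c - j)" using k by simp
qed

lemma tent_Suc_subset: "tent (Suc n) j \<subseteq> tent n (j div 2)"
proof
  fix z assume z: "z \<in> tent (Suc n) j"
  then have "2 ^ n dvd cell (Suc n) z div 2 - j div 2" by (intro dvd_diff_div2) (simp add: tent_def)
  then show "z \<in> tent n (j div 2)" using z annulus_mono[of n "Suc n"] by (auto simp: tent_def cell_Suc[of n])
qed

lemma tent_children: "tent (Suc n) (2 * j) \<subseteq> tent n j" "tent (Suc n) (2 * j + 1) \<subseteq> tent n j"
  "tent (Suc n) (2 * j) \<inter> tent (Suc n) (2 * j + 1) = {}"
proof -
  show "tent (Suc n) (2 * j) \<subseteq> tent n j" "tent (Suc n) (2 * j + 1) \<subseteq> tent n j"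
    using tent_Suc_subset[of n "2 * j"] tent_Suc_subset[of n "2 * j + 1"] by auto
  show "tent (Suc n) (2 * j) \<inter> tent (Suc n) (2 * j + 1) = {}"
  proof (rule equals0I)
    fix z assume "z \<in> tent (Suc n) (2 * j) \<inter> tent (Suc n) (2 * j + 1)"
    then have c: "2 ^ Suc n dvd cell (Suc n) z - 2 * j" "2 ^ Suc n dvd cell (Suc n) z - (2 * j + 1)" by (auto simp: tent_def)
    from dvd_diff_div2(2)[OF c(1)] dvd_diff_div2(2)[OF c(2)] show False by presburger
  qed
qed

lemma Arg_mult_cis:
  assumes "w \<noteq> 0" obtains m :: int where "Arg (w * cis t) = Arg w + t + 2 * pi * of_int m"
proof -
  have "w * cis t \<noteq> 0" using assms by simp
  then have "cis (Arg (w * cis t)) = sgn (w * cis t)" by (rule cis_Arg)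
  also have "\<dots> = sgn w * cis t" by (simp add: sgn_eq norm_mult)
  also have "\<dots> = cis (Arg w + t)" using assms by (simp add: cis_Arg cis_mult[symmetric])
  finally have "exp (\<i> * of_real (Arg (w * cis t))) = exp (\<i> * of_real (Arg w + t))" by (simp only: cis_conv_exp)
  then obtain m :: int where "\<i> * of_real (Arg (w * cis t)) = \<i> * of_real (Arg w + t) + (of_int (2 * m) * pi) * \<i>"
    unfolding exp_eq by blast
  then have "Im (\<i> * of_real (Arg (w * cis t))) = Im (\<i> * of_real (Arg w + t) + (of_int (2 * m) * pi) * \<i>)" by (rule arg_cong)
  then have "Arg (w * cis t) = Arg w + t + 2 * pi * of_int m" by simp
  then show thesis by (rule that)
qed

text \<open>Only a congruence, because the principal argument of the product may be off by a full
  turn, which is \<open>2^n\<close> cells.\<close>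

lemma cell_rotate:
  assumes "w \<noteq> 0" shows "2 ^ n dvd cell n (w * cis (2 * pi / 2 ^ n)) - (cell n w + 1)"
proof -
  obtain m :: int where m: "Arg (w * cis (2 * pi / 2 ^ n)) = Arg w + 2 * pi / 2 ^ n + 2 * pi * of_int m"
    by (rule Arg_mult_cis[OF assms])
  have "2 ^ n * (Arg (w * cis (2 * pi / 2 ^ n)) / (2 * pi)) = 2 ^ n * (Arg w / (2 * pi)) + of_int (1 + 2 ^ n * m)"
    unfolding m by (simp add: field_simps)
  then have "cell n (w * cis (2 * pi / 2 ^ n)) = cell n w + (1 + 2 ^ n * m)"
    unfolding cell_def by (simp only: floor_add_int[symmetric])
  then show ?thesis by simp
qed

text \<open>Rotation by one cell width preserves \<open>dA\<close> and a radial weight. Generation 0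
  is separate: there the tents contain the origin, whose argument does not rotate.\<close>

lemma weight_mass_tent_shift:
  assumes \<omega>: "weight \<omega>" and rad: "radial \<omega>"
  shows "weight_mass \<omega> (tent n (j + 1)) = weight_mass \<omega> (tent n j)"
proof (cases "n = 0")
  case False
  define c where "c = cis (2 * pi / 2 ^ n)"
  have c: "cmod c = 1" by (simp add: c_def)
  note borel_measurable_weight[OF \<omega>, measurable]
  have [measurable]: "tent n j \<in> sets dA" for j
    using tent_borel tent_subset annulus_subset by (intro borel_sets_dA) blast+
  have "weight_mass \<omega> (tent n (j + 1)) = (\<integral>\<^sup>+z. ennreal (\<omega> (c * z)) * indicator (tent n (j + 1)) (c * z) \<partial>dA)"
    unfolding weight_mass_def
    by (rule nn_integral_dA_rotate[of "\<lambda>z. ennreal (\<omega> z) * indicator (tent n (j + 1)) z", symmetric, OF _ c]) measurable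
  also have "\<dots> = weight_mass \<omega> (tent n j)" unfolding weight_mass_def
  proof (rule nn_integral_cong)
    fix z assume "z \<in> space dA"
    then have z: "cmod z < 1" by simp
    have "\<omega> (c * z) = \<omega> z" using radial_cmod[OF rad, of z] radial_cmod[OF rad, of "c * z"] z by (simp add: norm_mult c)
    moreover have "c * z \<in> tent n (j + 1) \<longleftrightarrow> z \<in> tent n j"
    proof (cases "z = 0")
      case True
      have "(1/2::real) ^ n \<le> (1/2) ^ 1" using False by (intro power_decreasing) auto
      then have "1 - (1/2::real) ^ n > 0" by simp
      then show ?thesis using True by (auto simp: tent_def annulus_def)
    next
      case nz: False
      have "2 ^ n dvd cell n (c * z) - (cell n z + 1)" using cell_rotate[OF nz, of n] by (simp add: c_def mult.commute)
      then have "2 ^ n dvd cell n (c * z) - (j + 1) \<longleftrightarrow> 2 ^ n dvd cell n z - j"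
        by (smt (verit) dvd_diff_commute dvd_add_right_iff diff_add_cancel dvd_diff)
      then show ?thesis by (simp add: tent_def annulus_def norm_mult c)
    qed
    ultimately show "ennreal (\<omega> (c * z)) * indicator (tent n (j + 1)) (c * z) = ennreal (\<omega> z) * indicator (tent n j) z"
      by (simp add: indicator_def)
  qed
  finally show ?thesis .
qed (simp add: tent_0)

lemma weight_mass_tent:
  assumes \<omega>: "weight \<omega>" and rad: "radial \<omega>"
  shows "weight_mass \<omega> (annulus n) = 2 ^ n * weight_mass \<omega> (tent n j)"
proof -
  have s: "weight_mass \<omega> (tent n (l + int k)) = weight_mass \<omega> (tent n l)" for l k
  proof (induction k)
    case (Suc k)
    then show ?case using weight_mass_tent_shift[OF \<omega> rad, of n "l + int k"] by (simp add: algebra_simps)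
  qed simp
  have eq: "weight_mass \<omega> (tent n i) = weight_mass \<omega> (tent n j)" for i
    using s[of j "nat (i - j)"] s[of i "nat (j - i)"] by (cases "j \<le> i") auto
  note borel_measurable_weight[OF \<omega>, measurable]
  have [measurable]: "tent n j \<in> sets dA" for j
    using tent_borel tent_subset annulus_subset by (intro borel_sets_dA) blast+
  have ind: "indicator (annulus n) z = (\<Sum>i\<in>{0..<2 ^ n}. indicator (tent n i) z :: ennreal)" for z
  proof (cases "z \<in> annulus n")
    case True
    define i0 where "i0 = cell n z mod 2 ^ n"
    have i0: "i0 \<in> {0..<2 ^ n}" by (simp add: i0_def)
    have "indicator (tent n i) z = (if i = i0 then 1 else 0 :: ennreal)" if "i \<in> {0..<2 ^ n}" for i
    proof -
      have "2 ^ n dvd cell n z - i \<longleftrightarrow> i = i0"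
        using that unfolding i0_def mod_eq_dvd_iff[symmetric] by (auto simp: mod_pos_pos_trivial)
      then have "z \<in> tent n i \<longleftrightarrow> i = i0" using True by (simp add: tent_def)
      then show ?thesis by (simp add: indicator_def)
    qed
    then have "(\<Sum>i\<in>{0..<2 ^ n}. indicator (tent n i) z :: ennreal) = (\<Sum>i\<in>{0..<2 ^ n}. if i = i0 then 1 else 0)"
      by (intro sum.cong) auto
    also have "\<dots> = 1" using i0 by simp
    finally show ?thesis using True by simp
  next
    case False
    then have "z \<notin> tent n i" for i using tent_subset by blast
    then show ?thesis using False by simp
  qed
  have "weight_mass \<omega> (annulus n) = (\<integral>\<^sup>+z. (\<Sum>i\<in>{0..<2 ^ n}. ennreal (\<omega> z) * indicator (tent n i) z) \<partial>dA)"
    unfolding weight_mass_def ind by (simp add: sum_distrib_left)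
  also have "\<dots> = (\<Sum>i\<in>{0..<2 ^ n}. weight_mass \<omega> (tent n i))"
    unfolding weight_mass_def by (rule nn_integral_sum) measurable
  also have "\<dots> = (\<Sum>i\<in>{0..<2 ^ n::int}. weight_mass \<omega> (tent n j))" by (intro sum.cong eq refl)
  also have "\<dots> = 2 ^ n * weight_mass \<omega> (tent n j)" by (simp add: nat_power_eq)
  finally show ?thesis .
qed

text \<open>Real numbers at distance at most 1 have floors differing by at most 1, so missing all
  three neighbouring cells forces an angle of more than one cell width, \<open>2 * pi / 2^m\<close>,
  modulo full turns. Such an \<open>m\<close> is at least 1, hence both moduli are at least 1/2, and
  the chord estimate with an angle of at least \<open>4 / 2^m\<close> yields the factor 2/3.\<close>

lemma cell_separation:
  assumes wz: "w \<in> annulus m" "\<zeta> \<in> annulus m"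
    and far: "\<And>i. i \<in> {-1, 0, 1} \<Longrightarrow> w \<notin> tent m (cell m \<zeta> + i)"
  shows "(1/2) ^ m * (2/3) \<le> cmod (w - \<zeta>)"
proof -
  have m0: "m \<noteq> 0"
  proof
    assume "m = 0"
    then show False using far[of 0] wz by (simp add: tent_0 annulus_0)
  qed
  have "(1/2::real) ^ m \<le> (1/2) ^ 1" using m0 by (intro power_decreasing) auto
  then have ge: "1/2 \<le> cmod w" "1/2 \<le> cmod \<zeta>" using wz by (auto simp: annulus_def)
  define x where "x = 2 ^ m * (Arg w / (2 * pi))"
  define y where "y = 2 ^ m * (Arg \<zeta> / (2 * pi))"
  \<comment> \<open>The number of full turns to remove so that the angle between the points falls
    into \<open>[-pi, pi]\<close>.\<close>
  define l where "l = round ((x - y) / 2 ^ m)"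
  define d where "d = x - y - 2 ^ m * of_int l"
  have "\<bar>of_int l - (x - y) / 2 ^ m\<bar> \<le> 1/2" unfolding l_def by (rule of_int_round_abs_le)
  then have "\<bar>(x - y) / 2 ^ m - of_int l\<bar> \<le> 1/2" by (simp add: abs_minus_commute)
  moreover have "d / 2 ^ m = (x - y) / 2 ^ m - of_int l" by (simp add: d_def field_simps)
  ultimately have dle: "\<bar>d / 2 ^ m\<bar> \<le> 1/2" by simp
  define t where "t = 2 * pi * (d / 2 ^ m)"
  have t: "\<bar>t\<bar> \<le> pi" using mult_left_mono[OF dle, of "2 * pi"] by (simp add: t_def abs_mult)
  have "1 < \<bar>d\<bar>"
  proof (rule ccontr)
    assume "\<not> 1 < \<bar>d\<bar>"
    then have d1: "-1 \<le> d" "d \<le> 1" by auto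
    define i where "i = \<lfloor>x\<rfloor> - \<lfloor>y\<rfloor> - 2 ^ m * l"
    have "of_int i = d + (y - of_int \<lfloor>y\<rfloor>) - (x - of_int \<lfloor>x\<rfloor>)" by (simp add: i_def d_def)
    moreover have "0 \<le> y - of_int \<lfloor>y\<rfloor>" "y - of_int \<lfloor>y\<rfloor> < 1" "0 \<le> x - of_int \<lfloor>x\<rfloor>" "x - of_int \<lfloor>x\<rfloor> < 1" by linarith+
    ultimately have "real_of_int i < 2" "-2 < real_of_int i" using d1 by linarith+
    then have "i < 2" "-2 < i" by linarith+
    then have "i \<in> {-1, 0, 1}" by auto
    then have "w \<notin> tent m (cell m \<zeta> + i)" by (rule far)
    moreover have "cell m w = \<lfloor>x\<rfloor>" "cell m \<zeta> = \<lfloor>y\<rfloor>" by (simp_all only: cell_def x_def y_def)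
    then have "cell m w - (cell m \<zeta> + i) = 2 ^ m * l" by (simp add: i_def)
    ultimately show False using wz(1) by (simp add: tent_def)
  qed
  have "\<bar>t\<bar> = 2 * pi * (\<bar>d\<bar> / 2 ^ m)" by (simp add: t_def abs_mult)
  also have "\<dots> \<ge> 2 * 2 * (1 / 2 ^ m)"
    using \<open>1 < \<bar>d\<bar>\<close> pi_ge_two by (intro mult_mono divide_right_mono) auto
  finally have tge: "4 * (1 / 2 ^ m) \<le> \<bar>t\<bar>" by simp
  have "1/2 * (\<bar>t\<bar> / 3) \<le> cmod (w - \<zeta>)"
  proof (rule cmod_diff_rcis_ge[OF t _ ge])
    show "\<zeta> = rcis (cmod \<zeta>) (Arg \<zeta>)" by (simp add: rcis_cmod_Arg)
    have "Arg w = (Arg \<zeta> + t) + 2 * pi * of_int l" by (simp add: t_def d_def x_def y_def field_simps)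
    then have "cis (Arg w) = cis ((Arg \<zeta> + t) + 2 * pi * of_int l)" by (rule arg_cong)
    also have "\<dots> = cis (Arg \<zeta> + t) * cis (2 * pi * of_int l)" by (rule cis_mult[symmetric])
    also have "cis (2 * pi * of_int l) = 1" by (rule cis_multiple_2pi) simp
    finally have "rcis (cmod w) (Arg w) = rcis (cmod w) (Arg \<zeta> + t)" by (simp add: rcis_def)
    then show "w = rcis (cmod w) (Arg \<zeta> + t)" by (simp add: rcis_cmod_Arg)
  qed simp
  then show ?thesis using tge by (simp add: power_divide)
qed

section \<open>Comparison of Carleson squares with tents\<close>

lemma carleson_square_iff:
  assumes "0 < cmod a" "cmod a < 1"
  shows "z \<in> carleson_square a \<longleftrightarrow> cmod a < cmod z \<and> cmod z < 1 \<and> \<bar>Arg (a * cnj z)\<bar> < (1 - cmod a) / 2"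
proof -
  have key: "Arg (a * cnj (rcis r \<theta>)) = Arg (a * cis (- \<theta>))" if "0 < r" for r \<theta>
  proof -
    have "a * cnj (rcis r \<theta>) = of_real r * (a * cis (- \<theta>))" by (simp add: rcis_def cis_cnj mult_ac)
    then show ?thesis using that by (simp only: Arg_times_of_real)
  qed
  show ?thesis
  proof
    assume "z \<in> carleson_square a"
    then obtain r \<theta> where r: "z = rcis r \<theta>" "cmod a < r" "r < 1" "\<bar>Arg (a * cis (- \<theta>))\<bar> < (1 - cmod a) / 2"
      by (auto simp: carleson_square_def)
    have "0 < r" using r(2) assms by linarith
    then show "cmod a < cmod z \<and> cmod z < 1 \<and> \<bar>Arg (a * cnj z)\<bar> < (1 - cmod a) / 2"
      using r key[of r \<theta>] by simp
  next
    assume z: "cmod a < cmod z \<and> cmod z < 1 \<and> \<bar>Arg (a * cnj z)\<bar> < (1 - cmod a) / 2"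
    have "0 < cmod z" using z assms by linarith
    then have "Arg (a * cis (- Arg z)) = Arg (a * cnj z)" using key[of "cmod z" "Arg z"] by (simp add: rcis_cmod_Arg)
    then show "z \<in> carleson_square a" unfolding carleson_square_def
      using z by (intro CollectI exI[of _ "cmod z"] exI[of _ "Arg z"]) (simp add: rcis_cmod_Arg)
  qed
qed

lemma carleson_square_subset: "carleson_square a \<subseteq> unit_disc"
proof
  fix z assume "z \<in> carleson_square a"
  then obtain r \<theta> where r: "z = rcis r \<theta>" "cmod a < r" "r < 1" by (auto simp: carleson_square_def)
  have "0 < r" using r(2) norm_ge_zero[of a] by linarith
  then show "z \<in> unit_disc" using r by simp
qed

text \<open>The angular bound is below pi, which keeps \<open>a * cnj z\<close> away from the cut,
  where the argument would be discontinuous.\<close>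

lemma open_carleson_square:
  assumes "0 < cmod a" "cmod a < 1"
  shows "open (carleson_square a)"
proof -
  define h where "h = (1 - cmod a) / 2"
  have iff: "z \<in> carleson_square a \<longleftrightarrow> cmod a < cmod z \<and> cmod z < 1 \<and> \<bar>Arg (a * cnj z)\<bar> < h" for z
    unfolding h_def by (rule carleson_square_iff[OF assms])
  have "h \<le> 1 / 2" by (simp add: h_def)
  moreover have "1 / 2 < pi" by (rule less_le_trans[OF _ pi_ge_two]) simp
  ultimately have h: "h < pi" by (rule le_less_trans)
  define O' where "O' = (\<lambda>z. a * cnj z) -` (- \<real>\<^sub>\<le>\<^sub>0)"
  have oO: "open O'" unfolding O'_def
    by (intro open_vimage continuous_intros) (simp add: open_Compl)
  have c: "continuous_on O' (\<lambda>z. Arg (a * cnj z))"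
    by (rule continuous_on_compose2[OF continuous_on_Arg]) (auto simp: O'_def intro!: continuous_intros)
  have "open ({z. cmod a < cmod z} \<inter> {z. cmod z < 1})"
    by (intro open_Int open_Collect_less continuous_intros)
  moreover have "open (O' \<inter> (\<lambda>z. Arg (a * cnj z)) -` {- h<..<h})"
    by (rule continuous_open_preimage[OF c oO]) simp
  ultimately have "open (({z. cmod a < cmod z} \<inter> {z. cmod z < 1}) \<inter>
     (O' \<inter> (\<lambda>z. Arg (a * cnj z)) -` {- h<..<h}))" (is "open ?S")
    by (rule open_Int)
  moreover have "carleson_square a = ?S"
  proof -
    have "a * cnj z \<notin> \<real>\<^sub>\<le>\<^sub>0" if "cmod a < cmod z" "\<bar>Arg (a * cnj z)\<bar> < h" for z
    proof
      assume "a * cnj z \<in> \<real>\<^sub>\<le>\<^sub>0"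
      moreover have "a * cnj z \<noteq> 0" using that assms by auto
      ultimately have "Arg (a * cnj z) = pi" unfolding Arg_eq_pi by (auto simp: complex_nonpos_Reals_iff complex_eq_iff)
      then show False using that(2) h pi_gt_zero by simp
    qed
    then show ?thesis by (auto simp: O'_def iff abs_less_iff)
  qed
  ultimately show ?thesis by simp
qed

text \<open>The witness is the point in the direction of \<open>a\<close> with modulus halfway
  between \<open>|a|\<close> and 1.\<close>

lemma carleson_square_nonempty:
  assumes "0 < cmod a" "cmod a < 1"
  shows "of_real ((1 + cmod a) / (2 * cmod a)) * a \<in> carleson_square a"
proof -
  define t where "t = (1 + cmod a) / (2 * cmod a)"
  have t: "0 < t" unfolding t_def using assms by (intro divide_pos_pos mult_pos_pos add_pos_nonneg) auto
  have "cmod (of_real t * a) = t * cmod a" using t by (simp only: norm_mult norm_of_real abs_of_pos)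
  then have n: "cmod (of_real t * a) = (1 + cmod a) / 2" using assms by (simp add: t_def)
  have "a * cnj (of_real t * a) = of_real (t * (cmod a)\<^sup>2)" using complex_norm_square[of a] by simp
  then have "Arg (a * cnj (of_real t * a)) = 0"
    using t by (simp only: Arg_eq_0) simp
  then show ?thesis using n assms by (simp add: carleson_square_iff t_def[symmetric])
qed

lemma Arg_rcis_eq:
  assumes "0 < r" obtains m :: int where "Arg (rcis r \<theta>) = \<theta> + 2 * pi * of_int m"
proof -
  obtain m :: int where "Arg (of_real r * cis \<theta>) = Arg (of_real r) + \<theta> + 2 * pi * of_int m"
    by (rule Arg_mult_cis[of "of_real r" \<theta>]) (use assms in auto)
  then show thesis using assms by (intro that[of m]) (simp add: rcis_def)
qed

text \<open>The half-width of the square is \<open>3/8 * (1/2)^N\<close>, less than half a cell of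
  generation \<open>N\<close>, so the square meets at most two consecutive cells. Its inner radius
  exceeds that of \<open>annulus N\<close>.\<close>

lemma carleson_square_subset_tents:
  assumes a: "cmod a = 1 - 3/2 * (1/2) ^ Suc N"
  obtains j where "carleson_square a \<subseteq> tent N j \<union> tent N (j + 1)"
proof -
  have pw: "0 < (1/2::real) ^ N" "(1/2::real) ^ N \<le> 1" by (simp_all add: power_le_one)
  have a0: "0 < cmod a" "cmod a < 1" unfolding a using pw by simp_all
  define x0 where "x0 = 2 ^ N * (Arg a / (2 * pi))"
  define k where "k = \<lfloor>x0 - 1/2\<rfloor>"
  show thesis
  proof (rule that[of k], rule subsetI)
    fix z assume "z \<in> carleson_square a"
    then have z: "cmod a < cmod z" "cmod z < 1" "\<bar>Arg (a * cnj z)\<bar> < (1 - cmod a) / 2"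
      using carleson_square_iff[OF a0] by auto
    have z0: "0 < cmod z" using z a0 by linarith
    define t where "t = Arg (a * cnj z)"
    have "z \<noteq> 0" using z0 by auto
    have "a * cnj z = rcis (cmod (a * cnj z)) t" by (simp add: t_def rcis_cmod_Arg)
    then have e1: "a * cnj z = of_real (cmod a * cmod z) * cis t" by (simp add: rcis_def norm_mult)
    have "z = rcis (cmod z) (Arg a - t)"
    proof -
      have "cnj z * z = of_real ((cmod z)\<^sup>2)" using complex_norm_square[of z] by (simp add: mult.commute)
      then have "a * of_real ((cmod z)\<^sup>2) = a * cnj z * z" by (simp add: mult.assoc)
      also have "\<dots> = of_real (cmod a * cmod z) * cis t * z" by (simp only: e1)
      also have "a = of_real (cmod a) * cis (Arg a)" by (metis rcis_cmod_Arg rcis_def)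
      finally have "of_real (cmod a) * cis (Arg a) * of_real ((cmod z)\<^sup>2) = of_real (cmod a * cmod z) * cis t * z"
        using \<open>a = of_real (cmod a) * cis (Arg a)\<close> a0 by (simp add: norm_mult)
      then have "of_real (cmod a * cmod z) * (cis (Arg a) * of_real (cmod z)) = of_real (cmod a * cmod z) * (cis t * z)"
        by (simp add: power2_eq_square mult_ac)
      moreover have "of_real (cmod a * cmod z) \<noteq> (0::complex)" using a0 z0 by (simp only: of_real_eq_0_iff) simp
      ultimately have "cis (Arg a) * of_real (cmod z) = cis t * z" by (metis mult_left_cancel)
      then have "cis (-t) * (cis (Arg a) * of_real (cmod z)) = cis (-t) * (cis t * z)" by simp
      also have "\<dots> = z" by (simp add: cis_mult mult.assoc[symmetric])
      finally show ?thesis by (simp add: rcis_def cis_mult mult.assoc[symmetric] mult.commute)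
    qed
    moreover obtain m :: int where "Arg (rcis (cmod z) (Arg a - t)) = Arg a - t + 2 * pi * of_int m"
      by (rule Arg_rcis_eq[OF z0])
    ultimately have Az: "Arg z = Arg a - t + 2 * pi * of_int m" by simp
    define u where "u = 2 ^ N * (t / (2 * pi))"
    have "2 ^ N * (Arg z / (2 * pi)) = (x0 - u) + of_int (2 ^ N * m)" unfolding Az by (simp add: x0_def u_def field_simps)
    then have cz: "cell N z = \<lfloor>x0 - u\<rfloor> + 2 ^ N * m" unfolding cell_def by (simp only: floor_add_int[symmetric])
    have "\<bar>t\<bar> < 3/8 * (1/2) ^ N" using z(3) unfolding t_def[symmetric] a by simp
    then have "2 ^ N * \<bar>t\<bar> < 2 ^ N * (3/8 * (1/2) ^ N)" by (intro mult_strict_left_mono) auto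
    also have "\<dots> = 3/8" by (simp add: power_divide)
    finally have "2 ^ N * \<bar>t\<bar> < 3/8" .
    then have "2 ^ N * \<bar>t\<bar> / (2 * pi) < (3/8) / (2 * pi)" by (intro divide_strict_right_mono) auto
    also have "\<dots> \<le> (3/8) / (2 * 2)" using pi_ge_two by (intro divide_left_mono) auto
    also have "2 ^ N * \<bar>t\<bar> / (2 * pi) = \<bar>u\<bar>" by (simp add: u_def abs_mult)
    finally have u: "\<bar>u\<bar> < 1/2" by simp
    have "of_int k \<le> x0 - 1/2" "x0 - 1/2 < of_int k + 1" unfolding k_def by linarith+
    then have "of_int k \<le> x0 - u" "x0 - u < of_int k + 2" using u by linarith+
    then have "k \<le> \<lfloor>x0 - u\<rfloor>" "\<lfloor>x0 - u\<rfloor> < k + 2" by (simp_all add: le_floor_iff floor_less_iff)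
    then have "\<lfloor>x0 - u\<rfloor> = k \<or> \<lfloor>x0 - u\<rfloor> = k + 1" by auto
    moreover have "z \<in> annulus N" using z pw unfolding annulus_def a by simp
    ultimately show "z \<in> tent N k \<union> tent N (k + 1)" by (auto simp: tent_def cz)
  qed
qed

text \<open>In units of \<open>(1/2)^n\<close> the tent has angular width \<open>2 * pi < 8\<close>,
  and a square of inner radius \<open>\<rho>\<close> has half-width 3/4. Eight squares with centres
  at the half-integers thus leave no point further than 1/2 from a centre. The radius
  \<open>\<rho>\<close> lies between the inner radii of generations \<open>n - 1\<close> and
  \<open>n\<close>; it is positive because \<open>n \<ge> 1\<close>.\<close>

lemma tent_subset_carleson_squares:
  assumes n: "1 \<le> n"
  defines "\<rho> \<equiv> 1 - 3/2 * (1/2) ^ n"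
  shows "tent n j \<subseteq> (\<Union>i\<in>{0..<8::nat}. carleson_square (rcis \<rho> (2 * pi * of_int j / 2 ^ n + (real i + 1/2) / 2 ^ n)))"
proof
  fix z assume z: "z \<in> tent n j"
  have pw: "0 < (1/2::real) ^ n" "(1/2::real) ^ n \<le> 1/2"
    using n power_decreasing[of 1 n "1/2::real"] by simp_all
  have \<rho>: "0 < \<rho>" "\<rho> < 1" using pw by (auto simp: \<rho>_def)
  have zb: "cmod z < 1" "1 - (1/2) ^ n \<le> cmod z" using z by (auto simp: tent_def annulus_def)
  have z0: "0 < cmod z" using zb pw by linarith
  define x where "x = 2 ^ n * (Arg z / (2 * pi))"
  obtain l where l: "\<lfloor>x\<rfloor> - j = 2 ^ n * l" using z by (auto simp: tent_def cell_def x_def dvd_def)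
  define y where "y = x - of_int \<lfloor>x\<rfloor>"
  have y: "0 \<le> y" "y < 1" unfolding y_def by linarith+
  define i where "i = nat \<lfloor>2 * pi * y\<rfloor>"
  have "2 * pi * y < 2 * pi * 1" using y by (intro mult_strict_left_mono) auto
  also have "\<dots> < 8" using pi_less_4 by simp
  finally have py: "0 \<le> 2 * pi * y" "2 * pi * y < 8" using y by auto
  have i: "real i \<le> 2 * pi * y" "2 * pi * y < real i + 1" "i < 8"
    using py unfolding i_def by (auto simp: nat_less_iff floor_less_iff)
  define \<phi> where "\<phi> = 2 * pi * of_int j / 2 ^ n + (real i + 1/2) / 2 ^ n"
  define \<theta> where "\<theta> = 2 * pi * of_int j / 2 ^ n + 2 * pi * y / 2 ^ n"
  have "Arg z = 2 * pi * x / 2 ^ n" by (simp add: x_def)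
  also have "x = y + of_int j + 2 ^ n * of_int l"
    using arg_cong[OF l, of real_of_int] by (simp add: y_def)
  also have "2 * pi * (y + of_int j + 2 ^ n * of_int l) / 2 ^ n = \<theta> + 2 * pi * of_int l"
    by (simp add: \<theta>_def field_simps)
  finally have "cis (Arg z) = cis (\<theta> + 2 * pi * of_int l)" by simp
  also have "\<dots> = cis \<theta> * cis (2 * pi * of_int l)" by (rule cis_mult[symmetric])
  also have "cis (2 * pi * of_int l) = 1" by (rule cis_multiple_2pi) simp
  finally have z\<theta>: "z = rcis (cmod z) \<theta>" by (metis mult.right_neutral rcis_cmod_Arg rcis_def)
  have "\<phi> - \<theta> = (real i + 1/2 - 2 * pi * y) / 2 ^ n" by (simp add: \<phi>_def \<theta>_def field_simps)
  then have "\<bar>\<phi> - \<theta>\<bar> = \<bar>real i + 1/2 - 2 * pi * y\<bar> / 2 ^ n" by (simp only: abs_divide) simp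
  also have "\<dots> \<le> (1/2) / 2 ^ n" by (intro divide_right_mono abs_leI) (use i in linarith, use i in linarith, simp)
  also have "\<dots> = 1/2 * (1/2) ^ n" by (simp add: power_divide)
  finally have d: "\<bar>\<phi> - \<theta>\<bar> \<le> 1/2 * (1/2) ^ n" .
  have "rcis \<rho> \<phi> * cis (- \<theta>) = rcis \<rho> (\<phi> - \<theta>)" by (simp add: rcis_def cis_mult mult.assoc)
  moreover have "\<phi> - \<theta> \<in> {-pi<..pi}"
  proof -
    have "\<bar>\<phi> - \<theta>\<bar> \<le> 1" using d pw by linarith
    moreover have "1 < pi" by (rule less_le_trans[OF _ pi_ge_two]) simp
    ultimately have "\<bar>\<phi> - \<theta>\<bar> < pi" by (rule le_less_trans)
    then show ?thesis by (auto simp: abs_less_iff)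
  qed
  ultimately have "Arg (rcis \<rho> \<phi> * cis (- \<theta>)) = \<phi> - \<theta>" using \<rho> by (simp add: Arg_rcis)
  moreover have "1/2 * (1/2::real) ^ n < (1 - \<rho>) / 2" using pw by (simp add: \<rho>_def)
  ultimately have "\<bar>Arg (rcis \<rho> \<phi> * cis (- \<theta>))\<bar> < (1 - cmod (rcis \<rho> \<phi>)) / 2" using d \<rho> by simp
  moreover have "cmod (rcis \<rho> \<phi>) < cmod z" using \<rho> zb pw by (simp add: \<rho>_def)
  ultimately have "z \<in> carleson_square (rcis \<rho> \<phi>)" unfolding carleson_square_def
    using z\<theta> zb by (intro CollectI exI[of _ "cmod z"] exI[of _ \<theta>]) auto
  then show "z \<in> (\<Union>i\<in>{0..<8::nat}. carleson_square (rcis \<rho> (2 * pi * of_int j / 2 ^ n + (real i + 1/2) / 2 ^ n)))"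
    using i(3) unfolding \<phi>_def by (intro UN_I[of i]) auto
qed

text \<open>The midpoint map of the doubling condition sends the inner radius of generation
  \<open>n\<close> to that of \<open>n + 1\<close>, so dyadic annuli are its natural scale and
  \<open>k\<close> generations cost \<open>C^k\<close>. Real numbers \<open>\<alpha> n\<close>
  replace the masses to make division harmless.\<close>

lemma D_hat_tents:
  assumes \<omega>D: "\<omega> \<in> D_hat" and pos: "AE z in dA. 0 < \<omega> z"
  obtains C \<alpha> where "1 \<le> C" "\<And>n. 0 < \<alpha> n" "\<And>n. weight_mass \<omega> (annulus n) = ennreal (\<alpha> n)"
    "\<And>n j. weight_mass \<omega> (tent n j) = ennreal (\<alpha> n / 2 ^ n)" "\<And>n k. \<alpha> n \<le> C ^ k * \<alpha> (n + k)"
proof -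
  have \<omega>: "weight \<omega>" "radial \<omega>" using \<omega>D by (auto simp: D_hat_def)
  obtain C where C: "1 \<le> C" "\<And>r. 0 \<le> r \<Longrightarrow> r < 1 \<Longrightarrow>
    weight_mass \<omega> {z \<in> unit_disc. r \<le> cmod z} \<le> ennreal C * weight_mass \<omega> {z \<in> unit_disc. (1 + r) / 2 \<le> cmod z}"
    by (rule D_hat_annulus_doubling[OF \<omega>D]) blast
  define \<alpha> where "\<alpha> = (\<lambda>n. enn2real (weight_mass \<omega> (annulus n)))"
  have fin: "weight_mass \<omega> E < top" for E using weight_mass_finite[OF \<omega>(1)] by simp
  have \<alpha>: "weight_mass \<omega> (annulus n) = ennreal (\<alpha> n)" for n
    unfolding \<alpha>_def using fin by simp
  have \<alpha>pos: "0 < \<alpha> n" for n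
  proof -
    have s: "annulus n \<in> sets dA" using annulus_borel annulus_subset by (rule borel_sets_dA)
    define c where "c = complex_of_real (1 - (1/2) ^ Suc n)"
    have pw: "0 < (1/2::real) ^ n" "(1/2::real) ^ n \<le> 1" by (simp_all add: power_le_one)
    have cn: "cmod c = 1 - (1/2) ^ Suc n" unfolding c_def using pw by (simp only: norm_of_real) simp
    have b: "ball c ((1/2) ^ Suc n) \<subseteq> annulus n"
    proof
      fix w assume "w \<in> ball c ((1/2) ^ Suc n)"
      then have d: "cmod (c - w) < (1/2) ^ Suc n" by (simp add: dist_norm)
      have "cmod w < 1" using d cn norm_triangle_ineq2[of w c] by (simp add: norm_minus_commute)
      moreover have "1 - (1/2) ^ n \<le> cmod w" using d cn norm_triangle_ineq2[of c w] by simp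
      ultimately show "w \<in> annulus n" by (simp add: annulus_def)
    qed
    have "emeasure dA (ball c ((1/2) ^ Suc n)) = ennreal (((1/2) ^ Suc n)\<^sup>2)"
      using b annulus_subset[of n] by (intro emeasure_dA_ball) auto
    moreover have "emeasure dA (ball c ((1/2) ^ Suc n)) \<le> emeasure dA (annulus n)" by (rule emeasure_mono[OF b s])
    moreover have "0 < ennreal (((1/2) ^ Suc n)\<^sup>2)" by simp
    ultimately have "emeasure dA (annulus n) \<noteq> 0" by (metis not_le le_zero_eq)
    from weight_mass_pos[OF \<omega>(1) pos s this] show ?thesis using \<alpha> by simp
  qed
  have step: "\<alpha> n \<le> C * \<alpha> (Suc n)" for n
  proof -
    have "0 \<le> 1 - (1/2::real) ^ n" "1 - (1/2::real) ^ n < 1" by (simp_all add: power_le_one)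
    from C(2)[OF this] have "weight_mass \<omega> (annulus n) \<le> ennreal C * weight_mass \<omega> (annulus (Suc n))"
      by (simp add: annulus_def add_divide_distrib diff_divide_distrib)
    then show ?thesis using C(1) \<alpha>pos[of "Suc n"] unfolding \<alpha> by (simp add: ennreal_mult[symmetric])
  qed
  have iter: "\<alpha> n \<le> C ^ k * \<alpha> (n + k)" for n k
  proof (induction k)
    case (Suc k)
    have "C ^ k * \<alpha> (n + k) \<le> C ^ k * (C * \<alpha> (Suc (n + k)))" using C step by (intro mult_left_mono) auto
    then show ?case using Suc by (simp add: mult_ac)
  qed simp
  have tent: "weight_mass \<omega> (tent n j) = ennreal (\<alpha> n / 2 ^ n)" for n j
  proof -
    obtain t where t: "weight_mass \<omega> (tent n j) = ennreal t" "0 \<le> t"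
      using fin[of "tent n j"] by (cases "weight_mass \<omega> (tent n j)") auto
    have "ennreal (\<alpha> n) = 2 ^ n * weight_mass \<omega> (tent n j)" using weight_mass_tent[OF \<omega>] \<alpha> by metis
    also have "\<dots> = ennreal (2 ^ n * t)" using t by (simp add: ennreal_mult ennreal_power[symmetric])
    finally have "\<alpha> n = 2 ^ n * t" using \<alpha>pos[of n] t by (simp add: ennreal_inj less_imp_le)
    then show ?thesis using t by simp
  qed
  show thesis by (rule that[OF C(1) \<alpha>pos \<alpha> tent iter])
qed

text \<open>Each tent is covered by eight Carleson squares, each of which lies in two tents of the
  previous generation, whose mass doubling controls. The tent of generation 0 contains the origin
  and is out of reach of Carleson squares; finite total mass takes care of it.\<close>

lemma measure_tent_le:
  assumes \<omega>D: "\<omega> \<in> D_hat" and pos: "AE z in dA. 0 < \<omega> z" and \<mu>: "borel_measure_on_disc \<mu>"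
    and fin: "emeasure \<mu> unit_disc < \<infinity>" and M: "0 \<le> M"
    and S: "\<And>a. a \<in> unit_disc - {0} \<Longrightarrow> emeasure \<mu> (carleson_square a) \<le> ennreal M * weight_mass \<omega> (carleson_square a)"
  obtains M' where "0 < M'" "\<And>n j. emeasure \<mu> (tent n j) \<le> ennreal M' * weight_mass \<omega> (tent n j)"
proof -
  have \<omega>: "weight \<omega>" "radial \<omega>" using \<omega>D by (auto simp: D_hat_def)
  obtain C \<alpha> where C: "1 \<le> C" and \<alpha>: "\<And>n. 0 < \<alpha> n" "\<And>n. weight_mass \<omega> (annulus n) = ennreal (\<alpha> n)"
    and tent: "\<And>n j. weight_mass \<omega> (tent n j) = ennreal (\<alpha> n / 2 ^ n)" and dbl: "\<And>n k. \<alpha> n \<le> C ^ k * \<alpha> (n + k)"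
    using D_hat_tents[OF \<omega>D pos] by blast
  obtain b where b: "emeasure \<mu> unit_disc = ennreal b" "0 \<le> b" using fin by (cases "emeasure \<mu> unit_disc") auto
  \<comment> \<open>The first term serves generation 0. In the second, 8 is the number of squares
    and \<open>4 * C\<close> bounds the mass of two parent tents by that of one tent: 2 for the
    pair, 2 for the halved width, \<open>C\<close> for doubling.\<close>
  define M' where "M' = b / \<alpha> 0 + 8 * M * (4 * C) + 1"
  have p1: "0 \<le> b / \<alpha> 0" "0 \<le> 8 * M * (4 * C)" using b \<alpha>(1)[of 0] M C by auto
  then have M': "0 < M'" unfolding M'_def by (intro add_nonneg_pos add_nonneg_nonneg) auto
  have "emeasure \<mu> (tent n j) \<le> ennreal M' * weight_mass \<omega> (tent n j)" for n j
  proof (cases n)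
    case 0
    have "b = b / \<alpha> 0 * \<alpha> 0" using \<alpha>(1)[of 0] by simp
    also have "\<dots> \<le> M' * \<alpha> 0" using p1 \<alpha>(1)[of 0] by (intro mult_right_mono) (auto simp: M'_def)
    finally have "ennreal b \<le> ennreal (M' * \<alpha> 0)" by (rule ennreal_leI)
    then show ?thesis using M' \<alpha>(1)[of 0] tent[of 0 j] by (simp add: 0 tent_0 b ennreal_mult)
  next
    case (Suc N)
    define \<rho> where "\<rho> = 1 - 3/2 * (1/2::real) ^ n"
    have pw: "0 < (1/2::real) ^ n" "(1/2::real) ^ n \<le> 1/2" using Suc power_decreasing[of 1 n "1/2::real"] by simp_all
    have \<rho>: "0 < \<rho>" "\<rho> < 1" using pw by (auto simp: \<rho>_def)
    define a where "a = (\<lambda>i::nat. rcis \<rho> (2 * pi * of_int j / 2 ^ n + (real i + 1/2) / 2 ^ n))"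
    have ca: "cmod (a i) = \<rho>" for i using \<rho> by (simp add: a_def)
    have a: "0 < cmod (a i)" "cmod (a i) < 1" for i using ca \<rho> by auto
    have sm: "carleson_square (a i) \<in> sets \<mu>" for i
      by (intro sets_borel_measure_on_disc[OF \<mu>] borel_open open_carleson_square a carleson_square_subset)
    have each: "emeasure \<mu> (carleson_square (a i)) \<le> ennreal (M * (4 * C)) * weight_mass \<omega> (tent n j)" for i
    proof -
      have "cmod (a i) = 1 - 3/2 * (1/2) ^ Suc N" by (simp add: ca \<rho>_def Suc)
      then obtain k where k: "carleson_square (a i) \<subseteq> tent N k \<union> tent N (k + 1)"
        by (rule carleson_square_subset_tents)
      have "weight_mass \<omega> (carleson_square (a i)) \<le> weight_mass \<omega> (tent N k \<union> tent N (k + 1))"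
        by (rule weight_mass_mono[OF k])
      also have "\<dots> \<le> (\<integral>\<^sup>+z. ennreal (\<omega> z) * indicator (tent N k) z + ennreal (\<omega> z) * indicator (tent N (k + 1)) z \<partial>dA)"
        unfolding weight_mass_def by (intro nn_integral_mono) (auto simp: indicator_def)
      also have "\<dots> = weight_mass \<omega> (tent N k) + weight_mass \<omega> (tent N (k + 1))"
        unfolding weight_mass_def
      proof (rule nn_integral_add)
        have "tent N j \<in> sets dA" for j
          using tent_borel tent_subset[of N j] annulus_subset[of N] by (intro borel_sets_dA) auto
        then show "(\<lambda>z. ennreal (\<omega> z) * indicator (tent N k) z) \<in> borel_measurable dA"
          "(\<lambda>z. ennreal (\<omega> z) * indicator (tent N (k + 1)) z) \<in> borel_measurable dA"
          using borel_measurable_weight[OF \<omega>(1)] by auto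
      qed
      also have "\<dots> = ennreal (2 * (\<alpha> N / 2 ^ N))" using \<alpha>(1)[of N] by (simp add: tent ennreal_plus[symmetric] del: ennreal_plus)
      also have "\<dots> \<le> ennreal (4 * C * (\<alpha> n / 2 ^ n))"
      proof (rule ennreal_leI)
        have "\<alpha> N \<le> C * \<alpha> n" using dbl[of N 1] by (simp add: Suc)
        then show "2 * (\<alpha> N / 2 ^ N) \<le> 4 * C * (\<alpha> n / 2 ^ n)" by (simp add: Suc divide_right_mono)
      qed
      finally have w: "weight_mass \<omega> (carleson_square (a i)) \<le> ennreal (4 * C * (\<alpha> n / 2 ^ n))" .
      have "emeasure \<mu> (carleson_square (a i)) \<le> ennreal M * weight_mass \<omega> (carleson_square (a i))"
        by (rule S) (use a[of i] in auto)
      also have "\<dots> \<le> ennreal M * ennreal (4 * C * (\<alpha> n / 2 ^ n))" by (rule mult_left_mono[OF w]) simp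
      also have "\<dots> = ennreal (M * (4 * C)) * weight_mass \<omega> (tent n j)"
        using M C \<alpha>(1)[of n] by (simp add: tent ennreal_mult[symmetric] mult_ac)
      finally show ?thesis .
    qed
    have "tent n j \<subseteq> (\<Union>i\<in>{0..<8}. carleson_square (a i))"
      using tent_subset_carleson_squares[of n j] Suc by (simp add: a_def \<rho>_def)
    then have "emeasure \<mu> (tent n j) \<le> emeasure \<mu> (\<Union>i\<in>{0..<8}. carleson_square (a i))"
      using sm by (intro emeasure_mono) auto
    also have "\<dots> \<le> (\<Sum>i\<in>{0..<8}. emeasure \<mu> (carleson_square (a i)))"
      using sm by (intro emeasure_subadditive_finite) auto
    also have "\<dots> \<le> (\<Sum>i\<in>{0..<8::nat}. ennreal (M * (4 * C)) * weight_mass \<omega> (tent n j))" by (intro sum_mono each)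
    also have "\<dots> = ennreal (8 * M * (4 * C)) * weight_mass \<omega> (tent n j)"
    proof -
      have "8 * ennreal x = ennreal (8 * x)" if "0 \<le> x" for x using that by (simp add: ennreal_mult)
      from this[of "M * (4 * C)"] show ?thesis using M C by (simp add: mult.assoc[symmetric])
    qed
    also have "\<dots> \<le> ennreal M' * weight_mass \<omega> (tent n j)"
      using p1 by (intro mult_right_mono ennreal_leI) (auto simp: M'_def)
    finally show ?thesis .
  qed
  then show thesis by (rule that[OF M'])
qed

section \<open>The majorant for radial doubling weights\<close>

text \<open>The kernel decays with the distance from \<open>z\<close>, and the distance is measured
  in the tree: if \<open>w\<close> is not in or next to the ancestor of \<open>\<zeta>\<close> at
  height \<open>k - 1\<close>, the two points are separated at that scale. Each further generation
  therefore gains a factor \<open>(1/2)^(\<gamma> + 1)\<close>. All three neighbours enter because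
  close points may lie in different branches of the tree.\<close>

lemma circle_kernel_le:
  assumes \<zeta>: "cmod \<zeta> < 1" and z: "z \<in> ball \<zeta> (1/6 * (1 - cmod \<zeta>))"
    and w: "w \<in> annulus (level \<zeta> + 3)"
  defines "n \<equiv> level \<zeta>"
  shows "cmod z < cmod w"
    "circle_kernel \<gamma> (cmod w) z w \<le> (\<Sum>k\<le>n. \<Sum>i\<in>{-1, 0, 1}. 4 * 16 ^ \<gamma> * 2 ^ n * ((1/2) ^ (\<gamma> + 1)) ^ k *
        indicator (tent (n - k) (cell (n - k) \<zeta> + i)) w)"
proof -
  define e where "e = (1/2::real) ^ n"
  have e: "0 < e" by (simp add: e_def)
  have l: "1 - e \<le> cmod \<zeta>" "cmod \<zeta> < 1 - e / 2" using level_bounds[OF \<zeta>] by (simp_all add: e_def n_def)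
  have e3: "(1/2::real) ^ (n + 3) = e / 8" by (simp add: e_def power_add power3_eq_cube)
  have "cmod w < 1 \<and> 1 - (1/2) ^ (n + 3) \<le> cmod w" using w by (simp only: annulus_def n_def mem_Collect_eq mem_ball_0)
  then have w1: "cmod w < 1" "1 - e / 8 \<le> cmod w" unfolding e3 by auto
  have zd: "cmod (z - \<zeta>) < 1/6 * (1 - cmod \<zeta>)" using z by (simp add: dist_norm norm_minus_commute)
  have arith1: "5/6 * (1 - b) \<le> 1 - a" if "a - b \<le> d" "d < 1/6 * (1 - b)" for a b d :: real
    using that by (simp add: field_simps)
  have arith2: "1 - a \<le> 7/6 * (1 - b)" if "b - a \<le> d" "d < 1/6 * (1 - b)" for a b d :: real
    using that by (simp add: field_simps)
  have "cmod z - cmod \<zeta> \<le> cmod (z - \<zeta>)" by (rule norm_triangle_ineq2)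
  then have zu: "5/6 * (1 - cmod \<zeta>) \<le> 1 - cmod z" using zd by (rule arith1)
  have "cmod \<zeta> - cmod z \<le> cmod (z - \<zeta>)" using norm_triangle_ineq2[of \<zeta> z] by (simp add: norm_minus_commute)
  then have zl: "1 - cmod z \<le> 7/6 * (1 - cmod \<zeta>)" using zd by (rule arith2)
  have zu': "5/6 - 5/6 * cmod \<zeta> \<le> 1 - cmod z" "1 - cmod z \<le> 7/6 - 7/6 * cmod \<zeta>"
    using zu zl by (simp_all only: right_diff_distrib mult_1_right)
  \<comment> \<open>With \<open>w\<close> three generations closer to the circle,
    \<open>1 - |w|\<close> is at most \<open>e / 8\<close>, while \<open>1 - |z|\<close> exceeds
    \<open>5/12 * e\<close>; the difference leaves more than \<open>e / 4\<close>.\<close>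
  have gap: "e / 4 \<le> cmod w - cmod z" using zu' l w1 e by linarith
  then show "cmod z < cmod w" using e by linarith
  have base: "e / 4 \<le> cmod (w - z)" using gap norm_triangle_ineq2[of w z] by linarith
  have top: "w \<in> tent (n - n) (cell (n - n) \<zeta> + 0)" using w1 by (simp add: tent_0)
  define Q where "Q = (\<lambda>k. \<exists>i\<in>{-1, 0, 1}. w \<in> tent (n - k) (cell (n - k) \<zeta> + i))"
  have Qn: "Q n" unfolding Q_def using top by (intro bexI[of _ 0]) auto
  \<comment> \<open>The number of generations to climb until \<open>w\<close> is in or next to the
    ancestor of \<open>\<zeta>\<close>. It exists since the tent of generation 0 is the whole disc.
    Failure at height \<open>k - 1\<close> gives the separation, from which the displacement of
    \<open>z\<close> against \<open>\<zeta>\<close>, at most 1/6 of the scale, is subtracted: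
    \<open>2/3 - 1/6 = 1/2\<close>.\<close>
  define k where "k = (LEAST k. Q k)"
  have kn: "k \<le> n" unfolding k_def using Qn by (rule Least_le)
  have Qk: "Q k" unfolding k_def using Qn by (rule LeastI)
  have dist: "2 ^ k * e / 4 \<le> cmod (w - z)"
  proof (cases k)
    case 0
    then show ?thesis using base by simp
  next
    case (Suc k')
    have nQ: "\<not> Q k'" unfolding k_def[symmetric] using not_less_Least[of k' Q] Suc by (simp add: k_def)
    define m where "m = n - k'"
    have mn: "m \<le> n" by (simp add: m_def)
    have em: "(1/2::real) ^ m = 2 ^ k' * e"
    proof -
      have "n = m + k'" using kn Suc by (simp add: m_def)
      then show ?thesis by (simp add: e_def power_add power_divide)
    qed
    have "w \<in> annulus m" using w annulus_mono[of m "level \<zeta> + 3"] mn by (auto simp: n_def)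
    moreover have "\<zeta> \<in> annulus m" using annulus_iff_level[OF \<zeta>] mn by (simp add: n_def)
    ultimately have "(1/2) ^ m * (2/3) \<le> cmod (w - \<zeta>)"
      by (rule cell_separation) (use nQ in \<open>auto simp: Q_def m_def\<close>)
    moreover have "cmod (z - \<zeta>) \<le> 1/6 * (1/2) ^ m"
    proof -
      have "e \<le> (1/2) ^ m" unfolding e_def using mn by (intro power_decreasing) auto
      then show ?thesis using zd l by simp
    qed
    moreover have "cmod (w - \<zeta>) \<le> cmod (w - z) + cmod (z - \<zeta>)" using norm_triangle_ineq[of "w - z" "z - \<zeta>"] by simp
    ultimately have "1/2 * (1/2) ^ m \<le> cmod (w - z)" by linarith
    then show ?thesis unfolding em by (simp add: Suc mult.commute)
  qed
  have pos: "0 < 2 ^ k * e / 4" using e by simp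
  have "0 \<le> cmod w - cmod z" "cmod w - cmod z \<le> 2 * e" using gap e zu' l w1 by linarith+
  then have s1: "0 \<le> 2 * (cmod w - cmod z)" "2 * (cmod w - cmod z) \<le> 4 * e" by simp_all
  have kern: "circle_kernel \<gamma> (cmod w) z w \<le> (4 * e / (2 ^ k * e / 4)) ^ \<gamma> * (1 / (2 ^ k * e / 4))"
    unfolding circle_kernel_def
  proof (rule mult_mono)
    show "(2 * (cmod w - cmod z) / cmod (w - z)) ^ \<gamma> \<le> (4 * e / (2 ^ k * e / 4)) ^ \<gamma>"
      using s1 dist pos by (intro power_mono frac_le divide_nonneg_nonneg) auto
    show "cmod w / cmod (w - z) \<le> 1 / (2 ^ k * e / 4)" using w1 dist pos by (intro frac_le) auto
    show "0 \<le> (4 * e / (2 ^ k * e / 4)) ^ \<gamma>" using e by simp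
  qed simp
  have "4 * e / (2 ^ k * e / 4) = 16 * (1/2) ^ k" using e by (simp add: power_divide)
  moreover have "1 / (2 ^ k * e / 4) = 4 * 2 ^ n * (1/2) ^ k" by (simp add: e_def power_divide)
  ultimately have "(4 * e / (2 ^ k * e / 4)) ^ \<gamma> * (1 / (2 ^ k * e / 4)) = 16 ^ \<gamma> * ((1/2) ^ k) ^ \<gamma> * (4 * 2 ^ n * (1/2) ^ k)"
    by (simp only: power_mult_distrib)
  also have "\<dots> = 4 * 16 ^ \<gamma> * 2 ^ n * ((1/2) ^ (\<gamma> + 1)) ^ k"
  proof -
    have "((1/2::real) ^ (\<gamma> + 1)) ^ k = ((1/2) ^ k) ^ \<gamma> * (1/2) ^ k"
      by (simp only: power_mult[symmetric] power_add[symmetric]) (simp add: algebra_simps)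
    then show ?thesis by (simp only: mult_ac)
  qed
  finally have kern2: "circle_kernel \<gamma> (cmod w) z w \<le> 4 * 16 ^ \<gamma> * 2 ^ n * ((1/2) ^ (\<gamma> + 1)) ^ k" using kern by simp
  define T where "T = (\<lambda>k i. 4 * 16 ^ \<gamma> * 2 ^ n * ((1/2) ^ (\<gamma> + 1)) ^ k * indicator (tent (n - k) (cell (n - k) \<zeta> + i)) w :: real)"
  have T0: "0 \<le> T k i" for k i by (simp add: T_def)
  obtain i where i: "i \<in> {-1, 0, 1}" "w \<in> tent (n - k) (cell (n - k) \<zeta> + i)" using Qk unfolding Q_def by blast
  have "circle_kernel \<gamma> (cmod w) z w \<le> T k i" using kern2 i(2) by (simp add: T_def)
  also have "\<dots> \<le> (\<Sum>i\<in>{-1, 0, 1}. T k i)" using i(1) T0 by (intro member_le_sum) auto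
  also have "\<dots> \<le> (\<Sum>k\<le>n. \<Sum>i\<in>{-1, 0, 1}. T k i)" using kn T0
    by (intro member_le_sum[of k "{..n}" "\<lambda>k. \<Sum>i\<in>{-1, 0, 1}. T k i"] sum_nonneg) auto
  finally show "circle_kernel \<gamma> (cmod w) z w \<le> (\<Sum>k\<le>n. \<Sum>i\<in>{-1, 0, 1}. 4 * 16 ^ \<gamma> * 2 ^ n * ((1/2) ^ (\<gamma> + 1)) ^ k *
        indicator (tent (n - k) (cell (n - k) \<zeta> + i)) w)"
    by (simp only: T_def)
qed

text \<open>The Forelli-type kernel with a large exponent \<open>\<gamma>\<close> beats the doubling constant of the weight, so
  the averages over the ancestors enter with geometrically decaying coefficients.\<close>

lemma D_hat_pointwise:
  fixes \<beta> :: real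
  assumes \<omega>D: "\<omega> \<in> D_hat" and pos: "AE z in dA. 0 < \<omega> z" and \<beta>: "0 < \<beta>"
  obtains B where "0 < B" "\<And>f \<zeta> z. f holomorphic_on unit_disc \<Longrightarrow> cmod \<zeta> < 1 \<Longrightarrow> z \<in> ball \<zeta> (1/6 * (1 - cmod \<zeta>)) \<Longrightarrow>
     ennreal (cmod (f z) powr \<beta>) \<le> (\<Sum>k\<le>level \<zeta>. \<Sum>i\<in>{-1, 0, 1}. ennreal (B * (1/4) ^ k) *
       ((\<integral>\<^sup>+w. ennreal (\<omega> w) * ennreal (cmod (f w) powr \<beta>) * indicator (tent (level \<zeta> - k) (cell (level \<zeta> - k) \<zeta> + i)) w \<partial>dA) /
         weight_mass \<omega> (tent (level \<zeta> - k) (cell (level \<zeta> - k) \<zeta> + i))))"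
proof -
  have \<omega>: "weight \<omega>" "radial \<omega>" using \<omega>D by (auto simp: D_hat_def)
  obtain C \<alpha> where C: "1 \<le> C" and \<alpha>: "\<And>n. 0 < \<alpha> n" "\<And>n. weight_mass \<omega> (annulus n) = ennreal (\<alpha> n)"
    and tent: "\<And>n j. weight_mass \<omega> (tent n j) = ennreal (\<alpha> n / 2 ^ n)" and dbl: "\<And>n k. \<alpha> n \<le> C ^ k * \<alpha> (n + k)"
    using D_hat_tents[OF \<omega>D pos] by blast
  \<comment> \<open>Climbing \<open>k\<close> generations multiplies the coefficient by
    \<open>(C / 2^\<gamma>)^k\<close>; this choice makes the ratio less than 1/4.\<close>
  obtain \<gamma> :: nat where \<gamma>: "4 * C < 2 ^ \<gamma>" using real_arch_pow[of 2 "4 * C"] by auto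
  \<comment> \<open>The constant of the kernel bound together with the doubling cost of the three
    generations between \<open>\<zeta>\<close> and the averaged annulus.\<close>
  define c where "c = 4 * 16 ^ \<gamma> * C ^ 3"
  have c: "0 < c" using C by (simp add: c_def)
  show thesis
  proof (rule that[OF c])
    fix f \<zeta> z
    assume f: "f holomorphic_on unit_disc" and \<zeta>: "cmod \<zeta> < 1" and z: "z \<in> ball \<zeta> (1/6 * (1 - cmod \<zeta>))"
    note borel_measurable_weight[OF \<omega>(1), measurable]
    note borel_measurable_holomorphic_disc(1)[OF f, measurable]
    define n where "n = level \<zeta>"
    have tm[measurable]: "tent m j \<in> sets dA" for m j
      using tent_borel tent_subset[of m j] annulus_subset[of m] by (intro borel_sets_dA) auto
    have [measurable]: "annulus m \<in> sets dA" for m using annulus_borel annulus_subset by (rule borel_sets_dA)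
    \<comment> \<open>The weight restricted to radii well beyond \<open>z\<close>. Its total mass
      \<open>\<alpha> (n + 3)\<close> is what the submean inequality is divided by.\<close>
    define \<sigma> where "\<sigma> = (\<lambda>w. ennreal (\<omega> w) * indicator (annulus (n + 3)) w)"
    have sm: "\<sigma> \<in> borel_measurable dA" unfolding \<sigma>_def by measurable
    define I where "I = (\<lambda>m j. \<integral>\<^sup>+w. ennreal (\<omega> w) * ennreal (cmod (f w) powr \<beta>) * indicator (tent m j) w \<partial>dA)"
    define D where "D = (\<lambda>k. 4 * 16 ^ \<gamma> * 2 ^ n * ((1/2::real) ^ (\<gamma> + 1)) ^ k)"
    have D0: "0 \<le> D k" for k by (simp add: D_def)
    have "ennreal (cmod (f z) powr \<beta>) * (\<integral>\<^sup>+w. \<sigma> w \<partial>dA) \<le>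
      (\<integral>\<^sup>+w. \<sigma> w * ennreal (cmod (f w) powr \<beta> * circle_kernel \<gamma> (cmod w) z w) \<partial>dA)"
    proof (rule holomorphic_radial_submean[OF f \<beta> sm])
      fix w :: complex assume w: "cmod w < 1"
      show "\<sigma> w = \<sigma> (of_real (cmod w))"
        using radial_cmod[OF \<omega>(2) w] by (simp add: \<sigma>_def annulus_def indicator_def)
      assume "\<sigma> w \<noteq> 0"
      then have "w \<in> annulus (level \<zeta> + 3)" by (auto simp: \<sigma>_def n_def indicator_eq_0_iff)
      then show "cmod z < cmod w \<and> cmod w < 1" using circle_kernel_le(1)[OF \<zeta> z] w by simp
    qed
    also have "\<dots> \<le> (\<integral>\<^sup>+w. (\<Sum>k\<le>n. \<Sum>i\<in>{-1, 0, 1}. ennreal (D k) * (ennreal (\<omega> w) * ennreal (cmod (f w) powr \<beta>) *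
         indicator (tent (n - k) (cell (n - k) \<zeta> + i)) w)) \<partial>dA)"
    proof (rule nn_integral_mono)
      fix w
      show "\<sigma> w * ennreal (cmod (f w) powr \<beta> * circle_kernel \<gamma> (cmod w) z w) \<le> (\<Sum>k\<le>n. \<Sum>i\<in>{-1, 0, 1}. ennreal (D k) * (ennreal (\<omega> w) * ennreal (cmod (f w) powr \<beta>) *
         indicator (tent (n - k) (cell (n - k) \<zeta> + i)) w))"
      proof (cases "w \<in> annulus (n + 3)")
        case True
        have "circle_kernel \<gamma> (cmod w) z w \<le> (\<Sum>k\<le>n. \<Sum>i\<in>{-1, 0, 1}. D k * indicator (tent (n - k) (cell (n - k) \<zeta> + i)) w)"
          using circle_kernel_le(2)[OF \<zeta> z] True unfolding n_def D_def by simp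
        then have "ennreal (circle_kernel \<gamma> (cmod w) z w) \<le> ennreal (\<Sum>k\<le>n. \<Sum>i\<in>{-1, 0, 1}. D k * indicator (tent (n - k) (cell (n - k) \<zeta> + i)) w)"
          by (rule ennreal_leI)
        also have "\<dots> = (\<Sum>k\<le>n. ennreal (\<Sum>i\<in>{-1, 0, 1}. D k * indicator (tent (n - k) (cell (n - k) \<zeta> + i)) w))"
          by (rule sum_ennreal[symmetric]) (intro sum_nonneg mult_nonneg_nonneg D0, simp)
        also have "\<dots> = (\<Sum>k\<le>n. \<Sum>i\<in>{-1, 0, 1}. ennreal (D k * indicator (tent (n - k) (cell (n - k) \<zeta> + i)) w))"
          by (intro sum.cong refl sum_ennreal[symmetric] mult_nonneg_nonneg D0) simp
        finally have "ennreal (circle_kernel \<gamma> (cmod w) z w) \<le> (\<Sum>k\<le>n. \<Sum>i\<in>{-1, 0, 1}. ennreal (D k * indicator (tent (n - k) (cell (n - k) \<zeta> + i)) w))" .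
        then have "ennreal (\<omega> w) * ennreal (cmod (f w) powr \<beta>) * ennreal (circle_kernel \<gamma> (cmod w) z w) \<le>
           ennreal (\<omega> w) * ennreal (cmod (f w) powr \<beta>) * (\<Sum>k\<le>n. \<Sum>i\<in>{-1, 0, 1}. ennreal (D k * indicator (tent (n - k) (cell (n - k) \<zeta> + i)) w))"
          by (rule mult_left_mono) simp
        also have "\<dots> = (\<Sum>k\<le>n. \<Sum>i\<in>{-1, 0, 1}. ennreal (D k) * (ennreal (\<omega> w) * ennreal (cmod (f w) powr \<beta>) *
          indicator (tent (n - k) (cell (n - k) \<zeta> + i)) w))"
          unfolding sum_distrib_left using D0 by (intro sum.cong refl) (simp add: ennreal_mult' mult_ac indicator_def)
        finally show ?thesis using True by (simp only: \<sigma>_def indicator_simps mult_1_right ennreal_mult' powr_ge_zero mult.assoc)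
      qed (simp add: \<sigma>_def)
    qed
    also have "\<dots> = (\<Sum>k\<le>n. \<Sum>i\<in>{-1, 0, 1}. ennreal (D k) * I (n - k) (cell (n - k) \<zeta> + i))"
    proof -
      define P where "P = (\<lambda>k i w. ennreal (\<omega> w) * ennreal (cmod (f w) powr \<beta>) * indicator (tent (n - k) (cell (n - k) \<zeta> + i)) w)"
      have [measurable]: "P k i \<in> borel_measurable dA" for k i unfolding P_def by measurable
      have "(\<integral>\<^sup>+w. (\<Sum>k\<le>n. \<Sum>i\<in>{-1, 0, 1}. ennreal (D k) * P k i w) \<partial>dA) = (\<Sum>k\<le>n. \<integral>\<^sup>+w. (\<Sum>i\<in>{-1, 0, 1}. ennreal (D k) * P k i w) \<partial>dA)"
        by (rule nn_integral_sum) measurable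
      also have "\<dots> = (\<Sum>k\<le>n. \<Sum>i\<in>{-1, 0, 1}. \<integral>\<^sup>+w. ennreal (D k) * P k i w \<partial>dA)"
        by (intro sum.cong refl nn_integral_sum) measurable
      also have "\<dots> = (\<Sum>k\<le>n. \<Sum>i\<in>{-1, 0, 1}. ennreal (D k) * (\<integral>\<^sup>+w. P k i w \<partial>dA))"
        by (intro sum.cong refl nn_integral_cmult) measurable
      finally show ?thesis by (simp only: P_def I_def)
    qed
    finally have le: "ennreal (cmod (f z) powr \<beta>) * ennreal (\<alpha> (n + 3)) \<le> (\<Sum>k\<le>n. \<Sum>i\<in>{-1, 0, 1}. ennreal (D k) * I (n - k) (cell (n - k) \<zeta> + i))"
      using \<alpha>(2)[of "n + 3"] by (simp add: \<sigma>_def weight_mass_def)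
    have "ennreal (cmod (f z) powr \<beta>) = ennreal (cmod (f z) powr \<beta>) * ennreal (\<alpha> (n + 3)) * ennreal (1 / \<alpha> (n + 3))"
      using \<alpha>(1)[of "n + 3"] by (simp add: mult.assoc ennreal_mult[symmetric])
    also have "\<dots> \<le> (\<Sum>k\<le>n. \<Sum>i\<in>{-1, 0, 1}. ennreal (D k) * I (n - k) (cell (n - k) \<zeta> + i)) * ennreal (1 / \<alpha> (n + 3))"
      by (rule mult_right_mono[OF le]) simp
    also have "\<dots> = (\<Sum>k\<le>n. \<Sum>i\<in>{-1, 0, 1}. ennreal (D k / \<alpha> (n + 3)) * I (n - k) (cell (n - k) \<zeta> + i))"
      unfolding sum_distrib_right
    proof (intro sum.cong refl)
      fix k i
      have "ennreal (D k / \<alpha> (n + 3)) = ennreal (D k) * ennreal (1 / \<alpha> (n + 3))"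
        using D0[of k] by (subst ennreal_mult'[symmetric]) auto
      then show "ennreal (D k) * I (n - k) (cell (n - k) \<zeta> + i) * ennreal (1 / \<alpha> (n + 3)) = ennreal (D k / \<alpha> (n + 3)) * I (n - k) (cell (n - k) \<zeta> + i)"
        by (simp only: mult_ac)
    qed
    also have "\<dots> \<le> (\<Sum>k\<le>n. \<Sum>i\<in>{-1, 0, 1}. ennreal (c * (1/4) ^ k) * (I (n - k) (cell (n - k) \<zeta> + i) / weight_mass \<omega> (tent (n - k) (cell (n - k) \<zeta> + i))))"
    proof (intro sum_mono)
      fix k i assume "k \<in> {..n}"
      then have k: "k \<le> n" by simp
      define a where "a = \<alpha> (n - k) / 2 ^ (n - k)"
      have a: "0 < a" using \<alpha>(1) by (simp add: a_def)
      \<comment> \<open>Doubling runs from the generation of the ancestor, \<open>n - k\<close>, to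
        that of the averaged annulus, \<open>n + 3\<close>.\<close>
      have "\<alpha> (n - k) \<le> C ^ (k + 3) * \<alpha> (n + 3)" using dbl[of "n - k" "k + 3"] k by simp
      then have "D k * a \<le> D k * (C ^ (k + 3) * \<alpha> (n + 3) / 2 ^ (n - k))"
        unfolding a_def by (intro mult_left_mono divide_right_mono D0) auto
      also have "\<dots> = c * (C / 2 ^ \<gamma>) ^ k * \<alpha> (n + 3)"
      proof -
        have "(2::real) ^ n = 2 ^ (n - k) * 2 ^ k" using k by (simp add: power_add[symmetric])
        then have "D k = 4 * 16 ^ \<gamma> * (2 ^ (n - k) * 2 ^ k) * ((1/2) ^ \<gamma> * (1/2)) ^ k" by (simp add: D_def mult.commute)
        also have "\<dots> = 4 * 16 ^ \<gamma> * 2 ^ (n - k) * (1 / 2 ^ \<gamma>) ^ k" by (simp add: power_mult_distrib power_divide)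
        finally show ?thesis by (simp add: c_def power_add power_divide)
      qed
      also have "\<dots> \<le> c * (1/4) ^ k * \<alpha> (n + 3)"
        using \<gamma> C c \<alpha>(1)[of "n + 3"] by (intro mult_right_mono mult_left_mono power_mono) (auto simp: field_simps)
      finally have "D k / \<alpha> (n + 3) \<le> c * (1/4) ^ k / a" using a \<alpha>(1)[of "n + 3"] by (simp add: field_simps)
      then have "ennreal (D k / \<alpha> (n + 3)) \<le> ennreal (c * (1/4) ^ k / a)" by (rule ennreal_leI)
      also have "\<dots> = ennreal (c * (1/4) ^ k) / ennreal a" using a c by (intro divide_ennreal[symmetric]) auto
      finally have "ennreal (D k / \<alpha> (n + 3)) * I (n - k) (cell (n - k) \<zeta> + i) \<le> ennreal (c * (1/4) ^ k) / ennreal a * I (n - k) (cell (n - k) \<zeta> + i)"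
        by (rule mult_right_mono) simp
      then show "ennreal (D k / \<alpha> (n + 3)) * I (n - k) (cell (n - k) \<zeta> + i) \<le> ennreal (c * (1/4) ^ k) * (I (n - k) (cell (n - k) \<zeta> + i) / weight_mass \<omega> (tent (n - k) (cell (n - k) \<zeta> + i)))"
        by (simp add: tent a_def divide_ennreal_def mult_ac)
    qed
    finally show "ennreal (cmod (f z) powr \<beta>) \<le> (\<Sum>k\<le>level \<zeta>. \<Sum>i\<in>{-1, 0, 1}. ennreal (c * (1/4) ^ k) *
       ((\<integral>\<^sup>+w. ennreal (\<omega> w) * ennreal (cmod (f w) powr \<beta>) * indicator (tent (level \<zeta> - k) (cell (level \<zeta> - k) \<zeta> + i)) w \<partial>dA) /
         weight_mass \<omega> (tent (level \<zeta> - k) (cell (level \<zeta> - k) \<zeta> + i))))"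
      by (simp only: I_def n_def)
  qed
qed

section \<open>Weighted integrals over tents and the embedding for the tree of tents\<close>

definition weighted_integral :: "(complex \<Rightarrow> real) \<Rightarrow> (complex \<Rightarrow> real) \<Rightarrow> complex set \<Rightarrow> real" where
  "weighted_integral \<omega> u X = enn2real (\<integral>\<^sup>+w. ennreal (\<omega> w) * ennreal (u w) * indicator X w \<partial>dA)"

context
  fixes \<omega> u :: "complex \<Rightarrow> real"
  assumes \<omega>: "weight \<omega>" and u: "u \<in> borel_measurable dA" "\<And>z. 0 \<le> u z"
    and fin: "(\<integral>\<^sup>+w. ennreal (\<omega> w) * ennreal ((u w)\<^sup>2) \<partial>dA) < \<infinity>"
begin

lemma weighted_integral_square_finite:
  "(\<integral>\<^sup>+w. ennreal (\<omega> w) * ennreal ((u w)\<^sup>2) * indicator X w \<partial>dA) < \<infinity>"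
proof -
  have "(\<integral>\<^sup>+w. ennreal (\<omega> w) * ennreal ((u w)\<^sup>2) * indicator X w \<partial>dA) \<le> (\<integral>\<^sup>+w. ennreal (\<omega> w) * ennreal ((u w)\<^sup>2) \<partial>dA)"
    by (intro nn_integral_mono) (simp add: indicator_def)
  then show ?thesis using fin by (rule le_less_trans)
qed

text \<open>One inequality with a free parameter gives both later facts: \<open>t = 1/2\<close>
  yields finiteness, and the quotient of integral and mass yields Cauchy-Schwarz.\<close>

lemma weighted_integral_young:
  assumes X: "X \<in> sets dA" and t: "0 \<le> t"
  shows "ennreal (2 * t) * (\<integral>\<^sup>+w. ennreal (\<omega> w) * ennreal (u w) * indicator X w \<partial>dA) \<le>
    (\<integral>\<^sup>+w. ennreal (\<omega> w) * ennreal ((u w)\<^sup>2) * indicator X w \<partial>dA) + ennreal (t\<^sup>2) * weight_mass \<omega> X"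
proof -
  note [measurable] = X u(1) borel_measurable_weight[OF \<omega>]
  have "ennreal (2 * t) * (\<integral>\<^sup>+w. ennreal (\<omega> w) * ennreal (u w) * indicator X w \<partial>dA) =
    (\<integral>\<^sup>+w. ennreal (2 * t) * (ennreal (\<omega> w) * ennreal (u w) * indicator X w) \<partial>dA)"
    by (rule nn_integral_cmult[symmetric]) measurable
  also have "\<dots> \<le> (\<integral>\<^sup>+w. ennreal (\<omega> w) * ennreal ((u w)\<^sup>2) * indicator X w + ennreal (t\<^sup>2) * (ennreal (\<omega> w) * indicator X w) \<partial>dA)"
  proof (rule nn_integral_mono)
    fix w
    have "0 \<le> (u w - t)\<^sup>2" by simp
    then have "2 * t * u w \<le> (u w)\<^sup>2 + t\<^sup>2" by (simp add: power2_eq_square algebra_simps)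
    then have "ennreal (2 * t * u w) \<le> ennreal ((u w)\<^sup>2 + t\<^sup>2)" by (rule ennreal_leI)
    also have "ennreal (2 * t * u w) = ennreal (2 * t) * ennreal (u w)" using t u(2)[of w] by (intro ennreal_mult) auto
    also have "ennreal ((u w)\<^sup>2 + t\<^sup>2) = ennreal ((u w)\<^sup>2) + ennreal (t\<^sup>2)" by (rule ennreal_plus) auto
    finally have "(ennreal (\<omega> w) * indicator X w) * (ennreal (2 * t) * ennreal (u w)) \<le> (ennreal (\<omega> w) * indicator X w) * (ennreal ((u w)\<^sup>2) + ennreal (t\<^sup>2))"
      by (rule mult_left_mono) simp
    then show "ennreal (2 * t) * (ennreal (\<omega> w) * ennreal (u w) * indicator X w) \<le> ennreal (\<omega> w) * ennreal ((u w)\<^sup>2) * indicator X w + ennreal (t\<^sup>2) * (ennreal (\<omega> w) * indicator X w)"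
      by (simp only: distrib_left mult_ac)
  qed
  also have "\<dots> = (\<integral>\<^sup>+w. ennreal (\<omega> w) * ennreal ((u w)\<^sup>2) * indicator X w \<partial>dA) + (\<integral>\<^sup>+w. ennreal (t\<^sup>2) * (ennreal (\<omega> w) * indicator X w) \<partial>dA)"
    by (rule nn_integral_add) measurable
  also have "(\<integral>\<^sup>+w. ennreal (t\<^sup>2) * (ennreal (\<omega> w) * indicator X w) \<partial>dA) = ennreal (t\<^sup>2) * weight_mass \<omega> X"
    unfolding weight_mass_def by (rule nn_integral_cmult) measurable
  finally show ?thesis .
qed

text \<open>Makes \<open>weighted_integral\<close> faithful: \<open>enn2real\<close> would turn an
  infinite integral into 0.\<close>

lemma weighted_integral_finite:
  assumes X: "X \<in> sets dA"
  shows "(\<integral>\<^sup>+w. ennreal (\<omega> w) * ennreal (u w) * indicator X w \<partial>dA) < \<infinity>"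
proof -
  have "ennreal (2 * (1/2)) * (\<integral>\<^sup>+w. ennreal (\<omega> w) * ennreal (u w) * indicator X w \<partial>dA) < \<infinity>"
    by (rule le_less_trans[OF weighted_integral_young[OF X, of "1/2"]])
       (use weighted_integral_square_finite weight_mass_finite[OF \<omega>] in \<open>auto simp: ennreal_mult_less_top\<close>)
  then show ?thesis by simp
qed

lemma weighted_integral_cauchy_schwarz:
  assumes X: "X \<in> sets dA"
  shows "(weighted_integral \<omega> u X)\<^sup>2 \<le> weighted_integral \<omega> (\<lambda>w. (u w)\<^sup>2) X * enn2real (weight_mass \<omega> X)"
proof -
  define G where "G = weighted_integral \<omega> u X"
  define H where "H = weighted_integral \<omega> (\<lambda>w. (u w)\<^sup>2) X"
  define W where "W = enn2real (weight_mass \<omega> X)"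
  have e: "(\<integral>\<^sup>+w. ennreal (\<omega> w) * ennreal (u w) * indicator X w \<partial>dA) = ennreal G"
    "(\<integral>\<^sup>+w. ennreal (\<omega> w) * ennreal ((u w)\<^sup>2) * indicator X w \<partial>dA) = ennreal H"
    "weight_mass \<omega> X = ennreal W"
    using weighted_integral_finite[OF X] weighted_integral_square_finite[of X] weight_mass_finite[OF \<omega>, of X]
    by (simp_all add: G_def H_def W_def weighted_integral_def)
  have nn: "0 \<le> G" "0 \<le> H" "0 \<le> W" by (simp_all add: G_def H_def W_def weighted_integral_def)
  have y: "2 * t * G \<le> H + t\<^sup>2 * W" if "0 \<le> t" for t
    using weighted_integral_young[OF X that] nn that unfolding e
    by (simp add: ennreal_mult[symmetric] ennreal_plus[symmetric] del: ennreal_plus)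
  show ?thesis
  proof (cases "W = 0")
    case True
    have "G = 0"
    proof (rule ccontr)
      assume "G \<noteq> 0"
      then have G: "0 < G" using nn by simp
      \<comment> \<open>With \<open>W = 0\<close> the bound is linear in the parameter; this value
        of it would give \<open>H + 1 \<le> H\<close>.\<close>
      have "0 \<le> (H + 1) / (2 * G)" using G nn by simp
      from y[OF this] show False using G True by simp
    qed
    then show ?thesis using nn by (simp add: G_def H_def W_def)
  next
    case False
    then have W: "0 < W" using nn by simp
    have "2 * (G / W) * G \<le> H + (G / W)\<^sup>2 * W" using nn W by (intro y) simp
    then have "G\<^sup>2 \<le> H * W" using W by (simp add: power2_eq_square field_simps)
    then show ?thesis by (simp add: G_def H_def W_def)
  qed
qed

end

lemma enn2real_integral_diff_Un:
  assumes F: "F \<in> borel_measurable dA" "(\<integral>\<^sup>+w. F w * indicator T w \<partial>dA) < \<infinity>"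
    and s: "T \<in> sets dA" "T1 \<in> sets dA" "T2 \<in> sets dA" "T1 \<subseteq> T" "T2 \<subseteq> T" "T1 \<inter> T2 = {}"
  shows "enn2real (\<integral>\<^sup>+w. F w * indicator T w \<partial>dA) = enn2real (\<integral>\<^sup>+w. F w * indicator (T - T1 - T2) w \<partial>dA) +
    enn2real (\<integral>\<^sup>+w. F w * indicator T1 w \<partial>dA) + enn2real (\<integral>\<^sup>+w. F w * indicator T2 w \<partial>dA)"
proof -
  note [measurable] = F(1) s(1-3)
  have "(\<integral>\<^sup>+w. F w * indicator T w \<partial>dA) = (\<integral>\<^sup>+w. (F w * indicator (T - T1 - T2) w + F w * indicator T1 w) + F w * indicator T2 w \<partial>dA)"
    using s(4-6) by (intro nn_integral_cong) (auto simp: indicator_def)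
  also have "\<dots> = (\<integral>\<^sup>+w. F w * indicator (T - T1 - T2) w + F w * indicator T1 w \<partial>dA) + (\<integral>\<^sup>+w. F w * indicator T2 w \<partial>dA)"
    by (rule nn_integral_add) measurable
  also have "(\<integral>\<^sup>+w. F w * indicator (T - T1 - T2) w + F w * indicator T1 w \<partial>dA) = (\<integral>\<^sup>+w. F w * indicator (T - T1 - T2) w \<partial>dA) + (\<integral>\<^sup>+w. F w * indicator T1 w \<partial>dA)"
    by (rule nn_integral_add) measurable
  finally have eq: "(\<integral>\<^sup>+w. F w * indicator T w \<partial>dA) = (\<integral>\<^sup>+w. F w * indicator (T - T1 - T2) w \<partial>dA) + (\<integral>\<^sup>+w. F w * indicator T1 w \<partial>dA) + (\<integral>\<^sup>+w. F w * indicator T2 w \<partial>dA)" .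
  then have "(\<integral>\<^sup>+w. F w * indicator (T - T1 - T2) w \<partial>dA) < top" "(\<integral>\<^sup>+w. F w * indicator T1 w \<partial>dA) < top" "(\<integral>\<^sup>+w. F w * indicator T2 w \<partial>dA) < top"
    using F(2) by (auto simp: less_top)
  then show ?thesis unfolding eq by (simp add: enn2real_plus)
qed

lemma tent_sets_dA: "tent n j \<in> sets dA"
  using tent_borel tent_subset[of n j] annulus_subset[of n] by (intro borel_sets_dA) auto

lemma D_hat_tent_masses:
  assumes "\<omega> \<in> D_hat" "AE z in dA. 0 < \<omega> z"
  shows "\<exists>\<alpha>. (\<forall>n. 0 < \<alpha> n) \<and> (\<forall>n j. weight_mass \<omega> (tent n j) = ennreal (\<alpha> n / 2 ^ n))"
proof (rule D_hat_tents[OF assms])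
  fix C \<alpha>
  assume "\<And>n. 0 < (\<alpha> n :: real)" "\<And>n j. weight_mass \<omega> (tent n j) = ennreal (\<alpha> n / 2 ^ n)"
  then show ?thesis by (intro exI[of _ \<alpha>]) simp
qed

text \<open>The Bellman argument for the tree of tents. A tent is not the union of its children; the
  remainder \<open>R\<close>, its part away from the boundary, supplies the terms \<open>W0\<close>,
  \<open>G0\<close> and \<open>H0\<close>.\<close>

lemma tent_embedding:
  assumes \<omega>D: "\<omega> \<in> D_hat" and pos: "AE z in dA. 0 < \<omega> z"
    and u: "u \<in> borel_measurable dA" "\<And>z. 0 \<le> u z"
    and fin: "(\<integral>\<^sup>+w. ennreal (\<omega> w) * ennreal ((u w)\<^sup>2) \<partial>dA) < \<infinity>"
    and a: "\<And>n j. 0 \<le> a n j" and car: "\<And>d n j. subtree_sum a d n j \<le> enn2real (weight_mass \<omega> (tent n j))"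
  shows "subtree_sum (\<lambda>n j. a n j * (weighted_integral \<omega> u (tent n j) / enn2real (weight_mass \<omega> (tent n j)))\<^sup>2) d 0 0 \<le>
    4 * enn2real (\<integral>\<^sup>+w. ennreal (\<omega> w) * ennreal ((u w)\<^sup>2) \<partial>dA)"
proof -
  have \<omega>: "weight \<omega>" using \<omega>D by (auto simp: D_hat_def)
  note [measurable] = u(1) borel_measurable_weight[OF \<omega>]
  define W where "W = (\<lambda>n j. enn2real (weight_mass \<omega> (tent n j)))"
  define G where "G = (\<lambda>n j. weighted_integral \<omega> u (tent n j))"
  define H where "H = (\<lambda>n j. weighted_integral \<omega> (\<lambda>w. (u w)\<^sup>2) (tent n j))"
  define R where "R = (\<lambda>n j. tent n j - tent (Suc n) (2 * j) - tent (Suc n) (2 * j + 1))"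
  have Rs: "R n j \<in> sets dA" for n j unfolding R_def by (intro sets.Diff tent_sets_dA)
  note parts = enn2real_integral_diff_Un[OF _ _ tent_sets_dA tent_sets_dA tent_sets_dA tent_children]
  have Wpos: "0 < W n j" for n j
  proof -
    obtain \<alpha> where "\<forall>n. 0 < \<alpha> n" "\<forall>n j. weight_mass \<omega> (tent n j) = ennreal (\<alpha> n / 2 ^ n)"
      using D_hat_tent_masses[OF \<omega>D pos] by blast
    then show ?thesis by (simp add: W_def less_imp_le)
  qed
  have nn: "0 \<le> weighted_integral \<omega> v X" for v X by (simp add: weighted_integral_def)
  have "subtree_sum (\<lambda>n j. a n j * (G n j / W n j)\<^sup>2) d 0 0 \<le> 4 * (H 0 0 - (G 0 0)\<^sup>2 / (W 0 0 + subtree_sum a d 0 0))"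
  proof (rule dyadic_carleson_embedding[OF a Wpos])
    fix n j
    show "0 \<le> H n j" by (simp add: H_def nn)
    show "0 \<le> weighted_integral \<omega> (\<lambda>w. (u w)\<^sup>2) (R n j)" by (rule nn)
    show "0 \<le> enn2real (weight_mass \<omega> (R n j))" by simp
    show "W n j = enn2real (weight_mass \<omega> (R n j)) + W (Suc n) (2 * j) + W (Suc n) (2 * j + 1)"
      unfolding W_def R_def weight_mass_def
      by (rule parts) (use weight_mass_finite[OF \<omega>] in \<open>auto simp: weight_mass_def\<close>)
    show "G n j = weighted_integral \<omega> u (R n j) + G (Suc n) (2 * j) + G (Suc n) (2 * j + 1)"
      unfolding G_def R_def weighted_integral_def
      by (rule parts) (use weighted_integral_finite[OF \<omega> u fin tent_sets_dA] in auto)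
    show "H n j = weighted_integral \<omega> (\<lambda>w. (u w)\<^sup>2) (R n j) + H (Suc n) (2 * j) + H (Suc n) (2 * j + 1)"
      unfolding H_def R_def weighted_integral_def
      by (rule parts) (use weighted_integral_square_finite[OF \<omega> u fin] in auto)
    show "(G n j)\<^sup>2 \<le> H n j * W n j" unfolding G_def H_def W_def
      by (rule weighted_integral_cauchy_schwarz[OF \<omega> u fin tent_sets_dA])
    show "(weighted_integral \<omega> u (R n j))\<^sup>2 \<le> weighted_integral \<omega> (\<lambda>w. (u w)\<^sup>2) (R n j) * enn2real (weight_mass \<omega> (R n j))"
      by (rule weighted_integral_cauchy_schwarz[OF \<omega> u fin Rs])
    show "subtree_sum a d n j \<le> W n j" for d unfolding W_def by (rule car)
  qed
  also have "\<dots> \<le> 4 * H 0 0"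
    using Wpos[of 0 0] subtree_sum_nonneg[of a d 0 0] a by (intro mult_left_mono) auto
  also have "H 0 0 = enn2real (\<integral>\<^sup>+w. ennreal (\<omega> w) * ennreal ((u w)\<^sup>2) \<partial>dA)"
    unfolding H_def weighted_integral_def tent_0 bergman_norm_p_restrict ..
  finally show ?thesis by (simp add: G_def W_def)
qed

section \<open>Shifted ancestors and their Carleson condition\<close>

lemma cell_div: "n \<le> m \<Longrightarrow> cell n z = cell m z div 2 ^ (m - n)"
proof (induction m)
  case (Suc m)
  show ?case
  proof (cases "n = Suc m")
    case False
    then have nm: "n \<le> m" using Suc.prems by simp
    have "cell n z = cell m z div 2 ^ (m - n)" by (rule Suc.IH[OF nm])
    also have "\<dots> = cell (Suc m) z div 2 div 2 ^ (m - n)" by (simp only: cell_Suc[of m])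
    also have "\<dots> = cell (Suc m) z div (2 * 2 ^ (m - n))" by (rule zdiv_zmult2_eq[symmetric]) simp
    also have "2 * 2 ^ (m - n) = (2::int) ^ (Suc m - n)" using nm by (simp add: Suc_diff_le)
    finally show ?thesis .
  qed simp
qed simp

text \<open>Ancestors of neighbouring cells coincide or are neighbours, so a shift by one cell stays
  a shift by at most one at every higher generation.\<close>

lemma div_neighbour:
  assumes "i \<in> {-1, 0, 1}" "(0::int) < D" shows "(x + i) div D - x div D \<in> {-1, 0, 1}"
proof -
  have D: "1 \<le> D" using assms by simp
  have up: "(y + 1) div D \<le> y div D + 1" "y div D \<le> (y + 1) div D" for y
  proof -
    have "(y + 1) div D \<le> (y + D) div D" using D by (intro zdiv_mono1) auto
    then show "(y + 1) div D \<le> y div D + 1" using D by simp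
    show "y div D \<le> (y + 1) div D" using D by (intro zdiv_mono1) auto
  qed
  from up[of x] up[of "x - 1"] show ?thesis using assms(1) by auto
qed

lemma level_set_borel: "{z \<in> unit_disc. level z = n} \<in> sets borel"
proof -
  have "{z \<in> unit_disc. level z = n} = annulus n - annulus (Suc n)"
    using annulus_subset[of n] by (auto simp: annulus_iff_level)
  then show ?thesis using annulus_borel by auto
qed

text \<open>The embedding is applied once for every height \<open>k\<close> and shift
  \<open>i\<close>, with node masses that push each point to the \<open>i\<close>-th neighbour of
  its ancestor \<open>k\<close> generations up. Shifting does not commute with taking ancestors, so
  the pushed mass below a node is not carried by one tent; it is carried by three neighbouring tents
  of the same generation, which explains the normalisation by \<open>3 * M\<close>.\<close>

lemma shifted_tent_sum_le:
  fixes k :: nat and i :: int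
  assumes \<omega>D: "\<omega> \<in> D_hat" and pos: "AE z in dA. 0 < \<omega> z" and \<mu>: "borel_measure_on_disc \<mu>"
    and fin\<mu>: "emeasure \<mu> unit_disc < \<infinity>" and M: "0 < M"
    and car: "\<And>n j. emeasure \<mu> (tent n j) \<le> ennreal M * weight_mass \<omega> (tent n j)"
    and i: "i \<in> {-1, 0, 1}"
  defines "a \<equiv> \<lambda>m j. measure \<mu> {\<zeta> \<in> unit_disc. level \<zeta> = m + k \<and> 2 ^ m dvd cell m \<zeta> + i - j} / (3 * M)"
  shows "subtree_sum a d n j \<le> enn2real (weight_mass \<omega> (tent n j))"
proof -
  have \<omega>: "weight \<omega>" using \<omega>D by (auto simp: D_hat_def)
  have sp: "space \<mu> = unit_disc" by (rule space_borel_measure_on_disc[OF \<mu>])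
  interpret \<mu>: finite_measure \<mu> using fin\<mu> by (intro finite_measureI) (auto simp: sp)
  \<comment> \<open>The points whose shifted ancestor, of generation
    \<open>level \<zeta> - k\<close>, is a descendant of the node \<open>(n, j)\<close> or that node
    itself: the whole mass that a subtree sum at this node can collect.\<close>
  define E where "E = (\<lambda>n j. {\<zeta> \<in> unit_disc. n + k \<le> level \<zeta> \<and> 2 ^ n dvd (cell (level \<zeta> - k) \<zeta> + i) div 2 ^ (level \<zeta> - k - n) - j})"
  define P where "P = (\<lambda>m j. {\<zeta> \<in> unit_disc. level \<zeta> = m + k \<and> 2 ^ m dvd cell m \<zeta> + i - j})"
  have Ps: "P m j \<in> sets \<mu>" for m j
  proof (rule sets_borel_measure_on_disc[OF \<mu>])
    have "P m j = {z \<in> unit_disc. level z = m + k} \<inter> {\<zeta>. 2 ^ m dvd cell m \<zeta> + i - j}" by (auto simp: P_def)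
    then show "P m j \<in> sets borel" using level_set_borel cell_measurable[of "\<lambda>c. 2 ^ m dvd c + i - j" m] by auto
  qed (auto simp: P_def)
  have Es: "E n j \<in> sets \<mu>" for n j
  proof (rule sets_borel_measure_on_disc[OF \<mu>])
    have "E n j = (\<Union>m\<in>{n..}. {z \<in> unit_disc. level z = m + k} \<inter> {\<zeta>. 2 ^ n dvd (cell m \<zeta> + i) div 2 ^ (m - n) - j})"
    proof (intro equalityI subsetI)
      fix \<zeta> assume "\<zeta> \<in> E n j"
      then show "\<zeta> \<in> (\<Union>m\<in>{n..}. {z \<in> unit_disc. level z = m + k} \<inter> {\<zeta>. 2 ^ n dvd (cell m \<zeta> + i) div 2 ^ (m - n) - j})"
        by (intro UN_I[of "level \<zeta> - k"]) (auto simp: E_def)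
    qed (auto simp: E_def)
    moreover have "{z \<in> unit_disc. level z = m + k} \<inter> {\<zeta>. 2 ^ n dvd (cell m \<zeta> + i) div 2 ^ (m - n) - j} \<in> sets borel" for m
      using level_set_borel cell_measurable[of "\<lambda>c. 2 ^ n dvd (c + i) div 2 ^ (m - n) - j" m] by auto
    ultimately show "E n j \<in> sets borel" by (simp add: sets.countable_UN')
  qed (auto simp: E_def)
  have PE: "P n j \<subseteq> E n j" for n j by (auto simp: P_def E_def)
  have ES: "E (Suc n) l \<subseteq> E n (l div 2)" for n l
  proof
    fix \<zeta> assume \<zeta>: "\<zeta> \<in> E (Suc n) l"
    define m where "m = level \<zeta> - k"
    have m: "Suc n \<le> m" using \<zeta> by (auto simp: E_def m_def)
    have "2 ^ Suc n dvd (cell m \<zeta> + i) div 2 ^ (m - Suc n) - l" using \<zeta> by (simp add: E_def m_def)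
    then have "2 ^ n dvd (cell m \<zeta> + i) div 2 ^ (m - Suc n) div 2 - l div 2" by (rule dvd_diff_div2(1))
    moreover have "(cell m \<zeta> + i) div 2 ^ (m - Suc n) div 2 = (cell m \<zeta> + i) div 2 ^ (m - n)"
    proof -
      have "(cell m \<zeta> + i) div 2 ^ (m - Suc n) div 2 = (cell m \<zeta> + i) div (2 ^ (m - Suc n) * 2)"
        by (rule zdiv_zmult2_eq[symmetric]) simp
      also have "2 ^ (m - Suc n) * 2 = (2::int) ^ (m - n)" using m by (simp add: Suc_diff_Suc flip: power_Suc2)
      finally show ?thesis .
    qed
    ultimately show "\<zeta> \<in> E n (l div 2)" using \<zeta> by (simp add: E_def m_def)
  qed
  have ES2: "E (Suc n) (2 * j) \<subseteq> E n j" "E (Suc n) (2 * j + 1) \<subseteq> E n j" for n j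
    using ES[of n "2 * j"] ES[of n "2 * j + 1"] by auto
  have d1: "P n j \<inter> E (Suc n) l = {}" for n j l by (auto simp: P_def E_def)
  have d2: "E (Suc n) (2 * j) \<inter> E (Suc n) (2 * j + 1) = {}" for n j
  proof (rule equals0I)
    fix \<zeta> assume "\<zeta> \<in> E (Suc n) (2 * j) \<inter> E (Suc n) (2 * j + 1)"
    moreover define x where "x = (cell (level \<zeta> - k) \<zeta> + i) div 2 ^ (level \<zeta> - k - Suc n)"
    ultimately have c: "2 ^ Suc n dvd x - 2 * j" "2 ^ Suc n dvd x - (2 * j + 1)" by (auto simp: E_def)
    from dvd_diff_div2(2)[OF c(1)] dvd_diff_div2(2)[OF c(2)] show False by presburger
  qed
  have le: "subtree_sum a d n j \<le> measure \<mu> (E n j) / (3 * M)" for d n j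
  proof (induction d arbitrary: n j)
    case (Suc d)
    have "measure \<mu> (P n j) + measure \<mu> (E (Suc n) (2 * j)) + measure \<mu> (E (Suc n) (2 * j + 1)) =
       measure \<mu> (P n j \<union> E (Suc n) (2 * j) \<union> E (Suc n) (2 * j + 1))"
    proof -
      have "(P n j \<union> E (Suc n) (2 * j)) \<inter> E (Suc n) (2 * j + 1) = {}" using d1 d2 by blast
      then have "measure \<mu> ((P n j \<union> E (Suc n) (2 * j)) \<union> E (Suc n) (2 * j + 1)) =
          measure \<mu> (P n j \<union> E (Suc n) (2 * j)) + measure \<mu> (E (Suc n) (2 * j + 1))"
        using Ps Es by (intro \<mu>.finite_measure_Union) auto
      moreover have "measure \<mu> (P n j \<union> E (Suc n) (2 * j)) = measure \<mu> (P n j) + measure \<mu> (E (Suc n) (2 * j))"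
        using Ps Es d1 by (intro \<mu>.finite_measure_Union) auto
      ultimately show ?thesis by simp
    qed
    also have "\<dots> \<le> measure \<mu> (E n j)" using Es PE ES2 by (intro \<mu>.finite_measure_mono) auto
    finally have "measure \<mu> (P n j) / (3 * M) + measure \<mu> (E (Suc n) (2 * j)) / (3 * M) + measure \<mu> (E (Suc n) (2 * j + 1)) / (3 * M) \<le> measure \<mu> (E n j) / (3 * M)"
      using M by (simp add: add_divide_distrib[symmetric] divide_right_mono)
    then show ?case using Suc.IH[of "Suc n" "2 * j"] Suc.IH[of "Suc n" "2 * j + 1"] by (simp add: a_def P_def)
  qed (use M in simp)
  obtain \<alpha> where "\<forall>n. 0 < \<alpha> n" "\<forall>n j. weight_mass \<omega> (tent n j) = ennreal (\<alpha> n / 2 ^ n)"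
    using D_hat_tent_masses[OF \<omega>D pos] by blast
  then have \<alpha>: "0 < \<alpha> n" "weight_mass \<omega> (tent n j) = ennreal (\<alpha> n / 2 ^ n)" for n j by blast+
  have ts: "tent n j \<in> sets \<mu>" for n j
    using tent_borel tent_subset[of n j] annulus_subset[of n] by (intro sets_borel_measure_on_disc[OF \<mu>]) auto
  have mt: "measure \<mu> (tent n j) \<le> M * (\<alpha> n / 2 ^ n)" for n j
  proof -
    have "emeasure \<mu> (tent n j) \<le> ennreal (M * (\<alpha> n / 2 ^ n))"
    proof -
      have "ennreal (M * (\<alpha> n / 2 ^ n)) = ennreal M * ennreal (\<alpha> n / 2 ^ n)"
        using M \<alpha>(1)[of n] by (intro ennreal_mult) auto
      then show ?thesis using car[of n j] by (simp only: \<alpha>(2))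
    qed
    then show ?thesis using M \<alpha>(1)[of n] by (simp add: \<mu>.emeasure_eq_measure)
  qed
  \<comment> \<open>Taking ancestors after the shift, instead of before it, changes the index by at
    most one.\<close>
  have "E n j \<subseteq> (\<Union>i'\<in>{-1, 0, 1}. tent n (j + i'))"
  proof
    fix \<zeta> assume \<zeta>: "\<zeta> \<in> E n j"
    define m where "m = level \<zeta> - k"
    have m: "n \<le> m" "n \<le> level \<zeta>" "cmod \<zeta> < 1" using \<zeta> by (auto simp: E_def m_def)
    define e where "e = (cell m \<zeta> + i) div 2 ^ (m - n) - cell m \<zeta> div 2 ^ (m - n)"
    have e: "e \<in> {-1, 0, 1}" unfolding e_def by (rule div_neighbour[OF i]) simp
    have "2 ^ n dvd (cell m \<zeta> + i) div 2 ^ (m - n) - j" using \<zeta> by (simp add: E_def m_def)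
    then have "2 ^ n dvd cell n \<zeta> - (j + (- e))" by (simp add: e_def cell_div[OF m(1)])
    then have "\<zeta> \<in> tent n (j + (- e))" using m by (simp add: tent_def annulus_iff_level)
    moreover have "- e \<in> {-1, 0, 1}" using e by auto
    ultimately show "\<zeta> \<in> (\<Union>i'\<in>{-1, 0, 1}. tent n (j + i'))" by blast
  qed
  then have "measure \<mu> (E n j) \<le> measure \<mu> (\<Union>i'\<in>{-1, 0, 1}. tent n (j + i'))"
    using ts by (intro \<mu>.finite_measure_mono) auto
  also have "\<dots> \<le> (\<Sum>i'\<in>{-1, 0, 1}. measure \<mu> (tent n (j + i')))"
    using ts by (intro \<mu>.finite_measure_subadditive_finite) auto
  also have "\<dots> \<le> (\<Sum>i'\<in>{-1, 0, 1::int}. M * (\<alpha> n / 2 ^ n))" by (intro sum_mono mt)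
  also have "\<dots> = 3 * M * (\<alpha> n / 2 ^ n)" by simp
  finally have "measure \<mu> (E n j) / (3 * M) \<le> \<alpha> n / 2 ^ n" using M by (simp add: divide_le_eq mult.commute)
  then show ?thesis using le[of d n j] \<alpha>(1)[of n] by (simp add: \<alpha>(2))
qed

lemma sum_quarter_powers_le: "(\<Sum>k\<le>n. (1/4::real) ^ k) \<le> 2"
proof -
  have "(\<Sum>k\<le>n. (1/4::real) ^ k) \<le> 4/3 - 1/3 * (1/4) ^ n" by (induction n) auto
  moreover have "0 \<le> 1/3 * (1/4::real) ^ n" by simp
  ultimately show ?thesis by linarith
qed

text \<open>Cauchy-Schwarz with \<open>(1/4)^k\<close> split as \<open>(1/2)^k * (1/2)^k\<close>: a
  factor 2 bounds the geometric sum and a factor 3 comes from the three shifts. The decay survives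
  on the right-hand side, so the sum over \<open>k\<close> can be integrated.\<close>

lemma square_weighted_sum_le:
  fixes v :: "nat \<Rightarrow> int \<Rightarrow> real"
  shows "(\<Sum>k\<le>n. \<Sum>i\<in>{-1, 0, 1}. (1/4) ^ k * v k i)\<^sup>2 \<le> 6 * (\<Sum>k\<le>n. \<Sum>i\<in>{-1, 0, 1}. (1/4) ^ k * (v k i)\<^sup>2)"
proof -
  define y where "y = (\<lambda>k. \<Sum>i\<in>{-1, 0, 1}. v k i)"
  have q: "(1/4::real) ^ k = (1/2) ^ k * (1/2) ^ k" for k by (simp add: power_mult_distrib[symmetric])
  have y3: "(y k)\<^sup>2 \<le> 3 * (\<Sum>i\<in>{-1, 0, 1}. (v k i)\<^sup>2)" for k
    using Cauchy_Schwarz_ineq_sum[of "\<lambda>_. 1" "v k" "{-1, 0, 1}"] by (simp add: y_def)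
  have "(\<Sum>k\<le>n. \<Sum>i\<in>{-1, 0, 1}. (1/4) ^ k * v k i) = (\<Sum>k\<le>n. (1/2) ^ k * ((1/2) ^ k * y k))"
    unfolding y_def sum_distrib_left q by (intro sum.cong refl) simp
  then have "(\<Sum>k\<le>n. \<Sum>i\<in>{-1, 0, 1}. (1/4) ^ k * v k i)\<^sup>2 \<le> (\<Sum>k\<le>n. ((1/2) ^ k)\<^sup>2) * (\<Sum>k\<le>n. ((1/2) ^ k * y k)\<^sup>2)"
    using Cauchy_Schwarz_ineq_sum[of "\<lambda>k. (1/2) ^ k" "\<lambda>k. (1/2) ^ k * y k" "{..n}"] by simp
  also have "(\<Sum>k\<le>n. ((1/2::real) ^ k)\<^sup>2) = (\<Sum>k\<le>n. (1/4) ^ k)" by (simp only: q power2_eq_square)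
  also have "(\<Sum>k\<le>n. ((1/2) ^ k * y k)\<^sup>2) = (\<Sum>k\<le>n. (1/4) ^ k * (y k)\<^sup>2)"
    by (intro sum.cong refl) (simp only: q power2_eq_square mult_ac)
  also have "(\<Sum>k\<le>n. (1/4) ^ k) * (\<Sum>k\<le>n. (1/4) ^ k * (y k)\<^sup>2) \<le> 2 * (\<Sum>k\<le>n. (1/4) ^ k * (3 * (\<Sum>i\<in>{-1, 0, 1}. (v k i)\<^sup>2)))"
    by (intro mult_mono sum_quarter_powers_le sum_mono mult_left_mono y3 sum_nonneg) auto
  also have "\<dots> = 6 * (\<Sum>k\<le>n. \<Sum>i\<in>{-1, 0, 1}. (1/4) ^ k * (v k i)\<^sup>2)"
    unfolding sum_distrib_left by (intro sum.cong refl) simp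
  finally show ?thesis .
qed

lemma tent_mod: "tent m (j mod 2 ^ m) = tent m j"
proof -
  have "2 ^ m dvd c - j mod 2 ^ m \<longleftrightarrow> 2 ^ m dvd c - j" for c :: int
    by (simp add: mod_eq_dvd_iff[symmetric])
  then show ?thesis by (simp add: tent_def)
qed

text \<open>Grouping the points by the node to which they are pushed turns the integral of the
  squared average into a tree sum with coefficients \<open>3 * M * a\<close>. The embedding bounds
  the tree sum by 4 times the norm, hence \<open>12 * M\<close>, uniformly in \<open>k\<close> and
  \<open>i\<close>.\<close>

lemma shifted_average_integral_le:
  fixes k :: nat and i :: int
  assumes \<omega>D: "\<omega> \<in> D_hat" and pos: "AE z in dA. 0 < \<omega> z" and \<mu>: "borel_measure_on_disc \<mu>"
    and fin\<mu>: "emeasure \<mu> unit_disc < \<infinity>" and M: "0 < M"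
    and car: "\<And>n j. emeasure \<mu> (tent n j) \<le> ennreal M * weight_mass \<omega> (tent n j)"
    and i: "i \<in> {-1, 0, 1}"
    and u: "u \<in> borel_measurable dA" "\<And>z. 0 \<le> u z"
    and fin: "(\<integral>\<^sup>+w. ennreal (\<omega> w) * ennreal ((u w)\<^sup>2) \<partial>dA) < \<infinity>"
  defines "V \<equiv> \<lambda>m j. (weighted_integral \<omega> u (tent m j) / enn2real (weight_mass \<omega> (tent m j)))\<^sup>2"
  defines "Q \<equiv> \<lambda>\<zeta>. if k \<le> level \<zeta> then ennreal (V (level \<zeta> - k) (cell (level \<zeta> - k) \<zeta> + i)) else 0"
  shows "Q \<in> borel_measurable \<mu>"
    and "(\<integral>\<^sup>+\<zeta>. Q \<zeta> \<partial>\<mu>) \<le> ennreal (12 * M) * (\<integral>\<^sup>+w. ennreal (\<omega> w) * ennreal ((u w)\<^sup>2) \<partial>dA)"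
proof -
  have sp: "space \<mu> = unit_disc" by (rule space_borel_measure_on_disc[OF \<mu>])
  interpret \<mu>: finite_measure \<mu> using fin\<mu> by (intro finite_measureI) (auto simp: sp)
  define P where "P = (\<lambda>m j. {\<zeta> \<in> unit_disc. level \<zeta> = m + k \<and> 2 ^ m dvd cell m \<zeta> + i - j})"
  have Ps[measurable]: "P m j \<in> sets \<mu>" for m j
  proof (rule sets_borel_measure_on_disc[OF \<mu>])
    have "P m j = {z \<in> unit_disc. level z = m + k} \<inter> {\<zeta>. 2 ^ m dvd cell m \<zeta> + i - j}" by (auto simp: P_def)
    then show "P m j \<in> sets borel" using level_set_borel cell_measurable[of "\<lambda>c. 2 ^ m dvd c + i - j" m] by auto
  qed (auto simp: P_def)
  \<comment> \<open>One representative of each residue class, so that every tent is counted exactly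
    once.\<close>
  define S where "S = (\<lambda>\<zeta> m. \<Sum>j\<in>{0..<2 ^ m}. ennreal (V m j) * indicator (P m j) \<zeta>)"
  have Sm[measurable]: "(\<lambda>\<zeta>. S \<zeta> m) \<in> borel_measurable \<mu>" for m unfolding S_def by measurable
  have QS: "Q \<zeta> = (\<Sum>m. S \<zeta> m)" if \<zeta>: "cmod \<zeta> < 1" for \<zeta>
  proof -
    have other: "S \<zeta> m = 0" if "level \<zeta> \<noteq> m + k" for m
      unfolding S_def by (intro sum.neutral) (auto simp: P_def that)
    have at_level: "S \<zeta> m = ennreal (V m (cell m \<zeta> + i))" if l: "level \<zeta> = m + k" for m
    proof -
      define j0 where "j0 = (cell m \<zeta> + i) mod 2 ^ m"
      have j0: "j0 \<in> {0..<2 ^ m}" by (simp add: j0_def)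
      have ind: "\<zeta> \<in> P m j \<longleftrightarrow> j = j0" if "j \<in> {0..<2 ^ m}" for j
        using that l \<zeta> unfolding P_def j0_def mod_eq_dvd_iff[symmetric] by (auto simp: mod_pos_pos_trivial)
      have "S \<zeta> m = (\<Sum>j\<in>{0..<2 ^ m}. if j = j0 then ennreal (V m j0) else 0)"
        unfolding S_def using ind by (intro sum.cong refl) (auto simp: indicator_def)
      also have "\<dots> = ennreal (V m j0)" using j0 by simp
      also have "V m j0 = V m (cell m \<zeta> + i)" unfolding V_def j0_def tent_mod ..
      finally show ?thesis .
    qed
    show ?thesis
    proof (cases "k \<le> level \<zeta>")
      case True
      then have l: "level \<zeta> = (level \<zeta> - k) + k" by simp
      have "(\<Sum>m. S \<zeta> m) = (\<Sum>m\<in>{level \<zeta> - k}. S \<zeta> m)"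
        using True by (intro suminf_finite other) auto
      then show ?thesis using at_level[OF l] True by (simp add: Q_def)
    next
      case False
      then have "S \<zeta> m = 0" for m by (intro other) auto
      then show ?thesis using False by (simp add: Q_def)
    qed
  qed
  have "(\<lambda>\<zeta>. \<Sum>m. S \<zeta> m) \<in> borel_measurable \<mu>" by measurable
  then show "Q \<in> borel_measurable \<mu>" by (rule measurable_cong[THEN iffD1, rotated]) (simp add: QS sp)
  define a where "a = (\<lambda>m j. measure \<mu> {\<zeta> \<in> unit_disc. level \<zeta> = m + k \<and> 2 ^ m dvd cell m \<zeta> + i - j} / (3 * M))"
  have aP: "emeasure \<mu> (P m j) = ennreal (3 * M * a m j)" for m j
    using M by (simp add: a_def P_def \<mu>.emeasure_eq_measure)
  define h where "h = enn2real (\<integral>\<^sup>+w. ennreal (\<omega> w) * ennreal ((u w)\<^sup>2) \<partial>dA)"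
  have h: "(\<integral>\<^sup>+w. ennreal (\<omega> w) * ennreal ((u w)\<^sup>2) \<partial>dA) = ennreal h" "0 \<le> h" using fin by (simp_all add: h_def)
  have a0: "0 \<le> a m j" for m j using M by (simp add: a_def)
  have V0: "0 \<le> V m j" for m j by (simp add: V_def)
  have partial: "(\<Sum>m<d. \<integral>\<^sup>+\<zeta>. S \<zeta> m \<partial>\<mu>) \<le> ennreal (12 * M * h)" for d
  proof -
    have int: "(\<integral>\<^sup>+\<zeta>. S \<zeta> m \<partial>\<mu>) = ennreal (3 * M * (\<Sum>j\<in>{0..<2 ^ m}. a m j * V m j))" for m
    proof -
      have "(\<integral>\<^sup>+\<zeta>. S \<zeta> m \<partial>\<mu>) = (\<Sum>j\<in>{0..<2 ^ m}. \<integral>\<^sup>+\<zeta>. ennreal (V m j) * indicator (P m j) \<zeta> \<partial>\<mu>)"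
        unfolding S_def by (rule nn_integral_sum) measurable
      also have "\<dots> = (\<Sum>j\<in>{0..<2 ^ m}. ennreal (V m j) * ennreal (3 * M * a m j))"
        by (intro sum.cong refl) (simp add: nn_integral_cmult aP)
      also have "\<dots> = (\<Sum>j\<in>{0..<2 ^ m}. ennreal (3 * M * (a m j * V m j)))"
      proof (intro sum.cong refl)
        fix j
        have "ennreal (V m j) * ennreal (3 * M * a m j) = ennreal (V m j * (3 * M * a m j))"
          using M a0[of m j] V0[of m j] by (intro ennreal_mult[symmetric]) auto
        also have "V m j * (3 * M * a m j) = 3 * M * (a m j * V m j)" by simp
        finally show "ennreal (V m j) * ennreal (3 * M * a m j) = ennreal (3 * M * (a m j * V m j))" .
      qed
      also have "\<dots> = ennreal (\<Sum>j\<in>{0..<2 ^ m}. 3 * M * (a m j * V m j))"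
        using M a0 V0 by (intro sum_ennreal) auto
      finally show ?thesis by (simp only: sum_distrib_left)
    qed
    have "(\<Sum>m<d. \<integral>\<^sup>+\<zeta>. S \<zeta> m \<partial>\<mu>) = ennreal (\<Sum>m<d. 3 * M * (\<Sum>j\<in>{0..<2 ^ m}. a m j * V m j))"
      unfolding int using M a0 V0 by (intro sum_ennreal mult_nonneg_nonneg sum_nonneg) auto
    also have "(\<Sum>m<d. 3 * M * (\<Sum>j\<in>{0..<2 ^ m}. a m j * V m j)) = 3 * M * subtree_sum (\<lambda>n j. a n j * V n j) d 0 0"
      unfolding subtree_sum_eq by (simp add: sum_distrib_left)
    also have "\<dots> \<le> 3 * M * (4 * h)"
    proof (rule mult_left_mono)
      show "subtree_sum (\<lambda>n j. a n j * V n j) d 0 0 \<le> 4 * h" unfolding V_def h_def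
        by (rule tent_embedding[OF \<omega>D pos u fin a0]) (unfold a_def, rule shifted_tent_sum_le[OF \<omega>D pos \<mu> fin\<mu> M car i])
    qed (use M in simp)
    finally show ?thesis by (simp add: ennreal_leI mult.assoc)
  qed
  have "(\<integral>\<^sup>+\<zeta>. Q \<zeta> \<partial>\<mu>) = (\<integral>\<^sup>+\<zeta>. (\<Sum>m. S \<zeta> m) \<partial>\<mu>)" by (intro nn_integral_cong QS) (simp add: sp)
  also have "\<dots> = (\<Sum>m. \<integral>\<^sup>+\<zeta>. S \<zeta> m \<partial>\<mu>)" by (rule nn_integral_suminf) measurable
  also have "\<dots> \<le> ennreal (12 * M * h)" by (rule suminf_le_const[OF summableI partial])
  also have "\<dots> = ennreal (12 * M) * (\<integral>\<^sup>+w. ennreal (\<omega> w) * ennreal ((u w)\<^sup>2) \<partial>dA)"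
    using M h by (simp add: ennreal_mult)
  finally show "(\<integral>\<^sup>+\<zeta>. Q \<zeta> \<partial>\<mu>) \<le> ennreal (12 * M) * (\<integral>\<^sup>+w. ennreal (\<omega> w) * ennreal ((u w)\<^sup>2) \<partial>dA)" .
qed

text \<open>Squaring the pointwise bound for the exponent p/2 gives a sum over all ancestors and
  their neighbours. Every height contributes the same bound to the integral, and the geometric
  weights make the series converge.\<close>

lemma D_hat_majorant:
  fixes p M :: real
  assumes p: "0 < p" and \<omega>D: "\<omega> \<in> D_hat" and pos: "AE z in dA. 0 < \<omega> z" and \<mu>: "borel_measure_on_disc \<mu>"
    and fin\<mu>: "emeasure \<mu> unit_disc < \<infinity>" and M: "0 < M"
    and car: "\<And>n j. emeasure \<mu> (tent n j) \<le> ennreal M * weight_mass \<omega> (tent n j)"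
  obtains K :: real where "0 \<le> K"
    "\<And>f. f \<in> bergman_space p \<omega> \<Longrightarrow> \<exists>U\<in>borel_measurable \<mu>.
        (\<forall>\<zeta>\<in>unit_disc. \<forall>z\<in>ball \<zeta> (1/6 * (1 - cmod \<zeta>)). ennreal (cmod (f z) powr p) \<le> U \<zeta>) \<and>
        (\<integral>\<^sup>+z. U z \<partial>\<mu>) \<le> ennreal K * bergman_norm_p p \<omega> f"
proof -
  have \<omega>: "weight \<omega>" using \<omega>D by (auto simp: D_hat_def)
  have p2: "0 < p / 2" using p by simp
  obtain B where B: "0 < B" and pw: "\<And>f \<zeta> z. f holomorphic_on unit_disc \<Longrightarrow> cmod \<zeta> < 1 \<Longrightarrow> z \<in> ball \<zeta> (1/6 * (1 - cmod \<zeta>)) \<Longrightarrow>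
     ennreal (cmod (f z) powr (p/2)) \<le> (\<Sum>k\<le>level \<zeta>. \<Sum>i\<in>{-1, 0, 1}. ennreal (B * (1/4) ^ k) *
       ((\<integral>\<^sup>+w. ennreal (\<omega> w) * ennreal (cmod (f w) powr (p/2)) * indicator (tent (level \<zeta> - k) (cell (level \<zeta> - k) \<zeta> + i)) w \<partial>dA) /
         weight_mass \<omega> (tent (level \<zeta> - k) (cell (level \<zeta> - k) \<zeta> + i))))"
    by (rule D_hat_pointwise[OF \<omega>D pos p2]) (rule that; assumption)
  obtain \<alpha> where "\<forall>n. 0 < \<alpha> n" "\<forall>n j. weight_mass \<omega> (tent n j) = ennreal (\<alpha> n / 2 ^ n)"
    using D_hat_tent_masses[OF \<omega>D pos] by blast
  then have \<alpha>: "0 < \<alpha> n" "weight_mass \<omega> (tent n j) = ennreal (\<alpha> n / 2 ^ n)" for n j by blast+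
  have sp: "space \<mu> = unit_disc" by (rule space_borel_measure_on_disc[OF \<mu>])
  define c where "c = 6 * B\<^sup>2"
  have c: "0 \<le> c" by (simp add: c_def)
  show thesis
  proof (rule that[of "c * (4/3) * (3 * (12 * M))"])
    show "0 \<le> c * (4/3) * (3 * (12 * M))" using c M by simp
    fix f assume fB: "f \<in> bergman_space p \<omega>"
    then have f: "f holomorphic_on unit_disc" and fn: "bergman_norm_p p \<omega> f < \<infinity>" by (auto simp: bergman_space_def)
    define u where "u = (\<lambda>w. cmod (f w) powr (p/2))"
    have u: "u \<in> borel_measurable dA" "\<And>z. 0 \<le> u z"
      using borel_measurable_holomorphic_disc(1)[OF f] by (auto simp: u_def)
    have u2: "(u w)\<^sup>2 = cmod (f w) powr p" for w by (simp add: u_def power2_eq_square powr_add[symmetric])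
    have norm: "(\<integral>\<^sup>+w. ennreal (\<omega> w) * ennreal ((u w)\<^sup>2) \<partial>dA) = bergman_norm_p p \<omega> f"
      unfolding bergman_norm_p_def u2 by (intro nn_integral_cong) (metis ennreal_mult' powr_ge_zero mult.commute)
    have fin: "(\<integral>\<^sup>+w. ennreal (\<omega> w) * ennreal ((u w)\<^sup>2) \<partial>dA) < \<infinity>" unfolding norm by (rule fn)
    define v where "v = (\<lambda>m j. weighted_integral \<omega> u (tent m j) / enn2real (weight_mass \<omega> (tent m j)))"
    have v0: "0 \<le> v m j" for m j by (simp add: v_def weighted_integral_def)
    have ve: "(\<integral>\<^sup>+w. ennreal (\<omega> w) * ennreal (cmod (f w) powr (p/2)) * indicator (tent m j) w \<partial>dA) / weight_mass \<omega> (tent m j) = ennreal (v m j)" for m j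
    proof -
      have "(\<integral>\<^sup>+w. ennreal (\<omega> w) * ennreal (u w) * indicator (tent m j) w \<partial>dA) = ennreal (weighted_integral \<omega> u (tent m j))"
        using weighted_integral_finite[OF \<omega> u fin tent_sets_dA] by (simp add: weighted_integral_def)
      then have I: "(\<integral>\<^sup>+w. ennreal (\<omega> w) * ennreal (cmod (f w) powr (p/2)) * indicator (tent m j) w \<partial>dA)
          = ennreal (weighted_integral \<omega> u (tent m j))" by (simp only: u_def)
      have q: "0 < \<alpha> m / 2 ^ m" using \<alpha>(1)[of m] by simp
      have w0: "0 \<le> weighted_integral \<omega> u (tent m j)" by (simp add: weighted_integral_def)
      show ?thesis unfolding I \<alpha>(2) v_def
        by (simp only: enn2real_ennreal[OF less_imp_le[OF q]] divide_ennreal[OF w0 q])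
    qed
    define Q where "Q = (\<lambda>k i \<zeta>. if k \<le> level \<zeta> then ennreal ((v (level \<zeta> - k) (cell (level \<zeta> - k) \<zeta> + i))\<^sup>2) else 0)"
    have Qm[measurable]: "Q k i \<in> borel_measurable \<mu>" and Qi: "(\<integral>\<^sup>+\<zeta>. Q k i \<zeta> \<partial>\<mu>) \<le> ennreal (12 * M) * bergman_norm_p p \<omega> f"
      if "i \<in> {-1, 0, 1}" for k i
      using shifted_average_integral_le[OF \<omega>D pos \<mu> fin\<mu> M car that u fin, of k] unfolding norm Q_def v_def by blast+
    \<comment> \<open>All three shifts at height \<open>k\<close>. Beyond the level of
      \<open>\<zeta>\<close> the terms vanish, so the infinite series over \<open>k\<close> is
      finite at each point and needs no range depending on \<open>\<zeta>\<close>.\<close>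
    define T where "T = (\<lambda>k \<zeta>. ennreal (c * (1/4) ^ k) * (Q k (-1) \<zeta> + Q k 0 \<zeta> + Q k 1 \<zeta>))"
    have Tm[measurable]: "T k \<in> borel_measurable \<mu>" for k unfolding T_def
      using Qm[of "-1" k] Qm[of 0 k] Qm[of 1 k] by measurable
    define U where "U = (\<lambda>\<zeta>. \<Sum>k. T k \<zeta>)"
    have Um: "U \<in> borel_measurable \<mu>" unfolding U_def by measurable
    have U1: "ennreal (cmod (f z) powr p) \<le> U \<zeta>" if \<zeta>: "cmod \<zeta> < 1" and z: "z \<in> ball \<zeta> (1/6 * (1 - cmod \<zeta>))" for \<zeta> z
    proof -
      define n where "n = level \<zeta>"
      define w where "w = (\<lambda>k i. v (n - k) (cell (n - k) \<zeta> + i))"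
      have w0: "0 \<le> w k i" for k i by (simp add: w_def v0)
      have "ennreal (u z) \<le> (\<Sum>k\<le>n. \<Sum>i\<in>{-1, 0, 1}. ennreal (B * (1/4) ^ k) * ennreal (w k i))"
        using pw[OF f \<zeta> z] unfolding ve by (simp only: u_def w_def n_def)
      also have "\<dots> = ennreal (\<Sum>k\<le>n. \<Sum>i\<in>{-1, 0, 1}. B * (1/4) ^ k * w k i)"
      proof -
        have "(\<Sum>k\<le>n. \<Sum>i\<in>{-1, 0, 1}. ennreal (B * (1/4) ^ k) * ennreal (w k i)) = (\<Sum>k\<le>n. \<Sum>i\<in>{-1, 0, 1}. ennreal (B * (1/4) ^ k * w k i))"
          using B w0 by (intro sum.cong refl ennreal_mult[symmetric]) auto
        also have "\<dots> = (\<Sum>k\<le>n. ennreal (\<Sum>i\<in>{-1, 0, 1}. B * (1/4) ^ k * w k i))"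
          using B w0 by (intro sum.cong refl sum_ennreal) auto
        also have "\<dots> = ennreal (\<Sum>k\<le>n. \<Sum>i\<in>{-1, 0, 1}. B * (1/4) ^ k * w k i)"
          using B w0 by (intro sum_ennreal sum_nonneg) auto
        finally show ?thesis .
      qed
      finally have "u z \<le> (\<Sum>k\<le>n. \<Sum>i\<in>{-1, 0, 1}. B * (1/4) ^ k * w k i)"
        using B w0 by (subst (asm) ennreal_le_iff) (auto intro!: sum_nonneg)
      also have "\<dots> = B * (\<Sum>k\<le>n. \<Sum>i\<in>{-1, 0, 1}. (1/4) ^ k * w k i)" by (simp only: sum_distrib_left mult.assoc)
      finally have "(u z)\<^sup>2 \<le> (B * (\<Sum>k\<le>n. \<Sum>i\<in>{-1, 0, 1}. (1/4) ^ k * w k i))\<^sup>2" using u(2)[of z] by (intro power_mono) auto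
      also have "\<dots> \<le> B\<^sup>2 * (6 * (\<Sum>k\<le>n. \<Sum>i\<in>{-1, 0, 1}. (1/4) ^ k * (w k i)\<^sup>2))"
        unfolding power_mult_distrib by (intro mult_left_mono square_weighted_sum_le) simp
      also have "\<dots> = (\<Sum>k\<le>n. c * (1/4) ^ k * ((w k (-1))\<^sup>2 + (w k 0)\<^sup>2 + (w k 1)\<^sup>2))"
        by (simp add: c_def sum_distrib_left algebra_simps)
      finally have "ennreal (cmod (f z) powr p) \<le> ennreal (\<Sum>k\<le>n. c * (1/4) ^ k * ((w k (-1))\<^sup>2 + (w k 0)\<^sup>2 + (w k 1)\<^sup>2))"
        unfolding u2 by (rule ennreal_leI)
      also have "\<dots> = (\<Sum>k\<le>n. ennreal (c * (1/4) ^ k * ((w k (-1))\<^sup>2 + (w k 0)\<^sup>2 + (w k 1)\<^sup>2)))"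
        using c by (intro sum_ennreal[symmetric]) auto
      also have "\<dots> = (\<Sum>k\<le>n. T k \<zeta>)"
      proof (intro sum.cong refl)
        fix k assume "k \<in> {..n}"
        then have k: "k \<le> level \<zeta>" by (simp add: n_def)
        have "ennreal (c * (1/4) ^ k * ((w k (-1))\<^sup>2 + (w k 0)\<^sup>2 + (w k 1)\<^sup>2)) = ennreal (c * (1/4) ^ k) * ennreal ((w k (-1))\<^sup>2 + (w k 0)\<^sup>2 + (w k 1)\<^sup>2)"
          using c by (intro ennreal_mult) auto
        also have "ennreal ((w k (-1))\<^sup>2 + (w k 0)\<^sup>2 + (w k 1)\<^sup>2) = ennreal ((w k (-1))\<^sup>2) + ennreal ((w k 0)\<^sup>2) + ennreal ((w k 1)\<^sup>2)"
          by (simp add: ennreal_plus)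
        finally show "ennreal (c * (1/4) ^ k * ((w k (-1))\<^sup>2 + (w k 0)\<^sup>2 + (w k 1)\<^sup>2)) = T k \<zeta>"
          using k by (simp only: T_def Q_def w_def n_def if_True)
      qed
      also have "\<dots> \<le> U \<zeta>" unfolding U_def by (rule sum_le_suminf) auto
      finally show ?thesis .
    qed
    have Ti: "(\<integral>\<^sup>+\<zeta>. T k \<zeta> \<partial>\<mu>) \<le> ennreal (c * (1/4) ^ k) * (ennreal (3 * (12 * M)) * bergman_norm_p p \<omega> f)" for k
    proof -
      note [measurable] = Qm[of "-1" k] Qm[of 0 k] Qm[of 1 k]
      have "(\<integral>\<^sup>+\<zeta>. T k \<zeta> \<partial>\<mu>) = ennreal (c * (1/4) ^ k) * (\<integral>\<^sup>+\<zeta>. Q k (-1) \<zeta> + Q k 0 \<zeta> + Q k 1 \<zeta> \<partial>\<mu>)"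
        unfolding T_def by (rule nn_integral_cmult) measurable
      also have "(\<integral>\<^sup>+\<zeta>. Q k (-1) \<zeta> + Q k 0 \<zeta> + Q k 1 \<zeta> \<partial>\<mu>) = (\<integral>\<^sup>+\<zeta>. Q k (-1) \<zeta> \<partial>\<mu>) + (\<integral>\<^sup>+\<zeta>. Q k 0 \<zeta> \<partial>\<mu>) + (\<integral>\<^sup>+\<zeta>. Q k 1 \<zeta> \<partial>\<mu>)"
        by (simp add: nn_integral_add)
      also have "\<dots> \<le> ennreal (12 * M) * bergman_norm_p p \<omega> f + ennreal (12 * M) * bergman_norm_p p \<omega> f + ennreal (12 * M) * bergman_norm_p p \<omega> f"
        by (intro add_mono Qi) auto
      also have "\<dots> = ennreal (3 * (12 * M)) * bergman_norm_p p \<omega> f"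
      proof -
        have "ennreal (3 * (12 * M)) = ennreal (12 * M) + ennreal (12 * M) + ennreal (12 * M)"
          using M by (simp add: ennreal_plus[symmetric] del: ennreal_plus)
        then show ?thesis by (simp only: distrib_right)
      qed
      finally show ?thesis by (simp add: mult_left_mono)
    qed
    have "(\<integral>\<^sup>+\<zeta>. U \<zeta> \<partial>\<mu>) = (\<Sum>k. \<integral>\<^sup>+\<zeta>. T k \<zeta> \<partial>\<mu>)" unfolding U_def by (rule nn_integral_suminf) measurable
    also have "\<dots> \<le> (\<Sum>k. ennreal (c * (1/4) ^ k) * (ennreal (3 * (12 * M)) * bergman_norm_p p \<omega> f))"
      by (intro suminf_le Ti summableI)
    also have "\<dots> = (\<Sum>k. ennreal (c * (1/4) ^ k)) * (ennreal (3 * (12 * M)) * bergman_norm_p p \<omega> f)"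
      by (rule ennreal_suminf_multc)
    also have "(\<Sum>k. ennreal (c * (1/4) ^ k)) = ennreal (c * (4/3))"
    proof -
      have "(\<lambda>k. (1/4::real) ^ k) sums (1 / (1 - 1/4))" by (rule geometric_sums) simp
      then have s: "(\<lambda>k. c * (1/4) ^ k) sums (c * (4/3))" using sums_mult[of "\<lambda>k. (1/4) ^ k" "4/3" c] by simp
      then show ?thesis using c by (subst suminf_ennreal2) (auto simp: sums_iff)
    qed
    also have "ennreal (c * (4/3)) * (ennreal (3 * (12 * M)) * bergman_norm_p p \<omega> f) = ennreal (c * (4/3) * (3 * (12 * M))) * bergman_norm_p p \<omega> f"
    proof -
      have "ennreal (c * (4/3) * (3 * (12 * M))) = ennreal (c * (4/3)) * ennreal (3 * (12 * M))" using c M by (intro ennreal_mult) auto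
      then show ?thesis by (simp only: mult.assoc)
    qed
    finally have U2: "(\<integral>\<^sup>+\<zeta>. U \<zeta> \<partial>\<mu>) \<le> ennreal (c * (4/3) * (3 * (12 * M))) * bergman_norm_p p \<omega> f" .
    show "\<exists>U\<in>borel_measurable \<mu>.
        (\<forall>\<zeta>\<in>unit_disc. \<forall>z\<in>ball \<zeta> (1/6 * (1 - cmod \<zeta>)). ennreal (cmod (f z) powr p) \<le> U \<zeta>) \<and>
        (\<integral>\<^sup>+z. U z \<partial>\<mu>) \<le> ennreal (c * (4/3) * (3 * (12 * M))) * bergman_norm_p p \<omega> f"
      by (intro bexI[OF _ Um] conjI ballI U1 U2) auto
  qed
qed

section \<open>Vanishing and infinite maximal functions\<close>

lemma carleson_square_mass_pos:
  assumes "weight \<omega>" "AE z in dA. 0 < \<omega> z" and a: "a \<in> unit_disc - {0}"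
  shows "emeasure dA (carleson_square a) \<noteq> 0" "0 < weight_mass \<omega> (carleson_square a)"
proof -
  have a': "0 < cmod a" "cmod a < 1" using a by auto
  obtain \<rho> where \<rho>: "0 < \<rho>" "ball (of_real ((1 + cmod a) / (2 * cmod a)) * a) \<rho> \<subseteq> carleson_square a"
    using open_carleson_square[OF a'] carleson_square_nonempty[OF a'] open_contains_ball by blast
  have S: "carleson_square a \<in> sets dA"
    using open_carleson_square[OF a'] carleson_square_subset by (intro borel_sets_dA) auto
  have "ball (of_real ((1 + cmod a) / (2 * cmod a)) * a) \<rho> \<subseteq> unit_disc"
    using \<rho>(2) carleson_square_subset by blast
  then have "emeasure dA (ball (of_real ((1 + cmod a) / (2 * cmod a)) * a) \<rho>) = ennreal (\<rho>\<^sup>2)"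
    using \<rho>(1) by (intro emeasure_dA_ball) auto
  then show *: "emeasure dA (carleson_square a) \<noteq> 0"
    using emeasure_mono[OF \<rho>(2) S] \<rho>(1) by (auto simp: ennreal_eq_0_iff)
  show "0 < weight_mass \<omega> (carleson_square a)"
    by (rule weight_mass_pos[OF assms(1,2) S *])
qed

text \<open>The essential supremum speaks only of almost every point, but a Carleson square has
  positive area and so contains a point where the maximal function is at most \<open>M\<close>; the
  square itself takes part in the supremum at that point.\<close>

lemma carleson_square_le_maximal_norm:
  assumes \<omega>: "weight \<omega>" "AE z in dA. 0 < \<omega> z" and M: "maximal_norm \<omega> \<mu> = ennreal M"
    and a: "a \<in> unit_disc - {0}"
  shows "emeasure \<mu> (carleson_square a) \<le> ennreal M * weight_mass \<omega> (carleson_square a)"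
proof -
  have a': "0 < cmod a" "cmod a < 1" using a by auto
  have S: "carleson_square a \<in> sets dA"
    using open_carleson_square[OF a'] carleson_square_subset by (intro borel_sets_dA) auto
  have "AE z in dA. maximal_function \<omega> \<mu> z \<le> ennreal M"
    using esssup_AE[of "maximal_function \<omega> \<mu>" dA] M by (simp add: maximal_norm_def)
  then have "\<exists>z\<in>carleson_square a. maximal_function \<omega> \<mu> z \<le> ennreal M"
  proof (rule contrapos_pp)
    assume "\<not> (\<exists>z\<in>carleson_square a. maximal_function \<omega> \<mu> z \<le> ennreal M)"
    then have sub: "z \<in> carleson_square a \<Longrightarrow> \<not> maximal_function \<omega> \<mu> z \<le> ennreal M" for z by blast
    show "\<not> (AE z in dA. maximal_function \<omega> \<mu> z \<le> ennreal M)"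
    proof
      assume "AE z in dA. maximal_function \<omega> \<mu> z \<le> ennreal M"
      then have "AE z in dA. z \<notin> carleson_square a" by eventually_elim (use sub in blast)
      then have "carleson_square a \<in> null_sets dA" using AE_iff_null_sets[OF S] by blast
      then show False using carleson_square_mass_pos(1)[OF \<omega> a] by auto
    qed
  qed
  then obtain z where z: "z \<in> carleson_square a" "maximal_function \<omega> \<mu> z \<le> ennreal M" by blast
  have "emeasure \<mu> (carleson_square a) / weight_mass \<omega> (carleson_square a) \<le> maximal_function \<omega> \<mu> z"
    unfolding maximal_function_def using a z(1) by (intro SUP_upper) auto
  then have le: "emeasure \<mu> (carleson_square a) / weight_mass \<omega> (carleson_square a) \<le> ennreal M"
    using z(2) by (rule order_trans)
  have w: "weight_mass \<omega> (carleson_square a) \<noteq> 0" "weight_mass \<omega> (carleson_square a) < top"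
    using carleson_square_mass_pos(2)[OF \<omega> a] weight_mass_finite[OF \<omega>(1), of "carleson_square a"] by auto
  have "emeasure \<mu> (carleson_square a)
      = emeasure \<mu> (carleson_square a) / weight_mass \<omega> (carleson_square a) * weight_mass \<omega> (carleson_square a)"
    by (simp only: ennreal_divide_times ennreal_divide_self[OF w] mult_1_right)
  also have "\<dots> \<le> ennreal M * weight_mass \<omega> (carleson_square a)"
    using le by (rule mult_right_mono) simp
  finally show ?thesis .
qed

lemma one_in_bergman_space:
  assumes "weight \<omega>"
  shows "bergman_norm_p p \<omega> (\<lambda>_. 1) = weight_mass \<omega> unit_disc" "(\<lambda>_. 1) \<in> bergman_space p \<omega>"
proof -
  have "bergman_norm_p p \<omega> (\<lambda>_. 1) = (\<integral>\<^sup>+z. ennreal (\<omega> z) \<partial>dA)" by (simp add: bergman_norm_p_def)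
  also have "\<dots> = weight_mass \<omega> unit_disc"
    unfolding weight_mass_def by (intro nn_integral_cong) (auto simp: space_dA)
  finally show *: "bergman_norm_p p \<omega> (\<lambda>_. 1) = weight_mass \<omega> unit_disc" .
  show "(\<lambda>_. 1) \<in> bergman_space p \<omega>"
    using weight_mass_finite[OF assms] by (simp add: bergman_space_def *)
qed

lemma weight_mass_unit_disc_pos:
  assumes "weight \<omega>" "AE z in dA. 0 < \<omega> z"
  shows "0 < weight_mass \<omega> unit_disc"
  using emeasure_dA_ball[of 0 1] by (intro weight_mass_pos[OF assms] borel_sets_dA) auto

lemma not_dominating_empty:
  assumes "weight \<omega>" "AE z in dA. 0 < \<omega> z" "0 < \<delta>"
  shows "\<not> dominating_set_with \<delta> p \<omega> {}"
proof
  assume "dominating_set_with \<delta> p \<omega> {}"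
  then have "ennreal \<delta> * weight_mass \<omega> unit_disc \<le> 0"
    using one_in_bergman_space[OF assms(1), of p] unfolding dominating_set_with_def by force
  then show False using weight_mass_unit_disc_pos[OF assms(1,2)] assms(3) by simp
qed

text \<open>The monomials concentrate their mass near the boundary.\<close>

lemma not_dominating_half_disc:
  assumes p: "0 < p" and \<omega>: "weight \<omega>" "AE z in dA. 0 < \<omega> z" and \<delta>: "0 < \<delta>" and G: "G \<subseteq> ball 0 (1/2)"
  shows "\<not> dominating_set_with \<delta> p \<omega> G"
proof
  assume dom: "dominating_set_with \<delta> p \<omega> G"
  \<comment> \<open>A ring of positive mass on which the n-th monomial is at least
    \<open>(3/4)^n\<close>, against at most \<open>(1/2)^n\<close> on \<open>G\<close>.\<close>
  define E where "E = {z \<in> unit_disc. 3/4 < cmod z}"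
  have E: "E \<in> sets dA" unfolding E_def
  proof (rule borel_sets_dA)
    have "open {z::complex. 3/4 < cmod z}" by (intro open_Collect_less continuous_intros)
    then have "open (unit_disc \<inter> {z::complex. 3/4 < cmod z})" by (intro open_Int) auto
    moreover have "{z \<in> unit_disc. 3/4 < cmod z} = unit_disc \<inter> {z. 3/4 < cmod z}" by auto
    ultimately show "{z \<in> unit_disc. 3/4 < cmod z} \<in> sets borel" by simp
  qed auto
  have "ball (of_real (7/8)) (1/8) \<subseteq> E"
  proof
    fix z :: complex assume "z \<in> ball (of_real (7/8)) (1/8)"
    then have "cmod (of_real (7/8) - z) < 1/8" by (simp add: dist_norm)
    moreover have "cmod (of_real (7/8) :: complex) = 7/8" by (simp only: norm_of_real)
    moreover have "cmod z \<le> cmod (of_real (7/8) :: complex) + cmod (of_real (7/8) - z)"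
      using norm_triangle_ineq2[of z "of_real (7/8)"] by (simp add: norm_minus_commute)
    moreover have "cmod (of_real (7/8) :: complex) - cmod z \<le> cmod (of_real (7/8) - z)"
      by (rule norm_triangle_ineq2)
    ultimately show "z \<in> E" unfolding E_def by (simp only: mem_Collect_eq mem_ball_0) linarith
  qed
  then have "emeasure dA (ball (of_real (7/8)) (1/8)) \<le> emeasure dA E" "ball (of_real (7/8)) (1/8) \<subseteq> unit_disc"
    using E by (auto intro: emeasure_mono simp: E_def)
  then have "emeasure dA E \<noteq> 0"
    using emeasure_dA_ball[of "of_real (7/8)" "1/8"] by (auto simp: ennreal_eq_0_iff)
  then have "0 < weight_mass \<omega> E" by (intro weight_mass_pos[OF \<omega>] E)
  then obtain e where e: "0 < e" "weight_mass \<omega> E = ennreal e"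
    using weight_mass_finite[OF \<omega>(1), of E] by (cases "weight_mass \<omega> E") (auto simp: less_top)
  obtain m where m: "0 \<le> m" "weight_mass \<omega> unit_disc = ennreal m"
    using weight_mass_finite[OF \<omega>(1), of unit_disc] by (cases "weight_mass \<omega> unit_disc") (auto simp: less_top)
  have le: "\<delta> * ((3/4) powr p) ^ n * e \<le> ((1/2) powr p) ^ n * m" for n
  proof -
    define f where "f = (\<lambda>z::complex. z ^ n)"
    have fp: "cmod (f z) powr p = (cmod z powr p) ^ n" for z
      by (cases "z = 0") (auto simp: f_def norm_power powr_realpow[symmetric] powr_powr mult.commute power_0_left p)
    have w: "(\<lambda>z. ennreal (\<omega> z)) \<in> borel_measurable dA" by (rule borel_measurable_weight[OF \<omega>(1)])
    have "bergman_norm_p p \<omega> f \<le> bergman_norm_p p \<omega> (\<lambda>_. 1)" unfolding bergman_norm_p_def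
    proof (intro nn_integral_mono ennreal_leI mult_right_mono)
      fix z assume z: "z \<in> space dA"
      then show "cmod (f z) powr p \<le> cmod 1 powr p"
        using p unfolding f_def by (intro powr_mono2) (auto simp: space_dA norm_power power_le_one)
      show "0 \<le> \<omega> z" using \<omega>(1) z by (auto simp: weight_def space_dA)
    qed
    then have fB: "f \<in> bergman_space p \<omega>"
      using one_in_bergman_space(2)[OF \<omega>(1), of p] by (auto simp: bergman_space_def f_def intro!: holomorphic_intros)
    have "ennreal (((3/4) powr p) ^ n) * weight_mass \<omega> E
        = (\<integral>\<^sup>+z. ennreal (((3/4) powr p) ^ n) * (ennreal (\<omega> z) * indicator E z) \<partial>dA)"
      unfolding weight_mass_def by (intro nn_integral_cmult[symmetric] borel_measurable_times_ennreal w borel_measurable_indicator E)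
    also have "\<dots> \<le> bergman_norm_p p \<omega> f" unfolding bergman_norm_p_def
    proof (rule nn_integral_mono)
      fix z assume z: "z \<in> space dA"
      show "ennreal (((3/4) powr p) ^ n) * (ennreal (\<omega> z) * indicator E z) \<le> ennreal (cmod (f z) powr p * \<omega> z)"
      proof (cases "z \<in> E")
        case True
        then have "((3/4) powr p) ^ n \<le> cmod (f z) powr p" unfolding fp E_def using p
          by (intro power_mono powr_mono2) auto
        then have "((3/4) powr p) ^ n * \<omega> z \<le> cmod (f z) powr p * \<omega> z"
          using \<omega>(1) z by (intro mult_right_mono) (auto simp: weight_def space_dA)
        then show ?thesis using True by (simp add: ennreal_mult'[symmetric] ennreal_leI)
      qed simp
    qed
    finally have 1: "ennreal (((3/4) powr p) ^ n) * weight_mass \<omega> E \<le> bergman_norm_p p \<omega> f" .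
    have "ennreal \<delta> * (ennreal (((3/4) powr p) ^ n) * weight_mass \<omega> E) \<le> ennreal \<delta> * bergman_norm_p p \<omega> f"
      using 1 by (rule mult_left_mono) simp
    also have "\<dots> \<le> (\<integral>\<^sup>+z\<in>G. ennreal (cmod (f z) powr p * \<omega> z) \<partial>dA)"
      using dom fB by (auto simp: dominating_set_with_def)
    also have "\<dots> \<le> (\<integral>\<^sup>+z. ennreal (((1/2) powr p) ^ n) * (ennreal (\<omega> z) * indicator unit_disc z) \<partial>dA)"
    proof (rule nn_integral_mono)
      fix z assume z: "z \<in> space dA"
      show "ennreal (cmod (f z) powr p * \<omega> z) * indicator G z \<le> ennreal (((1/2) powr p) ^ n) * (ennreal (\<omega> z) * indicator unit_disc z)"
      proof (cases "z \<in> G")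
        case True
        then have "cmod z < 1/2" using G by auto
        then have "cmod (f z) powr p \<le> ((1/2) powr p) ^ n" unfolding fp using p
          by (intro power_mono powr_mono2) auto
        then have "cmod (f z) powr p * \<omega> z \<le> ((1/2) powr p) ^ n * \<omega> z"
          using \<omega>(1) z by (intro mult_right_mono) (auto simp: weight_def space_dA)
        then show ?thesis using True z by (simp add: ennreal_mult'[symmetric] ennreal_leI space_dA)
      qed simp
    qed
    also have "\<dots> = ennreal (((1/2) powr p) ^ n) * weight_mass \<omega> unit_disc"
      unfolding weight_mass_def by (intro nn_integral_cmult borel_measurable_times_ennreal w borel_measurable_indicator borel_sets_dA) auto
    finally have "ennreal (\<delta> * ((3/4) powr p) ^ n * e) \<le> ennreal (((1/2) powr p) ^ n * m)"
      using e m \<delta> by (simp add: ennreal_mult'[symmetric] mult.assoc)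
    then show ?thesis using m by (subst (asm) ennreal_le_iff) auto
  qed
  \<comment> \<open>The ratio of 1/2 to 3/4, raised to \<open>p\<close>; its powers tend to 0, which
    contradicts the fixed share \<open>\<delta>\<close>.\<close>
  define x where "x = (2/3::real) powr p"
  have x: "0 < x" "x < 1" using p powr_less_mono2[of p "2/3" 1] by (auto simp: x_def)
  have "(\<lambda>n. x ^ n * m) \<longlonglongrightarrow> 0 * m" using x by (intro tendsto_intros LIMSEQ_realpow_zero) auto
  then have "eventually (\<lambda>n. x ^ n * m < \<delta> * e) sequentially" using e \<delta> by (intro order_tendstoD(2)) auto
  then obtain n where n: "x ^ n * m < \<delta> * e" by (auto simp: eventually_sequentially)
  have y: "0 < ((3/4) powr p) ^ n" by simp
  have "(1/2) powr p = (3/4) powr p * x" unfolding x_def by (simp add: powr_mult[symmetric])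
  then have "\<delta> * e * ((3/4) powr p) ^ n \<le> x ^ n * m * ((3/4) powr p) ^ n"
    using le[of n] by (simp add: power_mult_distrib mult_ac)
  then show False using n y by simp
qed

text \<open>If the maximal function vanishes almost everywhere, the measure can only charge the origin,
  which lies in no Carleson square.\<close>

lemma measure_null_off_origin:
  assumes \<mu>: "borel_measure_on_disc \<mu>" and null: "\<And>a. a \<in> unit_disc - {0} \<Longrightarrow> emeasure \<mu> (carleson_square a) = 0"
  shows "emeasure \<mu> (unit_disc - {0}) = 0"
proof -
  have "\<And>S. S \<in> carleson_square ` (unit_disc - {0}) \<Longrightarrow> open S" using open_carleson_square by force
  then obtain F' where F': "F' \<subseteq> carleson_square ` (unit_disc - {0})" "countable F'"
      "\<Union>F' = \<Union>(carleson_square ` (unit_disc - {0}))"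
    by (rule Lindelof)
  have "\<Union>F' \<in> null_sets \<mu>"
  proof (rule null_sets_UN'[OF F'(2), of "\<lambda>S. S", simplified])
    fix S assume "S \<in> F'"
    then obtain a where "a \<in> unit_disc - {0}" "S = carleson_square a" using F'(1) by blast
    then show "S \<in> null_sets \<mu>"
      using null open_carleson_square[of a] carleson_square_subset[of a]
      by (auto intro!: null_setsI sets_borel_measure_on_disc[OF \<mu>])
  qed
  moreover have "unit_disc - {0} \<subseteq> \<Union>F'" unfolding F'(3)
  proof
    fix z :: complex assume z: "z \<in> unit_disc - {0}"
    \<comment> \<open>Every nonzero \<open>z\<close> lies in the Carleson square of
      \<open>z / 2\<close>, so these squares exhaust the punctured disc.\<close>
    have "of_real (1/2) * z * cnj z = of_real (1/2 * (cmod z)\<^sup>2)"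
      by (simp only: of_real_mult complex_norm_square mult.assoc)
    then have "Arg (of_real (1/2) * z * cnj z) = 0" by (simp only: Arg_of_real) simp
    then have "z \<in> carleson_square (of_real (1/2) * z)"
      using z by (subst carleson_square_iff) (auto simp: norm_mult)
    moreover have "of_real (1/2) * z \<in> unit_disc - {0}" using z by (auto simp: norm_mult)
    ultimately show "z \<in> \<Union>(carleson_square ` (unit_disc - {0}))" by blast
  qed
  moreover have "unit_disc - {0} \<in> sets \<mu>" by (intro sets_borel_measure_on_disc[OF \<mu>]) auto
  ultimately show ?thesis using null_sets_subset[of "\<Union>F'" \<mu>] by blast
qed

theorem theorem10:
  fixes p \<epsilon> :: real and \<omega> :: "complex \<Rightarrow> real" and \<mu> :: "complex measure"
  assumes "0 < p" and "0 < \<epsilon>"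
    and "weight \<omega>" and "borel_measure_on_disc \<mu>"
    and "(\<omega> \<in> D_hat \<and> (AE z in dA. 0 < \<omega> z) \<and> carleson_measure p \<omega> \<mu>) \<or>
         (\<omega> \<in> C_infinity \<and> (\<exists>r\<^sub>0::real. 0 < r\<^sub>0 \<and> r\<^sub>0 < 1 \<and> (\<exists>C::real. 0 < C \<and>
            (\<forall>a\<in>unit_disc - {0}.
               emeasure \<mu> (pseudo_disc a r\<^sub>0) \<le> ennreal C * weight_mass \<omega> (pseudo_disc a r\<^sub>0)))))"
  shows "\<forall>\<delta>::real. 0 < \<delta> \<longrightarrow> (\<exists>r::real. 0 < r \<and> r < 1 \<and>
           (dominating_set_with \<delta> p \<omega>
              {z\<in>unit_disc. disc_average \<omega> \<mu> r z > ennreal \<epsilon> * maximal_norm \<omega> \<mu>}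
            \<longrightarrow> sampling_measure p \<omega> \<mu>))"
proof (intro allI impI)
  fix \<delta> :: real assume \<delta>: "0 < \<delta>"
  note p = assms(1) and \<epsilon> = assms(2) and \<omega> = assms(3) and \<mu> = assms(4)
  have pos: "AE z in dA. 0 < \<omega> z"
    using assms(5) by (auto simp: C_infinity_def C_class_def)
  consider "maximal_norm \<omega> \<mu> = top" | "maximal_norm \<omega> \<mu> = 0" | M where "maximal_norm \<omega> \<mu> = ennreal M" "0 < M"
    by (cases "maximal_norm \<omega> \<mu>") (auto simp: less_le)
  then show "\<exists>r. 0 < r \<and> r < 1 \<and> (dominating_set_with \<delta> p \<omega>
      {z \<in> unit_disc. ennreal \<epsilon> * maximal_norm \<omega> \<mu> < disc_average \<omega> \<mu> r z} \<longrightarrow> sampling_measure p \<omega> \<mu>)"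
  proof cases
    case 1
    \<comment> \<open>No average exceeds an infinite threshold, so the set is empty for any radius;
      1/2 is an arbitrary choice.\<close>
    then have e: "{z \<in> unit_disc. ennreal \<epsilon> * maximal_norm \<omega> \<mu> < disc_average \<omega> \<mu> (1/2) z} = {}"
      using \<epsilon> by (simp add: ennreal_mult_top)
    show ?thesis
      by (intro exI[of _ "1/2"]) (use not_dominating_empty[OF \<omega> pos \<delta>, of p] in \<open>simp only: e, simp\<close>)
  next
    case 2
    have z: "emeasure \<mu> (unit_disc - {0}) = 0"
    proof (rule measure_null_off_origin[OF \<mu>])
      fix a :: complex assume "a \<in> unit_disc - {0}"
      then show "emeasure \<mu> (carleson_square a) = 0"
        using carleson_square_le_maximal_norm[OF \<omega> pos, of \<mu> 0 a] 2 by simp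
    qed
    \<comment> \<open>The measure can charge only the origin, so a disc of positive measure must
      contain it, and its centre is then within pseudohyperbolic distance 1/2 of 0.\<close>
    have "{z \<in> unit_disc. ennreal \<epsilon> * maximal_norm \<omega> \<mu> < disc_average \<omega> \<mu> (1/2) z} \<subseteq> ball 0 (1/2)"
    proof
      fix w assume w: "w \<in> {z \<in> unit_disc. ennreal \<epsilon> * maximal_norm \<omega> \<mu> < disc_average \<omega> \<mu> (1/2) z}"
      then have "emeasure \<mu> (pseudo_disc w (1/2)) \<noteq> 0" by (auto simp: disc_average_def 2)
      then have "\<not> pseudo_disc w (1/2) \<subseteq> unit_disc - {0}"
        using emeasure_mono[of "pseudo_disc w (1/2)" "unit_disc - {0}" \<mu>] z
          sets_borel_measure_on_disc[OF \<mu>, of "unit_disc - {0}"] by auto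
      then have "0 \<in> pseudo_disc w (1/2)" by (auto simp: pseudo_disc_def)
      then show "w \<in> ball 0 (1/2)" by (simp add: pseudo_disc_def)
    qed
    from not_dominating_half_disc[OF p \<omega> pos \<delta> this] show ?thesis by (intro exI[of _ "1/2"]) simp
  next
    case M: 3
    from assms(5) show ?thesis
    proof (elim disjE conjE exE)
      assume \<omega>D: "\<omega> \<in> D_hat" and car: "carleson_measure p \<omega> \<mu>"
      have sp: "space \<mu> = unit_disc" by (rule space_borel_measure_on_disc[OF \<mu>])
      \<comment> \<open>The constant function 1 turns the Carleson inequality into finiteness of the
        total mass.\<close>
      obtain C where C: "(\<integral>\<^sup>+z. ennreal (cmod 1 powr p) \<partial>\<mu>) \<le> ennreal C * bergman_norm_p p \<omega> (\<lambda>_. 1)"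
        using car bspec[OF _ one_in_bergman_space(2)[OF \<omega>, of p]] unfolding carleson_measure_def by fast
      have "emeasure \<mu> unit_disc \<le> ennreal C * weight_mass \<omega> unit_disc"
        using C one_in_bergman_space(1)[OF \<omega>, of p] by (simp add: sp)
      also have "\<dots> < \<infinity>" using weight_mass_finite[OF \<omega>, of unit_disc] by (simp add: ennreal_mult_less_top)
      finally have fin: "emeasure \<mu> unit_disc < \<infinity>" .
      then interpret finite_measure \<mu> by (intro finite_measureI) (simp add: sp)
      obtain M' where M': "0 < M'" "\<And>n j. emeasure \<mu> (tent n j) \<le> ennreal M' * weight_mass \<omega> (tent n j)"
        using measure_tent_le[OF \<omega>D pos \<mu> fin less_imp_le[OF M(2)] carleson_square_le_maximal_norm[OF \<omega> pos M(1)]]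
        by blast
      \<comment> \<open>The value 1/6 of \<open>\<kappa>\<close> is the size of the Whitney balls
        for which the kernel estimate was made.\<close>
      show ?thesis
        by (rule D_hat_majorant[OF p \<omega>D pos \<mu> fin M'])
          (rule sampling_from_majorant[OF p \<omega> \<mu> sigma_finite_measure_axioms _ _ _ _ M \<epsilon> \<delta>, where \<kappa> = "1/6"]; simp)
    next
      fix r0 C :: real
      assume B: "\<omega> \<in> C_infinity" "0 < r0" "r0 < 1" "0 < C"
        and "\<forall>a\<in>unit_disc - {0}. emeasure \<mu> (pseudo_disc a r0) \<le> ennreal C * weight_mass \<omega> (pseudo_disc a r0)"
      then have le: "\<And>a. a \<in> unit_disc - {0} \<Longrightarrow> emeasure \<mu> (pseudo_disc a r0) \<le> ennreal C * weight_mass \<omega> (pseudo_disc a r0)"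
        by blast
      show ?thesis
        by (rule C_infinity_majorant[OF p \<mu> B le])
          (assumption | rule sampling_from_majorant[OF p \<omega> \<mu> _ _ _ _ _ M \<epsilon> \<delta>])+
    qed
  qed
qed

end
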